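(* Let $(\otimes,\mathrm{hom}_\ell,\mathrm{hom}_r)\colon\mathcal K\times\mathcal M\to\mathcal N$ be a two-variable adjunction ($\mathcal K,\mathcal M$ with pullbacks, $\mathcal N$ with pushouts). Suppose a small category $\mathcal I\to\mathcal K^{\mathbf 2}$ generates the awfs $(\mathbb C',\mathbb F')$ on $\mathcal K$, a small category $\mathcal J\to\mathcal M^{\mathbf 2}$ generates the awfs $(\mathbb C,\mathbb F)$ on $\mathcal M$, and $\mathcal N$ has an awfs $(\mathbb L,\mathbb R)$. Then $(\otimes,\mathrm{hom}_\ell,\mathrm{hom}_r)$ forms a two-variable adjunction of awfs $(\mathbb C',\mathbb F')\times(\mathbb C,\mathbb F)\to(\mathbb L,\mathbb R)$ if and only if $\mathcal I\widehat\otimes\mathcal J$ is cellular, that is, if and only if there is a functor $\mathcal I\times\mathcal J\to\mathbb L\text{-}\mathbf{coalg}$ whose composite with the forgetful functor $\mathbb L\text{-}\mathbf{coalg}\to\mathcal N^{\mathbf 2}$ equals $\mathcal I\times\mathcal J\to\mathcal K^{\mathbf 2}\times\mathcal M^{\mathbf 2}\xrightarrow{-\widehat\otimes-}\mathcal N^{\mathbf 2}$.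
   Context: $\mathcal M^{\mathbf 2}$ is the arrow category; a morphism $(u,v)\colon f\Rightarrow g$ is a commutative square $gu=vf$ (a lifting problem of $f$ against $g$). A functorial factorization $\vec E=(L,R)$ factors each arrow functorially as $f=Rf\cdot Lf$ with $Lf\colon\mathrm{dom}f\to Ef$, $Rf\colon Ef\to\mathrm{cod}f$, with canonical $\vec\epsilon_f=(1,Rf)\colon Lf\Rightarrow f$, $\vec\eta_f=(Lf,1)\colon f\Rightarrow Rf$. An algebraic weak factorization system (awfs) $(\mathbb L,\mathbb R)$ is a comonad $\mathbb L=(L,\vec\epsilon,\vec\delta)$ and a monad $\mathbb R=(R,\vec\eta,\vec\mu)$ on the arrow category arising from a functorial factorization, with $\vec\delta_f=(1,\delta_f)$, $\delta_f\colon Ef\to ELf$, $\vec\mu_f=(\mu_f,1)$, $\mu_f\colon ERf\to Ef$, such that $(\delta,\mu)\colon LR\Rightarrow RL$ is a distributive law. $\mathbb L\text{-}\mathbf{coalg}$ and $\mathbb R\text{-}\mathbf{alg}$ are the categories of (co)algebras; a coalgebra structure on $j$ is given by $s\colon\mathrm{cod}j\to Ej$, an algebra structure on $f$ by $r\colon Ef\to\mathrm{dom}f$; the canonical solution to $(u,v)\colon j\Rightarrow f$ is $r\cdot E(u,v)\cdot s$. A lifted functor commutes with forgetful functors to arrow categories. The awfs $(\mathbb C',\mathbb F')$, $(\mathbb C,\mathbb F)$, $(\mathbb L,\mathbb R)$ factor arrows through $Q'$, $Q$, $E$. Generation: for a functor $\mathcal J\to\mathcal M^{\mathbf 2}$ with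 $\mathcal J$ small, $\mathcal J^{\pitchfork}$ is the category over $\mathcal M^{\mathbf 2}$ of pairs $(f,\phi_f)$ of an arrow $f$ and a choice $\phi_f$ of solutions to all lifting problems of (images of) objects of $\mathcal J$ against $f$, compatible with morphisms of $\mathcal J$; morphisms are squares preserving chosen solutions. The awfs $(\mathbb C,\mathbb F)$ is generated by $\mathcal J$ if it is the awfs produced by Garner's small object argument; it comes with a unit functor $\mathcal J\to\mathbb C\text{-}\mathbf{coalg}$ over $\mathcal M^{\mathbf 2}$ which is universal among functors over $\mathcal M^{\mathbf 2}$ from $\mathcal J$ to coalgebra categories of awfs on $\mathcal M$ (with respect to morphisms of awfs, i.e. natural transformations $\xi$ between the middle-object functors giving simultaneously a comonad morphism $(1,\xi)$ and a monad morphism $(\xi,1)$), and the functor $\mathbb F\text{-}\mathbf{alg}\to\mathcal J^{\pitchfork}$ given by canonical solutions is an isomorphism. Categories carrying generated awfs are assumed to permit the small object argument (e.g. locally presentable or, more generally, locally bounded). A two-variable adjunction consists of bifunctors $\otimes\colon\mathcal K\times\mathcal M\to\mathcal N$, $\mathrm{hom}_\ell\colon\mathcal K^{\mathrm{op}}\times\mathcal N\to\mathcal M$, $\mathrm{hom}_r\colon\mathcal M^{\mathrm{op}}\times\mathcal N\to\mathcal K$ with natural isomorphisms $\mathcal N(k\otimes m,n)\cong\mathcal M(m,\mathrm{hom}_\ell(k,n))\cong\mathcal K(k,\mathrm{hom}_r(m,n))$. It induces $(\widehat\otimes,\widehat{\mathrm{hom}}_\ell,\widehat{\mathrm{hom}}_r)$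 on arrow categories: for $i\colon A\to B$, $j\colon J\to K$, $f\colon X\to Y$, $i\widehat\otimes j\colon A\otimes K\sqcup_{A\otimes J}B\otimes J\to B\otimes K$ and $\widehat{\mathrm{hom}}_\ell(i,f)\colon\mathrm{hom}_\ell(B,X)\to\mathrm{hom}_\ell(B,Y)\times_{\mathrm{hom}_\ell(A,Y)}\mathrm{hom}_\ell(A,X)$; $\widehat{\mathrm{hom}}_r$ is analogous. A two-variable adjunction of awfs $(\mathbb C',\mathbb F')\times(\mathbb C,\mathbb F)\to(\mathbb L,\mathbb R)$ consists of lifted functors $\widehat\otimes\colon\mathbb C'\text{-}\mathbf{coalg}\times\mathbb C\text{-}\mathbf{coalg}\to\mathbb L\text{-}\mathbf{coalg}$, $\widehat{\mathrm{hom}}_\ell\colon\mathbb C'\text{-}\mathbf{coalg}^{\mathrm{op}}\times\mathbb R\text{-}\mathbf{alg}\to\mathbb F\text{-}\mathbf{alg}$, $\widehat{\mathrm{hom}}_r\colon\mathbb C\text{-}\mathbf{coalg}^{\mathrm{op}}\times\mathbb R\text{-}\mathbf{alg}\to\mathbb F'\text{-}\mathbf{alg}$ whose characterizing natural transformations $\lambda_{i,j}\colon Q'i\otimes Qj\to E(i\widehat\otimes j)$, $\rho^\ell_{i,f}\colon Q\widehat{\mathrm{hom}}_\ell(i,f)\to\mathrm{hom}_\ell(Q'i,Ef)$, $\rho^r_{j,f}\colon Q'\widehat{\mathrm{hom}}_r(j,f)\to\mathrm{hom}_r(Qj,Ef)$ are parameterized mates. Here $\lambda$ characterizes $\widehat\otimes$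 if coalgebras $(i,s),(j,t)$ are sent to $i\widehat\otimes j$ with structure $\lambda_{i,j}\cdot(s\otimes t)$; $\rho^\ell$ characterizes $\widehat{\mathrm{hom}}_\ell$ if $(i,s),(f,r)$ are sent to $\widehat{\mathrm{hom}}_\ell(i,f)$ with structure $\mathrm{hom}_\ell(s,r)\cdot\rho^\ell_{i,f}$; and similarly for $\rho^r$ (each lifted functor has a unique characterizing transformation, given by its values on cofree coalgebras and free algebras). They are parameterized mates if for each $i$, $\lambda_{i,-},\rho^\ell_{i,-}$ are mates with respect to $i\widehat\otimes-\dashv\widehat{\mathrm{hom}}_\ell(i,-)$ and $Q'i\otimes-\dashv\mathrm{hom}_\ell(Q'i,-)$, and for each $j$, $\lambda_{-,j},\rho^r_{j,-}$ are mates with respect to $-\widehat\otimes j\dashv\widehat{\mathrm{hom}}_r(j,-)$ and $-\otimes Qj\dashv\mathrm{hom}_r(Qj,-)$. *)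

theory Defs
  imports Main
begin

section \<open>Categories, functors, natural transformations\<close>

record ('o, 'a) cat =
  ob :: "'o set"
  ar :: "'a set"
  src :: "'a \<Rightarrow> 'o"
  tgt :: "'a \<Rightarrow> 'o"
  idt :: "'o \<Rightarrow> 'a"
  cmp :: "'a \<Rightarrow> 'a \<Rightarrow> 'a"  (infixr "\<cdot>\<index>" 70)

definition hom :: "('o, 'a) cat \<Rightarrow> 'o \<Rightarrow> 'o \<Rightarrow> 'a set" where
  "hom C x y = {f \<in> ar C. src C f = x \<and> tgt C f = y}"

locale category =
  fixes C :: "('o, 'a) cat" (structure)
  assumes src_ob: "f \<in> ar C \<Longrightarrow> src C f \<in> ob C"
    and tgt_ob: "f \<in> ar C \<Longrightarrow> tgt C f \<in> ob C"
    and idt_hom: "x \<in> ob C \<Longrightarrow> idt C x \<in> hom C x x"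
    and cmp_hom: "\<lbrakk>f \<in> hom C x y; g \<in> hom C y z\<rbrakk> \<Longrightarrow> g \<cdot> f \<in> hom C x z"
    and idt_left: "f \<in> hom C x y \<Longrightarrow> idt C y \<cdot> f = f"
    and idt_right: "f \<in> hom C x y \<Longrightarrow> f \<cdot> idt C x = f"
    and cmp_assoc: "\<lbrakk>f \<in> hom C w x; g \<in> hom C x y; h \<in> hom C y z\<rbrakk>
      \<Longrightarrow> (h \<cdot> g) \<cdot> f = h \<cdot> (g \<cdot> f)"

definition op_cat :: "('o, 'a) cat \<Rightarrow> ('o, 'a) cat" where
  "op_cat C = \<lparr>ob = ob C, ar = ar C, src = tgt C, tgt = src C, idt = idt C,
     cmp = (\<lambda>g f. f \<cdot>\<^bsub>C\<^esub> g)\<rparr>"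

definition prod_cat ::
    "('o, 'a) cat \<Rightarrow> ('p, 'b) cat \<Rightarrow> ('o \<times> 'p, 'a \<times> 'b) cat" where
  "prod_cat C D = \<lparr>ob = ob C \<times> ob D, ar = ar C \<times> ar D,
     src = map_prod (src C) (src D), tgt = map_prod (tgt C) (tgt D),
     idt = map_prod (idt C) (idt D),
     cmp = (\<lambda>(g, g') (f, f'). (g \<cdot>\<^bsub>C\<^esub> f, g' \<cdot>\<^bsub>D\<^esub> f'))\<rparr>"

record ('o, 'a, 'p, 'b) func =
  fob :: "'o \<Rightarrow> 'p"
  far :: "'a \<Rightarrow> 'b"

locale is_functor =
  source: category C + target: category D
  for C :: "('o, 'a) cat" and D :: "('p, 'b) cat" +
  fixes F :: "('o, 'a, 'p, 'b) func"
  assumes fob_ob: "x \<in> ob C \<Longrightarrow> fob F x \<in> ob D"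
    and far_hom: "f \<in> hom C x y \<Longrightarrow> far F f \<in> hom D (fob F x) (fob F y)"
    and far_idt: "x \<in> ob C \<Longrightarrow> far F (idt C x) = idt D (fob F x)"
    and far_cmp: "\<lbrakk>f \<in> hom C x y; g \<in> hom C y z\<rbrakk>
      \<Longrightarrow> far F (g \<cdot>\<^bsub>C\<^esub> f) = far F g \<cdot>\<^bsub>D\<^esub> far F f"

text \<open>Functors are only meaningful on the carriers of their source, so this is
  the equality of functors with source \<open>C\<close>.\<close>

definition func_eq ::
    "('o, 'a) cat \<Rightarrow> ('o, 'a, 'p, 'b) func \<Rightarrow> ('o, 'a, 'p, 'b) func \<Rightarrow> bool" where
  "func_eq C F G \<longleftrightarrow>
     (\<forall>x\<in>ob C. fob F x = fob G x) \<and> (\<forall>f\<in>ar C. far F f = far G f)"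

definition id_func :: "('o, 'a, 'o, 'a) func" where
  "id_func = \<lparr>fob = (\<lambda>x. x), far = (\<lambda>f. f)\<rparr>"

definition comp_func ::
    "('p, 'b, 'q, 'c) func \<Rightarrow> ('o, 'a, 'p, 'b) func \<Rightarrow> ('o, 'a, 'q, 'c) func"
    (infixr "\<circ>\<^sub>F" 55) where
  "G \<circ>\<^sub>F F = \<lparr>fob = fob G \<circ> fob F, far = far G \<circ> far F\<rparr>"

definition prod_func ::
    "('o, 'a, 'p, 'b) func \<Rightarrow> ('o1, 'a1, 'p1, 'b1) func
      \<Rightarrow> ('o \<times> 'o1, 'a \<times> 'a1, 'p \<times> 'p1, 'b \<times> 'b1) func"
    (infixr "\<times>\<^sub>F" 60) where
  "F \<times>\<^sub>F G = \<lparr>fob = map_prod (fob F) (fob G), far = map_prod (far F) (far G)\<rparr>"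

definition is_iso_functor ::
    "('o, 'a) cat \<Rightarrow> ('p, 'b) cat \<Rightarrow> ('o, 'a, 'p, 'b) func \<Rightarrow> bool" where
  "is_iso_functor C D F \<longleftrightarrow> is_functor C D F
     \<and> bij_betw (fob F) (ob C) (ob D) \<and> bij_betw (far F) (ar C) (ar D)"

definition nat_trans ::
    "('o, 'a) cat \<Rightarrow> ('p, 'b) cat \<Rightarrow> ('o, 'a, 'p, 'b) func \<Rightarrow> ('o, 'a, 'p, 'b) func
      \<Rightarrow> ('o \<Rightarrow> 'b) \<Rightarrow> bool" where
  "nat_trans C D F G \<tau> \<longleftrightarrow> is_functor C D F \<and> is_functor C D G
     \<and> (\<forall>x\<in>ob C. \<tau> x \<in> hom D (fob F x) (fob G x))
     \<and> (\<forall>f\<in>ar C. far G f \<cdot>\<^bsub>D\<^esub> \<tau> (src C f) = \<tau> (tgt C f) \<cdot>\<^bsub>D\<^esub> far F f)"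


section \<open>Monads, comonads and their algebras and coalgebras\<close>

definition is_monad ::
    "('o, 'a) cat \<Rightarrow> ('o, 'a, 'o, 'a) func \<Rightarrow> ('o \<Rightarrow> 'a) \<Rightarrow> ('o \<Rightarrow> 'a) \<Rightarrow> bool" where
  "is_monad C T \<eta> \<mu> \<longleftrightarrow>
     nat_trans C C id_func T \<eta> \<and> nat_trans C C (T \<circ>\<^sub>F T) T \<mu> \<and>
     (\<forall>x\<in>ob C. \<mu> x \<cdot>\<^bsub>C\<^esub> \<eta> (fob T x) = idt C (fob T x)
       \<and> \<mu> x \<cdot>\<^bsub>C\<^esub> far T (\<eta> x) = idt C (fob T x)
       \<and> \<mu> x \<cdot>\<^bsub>C\<^esub> \<mu> (fob T x) = \<mu> x \<cdot>\<^bsub>C\<^esub> far T (\<mu> x))"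

definition is_comonad ::
    "('o, 'a) cat \<Rightarrow> ('o, 'a, 'o, 'a) func \<Rightarrow> ('o \<Rightarrow> 'a) \<Rightarrow> ('o \<Rightarrow> 'a) \<Rightarrow> bool" where
  "is_comonad C S \<epsilon> \<delta> \<longleftrightarrow>
     nat_trans C C S id_func \<epsilon> \<and> nat_trans C C S (S \<circ>\<^sub>F S) \<delta> \<and>
     (\<forall>x\<in>ob C. \<epsilon> (fob S x) \<cdot>\<^bsub>C\<^esub> \<delta> x = idt C (fob S x)
       \<and> far S (\<epsilon> x) \<cdot>\<^bsub>C\<^esub> \<delta> x = idt C (fob S x)
       \<and> \<delta> (fob S x) \<cdot>\<^bsub>C\<^esub> \<delta> x = far S (\<delta> x) \<cdot>\<^bsub>C\<^esub> \<delta> x)"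

text \<open>A distributive law of the comonad \<open>(S, \<epsilon>, \<delta>)\<close> over the monad \<open>(T, \<eta>, \<mu>)\<close>.\<close>

definition is_distributive_law ::
    "('o, 'a) cat \<Rightarrow> ('o, 'a, 'o, 'a) func \<Rightarrow> ('o \<Rightarrow> 'a) \<Rightarrow> ('o \<Rightarrow> 'a)
      \<Rightarrow> ('o, 'a, 'o, 'a) func \<Rightarrow> ('o \<Rightarrow> 'a) \<Rightarrow> ('o \<Rightarrow> 'a) \<Rightarrow> ('o \<Rightarrow> 'a) \<Rightarrow> bool" where
  "is_distributive_law C S \<epsilon> \<delta> T \<eta> \<mu> \<chi> \<longleftrightarrow>
     nat_trans C C (S \<circ>\<^sub>F T) (T \<circ>\<^sub>F S) \<chi> \<and>
     (\<forall>x\<in>ob C. \<chi> x \<cdot>\<^bsub>C\<^esub> far S (\<eta> x) = \<eta> (fob S x)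
       \<and> far T (\<epsilon> x) \<cdot>\<^bsub>C\<^esub> \<chi> x = \<epsilon> (fob T x)
       \<and> \<chi> x \<cdot>\<^bsub>C\<^esub> far S (\<mu> x) = \<mu> (fob S x) \<cdot>\<^bsub>C\<^esub> far T (\<chi> x) \<cdot>\<^bsub>C\<^esub> \<chi> (fob T x)
       \<and> far T (\<delta> x) \<cdot>\<^bsub>C\<^esub> \<chi> x = \<chi> (fob S x) \<cdot>\<^bsub>C\<^esub> far S (\<chi> x) \<cdot>\<^bsub>C\<^esub> \<delta> (fob T x))"

definition is_monad_morphism ::
    "('o, 'a) cat \<Rightarrow> ('o, 'a, 'o, 'a) func \<Rightarrow> ('o \<Rightarrow> 'a) \<Rightarrow> ('o \<Rightarrow> 'a)
      \<Rightarrow> ('o, 'a, 'o, 'a) func \<Rightarrow> ('o \<Rightarrow> 'a) \<Rightarrow> ('o \<Rightarrow> 'a) \<Rightarrow> ('o \<Rightarrow> 'a) \<Rightarrow> bool" where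
  "is_monad_morphism C T \<eta> \<mu> T' \<eta>' \<mu>' \<tau> \<longleftrightarrow>
     nat_trans C C T T' \<tau> \<and>
     (\<forall>x\<in>ob C. \<tau> x \<cdot>\<^bsub>C\<^esub> \<eta> x = \<eta>' x
       \<and> \<tau> x \<cdot>\<^bsub>C\<^esub> \<mu> x = \<mu>' x \<cdot>\<^bsub>C\<^esub> \<tau> (fob T' x) \<cdot>\<^bsub>C\<^esub> far T (\<tau> x))"

definition is_comonad_morphism ::
    "('o, 'a) cat \<Rightarrow> ('o, 'a, 'o, 'a) func \<Rightarrow> ('o \<Rightarrow> 'a) \<Rightarrow> ('o \<Rightarrow> 'a)
      \<Rightarrow> ('o, 'a, 'o, 'a) func \<Rightarrow> ('o \<Rightarrow> 'a) \<Rightarrow> ('o \<Rightarrow> 'a) \<Rightarrow> ('o \<Rightarrow> 'a) \<Rightarrow> bool" where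
  "is_comonad_morphism C S \<epsilon> \<delta> S' \<epsilon>' \<delta>' \<tau> \<longleftrightarrow>
     nat_trans C C S S' \<tau> \<and>
     (\<forall>x\<in>ob C. \<epsilon>' x \<cdot>\<^bsub>C\<^esub> \<tau> x = \<epsilon> x
       \<and> \<delta>' x \<cdot>\<^bsub>C\<^esub> \<tau> x = \<tau> (fob S' x) \<cdot>\<^bsub>C\<^esub> far S (\<tau> x) \<cdot>\<^bsub>C\<^esub> \<delta> x)"

definition is_algebra ::
    "('o, 'a) cat \<Rightarrow> ('o, 'a, 'o, 'a) func \<Rightarrow> ('o \<Rightarrow> 'a) \<Rightarrow> ('o \<Rightarrow> 'a) \<Rightarrow> 'o \<Rightarrow> 'a \<Rightarrow> bool" where
  "is_algebra C T \<eta> \<mu> x a \<longleftrightarrow> x \<in> ob C \<and> a \<in> hom C (fob T x) x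
     \<and> a \<cdot>\<^bsub>C\<^esub> \<eta> x = idt C x \<and> a \<cdot>\<^bsub>C\<^esub> \<mu> x = a \<cdot>\<^bsub>C\<^esub> far T a"

definition is_coalgebra ::
    "('o, 'a) cat \<Rightarrow> ('o, 'a, 'o, 'a) func \<Rightarrow> ('o \<Rightarrow> 'a) \<Rightarrow> ('o \<Rightarrow> 'a) \<Rightarrow> 'o \<Rightarrow> 'a \<Rightarrow> bool" where
  "is_coalgebra C S \<epsilon> \<delta> x a \<longleftrightarrow> x \<in> ob C \<and> a \<in> hom C x (fob S x)
     \<and> \<epsilon> x \<cdot>\<^bsub>C\<^esub> a = idt C x \<and> \<delta> x \<cdot>\<^bsub>C\<^esub> a = far S a \<cdot>\<^bsub>C\<^esub> a"

text \<open>The category of pairs \<open>(x, a)\<close> in \<open>S\<close>, of an object \<open>x\<close> of \<open>C\<close> and a structure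
  \<open>a\<close> on it, with morphisms those of \<open>C\<close> between the underlying objects that satisfy
  \<open>Q\<close>; each morphism carries its source and target.\<close>

definition structured_cat ::
    "('o, 'a) cat \<Rightarrow> ('o \<times> 's) set \<Rightarrow> ('o \<times> 's \<Rightarrow> 'a \<Rightarrow> 'o \<times> 's \<Rightarrow> bool)
      \<Rightarrow> ('o \<times> 's, ('o \<times> 's) \<times> 'a \<times> ('o \<times> 's)) cat" where
  "structured_cat C S Q = \<lparr>ob = S,
     ar = {(X, h, Y). X \<in> S \<and> Y \<in> S \<and> h \<in> hom C (fst X) (fst Y) \<and> Q X h Y},
     src = (\<lambda>(X, h, Y). X), tgt = (\<lambda>(X, h, Y). Y),
     idt = (\<lambda>X. (X, idt C (fst X), X)),
     cmp = (\<lambda>(Y, k, Z) (X, h, Y'). (X, k \<cdot>\<^bsub>C\<^esub> h, Z))\<rparr>"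

definition forget :: "('o \<times> 's, ('o \<times> 's) \<times> 'a \<times> ('o \<times> 's), 'o, 'a) func" where
  "forget = \<lparr>fob = fst, far = (\<lambda>(X, h, Y). h)\<rparr>"


section \<open>Arrow categories\<close>

text \<open>\<open>Sq f u v g\<close> is the square \<open>(u, v) : f \<Rightarrow> g\<close>.\<close>

datatype 'a sq = Sq (sdom: 'a) (stop: 'a) (sbot: 'a) (scod: 'a)

definition arrow_cat :: "('o, 'a) cat \<Rightarrow> ('a, 'a sq) cat" where
  "arrow_cat M = \<lparr>ob = ar M,
     ar = {Sq f u v g | f u v g. f \<in> ar M \<and> g \<in> ar M
        \<and> u \<in> hom M (src M f) (src M g) \<and> v \<in> hom M (tgt M f) (tgt M g)
        \<and> g \<cdot>\<^bsub>M\<^esub> u = v \<cdot>\<^bsub>M\<^esub> f},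
     src = sdom, tgt = scod,
     idt = (\<lambda>f. Sq f (idt M (src M f)) (idt M (tgt M f)) f),
     cmp = (\<lambda>\<beta> \<alpha>. Sq (sdom \<alpha>) (stop \<beta> \<cdot>\<^bsub>M\<^esub> stop \<alpha>) (sbot \<beta> \<cdot>\<^bsub>M\<^esub> sbot \<alpha>) (scod \<beta>))\<rparr>"


section \<open>Algebraic weak factorization systems\<close>

record ('o, 'a) ffact =
  mid :: "('a, 'a sq, 'o, 'a) func"
  lft :: "'a \<Rightarrow> 'a"
  rgt :: "'a \<Rightarrow> 'a"

record ('o, 'a) awfs = "('o, 'a) ffact" +
  comult :: "'a \<Rightarrow> 'a"
  mult :: "'a \<Rightarrow> 'a"

definition is_functorial_factorization ::
    "('o, 'a) cat \<Rightarrow> ('o, 'a, 'z) ffact_scheme \<Rightarrow> bool" where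
  "is_functorial_factorization M W \<longleftrightarrow>
     is_functor (arrow_cat M) M (mid W)
     \<and> (\<forall>f\<in>ar M. lft W f \<in> hom M (src M f) (fob (mid W) f)
          \<and> rgt W f \<in> hom M (fob (mid W) f) (tgt M f)
          \<and> rgt W f \<cdot>\<^bsub>M\<^esub> lft W f = f)
     \<and> (\<forall>\<alpha>\<in>ar (arrow_cat M).
          far (mid W) \<alpha> \<cdot>\<^bsub>M\<^esub> lft W (sdom \<alpha>) = lft W (scod \<alpha>) \<cdot>\<^bsub>M\<^esub> stop \<alpha>
          \<and> rgt W (scod \<alpha>) \<cdot>\<^bsub>M\<^esub> far (mid W) \<alpha> = sbot \<alpha> \<cdot>\<^bsub>M\<^esub> rgt W (sdom \<alpha>))"

definition lft_func :: "('o, 'a, 'z) ffact_scheme \<Rightarrow> ('a, 'a sq, 'a, 'a sq) func" where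
  "lft_func W = \<lparr>fob = lft W,
     far = (\<lambda>\<alpha>. Sq (lft W (sdom \<alpha>)) (stop \<alpha>) (far (mid W) \<alpha>) (lft W (scod \<alpha>)))\<rparr>"

definition rgt_func :: "('o, 'a, 'z) ffact_scheme \<Rightarrow> ('a, 'a sq, 'a, 'a sq) func" where
  "rgt_func W = \<lparr>fob = rgt W,
     far = (\<lambda>\<alpha>. Sq (rgt W (sdom \<alpha>)) (far (mid W) \<alpha>) (sbot \<alpha>) (rgt W (scod \<alpha>)))\<rparr>"

definition counit_sq :: "('o, 'a) cat \<Rightarrow> ('o, 'a, 'z) ffact_scheme \<Rightarrow> 'a \<Rightarrow> 'a sq" where
  "counit_sq M W f = Sq (lft W f) (idt M (src M f)) (rgt W f) f"

definition unit_sq :: "('o, 'a) cat \<Rightarrow> ('o, 'a, 'z) ffact_scheme \<Rightarrow> 'a \<Rightarrow> 'a sq" where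
  "unit_sq M W f = Sq f (lft W f) (idt M (tgt M f)) (rgt W f)"

definition comult_sq :: "('o, 'a) cat \<Rightarrow> ('o, 'a) awfs \<Rightarrow> 'a \<Rightarrow> 'a sq" where
  "comult_sq M W f = Sq (lft W f) (idt M (src M f)) (comult W f) (lft W (lft W f))"

definition mult_sq :: "('o, 'a) cat \<Rightarrow> ('o, 'a) awfs \<Rightarrow> 'a \<Rightarrow> 'a sq" where
  "mult_sq M W f = Sq (rgt W (rgt W f)) (mult W f) (idt M (tgt M f)) (rgt W f)"

definition is_awfs :: "('o, 'a) cat \<Rightarrow> ('o, 'a) awfs \<Rightarrow> bool" where
  "is_awfs M W \<longleftrightarrow>
     is_functorial_factorization M W
     \<and> is_comonad (arrow_cat M) (lft_func W) (counit_sq M W) (comult_sq M W)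
     \<and> is_monad (arrow_cat M) (rgt_func W) (unit_sq M W) (mult_sq M W)
     \<and> is_distributive_law (arrow_cat M)
          (lft_func W) (counit_sq M W) (comult_sq M W)
          (rgt_func W) (unit_sq M W) (mult_sq M W)
          (\<lambda>f. Sq (lft W (rgt W f)) (comult W f) (mult W f) (rgt W (lft W f)))"

definition is_awfs_morphism ::
    "('o, 'a) cat \<Rightarrow> ('o, 'a) awfs \<Rightarrow> ('o, 'a) awfs \<Rightarrow> ('a \<Rightarrow> 'a) \<Rightarrow> bool" where
  "is_awfs_morphism M W W' \<xi> \<longleftrightarrow>
     nat_trans (arrow_cat M) M (mid W) (mid W') \<xi>
     \<and> is_comonad_morphism (arrow_cat M)
          (lft_func W) (counit_sq M W) (comult_sq M W)
          (lft_func W') (counit_sq M W') (comult_sq M W')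
          (\<lambda>f. Sq (lft W f) (idt M (src M f)) (\<xi> f) (lft W' f))
     \<and> is_monad_morphism (arrow_cat M)
          (rgt_func W) (unit_sq M W) (mult_sq M W)
          (rgt_func W') (unit_sq M W') (mult_sq M W')
          (\<lambda>f. Sq (rgt W f) (\<xi> f) (idt M (tgt M f)) (rgt W' f))"

text \<open>By the (co)unit law, the structure square of a coalgebra has the form \<open>(1, s)\<close> and
  that of an algebra the form \<open>(r, 1)\<close>; the structure is recorded as \<open>s\<close>, respectively
  \<open>r\<close>.\<close>

definition coalg_sq :: "('o, 'a) cat \<Rightarrow> ('o, 'a) awfs \<Rightarrow> 'a \<times> 'a \<Rightarrow> 'a sq" where
  "coalg_sq M W = (\<lambda>(j, s). Sq j (idt M (src M j)) s (lft W j))"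

definition alg_sq :: "('o, 'a) cat \<Rightarrow> ('o, 'a) awfs \<Rightarrow> 'a \<times> 'a \<Rightarrow> 'a sq" where
  "alg_sq M W = (\<lambda>(f, r). Sq (rgt W f) r (idt M (tgt M f)) f)"

definition coalg_cat ::
    "('o, 'a) cat \<Rightarrow> ('o, 'a) awfs
      \<Rightarrow> ('a \<times> 'a, ('a \<times> 'a) \<times> 'a sq \<times> ('a \<times> 'a)) cat" where
  "coalg_cat M W = structured_cat (arrow_cat M)
     {X. is_coalgebra (arrow_cat M) (lft_func W) (counit_sq M W) (comult_sq M W)
           (fst X) (coalg_sq M W X)}
     (\<lambda>X \<alpha> Y. coalg_sq M W Y \<cdot>\<^bsub>arrow_cat M\<^esub> \<alpha>
        = far (lft_func W) \<alpha> \<cdot>\<^bsub>arrow_cat M\<^esub> coalg_sq M W X)"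

definition alg_cat ::
    "('o, 'a) cat \<Rightarrow> ('o, 'a) awfs
      \<Rightarrow> ('a \<times> 'a, ('a \<times> 'a) \<times> 'a sq \<times> ('a \<times> 'a)) cat" where
  "alg_cat M W = structured_cat (arrow_cat M)
     {X. is_algebra (arrow_cat M) (rgt_func W) (unit_sq M W) (mult_sq M W)
           (fst X) (alg_sq M W X)}
     (\<lambda>X \<alpha> Y. \<alpha> \<cdot>\<^bsub>arrow_cat M\<^esub> alg_sq M W X
        = alg_sq M W Y \<cdot>\<^bsub>arrow_cat M\<^esub> far (rgt_func W) \<alpha>)"

definition canonical_solution ::
    "('o, 'a) cat \<Rightarrow> ('o, 'a) awfs \<Rightarrow> 'a \<times> 'a \<Rightarrow> 'a \<times> 'a \<Rightarrow> 'a sq \<Rightarrow> 'a" where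
  "canonical_solution M W X Y \<alpha> = snd Y \<cdot>\<^bsub>M\<^esub> far (mid W) \<alpha> \<cdot>\<^bsub>M\<^esub> snd X"


section \<open>Generation of an awfs by a category of arrows\<close>

text \<open>A choice of solutions is a function of the object \<open>x\<close> of \<open>\<J>\<close> and the lifting
  problem \<open>\<alpha>\<close>; it is required to be \<open>undefined\<close> off the actual lifting problems so that
  distinct objects of the category \<open>lift_cat\<close> are really distinct.\<close>

definition lift_choices ::
    "('o, 'a) cat \<Rightarrow> ('jo, 'ja) cat \<Rightarrow> ('jo, 'ja, 'a, 'a sq) func
      \<Rightarrow> ('a \<times> ('jo \<Rightarrow> 'a sq \<Rightarrow> 'a)) set" where
  "lift_choices M \<J> U = {(f, \<phi>). f \<in> ar M
     \<and> (\<forall>x\<in>ob \<J>. \<forall>\<alpha>\<in>hom (arrow_cat M) (fob U x) f.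
          \<phi> x \<alpha> \<in> hom M (tgt M (fob U x)) (src M f)
          \<and> \<phi> x \<alpha> \<cdot>\<^bsub>M\<^esub> fob U x = stop \<alpha> \<and> f \<cdot>\<^bsub>M\<^esub> \<phi> x \<alpha> = sbot \<alpha>)
     \<and> (\<forall>a\<in>ar \<J>. \<forall>\<alpha>\<in>hom (arrow_cat M) (fob U (tgt \<J> a)) f.
          \<phi> (src \<J> a) (\<alpha> \<cdot>\<^bsub>arrow_cat M\<^esub> far U a)
            = \<phi> (tgt \<J> a) \<alpha> \<cdot>\<^bsub>M\<^esub> sbot (far U a))
     \<and> (\<forall>x \<alpha>. \<not> (x \<in> ob \<J> \<and> \<alpha> \<in> hom (arrow_cat M) (fob U x) f)
          \<longrightarrow> \<phi> x \<alpha> = undefined)}"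

text \<open>The category written \<open>\<J>\<close> with a superscript pitchfork.\<close>

definition lift_cat ::
    "('o, 'a) cat \<Rightarrow> ('jo, 'ja) cat \<Rightarrow> ('jo, 'ja, 'a, 'a sq) func
      \<Rightarrow> ('a \<times> ('jo \<Rightarrow> 'a sq \<Rightarrow> 'a),
          ('a \<times> ('jo \<Rightarrow> 'a sq \<Rightarrow> 'a)) \<times> 'a sq \<times> ('a \<times> ('jo \<Rightarrow> 'a sq \<Rightarrow> 'a))) cat" where
  "lift_cat M \<J> U = structured_cat (arrow_cat M) (lift_choices M \<J> U)
     (\<lambda>X \<beta> Y. \<forall>x\<in>ob \<J>. \<forall>\<alpha>\<in>hom (arrow_cat M) (fob U x) (fst X).
        stop \<beta> \<cdot>\<^bsub>M\<^esub> snd X x \<alpha> = snd Y x (\<beta> \<cdot>\<^bsub>arrow_cat M\<^esub> \<alpha>))"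

definition canonical_choice ::
    "('o, 'a) cat \<Rightarrow> ('jo, 'ja) cat \<Rightarrow> ('o, 'a) awfs
      \<Rightarrow> ('jo, 'ja, 'a \<times> 'a, ('a \<times> 'a) \<times> 'a sq \<times> ('a \<times> 'a)) func
      \<Rightarrow> 'a \<times> 'a \<Rightarrow> 'a \<times> ('jo \<Rightarrow> 'a sq \<Rightarrow> 'a)" where
  "canonical_choice M \<J> W G Y = (fst Y,
     \<lambda>x \<alpha>. if x \<in> ob \<J> \<and> \<alpha> \<in> hom (arrow_cat M) (fst (fob G x)) (fst Y)
       then canonical_solution M W (fob G x) Y \<alpha> else undefined)"

definition canonical_functor ::
    "('o, 'a) cat \<Rightarrow> ('jo, 'ja) cat \<Rightarrow> ('o, 'a) awfs
      \<Rightarrow> ('jo, 'ja, 'a \<times> 'a, ('a \<times> 'a) \<times> 'a sq \<times> ('a \<times> 'a)) func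
      \<Rightarrow> ('a \<times> 'a, ('a \<times> 'a) \<times> 'a sq \<times> ('a \<times> 'a), 'a \<times> ('jo \<Rightarrow> 'a sq \<Rightarrow> 'a),
          ('a \<times> ('jo \<Rightarrow> 'a sq \<Rightarrow> 'a)) \<times> 'a sq \<times> ('a \<times> ('jo \<Rightarrow> 'a sq \<Rightarrow> 'a))) func" where
  "canonical_functor M \<J> W G = \<lparr>fob = canonical_choice M \<J> W G,
     far = (\<lambda>(X, \<beta>, Y). (canonical_choice M \<J> W G X, \<beta>, canonical_choice M \<J> W G Y))\<rparr>"

definition is_functor_over ::
    "('jo, 'ja) cat \<Rightarrow> ('a \<times> 's, ('a \<times> 's) \<times> 'b \<times> ('a \<times> 's)) cat
      \<Rightarrow> ('jo, 'ja, 'a, 'b) func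
      \<Rightarrow> ('jo, 'ja, 'a \<times> 's, ('a \<times> 's) \<times> 'b \<times> ('a \<times> 's)) func \<Rightarrow> bool" where
  "is_functor_over \<J> D U G \<longleftrightarrow> is_functor \<J> D G \<and> func_eq \<J> (forget \<circ>\<^sub>F G) U"

text \<open>The functor between categories of coalgebras induced by a morphism of awfs.\<close>

definition coalg_map ::
    "('o, 'a) cat \<Rightarrow> ('a \<Rightarrow> 'a)
      \<Rightarrow> ('a \<times> 'a, ('a \<times> 'a) \<times> 'a sq \<times> ('a \<times> 'a),
          'a \<times> 'a, ('a \<times> 'a) \<times> 'a sq \<times> ('a \<times> 'a)) func" where
  "coalg_map M \<xi> = (let push = (\<lambda>(j, s). (j, \<xi> j \<cdot>\<^bsub>M\<^esub> s))
     in \<lparr>fob = push, far = (\<lambda>(X, \<alpha>, Y). (push X, \<alpha>, push Y))\<rparr>)"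

text \<open>The awfs generated by \<open>U : \<J> \<rightarrow> M\<^sup>2\<close> is the algebraically free one: the unit is
  universal among functors from \<open>\<J>\<close> to categories of coalgebras, and its algebras are the
  objects of \<open>lift_cat\<close>.  This determines it up to isomorphism.  No smallness of \<open>\<J>\<close> or
  cocompleteness of \<open>M\<close> is imposed: these only serve to ensure that such an awfs exists.\<close>

definition generates ::
    "('o, 'a) cat \<Rightarrow> ('jo, 'ja) cat \<Rightarrow> ('jo, 'ja, 'a, 'a sq) func
      \<Rightarrow> ('o, 'a) awfs \<Rightarrow> bool" where
  "generates M \<J> U W \<longleftrightarrow>
     is_functor \<J> (arrow_cat M) U \<and> is_awfs M W \<and>
     (\<exists>G. is_functor_over \<J> (coalg_cat M W) U G
        \<and> (\<forall>W' G'. is_awfs M W' \<and> is_functor_over \<J> (coalg_cat M W') U G' \<longrightarrow>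
             (\<exists>\<xi>. is_awfs_morphism M W W' \<xi> \<and> func_eq \<J> (coalg_map M \<xi> \<circ>\<^sub>F G) G'
                \<and> (\<forall>\<xi>'. is_awfs_morphism M W W' \<xi>' \<and> func_eq \<J> (coalg_map M \<xi>' \<circ>\<^sub>F G) G'
                     \<longrightarrow> (\<forall>f\<in>ar M. \<xi>' f = \<xi> f))))
        \<and> is_iso_functor (alg_cat M W) (lift_cat M \<J> U) (canonical_functor M \<J> W G))"

definition cellular ::
    "('o, 'a) cat \<Rightarrow> ('o, 'a) awfs \<Rightarrow> ('jo, 'ja) cat \<Rightarrow> ('jo, 'ja, 'a, 'a sq) func \<Rightarrow> bool"
    where
  "cellular M W \<J> U \<longleftrightarrow> (\<exists>G. is_functor_over \<J> (coalg_cat M W) U G)"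


section \<open>Pushouts and pullbacks\<close>

text \<open>A span \<open>f, g\<close> completed by \<open>p, q\<close> with \<open>p \<cdot> f = q \<cdot> g\<close>.\<close>

definition is_pushout :: "('o, 'a) cat \<Rightarrow> 'a \<Rightarrow> 'a \<Rightarrow> 'a \<Rightarrow> 'a \<Rightarrow> bool" where
  "is_pushout C f g p q \<longleftrightarrow> {f, g, p, q} \<subseteq> ar C \<and> src C f = src C g
     \<and> src C p = tgt C f \<and> src C q = tgt C g \<and> tgt C p = tgt C q
     \<and> p \<cdot>\<^bsub>C\<^esub> f = q \<cdot>\<^bsub>C\<^esub> g
     \<and> (\<forall>z. \<forall>x\<in>hom C (tgt C f) z. \<forall>y\<in>hom C (tgt C g) z.
          x \<cdot>\<^bsub>C\<^esub> f = y \<cdot>\<^bsub>C\<^esub> g \<longrightarrow>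
          (\<exists>!m. m \<in> hom C (tgt C p) z \<and> m \<cdot>\<^bsub>C\<^esub> p = x \<and> m \<cdot>\<^bsub>C\<^esub> q = y))"

definition has_pushouts :: "('o, 'a) cat \<Rightarrow> bool" where
  "has_pushouts C \<longleftrightarrow>
     (\<forall>f\<in>ar C. \<forall>g\<in>ar C. src C f = src C g \<longrightarrow> (\<exists>p q. is_pushout C f g p q))"

definition po_inl :: "('o, 'a) cat \<Rightarrow> 'a \<Rightarrow> 'a \<Rightarrow> 'a" where
  "po_inl C f g = fst (SOME (p, q). is_pushout C f g p q)"

definition po_inr :: "('o, 'a) cat \<Rightarrow> 'a \<Rightarrow> 'a \<Rightarrow> 'a" where
  "po_inr C f g = snd (SOME (p, q). is_pushout C f g p q)"

definition po_map :: "('o, 'a) cat \<Rightarrow> 'a \<Rightarrow> 'a \<Rightarrow> 'a \<Rightarrow> 'a \<Rightarrow> 'a" where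
  "po_map C f g x y = (THE m. m \<in> hom C (tgt C (po_inl C f g)) (tgt C x)
     \<and> m \<cdot>\<^bsub>C\<^esub> po_inl C f g = x \<and> m \<cdot>\<^bsub>C\<^esub> po_inr C f g = y)"

definition has_pullbacks :: "('o, 'a) cat \<Rightarrow> bool" where
  "has_pullbacks C \<longleftrightarrow> has_pushouts (op_cat C)"

text \<open>The projections of the pullback of a cospan \<open>f, g\<close> (to the source of \<open>f\<close> and of \<open>g\<close>
  respectively) and the map into it with components \<open>x\<close> and \<open>y\<close>.\<close>

definition pb_fst :: "('o, 'a) cat \<Rightarrow> 'a \<Rightarrow> 'a \<Rightarrow> 'a" where
  "pb_fst C = po_inl (op_cat C)"

definition pb_snd :: "('o, 'a) cat \<Rightarrow> 'a \<Rightarrow> 'a \<Rightarrow> 'a" where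
  "pb_snd C = po_inr (op_cat C)"

definition pb_map :: "('o, 'a) cat \<Rightarrow> 'a \<Rightarrow> 'a \<Rightarrow> 'a \<Rightarrow> 'a \<Rightarrow> 'a" where
  "pb_map C = po_map (op_cat C)"


section \<open>Two-variable adjunctions\<close>

text \<open>\<open>transl A k m n\<close> and \<open>transr A k m n\<close> are the bijections from maps
  \<open>k \<otimes> m \<rightarrow> n\<close> to maps \<open>m \<rightarrow> homl k n\<close> and \<open>k \<rightarrow> homr m n\<close>.\<close>

record ('ko, 'ka, 'mo, 'ma, 'no, 'na) tva =
  tensor :: "('ko \<times> 'mo, 'ka \<times> 'ma, 'no, 'na) func"
  homl :: "('ko \<times> 'no, 'ka \<times> 'na, 'mo, 'ma) func"
  homr :: "('mo \<times> 'no, 'ma \<times> 'na, 'ko, 'ka) func"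
  transl :: "'ko \<Rightarrow> 'mo \<Rightarrow> 'no \<Rightarrow> 'na \<Rightarrow> 'ma"
  transr :: "'ko \<Rightarrow> 'mo \<Rightarrow> 'no \<Rightarrow> 'na \<Rightarrow> 'ka"

definition is_two_variable_adjunction ::
    "('ko, 'ka) cat \<Rightarrow> ('mo, 'ma) cat \<Rightarrow> ('no, 'na) cat
      \<Rightarrow> ('ko, 'ka, 'mo, 'ma, 'no, 'na) tva \<Rightarrow> bool" where
  "is_two_variable_adjunction K M N A \<longleftrightarrow>
     is_functor (prod_cat K M) N (tensor A)
     \<and> is_functor (prod_cat (op_cat K) N) M (homl A)
     \<and> is_functor (prod_cat (op_cat M) N) K (homr A)
     \<and> (\<forall>k\<in>ob K. \<forall>m\<in>ob M. \<forall>n\<in>ob N.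
          bij_betw (transl A k m n)
            (hom N (fob (tensor A) (k, m)) n) (hom M m (fob (homl A) (k, n)))
          \<and> bij_betw (transr A k m n)
            (hom N (fob (tensor A) (k, m)) n) (hom K k (fob (homr A) (m, n))))
     \<and> (\<forall>a\<in>ar K. \<forall>b\<in>ar M. \<forall>c\<in>ar N.
          \<forall>h\<in>hom N (fob (tensor A) (tgt K a, tgt M b)) (src N c).
            transl A (src K a) (src M b) (tgt N c)
                (c \<cdot>\<^bsub>N\<^esub> h \<cdot>\<^bsub>N\<^esub> far (tensor A) (a, b))
              = far (homl A) (a, c) \<cdot>\<^bsub>M\<^esub> transl A (tgt K a) (tgt M b) (src N c) h \<cdot>\<^bsub>M\<^esub> b
            \<and> transr A (src K a) (src M b) (tgt N c)
                (c \<cdot>\<^bsub>N\<^esub> h \<cdot>\<^bsub>N\<^esub> far (tensor A) (a, b))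
              = far (homr A) (b, c) \<cdot>\<^bsub>K\<^esub> transr A (tgt K a) (tgt M b) (src N c) h \<cdot>\<^bsub>K\<^esub> a)"


subsection \<open>The induced two-variable adjunction on arrow categories\<close>

text \<open>The span \<open>A \<otimes> K \<leftarrow> A \<otimes> J \<rightarrow> B \<otimes> J\<close> for \<open>i : A \<rightarrow> B\<close> and \<open>j : J \<rightarrow> K\<close>; in the
  following definitions \<open>inl\<close> and \<open>inr\<close> are the maps from \<open>A \<otimes> K\<close> and \<open>B \<otimes> J\<close>
  into its pushout.\<close>

definition pp_span1 ::
    "('ko, 'ka) cat \<Rightarrow> ('ko \<times> 'mo, 'ka \<times> 'ma, 'no, 'na) func \<Rightarrow> 'ka \<Rightarrow> 'ma \<Rightarrow> 'na" where
  "pp_span1 K T i j = far T (idt K (src K i), j)"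

definition pp_span2 ::
    "('mo, 'ma) cat \<Rightarrow> ('ko \<times> 'mo, 'ka \<times> 'ma, 'no, 'na) func \<Rightarrow> 'ka \<Rightarrow> 'ma \<Rightarrow> 'na" where
  "pp_span2 M T i j = far T (i, idt M (src M j))"

definition pp_inl ::
    "('ko, 'ka) cat \<Rightarrow> ('mo, 'ma) cat \<Rightarrow> ('no, 'na) cat
      \<Rightarrow> ('ko \<times> 'mo, 'ka \<times> 'ma, 'no, 'na) func \<Rightarrow> 'ka \<Rightarrow> 'ma \<Rightarrow> 'na" where
  "pp_inl K M N T i j = po_inl N (pp_span1 K T i j) (pp_span2 M T i j)"

definition pp_inr ::
    "('ko, 'ka) cat \<Rightarrow> ('mo, 'ma) cat \<Rightarrow> ('no, 'na) cat
      \<Rightarrow> ('ko \<times> 'mo, 'ka \<times> 'ma, 'no, 'na) func \<Rightarrow> 'ka \<Rightarrow> 'ma \<Rightarrow> 'na" where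
  "pp_inr K M N T i j = po_inr N (pp_span1 K T i j) (pp_span2 M T i j)"

definition pp_map ::
    "('ko, 'ka) cat \<Rightarrow> ('mo, 'ma) cat \<Rightarrow> ('no, 'na) cat
      \<Rightarrow> ('ko \<times> 'mo, 'ka \<times> 'ma, 'no, 'na) func \<Rightarrow> 'ka \<Rightarrow> 'ma \<Rightarrow> 'na \<Rightarrow> 'na \<Rightarrow> 'na" where
  "pp_map K M N T i j = po_map N (pp_span1 K T i j) (pp_span2 M T i j)"

definition pushout_product ::
    "('ko, 'ka) cat \<Rightarrow> ('mo, 'ma) cat \<Rightarrow> ('no, 'na) cat
      \<Rightarrow> ('ko \<times> 'mo, 'ka \<times> 'ma, 'no, 'na) func
      \<Rightarrow> ('ka \<times> 'ma, 'ka sq \<times> 'ma sq, 'na, 'na sq) func" where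
  "pushout_product K M N T =
     (let pp = (\<lambda>(i, j). pp_map K M N T i j
                  (far T (i, idt M (tgt M j))) (far T (idt K (tgt K i), j)))
      in \<lparr>fob = pp,
          far = (\<lambda>(\<alpha>, \<beta>). Sq (pp (sdom \<alpha>, sdom \<beta>))
            (pp_map K M N T (sdom \<alpha>) (sdom \<beta>)
               (pp_inl K M N T (scod \<alpha>) (scod \<beta>) \<cdot>\<^bsub>N\<^esub> far T (stop \<alpha>, sbot \<beta>))
               (pp_inr K M N T (scod \<alpha>) (scod \<beta>) \<cdot>\<^bsub>N\<^esub> far T (sbot \<alpha>, stop \<beta>)))
            (far T (sbot \<alpha>, sbot \<beta>))
            (pp (scod \<alpha>, scod \<beta>)))\<rparr>)"

text \<open>For a functor \<open>H : C\<^sup>o\<^sup>p \<times> N \<rightarrow> D\<close>, \<open>i : A \<rightarrow> B\<close> in \<open>C\<close> and \<open>f : X \<rightarrow> Y\<close> in \<open>N\<close>, the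
  cospan \<open>H B Y \<rightarrow> H A Y \<leftarrow> H A X\<close>; in the following definitions \<open>fst\<close> and \<open>snd\<close> are
  the projections of its pullback to \<open>H B Y\<close> and \<open>H A X\<close>.\<close>

definition ph_cospan1 ::
    "('no, 'na) cat \<Rightarrow> ('co \<times> 'no, 'ca \<times> 'na, 'do, 'da) func \<Rightarrow> 'ca \<Rightarrow> 'na \<Rightarrow> 'da" where
  "ph_cospan1 N H i f = far H (i, idt N (tgt N f))"

definition ph_cospan2 ::
    "('co, 'ca) cat \<Rightarrow> ('co \<times> 'no, 'ca \<times> 'na, 'do, 'da) func \<Rightarrow> 'ca \<Rightarrow> 'na \<Rightarrow> 'da" where
  "ph_cospan2 C H i f = far H (idt C (src C i), f)"

definition ph_fst ::
    "('co, 'ca) cat \<Rightarrow> ('no, 'na) cat \<Rightarrow> ('do, 'da) cat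
      \<Rightarrow> ('co \<times> 'no, 'ca \<times> 'na, 'do, 'da) func \<Rightarrow> 'ca \<Rightarrow> 'na \<Rightarrow> 'da" where
  "ph_fst C N D H i f = pb_fst D (ph_cospan1 N H i f) (ph_cospan2 C H i f)"

definition ph_snd ::
    "('co, 'ca) cat \<Rightarrow> ('no, 'na) cat \<Rightarrow> ('do, 'da) cat
      \<Rightarrow> ('co \<times> 'no, 'ca \<times> 'na, 'do, 'da) func \<Rightarrow> 'ca \<Rightarrow> 'na \<Rightarrow> 'da" where
  "ph_snd C N D H i f = pb_snd D (ph_cospan1 N H i f) (ph_cospan2 C H i f)"

definition ph_map ::
    "('co, 'ca) cat \<Rightarrow> ('no, 'na) cat \<Rightarrow> ('do, 'da) cat
      \<Rightarrow> ('co \<times> 'no, 'ca \<times> 'na, 'do, 'da) func \<Rightarrow> 'ca \<Rightarrow> 'na \<Rightarrow> 'da \<Rightarrow> 'da \<Rightarrow> 'da" where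
  "ph_map C N D H i f = pb_map D (ph_cospan1 N H i f) (ph_cospan2 C H i f)"

text \<open>Contravariant in the first argument: a pair of squares \<open>\<alpha> : i \<Rightarrow> i'\<close> and
  \<open>\<beta> : f \<Rightarrow> f'\<close> goes to a square from the value at \<open>(i', f)\<close> to that at \<open>(i, f')\<close>.\<close>

definition pullback_hom ::
    "('co, 'ca) cat \<Rightarrow> ('no, 'na) cat \<Rightarrow> ('do, 'da) cat
      \<Rightarrow> ('co \<times> 'no, 'ca \<times> 'na, 'do, 'da) func
      \<Rightarrow> ('ca \<times> 'na, 'ca sq \<times> 'na sq, 'da, 'da sq) func" where
  "pullback_hom C N D H =
     (let ph = (\<lambda>(i, f). ph_map C N D H i f
                  (far H (idt C (tgt C i), f)) (far H (i, idt N (src N f))))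
      in \<lparr>fob = ph,
          far = (\<lambda>(\<alpha>, \<beta>). Sq (ph (scod \<alpha>, sdom \<beta>))
            (far H (sbot \<alpha>, stop \<beta>))
            (ph_map C N D H (sdom \<alpha>) (scod \<beta>)
               (far H (sbot \<alpha>, sbot \<beta>) \<cdot>\<^bsub>D\<^esub> ph_fst C N D H (scod \<alpha>) (sdom \<beta>))
               (far H (stop \<alpha>, stop \<beta>) \<cdot>\<^bsub>D\<^esub> ph_snd C N D H (scod \<alpha>) (sdom \<beta>)))
            (ph (sdom \<alpha>, scod \<beta>)))\<rparr>)"

text \<open>The transposes of a square \<open>(u, v)\<close> from the pushout-product of \<open>i\<close> and \<open>j\<close> to \<open>f\<close> are
  obtained by transposing \<open>v\<close> and the two components \<open>u \<cdot> inl\<close> and \<open>u \<cdot> inr\<close> of \<open>u\<close>.\<close>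

definition arrow_tva ::
    "('ko, 'ka) cat \<Rightarrow> ('mo, 'ma) cat \<Rightarrow> ('no, 'na) cat
      \<Rightarrow> ('ko, 'ka, 'mo, 'ma, 'no, 'na) tva
      \<Rightarrow> ('ka, 'ka sq, 'ma, 'ma sq, 'na, 'na sq) tva" where
  "arrow_tva K M N A = \<lparr>
     tensor = pushout_product K M N (tensor A),
     homl = pullback_hom K N M (homl A),
     homr = pullback_hom M N K (homr A),
     transl = (\<lambda>i j f \<gamma>. Sq j
       (transl A (tgt K i) (src M j) (src N f)
          (stop \<gamma> \<cdot>\<^bsub>N\<^esub> pp_inr K M N (tensor A) i j))
       (ph_map K N M (homl A) i f
          (transl A (tgt K i) (tgt M j) (tgt N f) (sbot \<gamma>))
          (transl A (src K i) (tgt M j) (src N f)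
             (stop \<gamma> \<cdot>\<^bsub>N\<^esub> pp_inl K M N (tensor A) i j)))
       (fob (pullback_hom K N M (homl A)) (i, f))),
     transr = (\<lambda>i j f \<gamma>. Sq i
       (transr A (src K i) (tgt M j) (src N f)
          (stop \<gamma> \<cdot>\<^bsub>N\<^esub> pp_inl K M N (tensor A) i j))
       (ph_map M N K (homr A) j f
          (transr A (tgt K i) (tgt M j) (tgt N f) (sbot \<gamma>))
          (transr A (tgt K i) (src M j) (src N f)
             (stop \<gamma> \<cdot>\<^bsub>N\<^esub> pp_inr K M N (tensor A) i j)))
       (fob (pullback_hom M N K (homr A)) (j, f)))\<rparr>"


section \<open>Mates\<close>

record ('co, 'ca, 'do, 'da) adj =
  ladj :: "('co, 'ca, 'do, 'da) func"
  radj :: "('do, 'da, 'co, 'ca) func"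
  transp :: "'co \<Rightarrow> 'do \<Rightarrow> 'da \<Rightarrow> 'ca"

definition adj_unit :: "('do, 'da) cat \<Rightarrow> ('co, 'ca, 'do, 'da) adj \<Rightarrow> 'co \<Rightarrow> 'ca" where
  "adj_unit D P x = transp P x (fob (ladj P) x) (idt D (fob (ladj P) x))"

definition adj_counit ::
    "('co, 'ca) cat \<Rightarrow> ('do, 'da) cat \<Rightarrow> ('co, 'ca, 'do, 'da) adj \<Rightarrow> 'do \<Rightarrow> 'da" where
  "adj_counit C D P y =
     inv_into (hom D (fob (ladj P) (fob (radj P) y)) y) (transp P (fob (radj P) y) y)
       (idt C (fob (radj P) y))"

text \<open>Given adjunctions \<open>F \<stileturn> G\<close> between \<open>C\<close> and \<open>D\<close> and \<open>F' \<stileturn> G'\<close> between \<open>C'\<close> and \<open>D'\<close>,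
  and functors \<open>S : C \<rightarrow> C'\<close> and \<open>T : D \<rightarrow> D'\<close>, the transformation \<open>\<rho> : S G \<Rightarrow> G' T\<close> is the
  mate of \<open>\<tau> : F' S \<Rightarrow> T F\<close>.\<close>

definition are_mates ::
    "('co, 'ca) cat \<Rightarrow> ('do, 'da) cat \<Rightarrow> ('co1, 'ca1) cat \<Rightarrow> ('do1, 'da1) cat
      \<Rightarrow> ('co, 'ca, 'do, 'da) adj \<Rightarrow> ('co1, 'ca1, 'do1, 'da1) adj
      \<Rightarrow> ('co, 'ca, 'co1, 'ca1) func \<Rightarrow> ('do, 'da, 'do1, 'da1) func
      \<Rightarrow> ('co \<Rightarrow> 'da1) \<Rightarrow> ('do \<Rightarrow> 'ca1) \<Rightarrow> bool" where
  "are_mates C D C' D' P P' S T \<tau> \<rho> \<longleftrightarrow>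
     (\<forall>y\<in>ob D. \<rho> y =
        far (radj P') (far T (adj_counit C D P y))
        \<cdot>\<^bsub>C'\<^esub> far (radj P') (\<tau> (fob (radj P) y))
        \<cdot>\<^bsub>C'\<^esub> adj_unit D' P' (fob S (fob (radj P) y)))"

definition adj_fix_left ::
    "('ko, 'ka) cat \<Rightarrow> ('ko, 'ka, 'mo, 'ma, 'no, 'na) tva \<Rightarrow> 'ko
      \<Rightarrow> ('mo, 'ma, 'no, 'na) adj" where
  "adj_fix_left K A k = \<lparr>
     ladj = \<lparr>fob = (\<lambda>m. fob (tensor A) (k, m)), far = (\<lambda>b. far (tensor A) (idt K k, b))\<rparr>,
     radj = \<lparr>fob = (\<lambda>n. fob (homl A) (k, n)), far = (\<lambda>c. far (homl A) (idt K k, c))\<rparr>,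
     transp = transl A k\<rparr>"

definition adj_fix_right ::
    "('mo, 'ma) cat \<Rightarrow> ('ko, 'ka, 'mo, 'ma, 'no, 'na) tva \<Rightarrow> 'mo
      \<Rightarrow> ('ko, 'ka, 'no, 'na) adj" where
  "adj_fix_right M A m = \<lparr>
     ladj = \<lparr>fob = (\<lambda>k. fob (tensor A) (k, m)), far = (\<lambda>a. far (tensor A) (a, idt M m))\<rparr>,
     radj = \<lparr>fob = (\<lambda>n. fob (homr A) (m, n)), far = (\<lambda>c. far (homr A) (idt M m, c))\<rparr>,
     transp = (\<lambda>k. transr A k m)\<rparr>"


section \<open>Two-variable adjunctions of awfs\<close>

definition is_lifted_functor ::
    "('o, 'a) cat \<Rightarrow> ('p, 'b) cat \<Rightarrow> ('o, 'a, 'p0, 'b0) func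
      \<Rightarrow> ('p, 'b, 'q0, 'c0) func \<Rightarrow> ('p0, 'b0, 'q0, 'c0) func
      \<Rightarrow> ('o, 'a, 'p, 'b) func \<Rightarrow> bool" where
  "is_lifted_functor C D U V F F' \<longleftrightarrow>
     is_functor C D F' \<and> func_eq C (V \<circ>\<^sub>F F') (F \<circ>\<^sub>F U)"

text \<open>The awfs \<open>W'\<close>, \<open>W\<close> and \<open>V\<close> play the roles of \<open>(\<C>', \<F>')\<close>, \<open>(\<C>, \<F>)\<close> and \<open>(\<L>, \<R>)\<close>.\<close>

definition lifted_two_variable_adjunction ::
    "('ko, 'ka) cat \<Rightarrow> ('mo, 'ma) cat \<Rightarrow> ('no, 'na) cat
      \<Rightarrow> ('ko, 'ka, 'mo, 'ma, 'no, 'na) tva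
      \<Rightarrow> ('ko, 'ka) awfs \<Rightarrow> ('mo, 'ma) awfs \<Rightarrow> ('no, 'na) awfs
      \<Rightarrow> (('ka \<times> 'ka) \<times> ('ma \<times> 'ma),
          (('ka \<times> 'ka) \<times> 'ka sq \<times> ('ka \<times> 'ka)) \<times> (('ma \<times> 'ma) \<times> 'ma sq \<times> ('ma \<times> 'ma)),
          'na \<times> 'na, ('na \<times> 'na) \<times> 'na sq \<times> ('na \<times> 'na)) func
      \<Rightarrow> (('ka \<times> 'ka) \<times> ('na \<times> 'na),
          (('ka \<times> 'ka) \<times> 'ka sq \<times> ('ka \<times> 'ka)) \<times> (('na \<times> 'na) \<times> 'na sq \<times> ('na \<times> 'na)),
          'ma \<times> 'ma, ('ma \<times> 'ma) \<times> 'ma sq \<times> ('ma \<times> 'ma)) func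
      \<Rightarrow> (('ma \<times> 'ma) \<times> ('na \<times> 'na),
          (('ma \<times> 'ma) \<times> 'ma sq \<times> ('ma \<times> 'ma)) \<times> (('na \<times> 'na) \<times> 'na sq \<times> ('na \<times> 'na)),
          'ka \<times> 'ka, ('ka \<times> 'ka) \<times> 'ka sq \<times> ('ka \<times> 'ka)) func \<Rightarrow> bool" where
  "lifted_two_variable_adjunction K M N A W' W V T Hl Hr \<longleftrightarrow>
     is_lifted_functor (prod_cat (coalg_cat K W') (coalg_cat M W)) (coalg_cat N V)
       (forget \<times>\<^sub>F forget) forget (tensor (arrow_tva K M N A)) T
     \<and> is_lifted_functor (prod_cat (op_cat (coalg_cat K W')) (alg_cat N V)) (alg_cat M W)
       (forget \<times>\<^sub>F forget) forget (homl (arrow_tva K M N A)) Hl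
     \<and> is_lifted_functor (prod_cat (op_cat (coalg_cat M W)) (alg_cat N V)) (alg_cat K W')
       (forget \<times>\<^sub>F forget) forget (homr (arrow_tva K M N A)) Hr"

definition characterizes_tensor ::
    "('ko, 'ka) cat \<Rightarrow> ('mo, 'ma) cat \<Rightarrow> ('no, 'na) cat
      \<Rightarrow> ('ko, 'ka, 'mo, 'ma, 'no, 'na) tva
      \<Rightarrow> ('ko, 'ka) awfs \<Rightarrow> ('mo, 'ma) awfs \<Rightarrow> ('no, 'na) awfs
      \<Rightarrow> (('ka \<times> 'ka) \<times> ('ma \<times> 'ma), 'x, 'na \<times> 'na, 'y) func
      \<Rightarrow> ('ka \<times> 'ma \<Rightarrow> 'na) \<Rightarrow> bool" where
  "characterizes_tensor K M N A W' W V T lam \<longleftrightarrow>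
     nat_trans (prod_cat (arrow_cat K) (arrow_cat M)) N
       (tensor A \<circ>\<^sub>F (mid W' \<times>\<^sub>F mid W)) (mid V \<circ>\<^sub>F tensor (arrow_tva K M N A)) lam
     \<and> (\<forall>(i, s)\<in>ob (coalg_cat K W'). \<forall>(j, t)\<in>ob (coalg_cat M W).
          fob T ((i, s), (j, t)) =
            (fob (tensor (arrow_tva K M N A)) (i, j),
             lam (i, j) \<cdot>\<^bsub>N\<^esub> far (tensor A) (s, t)))"

text \<open>\<open>characterizes_hom\<close> is used both for \<open>H = homl A\<close> (with \<open>(C, D) = (K, M)\<close>) and for
  \<open>H = homr A\<close> (with \<open>(C, D) = (M, K)\<close>).\<close>

definition characterizes_hom ::
    "('co, 'ca) cat \<Rightarrow> ('no, 'na) cat \<Rightarrow> ('do, 'da) cat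
      \<Rightarrow> ('co \<times> 'no, 'ca \<times> 'na, 'do, 'da) func
      \<Rightarrow> ('ca \<times> 'na, 'ca sq \<times> 'na sq, 'da, 'da sq) func
      \<Rightarrow> ('co, 'ca) awfs \<Rightarrow> ('no, 'na) awfs \<Rightarrow> ('do, 'da) awfs
      \<Rightarrow> (('ca \<times> 'ca) \<times> ('na \<times> 'na), 'x, 'da \<times> 'da, 'y) func
      \<Rightarrow> ('ca \<times> 'na \<Rightarrow> 'da) \<Rightarrow> bool" where
  "characterizes_hom C N D H Hhat WC V WD H' \<rho> \<longleftrightarrow>
     nat_trans (prod_cat (op_cat (arrow_cat C)) (arrow_cat N)) D
       (mid WD \<circ>\<^sub>F Hhat) (H \<circ>\<^sub>F (mid WC \<times>\<^sub>F mid V)) \<rho>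
     \<and> (\<forall>(i, s)\<in>ob (coalg_cat C WC). \<forall>(f, r)\<in>ob (alg_cat N V).
          fob H' ((i, s), (f, r)) =
            (fob Hhat (i, f), far H (s, r) \<cdot>\<^bsub>D\<^esub> \<rho> (i, f)))"

definition parameterized_mates ::
    "('ko, 'ka) cat \<Rightarrow> ('mo, 'ma) cat \<Rightarrow> ('no, 'na) cat
      \<Rightarrow> ('ko, 'ka, 'mo, 'ma, 'no, 'na) tva
      \<Rightarrow> ('ko, 'ka) awfs \<Rightarrow> ('mo, 'ma) awfs \<Rightarrow> ('no, 'na) awfs
      \<Rightarrow> ('ka \<times> 'ma \<Rightarrow> 'na) \<Rightarrow> ('ka \<times> 'na \<Rightarrow> 'ma) \<Rightarrow> ('ma \<times> 'na \<Rightarrow> 'ka) \<Rightarrow> bool" where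
  "parameterized_mates K M N A W' W V lam \<rho>l \<rho>r \<longleftrightarrow>
     (\<forall>i\<in>ar K. are_mates (arrow_cat M) (arrow_cat N) M N
        (adj_fix_left (arrow_cat K) (arrow_tva K M N A) i)
        (adj_fix_left K A (fob (mid W') i))
        (mid W) (mid V) (\<lambda>j. lam (i, j)) (\<lambda>f. \<rho>l (i, f)))
     \<and> (\<forall>j\<in>ar M. are_mates (arrow_cat K) (arrow_cat N) K N
        (adj_fix_right (arrow_cat M) (arrow_tva K M N A) j)
        (adj_fix_right M A (fob (mid W) j))
        (mid W') (mid V) (\<lambda>i. lam (i, j)) (\<lambda>f. \<rho>r (j, f)))"

definition forms_two_variable_adjunction_of_awfs ::
    "('ko, 'ka) cat \<Rightarrow> ('mo, 'ma) cat \<Rightarrow> ('no, 'na) cat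
      \<Rightarrow> ('ko, 'ka, 'mo, 'ma, 'no, 'na) tva
      \<Rightarrow> ('ko, 'ka) awfs \<Rightarrow> ('mo, 'ma) awfs \<Rightarrow> ('no, 'na) awfs \<Rightarrow> bool" where
  "forms_two_variable_adjunction_of_awfs K M N A W' W V \<longleftrightarrow>
     (\<exists>T Hl Hr. lifted_two_variable_adjunction K M N A W' W V T Hl Hr
        \<and> (\<exists>lam \<rho>l \<rho>r. characterizes_tensor K M N A W' W V T lam
             \<and> characterizes_hom K N M (homl A) (homl (arrow_tva K M N A)) W' V W Hl \<rho>l
             \<and> characterizes_hom M N K (homr A) (homr (arrow_tva K M N A)) W V W' Hr \<rho>r
             \<and> parameterized_mates K M N A W' W V lam \<rho>l \<rho>r))"

end

theory Submission
  imports Defs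
begin

text \<open>A two-variable adjunction is a ternary relation: a map \<open>k \<otimes> m \<rightarrow> n\<close> is the same as a map
\<open>m \<rightarrow> homl k n\<close> or \<open>k \<rightarrow> homr m n\<close>.  For \<open>i : A \<rightarrow> B\<close>, \<open>j : J \<rightarrow> K\<close> and \<open>f : X \<rightarrow> Y\<close>, lifting
problems of the pushout-product of \<open>i\<close> and \<open>j\<close> against \<open>f\<close>, of \<open>i\<close> against the pullback-hom of
\<open>j\<close> and \<open>f\<close>, and of \<open>j\<close> against the pullback-hom of \<open>i\<close> and \<open>f\<close> are therefore one and the same
thing: compatible maps \<open>y : B \<otimes> K \<rightarrow> Y\<close>, \<open>b : A \<otimes> K \<rightarrow> X\<close>, \<open>c : B \<otimes> J \<rightarrow> X\<close> (\<open>prob\<close>), to be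
solved by a map \<open>B \<otimes> K \<rightarrow> X\<close> (\<open>sol\<close>).  Both sides of the theorem are statements about
operations \<open>S\<close> that choose such solutions when \<open>i\<close> and \<open>j\<close> carry coalgebra structures and \<open>f\<close>
carries an algebra structure.

If the lifted functors exist, precomposing the lift of the tensor with the two unit functors
exhibits the pushout-products of the generators as cellular (\<open>forms_cellular\<close>).

Conversely, a functor into \<open>\<L>\<close>-coalgebras on \<open>\<I> \<times> \<J>\<close> solves all problems in which \<open>i\<close> and \<open>j\<close> are
generators and \<open>f\<close> is an \<open>\<R>\<close>-algebra, by the canonical solutions.  For fixed \<open>j\<close> and \<open>f\<close> these
solutions, natural in \<open>i\<close>, are an object of the category of arrows with chosen lifts against
\<open>\<I>\<close>, hence an \<open>\<F>'\<close>-algebra structure on the pullback-hom of \<open>j\<close> and \<open>f\<close>; the canonical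
solutions of that algebra extend \<open>S\<close> from \<open>\<I>\<close> to all \<open>\<C>'\<close>-coalgebras.  The same step with the two
variables exchanged extends \<open>S\<close> from \<open>\<J>\<close> to all \<open>\<C>\<close>-coalgebras (\<open>extend_lifting_op\<close>).

Naturality of \<open>S\<close> alone would only give structures for the underlying (co)pointed
endofunctors.  The associativity laws come from vertical composition: a (co)algebra for one half
of an awfs is the same as a natural choice of solutions against the other half for which
composites are solved in two stages (\<open>coalg_criterion\<close>, \<open>alg_criterion\<close>).  So \<open>S\<close> is required to
solve composites in each of the three variables in stages.  This holds at the start in the
variable \<open>f\<close>, is automatic in the variable that is being extended, and survives an extension in
another variable: the pullback-hom at a composite is a composite of one pullback-hom with a
pullback of another, such an arrow again carries a composite algebra structure
(\<open>pullback_composite_alg\<close>), and the algebra structures are determined by their solutions against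
the generators.

The value of \<open>S\<close> at two cofree coalgebras and a free algebra is the transformation \<open>\<lambda>\<close>
(\<open>lam\<close>), which determines \<open>S\<close> (\<open>S_formula\<close>); transposing it gives the mates \<open>\<rho>\<close> (\<open>rho\<close>).  The
criterion for coalgebras makes \<open>\<lambda>\<close> a lift of the tensor, the criterion for algebras makes the \<open>\<rho>\<close>
lifts of the two homs (\<open>full_forms\<close>).\<close>

section \<open>Categories and commutative squares\<close>

lemma hom_iff [simp]: "f \<in> hom C x y \<longleftrightarrow> f \<in> ar C \<and> src C f = x \<and> tgt C f = y"
  by (auto simp: hom_def)

context category
begin

lemma ob_simps [simp]: "f \<in> ar C \<Longrightarrow> src C f \<in> ob C" "f \<in> ar C \<Longrightarrow> tgt C f \<in> ob C"
  by (simp_all add: src_ob tgt_ob)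

lemma idt_simps [simp]:
  "x \<in> ob C \<Longrightarrow> idt C x \<in> ar C" "x \<in> ob C \<Longrightarrow> src C (idt C x) = x" "x \<in> ob C \<Longrightarrow> tgt C (idt C x) = x"
  using idt_hom[of x] by simp_all

lemma comp_simps [simp]:
  assumes "f \<in> ar C" "g \<in> ar C" "tgt C f = src C g"
  shows "g \<cdot> f \<in> ar C" "src C (g \<cdot> f) = src C f" "tgt C (g \<cdot> f) = tgt C g"
  using cmp_hom[of f "src C f" "src C g" g "tgt C g"] assms by simp_all

lemma unit_simps [simp]:
  "f \<in> ar C \<Longrightarrow> tgt C f = x \<Longrightarrow> idt C x \<cdot> f = f"
  "f \<in> ar C \<Longrightarrow> src C f = x \<Longrightarrow> f \<cdot> idt C x = f"
  using idt_left[of f "src C f" "tgt C f"] idt_right[of f "src C f" "tgt C f"] by simp_all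

lemma assoc [simp]:
  assumes "f \<in> ar C" "g \<in> ar C" "h \<in> ar C" "tgt C f = src C g" "tgt C g = src C h"
  shows "(h \<cdot> g) \<cdot> f = h \<cdot> (g \<cdot> f)"
  using cmp_assoc[of f "src C f" "tgt C f" g "tgt C g" h "tgt C h"] assms by simp

text \<open>Composites are kept associated to the right, so an equation between composites of two
  arrows is used on the head of a longer composite.\<close>

lemma comp_reduce:
  assumes "a \<cdot> b = c" "a \<in> ar C" "b \<in> ar C" "tgt C b = src C a" "x \<in> ar C" "tgt C x = src C b"
  shows "a \<cdot> (b \<cdot> x) = c \<cdot> x"
  using assms by (metis assoc)

lemma comp_exchange:
  assumes "a \<cdot> b = c \<cdot> d" "a \<in> ar C" "b \<in> ar C" "c \<in> ar C" "d \<in> ar C" "tgt C b = src C a" "tgt C d = src C c"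
    "x \<in> ar C" "tgt C x = src C b" "src C b = src C d"
  shows "a \<cdot> (b \<cdot> x) = c \<cdot> (d \<cdot> x)"
  using assms by (metis assoc)

end

lemma op_cat_simps [simp]:
  "ob (op_cat C) = ob C" "ar (op_cat C) = ar C" "src (op_cat C) = tgt C" "tgt (op_cat C) = src C"
  "idt (op_cat C) = idt C" "cmp (op_cat C) g f = cmp C f g"
  by (simp_all add: op_cat_def)

lemma category_op: "category C \<Longrightarrow> category (op_cat C)"
proof -
  assume "category C" then interpret category C .
  show ?thesis by unfold_locales simp_all
qed

definition square :: "('o, 'a) cat \<Rightarrow> 'a \<Rightarrow> 'a \<Rightarrow> 'a \<Rightarrow> 'a \<Rightarrow> bool" where
  "square C f u v g \<longleftrightarrow> f \<in> ar C \<and> g \<in> ar C \<and> u \<in> ar C \<and> v \<in> ar C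
     \<and> src C u = src C f \<and> tgt C u = src C g \<and> src C v = tgt C f \<and> tgt C v = tgt C g
     \<and> g \<cdot>\<^bsub>C\<^esub> u = v \<cdot>\<^bsub>C\<^esub> f"

lemma squareD:
  assumes "square C f u v g"
  shows "f \<in> ar C" "g \<in> ar C" "u \<in> ar C" "v \<in> ar C" "src C u = src C f" "tgt C u = src C g"
    "src C v = tgt C f" "tgt C v = tgt C g" "g \<cdot>\<^bsub>C\<^esub> u = v \<cdot>\<^bsub>C\<^esub> f"
  using assms by (auto simp: square_def)

lemma square_op: "square (op_cat C) f u v g \<longleftrightarrow> square C g v u f"
  by (auto simp: square_def)

lemma (in category) square_comp:
  assumes "square C f u v g" "square C g u' v' h"
  shows "square C f (u' \<cdot> u) (v' \<cdot> v) h"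
proof -
  note 1 = squareD[OF assms(1)] and 2 = squareD[OF assms(2)]
  have "h \<cdot> (u' \<cdot> u) = v' \<cdot> (g \<cdot> u)" using 1 2 by (intro comp_exchange) auto
  then show ?thesis unfolding square_def using 1 2 by simp
qed

lemma (in category) square_idt: "f \<in> ar C \<Longrightarrow> square C f (idt C (src C f)) (idt C (tgt C f)) f"
  by (simp add: square_def)

section \<open>Algebraic weak factorization systems as equations\<close>

text \<open>The data of an awfs in terms of the underlying category: \<open>Qm f u v g\<close> is the value of the
middle-object functor at the square \<open>(u, v) : f \<Rightarrow> g\<close>.  The point of this form is that the list
of laws is invariant under reversing \<open>C\<close> while exchanging \<open>L\<close> with \<open>R\<close> and \<open>D\<close> with \<open>U\<close>, so that
every result about algebras yields one about coalgebras.\<close>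

locale awfs_laws = category C for C :: "('o, 'a) cat" (structure) +
  fixes Q :: "'a \<Rightarrow> 'o" and Qm :: "'a \<Rightarrow> 'a \<Rightarrow> 'a \<Rightarrow> 'a \<Rightarrow> 'a"
    and L R D U :: "'a \<Rightarrow> 'a"
  assumes Qm_hom: "square C f u v g \<Longrightarrow> Qm f u v g \<in> hom C (Q f) (Q g)"
    and Qm_idt: "f \<in> ar C \<Longrightarrow> Qm f (idt C (src C f)) (idt C (tgt C f)) f = idt C (Q f)"
    and Qm_comp: "square C f u v g \<Longrightarrow> square C g u' v' h \<Longrightarrow>
      Qm g u' v' h \<cdot> Qm f u v g = Qm f (u' \<cdot> u) (v' \<cdot> v) h"
    and L_hom: "f \<in> ar C \<Longrightarrow> L f \<in> hom C (src C f) (Q f)"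
    and R_hom: "f \<in> ar C \<Longrightarrow> R f \<in> hom C (Q f) (tgt C f)"
    and R_L: "f \<in> ar C \<Longrightarrow> R f \<cdot> L f = f"
    and Qm_L: "square C f u v g \<Longrightarrow> Qm f u v g \<cdot> L f = L g \<cdot> u"
    and R_Qm: "square C f u v g \<Longrightarrow> R g \<cdot> Qm f u v g = v \<cdot> R f"
    and D_hom: "f \<in> ar C \<Longrightarrow> D f \<in> hom C (Q f) (Q (L f))"
    and U_hom: "f \<in> ar C \<Longrightarrow> U f \<in> hom C (Q (R f)) (Q f)"
    and D_L: "f \<in> ar C \<Longrightarrow> D f \<cdot> L f = L (L f)"
    and R_U: "f \<in> ar C \<Longrightarrow> R f \<cdot> U f = R (R f)"
    and R_D: "f \<in> ar C \<Longrightarrow> R (L f) \<cdot> D f = idt C (Q f)"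
    and U_L: "f \<in> ar C \<Longrightarrow> U f \<cdot> L (R f) = idt C (Q f)"
    and Qm_D: "f \<in> ar C \<Longrightarrow> Qm (L f) (idt C (src C f)) (R f) f \<cdot> D f = idt C (Q f)"
    and U_Qm: "f \<in> ar C \<Longrightarrow> U f \<cdot> Qm f (L f) (idt C (tgt C f)) (R f) = idt C (Q f)"
    and D_nat: "square C f u v g \<Longrightarrow> D g \<cdot> Qm f u v g = Qm (L f) u (Qm f u v g) (L g) \<cdot> D f"
    and U_nat: "square C f u v g \<Longrightarrow> Qm f u v g \<cdot> U f = U g \<cdot> Qm (R f) (Qm f u v g) v (R g)"
    and D_assoc: "f \<in> ar C \<Longrightarrow> D (L f) \<cdot> D f = Qm (L f) (idt C (src C f)) (D f) (L (L f)) \<cdot> D f"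
    and U_assoc: "f \<in> ar C \<Longrightarrow> U f \<cdot> U (R f) = U f \<cdot> Qm (R (R f)) (U f) (idt C (tgt C f)) (R f)"
    and distrib: "f \<in> ar C \<Longrightarrow> D f \<cdot> U f = U (L f) \<cdot> Qm (L (R f)) (D f) (U f) (R (L f)) \<cdot> D (R f)"
begin

lemma L_simps [simp]: "f \<in> ar C \<Longrightarrow> L f \<in> ar C" "f \<in> ar C \<Longrightarrow> src C (L f) = src C f"
    "f \<in> ar C \<Longrightarrow> tgt C (L f) = Q f"
  using L_hom[of f] by simp_all

lemma R_simps [simp]: "f \<in> ar C \<Longrightarrow> R f \<in> ar C" "f \<in> ar C \<Longrightarrow> src C (R f) = Q f"
    "f \<in> ar C \<Longrightarrow> tgt C (R f) = tgt C f"
  using R_hom[of f] by simp_all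

lemma D_simps [simp]: "f \<in> ar C \<Longrightarrow> D f \<in> ar C" "f \<in> ar C \<Longrightarrow> src C (D f) = Q f"
    "f \<in> ar C \<Longrightarrow> tgt C (D f) = Q (L f)"
  using D_hom[of f] by simp_all

lemma U_simps [simp]: "f \<in> ar C \<Longrightarrow> U f \<in> ar C" "f \<in> ar C \<Longrightarrow> src C (U f) = Q (R f)"
    "f \<in> ar C \<Longrightarrow> tgt C (U f) = Q f"
  using U_hom[of f] by simp_all

lemma Q_ob [simp]: "f \<in> ar C \<Longrightarrow> Q f \<in> ob C"
  using L_simps(1,3) ob_simps(2) by metis

lemma Qm_simps [simp]: "square C f u v g \<Longrightarrow> Qm f u v g \<in> ar C"
    "square C f u v g \<Longrightarrow> src C (Qm f u v g) = Q f"
    "square C f u v g \<Longrightarrow> tgt C (Qm f u v g) = Q g"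
  using Qm_hom[of f u v g] by simp_all

lemma dual: "awfs_laws (op_cat C) Q (\<lambda>f u v g. Qm g v u f) R L U D"
proof -
  have d: "awfs_laws_axioms (op_cat C) Q (\<lambda>f u v g. Qm g v u f) R L U D"
  proof (unfold_locales, unfold square_op, goal_cases)
    case (21 f)
    have s: "square C (L (R f)) (D f) (U f) (R (L f))"
      using 21 by (simp add: square_def R_D U_L)
    show ?case using 21 s distrib[of f] by simp
  qed (simp_all add: Qm_idt Qm_comp R_L Qm_L R_Qm D_L R_U R_D U_L Qm_D U_Qm
      D_nat U_nat D_assoc U_assoc)
  show ?thesis using d category_op[OF category_axioms] by (simp add: awfs_laws_def)
qed

definition coalg :: "'a \<Rightarrow> 'a \<Rightarrow> bool" where
  "coalg j s \<longleftrightarrow> j \<in> ar C \<and> s \<in> hom C (tgt C j) (Q j) \<and> s \<cdot> j = L j \<and> R j \<cdot> s = idt C (tgt C j)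
     \<and> D j \<cdot> s = Qm j (idt C (src C j)) s (L j) \<cdot> s"

definition alg :: "'a \<Rightarrow> 'a \<Rightarrow> bool" where
  "alg f r \<longleftrightarrow> f \<in> ar C \<and> r \<in> hom C (Q f) (src C f) \<and> f \<cdot> r = R f \<and> r \<cdot> L f = idt C (src C f)
     \<and> r \<cdot> U f = r \<cdot> Qm (R f) r (idt C (tgt C f)) f"

definition coalg_map :: "'a \<Rightarrow> 'a \<Rightarrow> 'a \<Rightarrow> 'a \<Rightarrow> 'a \<Rightarrow> 'a \<Rightarrow> bool" where
  "coalg_map j s u v j' s' \<longleftrightarrow> square C j u v j' \<and> coalg j s \<and> coalg j' s' \<and> s' \<cdot> v = Qm j u v j' \<cdot> s"

definition alg_map :: "'a \<Rightarrow> 'a \<Rightarrow> 'a \<Rightarrow> 'a \<Rightarrow> 'a \<Rightarrow> 'a \<Rightarrow> bool" where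
  "alg_map f r u v f' r' \<longleftrightarrow> square C f u v f' \<and> alg f r \<and> alg f' r' \<and> u \<cdot> r = r' \<cdot> Qm f u v f'"

lemma coalgD:
  assumes "coalg j s"
  shows "j \<in> ar C" "s \<in> ar C" "src C s = tgt C j" "tgt C s = Q j" "s \<cdot> j = L j"
    "R j \<cdot> s = idt C (tgt C j)" "D j \<cdot> s = Qm j (idt C (src C j)) s (L j) \<cdot> s"
    "square C j (idt C (src C j)) s (L j)"
  using assms by (auto simp: coalg_def square_def)

lemma algD:
  assumes "alg f r"
  shows "f \<in> ar C" "r \<in> ar C" "src C r = Q f" "tgt C r = src C f" "f \<cdot> r = R f"
    "r \<cdot> L f = idt C (src C f)" "r \<cdot> U f = r \<cdot> Qm (R f) r (idt C (tgt C f)) f"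
    "square C (R f) r (idt C (tgt C f)) f"
  using assms by (auto simp: alg_def square_def)

lemma alg_dual: "awfs_laws.alg (op_cat C) Q (\<lambda>f u v g. Qm g v u f) R L D = coalg"
proof -
  interpret op: awfs_laws "op_cat C" Q "\<lambda>f u v g. Qm g v u f" R L U D by (rule dual)
  show ?thesis by (rule ext)+ (auto simp: op.alg_def coalg_def)
qed

lemma coalg_dual: "awfs_laws.coalg (op_cat C) Q (\<lambda>f u v g. Qm g v u f) R L U = alg"
proof -
  interpret op: awfs_laws "op_cat C" Q "\<lambda>f u v g. Qm g v u f" R L U D by (rule dual)
  show ?thesis by (rule ext)+ (auto simp: op.coalg_def alg_def)
qed

lemma cofree_coalg: "f \<in> ar C \<Longrightarrow> coalg (L f) (D f)"
  using D_L[of f] R_D[of f] D_assoc[of f] by (simp add: coalg_def)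

lemma free_alg: "f \<in> ar C \<Longrightarrow> alg (R f) (U f)"
  using R_U[of f] U_L[of f] U_assoc[of f] by (simp add: alg_def)

lemma square_L:
  assumes "square C f u v g" shows "square C (L f) u (Qm f u v g) (L g)"
proof -
  note 1 = squareD(1-8)[OF assms]
  show ?thesis unfolding square_def using 1 assms Qm_L[OF assms] by simp
qed

lemma square_R:
  assumes "square C f u v g" shows "square C (R f) (Qm f u v g) v (R g)"
proof -
  note 1 = squareD(1-8)[OF assms]
  show ?thesis unfolding square_def using 1 assms R_Qm[OF assms] by simp
qed

lemma square_counit: "f \<in> ar C \<Longrightarrow> square C (L f) (idt C (src C f)) (R f) f"
  by (simp add: square_def R_L)

lemma square_unit: "f \<in> ar C \<Longrightarrow> square C f (L f) (idt C (tgt C f)) (R f)"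
  by (simp add: square_def R_L)

lemma cofree_coalg_map:
  assumes "square C f u v g" shows "coalg_map (L f) (D f) u (Qm f u v g) (L g) (D g)"
  using squareD(1,2)[OF assms] D_nat[OF assms] square_L[OF assms]
  by (simp add: cofree_coalg coalg_map_def)

lemma free_alg_map:
  assumes "square C f u v g" shows "alg_map (R f) (U f) (Qm f u v g) v (R g) (U g)"
  using squareD(1,2)[OF assms] U_nat[OF assms] square_R[OF assms]
  by (simp add: free_alg alg_map_def)

text \<open>The structure of a coalgebra is itself a coalgebra map into a cofree one, by coassociativity; this
reduces statements that are natural in coalgebras to cofree ones, and dually for algebras.\<close>

lemma coalg_map_structure:
  assumes "coalg j s" shows "coalg_map j s (idt C (src C j)) s (L j) (D j)"
  using coalgD[OF assms] assms by (simp add: coalg_map_def cofree_coalg)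

lemma alg_map_structure:
  assumes "alg f r" shows "alg_map (R f) (U f) r (idt C (tgt C f)) f r"
  using algD[OF assms] assms by (simp add: alg_map_def free_alg)

lemma alg_map_comp:
  assumes "alg_map f r u v f' r'" "alg_map f' r' u' v' f'' r''"
  shows "alg_map f r (u' \<cdot> u) (v' \<cdot> v) f'' r''"
proof -
  have sq: "square C f u v f'" "square C f' u' v' f''" and al: "alg f r" "alg f' r'" "alg f'' r''"
    and e: "u \<cdot> r = r' \<cdot> Qm f u v f'" "u' \<cdot> r' = r'' \<cdot> Qm f' u' v' f''"
    using assms by (auto simp: alg_map_def)
  note [simp] = squareD(1-8)[OF sq(1)] squareD(1-8)[OF sq(2)] algD(1-4)[OF al(1)] algD(1-4)[OF al(2)]
    algD(1-4)[OF al(3)] sq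
  have "u' \<cdot> u \<cdot> r = u' \<cdot> r' \<cdot> Qm f u v f'" by (simp add: e(1))
  also have "\<dots> = r'' \<cdot> Qm f' u' v' f'' \<cdot> Qm f u v f'" by (intro comp_exchange) (simp_all add: e)
  also have "\<dots> = r'' \<cdot> Qm f (u' \<cdot> u) (v' \<cdot> v) f''" by (simp add: Qm_comp)
  finally show ?thesis using square_comp[OF sq] by (simp add: alg_map_def al)
qed

end


section \<open>Vertical composition of algebras and coalgebras\<close>

context awfs_laws
begin

lemma Qm_comp':
  assumes "square C f u v g" "square C g u' v' h" "x \<in> ar C" "tgt C x = Q f"
  shows "Qm g u' v' h \<cdot> (Qm f u v g \<cdot> x) = Qm f (u' \<cdot> u) (v' \<cdot> v) h \<cdot> x"
  by (rule comp_reduce) (simp_all add: assms Qm_comp)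

lemma Qm_L':
  assumes "square C f u v g" "x \<in> ar C" "tgt C x = src C f"
  shows "Qm f u v g \<cdot> (L f \<cdot> x) = L g \<cdot> (u \<cdot> x)"
  by (rule comp_exchange) (use assms squareD[OF assms(1)] in \<open>simp_all add: Qm_L\<close>)

text \<open>Let \<open>h = w \<cdot> hf\<close>, where \<open>w\<close> is a pullback of \<open>hg\<close> along \<open>p\<close> with second projection \<open>\<pi>\<close>.  Algebra
structures on \<open>hf\<close> and \<open>hg\<close> induce one on \<open>h\<close>: a lifting problem against \<open>h\<close> is solved by first
solving the induced problem against \<open>hg\<close>, which gives a map into the pullback, and then lifting
that map through \<open>hf\<close>.  Doing this for the cofree coalgebra on \<open>h\<close> gives the formula for the
structure; its associativity is where the distributive law enters.  Ordinary composites of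
algebras are the case \<open>p = 1\<close>, \<open>\<pi> = 1\<close>.\<close>

lemma pullback_composite_alg:
  assumes hf: "alg hf \<theta>f" and hg: "alg hg \<theta>g"
    and sq: "square C h b p hg"
    and w: "w \<in> hom C (tgt C hf) (tgt C h)" and \<pi>: "\<pi> \<in> hom C (tgt C hf) (src C hg)"
    and src_hf: "src C hf = src C h"
    and w_hf: "w \<cdot> hf = h" and \<pi>_hf: "\<pi> \<cdot> hf = b"
    and pb: "\<And>x y. \<lbrakk>x \<in> ar C; y \<in> ar C; src C x = src C y; tgt C x = tgt C h; tgt C y = src C hg;
        p \<cdot> x = hg \<cdot> y\<rbrakk> \<Longrightarrow> \<exists>m. m \<in> hom C (src C x) (tgt C hf) \<and> w \<cdot> m = x \<and> \<pi> \<cdot> m = y"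
    and mono: "\<And>m m'. \<lbrakk>m \<in> ar C; m' \<in> ar C; src C m = src C m'; tgt C m = tgt C hf; tgt C m' = tgt C hf;
        w \<cdot> m = w \<cdot> m'; \<pi> \<cdot> m = \<pi> \<cdot> m'\<rbrakk> \<Longrightarrow> m = m'"
  shows "\<exists>\<theta>. alg h \<theta> \<and> (\<forall>j s u v m. coalg j s \<longrightarrow> square C j u v h \<longrightarrow> m \<in> hom C (tgt C j) (tgt C hf) \<longrightarrow>
      w \<cdot> m = v \<longrightarrow> \<pi> \<cdot> m = \<theta>g \<cdot> (Qm j (b \<cdot> u) (p \<cdot> v) hg \<cdot> s) \<longrightarrow>
      \<theta> \<cdot> (Qm j u v h \<cdot> s) = \<theta>f \<cdot> (Qm j u m hf \<cdot> s))"
proof -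
  note [simp] = algD(1-4)[OF hf] algD(1-4)[OF hg] squareD(1-8)[OF sq] src_hf sq
  have [simp]: "w \<in> ar C" "src C w = tgt C hf" "tgt C w = tgt C h"
    "\<pi> \<in> ar C" "src C \<pi> = tgt C hf" "tgt C \<pi> = src C hg"
    using w \<pi> by simp_all
  \<comment> \<open>the first stage, for the counit square of \<open>h\<close> composed with the square to \<open>hg\<close>\<close>
  define k where "k = \<theta>g \<cdot> Qm h b p hg"
  have k[simp]: "k \<in> ar C" "src C k = Q h" "tgt C k = src C hg" by (simp_all add: k_def)
  have "hg \<cdot> k = R hg \<cdot> Qm h b p hg"
    unfolding k_def by (rule comp_reduce) (simp_all add: algD(5)[OF hg])
  then have hgk: "p \<cdot> R h = hg \<cdot> k" by (simp add: R_Qm)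
  obtain \<kappa> where \<kappa>: "\<kappa> \<in> hom C (Q h) (tgt C hf)" "w \<cdot> \<kappa> = R h" "\<pi> \<cdot> \<kappa> = k"
    using pb[of "R h" k] hgk by auto
  have [simp]: "\<kappa> \<in> ar C" "src C \<kappa> = Q h" "tgt C \<kappa> = tgt C hf" using \<kappa> by simp_all
  have kL: "k \<cdot> L h = b"
  proof -
    have "k \<cdot> L h = \<theta>g \<cdot> L hg \<cdot> b" by (simp add: k_def Qm_L)
    also have "\<dots> = b" by (subst comp_reduce[OF algD(6)[OF hg]]) simp_all
    finally show ?thesis .
  qed
  have \<kappa>L: "\<kappa> \<cdot> L h = hf"
  proof (rule mono)
    show "w \<cdot> \<kappa> \<cdot> L h = w \<cdot> hf" by (subst comp_reduce[OF \<kappa>(2)]) (simp_all add: R_L w_hf)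
    show "\<pi> \<cdot> \<kappa> \<cdot> L h = \<pi> \<cdot> hf" by (subst comp_reduce[OF \<kappa>(3)]) (simp_all add: kL \<pi>_hf)
  qed simp_all
  have s\<kappa>[simp]: "square C (L h) (idt C (src C h)) \<kappa> hf" by (simp add: square_def \<kappa>L)
  \<comment> \<open>the second stage: the canonical solution of the problem \<open>(1, \<kappa>)\<close> against \<open>hf\<close>\<close>
  define \<theta> where "\<theta> = \<theta>f \<cdot> Qm (L h) (idt C (src C h)) \<kappa> hf \<cdot> D h"
  have [simp]: "\<theta> \<in> ar C" "src C \<theta> = Q h" "tgt C \<theta> = src C h" by (simp_all add: \<theta>_def)
  have hf\<theta>: "hf \<cdot> \<theta> = \<kappa>"
  proof -
    have "hf \<cdot> \<theta> = R hf \<cdot> Qm (L h) (idt C (src C h)) \<kappa> hf \<cdot> D h"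
      unfolding \<theta>_def by (rule comp_reduce) (simp_all add: algD(5)[OF hf])
    also have "\<dots> = \<kappa> \<cdot> R (L h) \<cdot> D h"
      by (rule comp_exchange) (simp_all add: R_Qm)
    finally show ?thesis by (simp add: R_D)
  qed
  have h\<theta>: "h \<cdot> \<theta> = R h"
    using comp_reduce[OF w_hf, of \<theta>] by (simp add: hf\<theta> \<kappa>)
  have b\<theta>: "b \<cdot> \<theta> = k"
    using comp_reduce[OF \<pi>_hf, of \<theta>] by (simp add: hf\<theta> \<kappa>)
  have \<theta>L: "\<theta> \<cdot> L h = idt C (src C h)"
  proof -
    have "\<theta> \<cdot> L h = \<theta>f \<cdot> Qm (L h) (idt C (src C h)) \<kappa> hf \<cdot> L (L h)" by (simp add: \<theta>_def D_L)
    also have "\<dots> = \<theta>f \<cdot> L hf" by (simp add: Qm_L)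
    finally show ?thesis by (simp add: algD[OF hf])
  qed
  have s\<theta>[simp]: "square C (R h) \<theta> (idt C (tgt C h)) h" by (simp add: square_def h\<theta>)
  have sR[simp]: "square C (R hf) \<theta>f (idt C (tgt C hf)) hf" by (simp add: square_def algD[OF hf])
  have sRg[simp]: "square C (R hg) \<theta>g (idt C (tgt C hg)) hg" by (simp add: square_def algD[OF hg])
  have sd[simp]: "square C (L (R h)) (D h) (U h) (R (L h))" by (simp add: square_def R_D U_L)
  have kU: "k \<cdot> U h = k \<cdot> Qm (R h) \<theta> (idt C (tgt C h)) h"
  proof -
    have "k \<cdot> U h = \<theta>g \<cdot> U hg \<cdot> Qm (R h) (Qm h b p hg) p (R hg)" by (simp add: k_def U_nat)
    also have "\<dots> = \<theta>g \<cdot> Qm (R hg) \<theta>g (idt C (tgt C hg)) hg \<cdot> Qm (R h) (Qm h b p hg) p (R hg)"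
      by (rule comp_exchange) (simp_all add: algD(7)[OF hg] square_R)
    also have "\<dots> = \<theta>g \<cdot> Qm (R h) k p hg"
      by (simp add: Qm_comp square_R k_def)
    also have "\<dots> = k \<cdot> Qm (R h) \<theta> (idt C (tgt C h)) h"
      by (simp add: k_def Qm_comp b\<theta>[unfolded k_def])
    finally show ?thesis .
  qed
  have \<kappa>U: "\<kappa> \<cdot> U h = \<kappa> \<cdot> Qm (R h) \<theta> (idt C (tgt C h)) h"
  proof (rule mono)
    have "w \<cdot> \<kappa> \<cdot> U h = R h \<cdot> U h" by (rule comp_reduce) (simp_all add: \<kappa>)
    also have "\<dots> = R h \<cdot> Qm (R h) \<theta> (idt C (tgt C h)) h" by (simp add: R_U R_Qm)
    also have "\<dots> = w \<cdot> \<kappa> \<cdot> Qm (R h) \<theta> (idt C (tgt C h)) h"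
      by (rule comp_reduce[symmetric]) (simp_all add: \<kappa>)
    finally show "w \<cdot> \<kappa> \<cdot> U h = w \<cdot> \<kappa> \<cdot> Qm (R h) \<theta> (idt C (tgt C h)) h" .
    show "\<pi> \<cdot> \<kappa> \<cdot> U h = \<pi> \<cdot> \<kappa> \<cdot> Qm (R h) \<theta> (idt C (tgt C h)) h"
      by (subst (1 2) comp_reduce[OF \<kappa>(3)]) (simp_all add: kU)
  qed simp_all
  have \<theta>U: "\<theta> \<cdot> U h = \<theta> \<cdot> Qm (R h) \<theta> (idt C (tgt C h)) h"
  proof -
    let ?q = "Qm (L h) (idt C (src C h)) \<kappa> hf" and ?d = "Qm (L (R h)) (D h) (U h) (R (L h))"
    have [simp]: "square C (R (L h)) ?q \<kappa> (R hf)" by (rule square_R) simp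
    have [simp]: "square C (L (R h)) (?q \<cdot> D h) (\<kappa> \<cdot> U h) (R hf)"
      by (rule square_comp[OF sd]) simp
    have "\<theta> \<cdot> U h = \<theta>f \<cdot> ?q \<cdot> U (L h) \<cdot> ?d \<cdot> D (R h)" by (simp add: \<theta>_def distrib)
    also have "?q \<cdot> U (L h) \<cdot> ?d \<cdot> D (R h) = U hf \<cdot> Qm (R (L h)) ?q \<kappa> (R hf) \<cdot> ?d \<cdot> D (R h)"
      by (subst comp_reduce[OF U_nat]) simp_all
    also have "\<theta>f \<cdot> U hf \<cdot> Qm (R (L h)) ?q \<kappa> (R hf) \<cdot> ?d \<cdot> D (R h)
        = \<theta>f \<cdot> Qm (R hf) \<theta>f (idt C (tgt C hf)) hf \<cdot> Qm (R (L h)) ?q \<kappa> (R hf) \<cdot> ?d \<cdot> D (R h)"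
      by (rule comp_exchange) (simp_all add: algD(7)[OF hf])
    also have "\<dots> = \<theta>f \<cdot> Qm (L (R h)) \<theta> (\<kappa> \<cdot> U h) hf \<cdot> D (R h)"
      by (simp add: Qm_comp' square_comp \<theta>_def)
    finally have 1: "\<theta> \<cdot> U h = \<theta>f \<cdot> Qm (L (R h)) \<theta> (\<kappa> \<cdot> U h) hf \<cdot> D (R h)" .
    have "\<theta> \<cdot> Qm (R h) \<theta> (idt C (tgt C h)) h
        = \<theta>f \<cdot> ?q \<cdot> Qm (L (R h)) \<theta> (Qm (R h) \<theta> (idt C (tgt C h)) h) (L h) \<cdot> D (R h)"
      by (simp add: \<theta>_def D_nat s\<theta>[unfolded \<theta>_def])
    also have "\<dots> = \<theta>f \<cdot> Qm (L (R h)) \<theta> (\<kappa> \<cdot> U h) hf \<cdot> D (R h)"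
      by (simp add: Qm_comp' square_L \<kappa>U)
    finally show ?thesis using 1 by simp
  qed
  have "alg h \<theta>" by (simp add: alg_def h\<theta> \<theta>L \<theta>U)
  moreover have "\<theta> \<cdot> (Qm j u v h \<cdot> s) = \<theta>f \<cdot> (Qm j u m hf \<cdot> s)"
    if c: "coalg j s" and q: "square C j u v h" and m: "m \<in> hom C (tgt C j) (tgt C hf)"
      and wm: "w \<cdot> m = v" and \<pi>m: "\<pi> \<cdot> m = \<theta>g \<cdot> (Qm j (b \<cdot> u) (p \<cdot> v) hg \<cdot> s)" for j s u v m
  proof -
    note [simp] = squareD(1-8)[OF q] q coalgD(1-4)[OF c] coalgD(8)[OF c]
    have m_eq: "\<kappa> \<cdot> (Qm j u v h \<cdot> s) = m"
    proof (rule mono)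
      have "w \<cdot> \<kappa> \<cdot> Qm j u v h \<cdot> s = R h \<cdot> Qm j u v h \<cdot> s" by (rule comp_reduce) (simp_all add: \<kappa>)
      also have "\<dots> = v \<cdot> R j \<cdot> s" by (rule comp_exchange) (simp_all add: R_Qm)
      finally show "w \<cdot> \<kappa> \<cdot> Qm j u v h \<cdot> s = w \<cdot> m" by (simp add: coalgD(6)[OF c] wm)
      have "\<pi> \<cdot> \<kappa> \<cdot> Qm j u v h \<cdot> s = k \<cdot> Qm j u v h \<cdot> s" by (rule comp_reduce) (simp_all add: \<kappa>)
      then show "\<pi> \<cdot> \<kappa> \<cdot> Qm j u v h \<cdot> s = \<pi> \<cdot> m" by (simp add: \<pi>m k_def Qm_comp')
    qed (use m in simp_all)
    have "\<theta> \<cdot> (Qm j u v h \<cdot> s)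
      = \<theta>f \<cdot> Qm (L h) (idt C (src C h)) \<kappa> hf \<cdot> Qm (L j) u (Qm j u v h) (L h) \<cdot> D j \<cdot> s"
      by (simp add: \<theta>_def comp_reduce[OF D_nat] square_L)
    also have "\<dots> = \<theta>f \<cdot> Qm (L j) u (\<kappa> \<cdot> Qm j u v h) hf \<cdot> D j \<cdot> s"
      by (simp add: Qm_comp' square_L)
    also have "\<dots> = \<theta>f \<cdot> Qm (L j) u (\<kappa> \<cdot> Qm j u v h) hf \<cdot> Qm j (idt C (src C j)) s (L j) \<cdot> s"
      by (simp add: coalgD(7)[OF c])
    also have "\<dots> = \<theta>f \<cdot> (Qm j u m hf \<cdot> s)"
    proof -
      have "square C (L j) u (\<kappa> \<cdot> Qm j u v h) hf"
        using square_comp[OF square_L[OF q] s\<kappa>] by simp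
      then show ?thesis by (simp add: Qm_comp' m_eq)
    qed
    finally show ?thesis .
  qed
  ultimately show ?thesis by blast
qed

text \<open>The composite \<open>c\<close> of two structures is specified by its canonical solutions, which are those of
a two-stage lift, rather than by a formula; this is the form in which composites are compared.\<close>

definition composite_alg :: "'a \<Rightarrow> 'a \<Rightarrow> 'a \<Rightarrow> 'a \<Rightarrow> 'a \<Rightarrow> bool" where
  "composite_alg f r g t c \<longleftrightarrow> alg f r \<and> alg g t \<and> tgt C f = src C g \<and> alg (g \<cdot> f) c \<and>
     (\<forall>j s u v. coalg j s \<longrightarrow> square C j u v (g \<cdot> f) \<longrightarrow>
        c \<cdot> (Qm j u v (g \<cdot> f) \<cdot> s) = r \<cdot> (Qm j u (t \<cdot> (Qm j (f \<cdot> u) v g \<cdot> s)) f \<cdot> s))"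

definition composite_coalg :: "'a \<Rightarrow> 'a \<Rightarrow> 'a \<Rightarrow> 'a \<Rightarrow> 'a \<Rightarrow> bool" where
  "composite_coalg j s j' s' c \<longleftrightarrow> coalg j s \<and> coalg j' s' \<and> tgt C j = src C j' \<and> coalg (j' \<cdot> j) c \<and>
     (\<forall>f r u v. alg f r \<longrightarrow> square C (j' \<cdot> j) u v f \<longrightarrow>
        r \<cdot> (Qm (j' \<cdot> j) u v f \<cdot> c) = r \<cdot> (Qm j' (r \<cdot> (Qm j u (v \<cdot> j') f \<cdot> s)) v f \<cdot> s'))"

lemma lift_square:
  assumes c: "coalg j s" and a: "alg f r" and q: "square C j u v f"
  shows "r \<cdot> (Qm j u v f \<cdot> s) \<in> hom C (tgt C j) (src C f)"
    "(r \<cdot> (Qm j u v f \<cdot> s)) \<cdot> j = u" "f \<cdot> (r \<cdot> (Qm j u v f \<cdot> s)) = v"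
proof -
  note [simp] = squareD(1-8)[OF q] q coalgD(1-4)[OF c] coalgD(8)[OF c] algD(1-4)[OF a]
  show "r \<cdot> (Qm j u v f \<cdot> s) \<in> hom C (tgt C j) (src C f)" by simp
  have "(r \<cdot> (Qm j u v f \<cdot> s)) \<cdot> j = r \<cdot> L f \<cdot> u" by (simp add: coalgD(5)[OF c] Qm_L)
  also have "\<dots> = u" by (subst comp_reduce[OF algD(6)[OF a]]) simp_all
  finally show "(r \<cdot> (Qm j u v f \<cdot> s)) \<cdot> j = u" .
  have "f \<cdot> (r \<cdot> (Qm j u v f \<cdot> s)) = R f \<cdot> Qm j u v f \<cdot> s"
    by (rule comp_reduce) (simp_all add: algD(5)[OF a])
  also have "\<dots> = v \<cdot> R j \<cdot> s" by (rule comp_exchange) (simp_all add: R_Qm)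
  finally show "f \<cdot> (r \<cdot> (Qm j u v f \<cdot> s)) = v" by (simp add: coalgD(6)[OF c])
qed

lemma ex_composite_alg:
  assumes f: "alg f r" and g: "alg g t" and fg: "tgt C f = src C g"
  shows "\<exists>c. composite_alg f r g t c"
proof -
  note [simp] = algD(1-4)[OF f] algD(1-4)[OF g] fg
  have "square C (g \<cdot> f) f (idt C (tgt C g)) g" by (simp add: square_def)
  moreover have "\<exists>m. m \<in> hom C (src C x) (tgt C f) \<and> g \<cdot> m = x \<and> idt C (src C g) \<cdot> m = y"
    if "x \<in> ar C" "y \<in> ar C" "src C x = src C y" "tgt C x = tgt C (g \<cdot> f)" "tgt C y = src C g"
      "idt C (tgt C g) \<cdot> x = g \<cdot> y" for x y
    using that by (intro exI[of _ y]) simp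
  ultimately have "\<exists>c. alg (g \<cdot> f) c \<and> (\<forall>j s u v m. coalg j s \<longrightarrow> square C j u v (g \<cdot> f) \<longrightarrow>
      m \<in> hom C (tgt C j) (tgt C f) \<longrightarrow> g \<cdot> m = v \<longrightarrow>
      idt C (src C g) \<cdot> m = t \<cdot> (Qm j (f \<cdot> u) (idt C (tgt C g) \<cdot> v) g \<cdot> s) \<longrightarrow>
      c \<cdot> (Qm j u v (g \<cdot> f) \<cdot> s) = r \<cdot> (Qm j u m f \<cdot> s))"
    by (intro pullback_composite_alg[OF f g]) simp_all
  then obtain c where c: "alg (g \<cdot> f) c" and e: "\<And>j s u v m. coalg j s \<Longrightarrow> square C j u v (g \<cdot> f) \<Longrightarrow>
     m \<in> hom C (tgt C j) (tgt C f) \<Longrightarrow> g \<cdot> m = v \<Longrightarrow>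
     idt C (src C g) \<cdot> m = t \<cdot> (Qm j (f \<cdot> u) (idt C (tgt C g) \<cdot> v) g \<cdot> s) \<Longrightarrow>
      c \<cdot> (Qm j u v (g \<cdot> f) \<cdot> s) = r \<cdot> (Qm j u m f \<cdot> s)"
    by blast
  have "c \<cdot> (Qm j u v (g \<cdot> f) \<cdot> s) = r \<cdot> (Qm j u (t \<cdot> (Qm j (f \<cdot> u) v g \<cdot> s)) f \<cdot> s)"
    if j: "coalg j s" and q: "square C j u v (g \<cdot> f)" for j s u v
  proof -
    note [simp] = squareD(1-8)[OF q]
    have "square C j (f \<cdot> u) v g" using squareD(9)[OF q] by (simp add: square_def)
    note l = lift_square[OF j g this]
    show ?thesis by (rule e[OF j q]) (use l in simp_all)
  qed
  then show ?thesis using f g fg c unfolding composite_alg_def by blast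
qed

text \<open>The two readings of a two-stage lift differ only in the bracketing of composites, which the
definitions fix differently in \<open>C\<close> and its opposite.\<close>

lemma composite_dual:
  "awfs_laws.composite_alg (op_cat C) Q (\<lambda>f u v g. Qm g v u f) R L U D j' s' j s c
    \<longleftrightarrow> composite_coalg j s j' s' c"
proof -
  interpret op: awfs_laws "op_cat C" Q "\<lambda>f u v g. Qm g v u f" R L U D by (rule dual)
  have key: "(r \<cdot> Qm (j' \<cdot> j) u v f) \<cdot> c = r \<cdot> (Qm (j' \<cdot> j) u v f \<cdot> c)"
      "(r \<cdot> Qm j' ((r \<cdot> Qm j u (v \<cdot> j') f) \<cdot> s) v f) \<cdot> s'
        = r \<cdot> (Qm j' (r \<cdot> (Qm j u (v \<cdot> j') f \<cdot> s)) v f \<cdot> s')"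
    if q: "square C (j' \<cdot> j) u v f" and a: "coalg j s" "coalg j' s'" "coalg (j' \<cdot> j) c" "alg f r"
      and t: "tgt C j = src C j'" for f r u v
  proof -
    note [simp] = squareD(1-8)[OF q] q coalgD(1-4)[OF a(1)] coalgD(1-4)[OF a(2)] coalgD(1-4)[OF a(3)]
      algD(1-4)[OF a(4)]
    have q1: "square C j u (v \<cdot> j') f" using squareD[OF q] t by (simp add: square_def)
    note l = lift_square[OF a(1,4) q1]
    have q2: "square C j' (r \<cdot> (Qm j u (v \<cdot> j') f \<cdot> s)) v f" using l t unfolding square_def by simp
    show "(r \<cdot> Qm (j' \<cdot> j) u v f) \<cdot> c = r \<cdot> (Qm (j' \<cdot> j) u v f \<cdot> c)"
      "(r \<cdot> Qm j' ((r \<cdot> Qm j u (v \<cdot> j') f) \<cdot> s) v f) \<cdot> s'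
        = r \<cdot> (Qm j' (r \<cdot> (Qm j u (v \<cdot> j') f \<cdot> s)) v f \<cdot> s')"
      using q1 q2 t by simp_all
  qed
  have 1: "op.composite_alg j' s' j s c \<longleftrightarrow> coalg j s \<and> coalg j' s' \<and> tgt C j = src C j' \<and> coalg (j' \<cdot> j) c \<and>
     (\<forall>f r v u. alg f r \<longrightarrow> square C (j' \<cdot> j) u v f \<longrightarrow> (r \<cdot> Qm (j' \<cdot> j) u v f) \<cdot> c
       = (r \<cdot> Qm j' ((r \<cdot> Qm j u (v \<cdot> j') f) \<cdot> s) v f) \<cdot> s')"
    unfolding op.composite_alg_def alg_dual coalg_dual square_op op_cat_simps by (auto 0 0)
  show ?thesis unfolding 1 composite_coalg_def using key by (auto 0 3)
qed

text \<open>If solutions of problems from \<open>j\<close> defined by \<open>s\<close> respect composite algebras, then \<open>s\<close> is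
coassociative.  The test case is the composite of the free algebras on \<open>j\<close> and on \<open>L j\<close> with the
square \<open>(L (L j), 1)\<close>: solving in one go yields \<open>D j \<cdot> s\<close>, solving in two stages yields
\<open>Qm j 1 s (L j) \<cdot> s\<close>.\<close>

lemma coalg_criterion:
  assumes j: "j \<in> ar C" and s: "s \<in> hom C (tgt C j) (Q j)" and sj: "s \<cdot> j = L j" and Rs: "R j \<cdot> s = idt C (tgt C j)"
    and comp: "\<And>f r g t c u v. composite_alg f r g t c \<Longrightarrow> square C j u v (g \<cdot> f) \<Longrightarrow>
        c \<cdot> (Qm j u v (g \<cdot> f) \<cdot> s) = r \<cdot> (Qm j u (t \<cdot> (Qm j (f \<cdot> u) v g \<cdot> s)) f \<cdot> s)"
  shows "coalg j s"
proof -
  note [simp] = j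
  have [simp]: "s \<in> ar C" "src C s = tgt C j" "tgt C s = Q j" using s by simp_all
  obtain c where c: "composite_alg (R (L j)) (U (L j)) (R j) (U j) c"
    using ex_composite_alg[OF free_alg[of "L j"] free_alg[of j]] by auto
  let ?i = "idt C (src C j)" and ?e = "R j \<cdot> R (L j)" and ?o = "idt C (tgt C j)"
  have q: "square C j (L (L j)) ?o ?e" and qs: "square C (L j) (L (L j)) (R j) ?e"
    by (simp_all add: square_def R_L)
  have [simp]: "square C j (L j) ?o (R j)" "square C (L j) (L j) (R j) (R j)"
     "square C (L j) ?i (R j) j" "square C (L j) (L (L j)) (idt C (Q j)) (R (L j))"
     "square C j ?i s (L j)"
     "square C j (L (L j)) s (R (L j))"
     by (simp_all add: square_def R_L sj)
  have c': "alg ?e c" using c by (simp add: composite_alg_def)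
  note [simp] = algD(2-4)[OF c'] q qs
  have e1: "U j \<cdot> Qm j (L j) ?o (R j) \<cdot> s = s"
    by (subst comp_reduce[OF U_Qm]) simp_all
  have "Qm (L j) (L j) (R j) (R j) \<cdot> D j = Qm j (L j) ?o (R j) \<cdot> Qm (L j) ?i (R j) j \<cdot> D j"
    by (subst Qm_comp') simp_all
  then have e2: "Qm (L j) (L j) (R j) (R j) \<cdot> D j = Qm j (L j) ?o (R j)" by (simp add: Qm_D)
  \<comment> \<open>the comparison \<open>Q j \<rightarrow> Q (L j)\<close> given by the composite structure is the comultiplication\<close>
  have e3: "c \<cdot> (Qm (L j) (L (L j)) (R j) ?e \<cdot> D j) = D j"
  proof -
    have "c \<cdot> (Qm (L j) (L (L j)) (R j) ?e \<cdot> D j)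
      = U (L j) \<cdot> (Qm (L j) (L (L j)) (U j \<cdot> (Qm (L j) (R (L j) \<cdot> L (L j)) (R j) (R j) \<cdot> D j)) (R (L j)) \<cdot> D j)"
      using c cofree_coalg[OF j] qs unfolding composite_alg_def by blast
    also have "\<dots> = U (L j) \<cdot> (Qm (L j) (L (L j)) (idt C (Q j)) (R (L j)) \<cdot> D j)"
      by (simp add: R_L e2 U_Qm)
    also have "\<dots> = D j" using U_Qm[of "L j"] by (subst comp_reduce[OF U_Qm[of "L j", simplified]]) simp_all
    finally show ?thesis .
  qed
  have "Qm (L j) (L (L j)) (R j) ?e \<cdot> D j = Qm j (L (L j)) ?o ?e \<cdot> Qm (L j) ?i (R j) j \<cdot> D j"
    by (subst Qm_comp') simp_all
  then have e4: "c \<cdot> Qm j (L (L j)) ?o ?e = D j" using e3 by (simp add: Qm_D)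
  have "D j \<cdot> s = c \<cdot> Qm j (L (L j)) ?o ?e \<cdot> s"
    by (rule comp_reduce[symmetric]) (simp_all add: e4)
  also have "\<dots> = U (L j) \<cdot> Qm j (L (L j)) (U j \<cdot> Qm j (R (L j) \<cdot> L (L j)) ?o (R j) \<cdot> s) (R (L j)) \<cdot> s"
    by (rule comp[OF c q])
  also have "\<dots> = U (L j) \<cdot> Qm j (L (L j)) s (R (L j)) \<cdot> s" by (simp add: R_L e1)
  also have "\<dots> = U (L j) \<cdot> Qm (L j) (L (L j)) (idt C (Q j)) (R (L j)) \<cdot> Qm j ?i s (L j) \<cdot> s"
    by (subst Qm_comp') simp_all
  also have "\<dots> = Qm j ?i s (L j) \<cdot> s"
    by (subst comp_reduce[OF U_Qm[of "L j", simplified]]) simp_all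
  finally show ?thesis by (simp add: coalg_def sj Rs)
qed

lemma alg_criterion:
  assumes f: "f \<in> ar C" and r: "r \<in> hom C (Q f) (src C f)" and "f \<cdot> r = R f" and "r \<cdot> L f = idt C (src C f)"
    and comp: "\<And>j s j' s' c u v. composite_coalg j s j' s' c \<Longrightarrow> square C (j' \<cdot> j) u v f \<Longrightarrow>
        r \<cdot> (Qm (j' \<cdot> j) u v f \<cdot> c) = r \<cdot> (Qm j' (r \<cdot> (Qm j u (v \<cdot> j') f \<cdot> s)) v f \<cdot> s')"
  shows "alg f r"
proof -
  interpret op: awfs_laws "op_cat C" Q "\<lambda>f u v g. Qm g v u f" R L U D by (rule dual)
  have "op.coalg f r"
  proof (rule op.coalg_criterion)
    fix j' s' j s c v u
    assume c: "op.composite_alg j' s' j s c" and q: "square (op_cat C) f v u (j \<cdot>\<^bsub>op_cat C\<^esub> j')"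
    have c': "composite_coalg j s j' s' c" and q': "square C (j' \<cdot> j) u v f"
      using c q by (simp_all add: composite_dual square_op)
    have a: "coalg j s" "coalg j' s'" "coalg (j' \<cdot> j) c" and t: "tgt C j = src C j'"
      using c' by (auto simp: composite_coalg_def)
    note [simp] = squareD(1-8)[OF q'] q' coalgD(1-4)[OF a(1)] coalgD(1-4)[OF a(2)] coalgD(1-4)[OF a(3)] f
    have [simp]: "r \<in> ar C" "src C r = Q f" "tgt C r = src C f" using r by simp_all
    have q1: "square C j u (v \<cdot> j') f" using squareD[OF q'] t by (simp add: square_def)
    have "f \<cdot> (r \<cdot> Qm j u (v \<cdot> j') f \<cdot> s) = R f \<cdot> Qm j u (v \<cdot> j') f \<cdot> s"
      by (rule comp_reduce) (use q1 in \<open>simp_all add: assms(3)\<close>)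
    also have "\<dots> = (v \<cdot> j') \<cdot> R j \<cdot> s" by (rule comp_exchange) (use q1 t in \<open>simp_all add: R_Qm\<close>)
    finally have l2: "f \<cdot> (r \<cdot> Qm j u (v \<cdot> j') f \<cdot> s) = v \<cdot> j'" using t by (simp add: coalgD(6)[OF a(1)])
    have h: "r \<cdot> (Qm j u (v \<cdot> j') f \<cdot> s) \<in> ar C" "src C (r \<cdot> (Qm j u (v \<cdot> j') f \<cdot> s)) = tgt C j"
      "tgt C (r \<cdot> (Qm j u (v \<cdot> j') f \<cdot> s)) = src C f" using q1 by simp_all
    have q2: "square C j' (r \<cdot> (Qm j u (v \<cdot> j') f \<cdot> s)) v f" unfolding square_def using l2 t h by simp
    show "c \<cdot>\<^bsub>op_cat C\<^esub> (Qm (j \<cdot>\<^bsub>op_cat C\<^esub> j') u v f \<cdot>\<^bsub>op_cat C\<^esub> r) =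
       s' \<cdot>\<^bsub>op_cat C\<^esub> (Qm j' (s \<cdot>\<^bsub>op_cat C\<^esub> (Qm j u (j' \<cdot>\<^bsub>op_cat C\<^esub> v) f \<cdot>\<^bsub>op_cat C\<^esub> r)) v f \<cdot>\<^bsub>op_cat C\<^esub> r)"
      using comp[OF c' q'] q1 q2 t by simp
  qed (use assms in simp_all)
  then show ?thesis by (simp add: coalg_dual)
qed

end


section \<open>Arrow categories, products and functors\<close>

lemma arrow_cat_simps [simp]:
  "ob (arrow_cat M) = ar M" "src (arrow_cat M) = sdom" "tgt (arrow_cat M) = scod"
  "idt (arrow_cat M) f = Sq f (idt M (src M f)) (idt M (tgt M f)) f"
  "cmp (arrow_cat M) \<beta> \<alpha> = Sq (sdom \<alpha>) (stop \<beta> \<cdot>\<^bsub>M\<^esub> stop \<alpha>) (sbot \<beta> \<cdot>\<^bsub>M\<^esub> sbot \<alpha>) (scod \<beta>)"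
  "Sq f u v g \<in> ar (arrow_cat M) \<longleftrightarrow> square M f u v g"
  by (auto simp: arrow_cat_def square_def)

lemma arrow_catE:
  assumes "\<alpha> \<in> ar (arrow_cat M)"
  obtains f u v g where "\<alpha> = Sq f u v g" "square M f u v g"
  using assms by (cases \<alpha>) simp

lemma (in category) category_arrow_cat: "category (arrow_cat C)"
proof
  fix f x y g z assume "f \<in> hom (arrow_cat C) x y" "g \<in> hom (arrow_cat C) y z"
  then show "g \<cdot>\<^bsub>arrow_cat C\<^esub> f \<in> hom (arrow_cat C) x z"
    by (auto elim!: arrow_catE intro: square_comp)
next
  fix f w x g y h z
  assume "f \<in> hom (arrow_cat C) w x" "g \<in> hom (arrow_cat C) x y" "h \<in> hom (arrow_cat C) y z"
  then show "(h \<cdot>\<^bsub>arrow_cat C\<^esub> g) \<cdot>\<^bsub>arrow_cat C\<^esub> f = h \<cdot>\<^bsub>arrow_cat C\<^esub> g \<cdot>\<^bsub>arrow_cat C\<^esub> f"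
    by (auto elim!: arrow_catE simp: square_def)
qed (auto elim!: arrow_catE simp: square_def)

lemma prod_cat_simps [simp]:
  "ob (prod_cat C D) = ob C \<times> ob D" "ar (prod_cat C D) = ar C \<times> ar D"
  "src (prod_cat C D) p = (src C (fst p), src D (snd p))" "tgt (prod_cat C D) p = (tgt C (fst p), tgt D (snd p))"
  "idt (prod_cat C D) q = (idt C (fst q), idt D (snd q))"
  "cmp (prod_cat C D) p p' = (fst p \<cdot>\<^bsub>C\<^esub> fst p', snd p \<cdot>\<^bsub>D\<^esub> snd p')"
  by (simp_all add: prod_cat_def map_prod_def split: prod.splits)

lemma category_prod_cat:
  assumes "category C" "category D" shows "category (prod_cat C D)"
proof -
  interpret C: category C by fact
  interpret D: category D by fact
  show ?thesis by unfold_locales auto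
qed

lemma func_simps [simp]:
  "fob (G \<circ>\<^sub>F F) x = fob G (fob F x)" "far (G \<circ>\<^sub>F F) f = far G (far F f)"
  "fob (F \<times>\<^sub>F H) p = (fob F (fst p), fob H (snd p))" "far (F \<times>\<^sub>F H) q = (far F (fst q), far H (snd q))"
  "fob id_func x = x" "far id_func f = f" "fob forget = fst" "far forget (X, h, Y) = h"
  by (simp_all add: comp_func_def prod_func_def id_func_def forget_def map_prod_def split: prod.splits)

lemma is_functor_comp:
  assumes "is_functor B C F" "is_functor C D G" shows "is_functor B D (G \<circ>\<^sub>F F)"
proof -
  interpret F: is_functor B C F by fact
  interpret G: is_functor C D G by fact
  show ?thesis
  proof
    fix f x y g z assume "f \<in> hom B x y" "g \<in> hom B y z"
    then show "far (G \<circ>\<^sub>F F) (g \<cdot>\<^bsub>B\<^esub> f) = far (G \<circ>\<^sub>F F) g \<cdot>\<^bsub>D\<^esub> far (G \<circ>\<^sub>F F) f"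
      using F.far_cmp F.far_hom G.far_cmp unfolding func_simps by metis
  qed (use F.fob_ob G.fob_ob F.far_hom G.far_hom F.far_idt G.far_idt in \<open>auto simp del: hom_iff\<close>)
qed

lemma is_functor_prod:
  assumes "is_functor B C F" "is_functor B' C' F'"
  shows "is_functor (prod_cat B B') (prod_cat C C') (F \<times>\<^sub>F F')"
proof -
  interpret F: is_functor B C F by fact
  interpret F': is_functor B' C' F' by fact
  interpret P: category "prod_cat B B'" by (rule category_prod_cat) unfold_locales
  interpret P': category "prod_cat C C'" by (rule category_prod_cat) unfold_locales
  show ?thesis
  proof
    fix f x y assume "f \<in> hom (prod_cat B B') x y"
    then show "far (F \<times>\<^sub>F F') f \<in> hom (prod_cat C C') (fob (F \<times>\<^sub>F F') x) (fob (F \<times>\<^sub>F F') y)"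
      using F.far_hom[of "fst f"] F'.far_hom[of "snd f"] by (auto simp: prod_eq_iff mem_Times_iff)
  next
    fix f x y g z assume "f \<in> hom (prod_cat B B') x y" "g \<in> hom (prod_cat B B') y z"
    then show "far (F \<times>\<^sub>F F') (g \<cdot>\<^bsub>prod_cat B B'\<^esub> f)
        = far (F \<times>\<^sub>F F') g \<cdot>\<^bsub>prod_cat C C'\<^esub> far (F \<times>\<^sub>F F') f"
      using F.far_cmp[of "fst f" "fst x" "fst y" "fst g" "fst z"]
        F'.far_cmp[of "snd f" "snd x" "snd y" "snd g" "snd z"] by (auto simp: prod_eq_iff mem_Times_iff)
  qed (auto simp: F.fob_ob F'.fob_ob F.far_idt F'.far_idt)
qed

lemma is_functor_op:
  assumes "is_functor C D F" shows "is_functor (op_cat C) (op_cat D) F"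
proof -
  interpret F: is_functor C D F by fact
  interpret P: category "op_cat C" by (rule category_op) unfold_locales
  interpret P': category "op_cat D" by (rule category_op) unfold_locales
  show ?thesis
  proof
    fix f x y g z assume "f \<in> hom (op_cat C) x y" "g \<in> hom (op_cat C) y z"
    then show "far F (g \<cdot>\<^bsub>op_cat C\<^esub> f) = far F g \<cdot>\<^bsub>op_cat D\<^esub> far F f"
      using F.far_cmp[of g z y f x] by simp
  next
    fix f x y assume "f \<in> hom (op_cat C) x y"
    then show "far F f \<in> hom (op_cat D) (fob F x) (fob F y)"
      using F.far_hom[of f y x] by simp
  qed (auto simp: F.fob_ob F.far_idt)
qed

section \<open>The elementary form of an awfs and of its (co)algebras\<close>

locale awfs = category M for M :: "('o, 'a) cat" (structure) +
  fixes W :: "('o, 'a) awfs"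
  assumes W: "is_awfs M W"

sublocale awfs \<subseteq> awfs_laws M "fob (mid W)" "\<lambda>f u v g. far (mid W) (Sq f u v g)" "lft W" "rgt W" "comult W" "mult W"
proof -
  have ff: "is_functorial_factorization M W"
    and cm: "is_comonad (arrow_cat M) (lft_func W) (counit_sq M W) (comult_sq M W)"
    and mn: "is_monad (arrow_cat M) (rgt_func W) (unit_sq M W) (mult_sq M W)"
    and dl: "is_distributive_law (arrow_cat M)
          (lft_func W) (counit_sq M W) (comult_sq M W)
          (rgt_func W) (unit_sq M W) (mult_sq M W)
          (\<lambda>f. Sq (lft W (rgt W f)) (comult W f) (mult W f) (rgt W (lft W f)))"
    using W by (auto simp: is_awfs_def)
  interpret mid: is_functor "arrow_cat M" M "mid W" using ff by (simp add: is_functorial_factorization_def)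
  have ff1: "lft W f \<in> hom M (src M f) (fob (mid W) f)" "rgt W f \<in> hom M (fob (mid W) f) (tgt M f)"
     "rgt W f \<cdot> lft W f = f" if "f \<in> ar M" for f
    using ff that by (auto simp: is_functorial_factorization_def)
  have ff2: "far (mid W) (Sq f u v g) \<cdot> lft W f = lft W g \<cdot> u"
      "rgt W g \<cdot> far (mid W) (Sq f u v g) = v \<cdot> rgt W f" if "square M f u v g" for f u v g
  proof -
    have "\<forall>\<alpha>\<in>ar (arrow_cat M).
          far (mid W) \<alpha> \<cdot>\<^bsub>M\<^esub> lft W (sdom \<alpha>) = lft W (scod \<alpha>) \<cdot>\<^bsub>M\<^esub> stop \<alpha>
          \<and> rgt W (scod \<alpha>) \<cdot>\<^bsub>M\<^esub> far (mid W) \<alpha> = sbot \<alpha> \<cdot>\<^bsub>M\<^esub> rgt W (sdom \<alpha>)"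
      using ff by (simp add: is_functorial_factorization_def)
    from this[rule_format, of "Sq f u v g"] that show "far (mid W) (Sq f u v g) \<cdot> lft W f = lft W g \<cdot> u"
      "rgt W g \<cdot> far (mid W) (Sq f u v g) = v \<cdot> rgt W f" by auto
  qed
  have c1: "comult_sq M W f \<in> hom (arrow_cat M) (lft W f) (lft W (lft W f))"
    "counit_sq M W (lft W f) \<cdot>\<^bsub>arrow_cat M\<^esub> comult_sq M W f = idt (arrow_cat M) (lft W f)"
    "far (lft_func W) (counit_sq M W f) \<cdot>\<^bsub>arrow_cat M\<^esub> comult_sq M W f = idt (arrow_cat M) (lft W f)"
    "comult_sq M W (lft W f) \<cdot>\<^bsub>arrow_cat M\<^esub> comult_sq M W f
      = far (lft_func W) (comult_sq M W f) \<cdot>\<^bsub>arrow_cat M\<^esub> comult_sq M W f"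
    if "f \<in> ar M" for f
    using cm that by (auto simp: is_comonad_def nat_trans_def lft_func_def simp del: hom_iff)
  have m1: "mult_sq M W f \<in> hom (arrow_cat M) (rgt W (rgt W f)) (rgt W f)"
    "mult_sq M W f \<cdot>\<^bsub>arrow_cat M\<^esub> unit_sq M W (rgt W f) = idt (arrow_cat M) (rgt W f)"
    "mult_sq M W f \<cdot>\<^bsub>arrow_cat M\<^esub> far (rgt_func W) (unit_sq M W f) = idt (arrow_cat M) (rgt W f)"
    "mult_sq M W f \<cdot>\<^bsub>arrow_cat M\<^esub> mult_sq M W (rgt W f)
      = mult_sq M W f \<cdot>\<^bsub>arrow_cat M\<^esub> far (rgt_func W) (mult_sq M W f)"
    if "f \<in> ar M" for f
    using mn that by (auto simp: is_monad_def nat_trans_def rgt_func_def simp del: hom_iff)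
  have c2: "far (lft_func W \<circ>\<^sub>F lft_func W) \<alpha> \<cdot>\<^bsub>arrow_cat M\<^esub> comult_sq M W (sdom \<alpha>)
      = comult_sq M W (scod \<alpha>) \<cdot>\<^bsub>arrow_cat M\<^esub> far (lft_func W) \<alpha>" if "\<alpha> \<in> ar (arrow_cat M)" for \<alpha>
    using cm that unfolding is_comonad_def nat_trans_def arrow_cat_simps(2,3) by blast
  have m2: "far (rgt_func W) \<alpha> \<cdot>\<^bsub>arrow_cat M\<^esub> mult_sq M W (sdom \<alpha>)
      = mult_sq M W (scod \<alpha>) \<cdot>\<^bsub>arrow_cat M\<^esub> far (rgt_func W \<circ>\<^sub>F rgt_func W) \<alpha>" if "\<alpha> \<in> ar (arrow_cat M)" for \<alpha>
    using mn that unfolding is_monad_def nat_trans_def arrow_cat_simps(2,3) by blast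
  have d: "Sq (lft W (rgt W f)) (comult W f) (mult W f) (rgt W (lft W f))
      \<cdot>\<^bsub>arrow_cat M\<^esub> far (lft_func W) (mult_sq M W f)
      = mult_sq M W (lft W f) \<cdot>\<^bsub>arrow_cat M\<^esub> far (rgt_func W) (Sq (lft W (rgt W f)) (comult W f) (mult W f)
          (rgt W (lft W f)))
        \<cdot>\<^bsub>arrow_cat M\<^esub> Sq (lft W (rgt W (rgt W f))) (comult W (rgt W f)) (mult W (rgt W f)) (rgt W (lft W (rgt W f)))"
    if "f \<in> ar M" for f
    using dl that by (simp add: is_distributive_law_def lft_func_def rgt_func_def)
  note sqs = comult_sq_def mult_sq_def counit_sq_def unit_sq_def lft_func_def rgt_func_def
  have LR[simp]: "lft W f \<in> ar M" "src M (lft W f) = src M f" "tgt M (lft W f) = fob (mid W) f"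
    "rgt W f \<in> ar M" "src M (rgt W f) = fob (mid W) f" "tgt M (rgt W f) = tgt M f" if "f \<in> ar M" for f
    using ff1[OF that] by simp_all
  have sD: "square M (lft W f) (idt M (src M f)) (comult W f) (lft W (lft W f))"
    and sU: "square M (rgt W (rgt W f)) (mult W f) (idt M (tgt M f)) (rgt W f)" if "f \<in> ar M" for f
    using c1(1)[OF that] m1(1)[OF that] by (simp_all add: sqs)
  have DU[simp]: "comult W f \<in> ar M" "src M (comult W f) = fob (mid W) f" "tgt M (comult W f) = fob (mid W) (lft W f)"
    "mult W f \<in> ar M" "src M (mult W f) = fob (mid W) (rgt W f)" "tgt M (mult W f)
        = fob (mid W) f" if "f \<in> ar M" for f
    using squareD[OF sD[OF that]] squareD[OF sU[OF that]] that by simp_all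
  show "awfs_laws M (fob (mid W)) (\<lambda>f u v g. far (mid W) (Sq f u v g)) (lft W) (rgt W) (comult W) (mult W)"
  proof (unfold_locales, goal_cases)
    case (1 f u v g) then show ?case using mid.far_hom[of "Sq f u v g" f g] by simp
  next
    case (2 f) then show ?case using mid.far_idt[of f] by simp
  next
    case (3 f u v g u' v' h) then show ?case
      using mid.far_cmp[of "Sq f u v g" f g "Sq g u' v' h" h] by simp
  next
    case (11 f) then show ?case using squareD(9)[OF sD[of f]] by simp
  next
    case (12 f) then show ?case using squareD(9)[OF sU[of f]] by simp
  next
    case (13 f) then show ?case using c1(2)[of f] by (simp add: sqs)
  next
    case (14 f) then show ?case using m1(2)[of f] by (simp add: sqs)
  next
    case (15 f) then show ?case using c1(3)[of f] by (simp add: sqs)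
  next
    case (16 f) then show ?case using m1(3)[of f] by (simp add: sqs)
  next
    case (17 f u v g) then show ?case using c2[of "Sq f u v g"] by (simp add: sqs)
  next
    case (18 f u v g) then show ?case using m2[of "Sq f u v g"] by (simp add: sqs)
  next
    case (19 f) then show ?case using c1(4)[of f] by (simp add: sqs)
  next
    case (20 f) then show ?case using m1(4)[of f] by (simp add: sqs)
  next
    case (21 f) then show ?case using d[of f] by (simp add: sqs)
  qed (simp_all add: ff1 ff2)
qed

context awfs
begin

lemma ob_coalg_cat: "X \<in> ob (coalg_cat M W) \<longleftrightarrow> coalg (fst X) (snd X)"
proof (cases X)
  case (Pair j s)
  show ?thesis
  proof
    assume "X \<in> ob (coalg_cat M W)"
    then have "j \<in> ar M" "square M j (idt M (src M j)) s (lft W j)" "rgt W j \<cdot> s = idt M (tgt M j)"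
       "comult W j \<cdot> s = far (mid W) (Sq j (idt M (src M j)) s (lft W j)) \<cdot> s"
      by (auto simp: Pair coalg_cat_def structured_cat_def is_coalgebra_def coalg_sq_def
          lft_func_def counit_sq_def comult_sq_def)
    then show "coalg (fst X) (snd X)" using squareD[of M j "idt M (src M j)" s "lft W j"]
      by (simp add: Pair coalg_def)
  next
    assume "coalg (fst X) (snd X)"
    then have c: "coalg j s" by (simp add: Pair)
    show "X \<in> ob (coalg_cat M W)" using coalgD[OF c]
      by (auto simp: Pair coalg_cat_def structured_cat_def is_coalgebra_def coalg_sq_def
          lft_func_def counit_sq_def comult_sq_def)
  qed
qed

lemma ob_alg_cat: "X \<in> ob (alg_cat M W) \<longleftrightarrow> alg (fst X) (snd X)"
proof (cases X)
  case (Pair f r)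
  show ?thesis
  proof
    assume "X \<in> ob (alg_cat M W)"
    then have "f \<in> ar M" "square M (rgt W f) r (idt M (tgt M f)) f" "r \<cdot> lft W f = idt M (src M f)"
       "r \<cdot> mult W f = r \<cdot> far (mid W) (Sq (rgt W f) r (idt M (tgt M f)) f)"
      by (auto simp: Pair alg_cat_def structured_cat_def is_algebra_def alg_sq_def
          rgt_func_def unit_sq_def mult_sq_def)
    then show "alg (fst X) (snd X)" using squareD[of M "rgt W f" r "idt M (tgt M f)" f]
      by (simp add: Pair alg_def)
  next
    assume "alg (fst X) (snd X)"
    then have c: "alg f r" by (simp add: Pair)
    show "X \<in> ob (alg_cat M W)" using algD[OF c]
      by (auto simp: Pair alg_cat_def structured_cat_def is_algebra_def alg_sq_def
          rgt_func_def unit_sq_def mult_sq_def)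
  qed
qed

lemma ar_coalg_cat: "(X, \<alpha>, Y) \<in> ar (coalg_cat M W) \<longleftrightarrow>
    (\<exists>u v. \<alpha> = Sq (fst X) u v (fst Y) \<and> coalg_map (fst X) (snd X) u v (fst Y) (snd Y))"
proof -
  have "(X, \<alpha>, Y) \<in> ar (coalg_cat M W) \<longleftrightarrow> X \<in> ob (coalg_cat M W) \<and> Y \<in> ob (coalg_cat M W)
     \<and> \<alpha> \<in> hom (arrow_cat M) (fst X) (fst Y) \<and>
     coalg_sq M W Y \<cdot>\<^bsub>arrow_cat M\<^esub> \<alpha> = far (lft_func W) \<alpha> \<cdot>\<^bsub>arrow_cat M\<^esub> coalg_sq M W X"
    by (auto simp: coalg_cat_def structured_cat_def)
  also have "\<dots> \<longleftrightarrow> (\<exists>u v. \<alpha> = Sq (fst X) u v (fst Y) \<and> coalg_map (fst X) (snd X) u v (fst Y) (snd Y))"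
    unfolding ob_coalg_cat coalg_map_def
    by (cases X; cases Y; cases \<alpha>) (auto simp: coalg_sq_def lft_func_def square_def)
  finally show ?thesis .
qed

lemma ar_alg_cat: "(X, \<alpha>, Y) \<in> ar (alg_cat M W) \<longleftrightarrow>
    (\<exists>u v. \<alpha> = Sq (fst X) u v (fst Y) \<and> alg_map (fst X) (snd X) u v (fst Y) (snd Y))"
proof -
  have "(X, \<alpha>, Y) \<in> ar (alg_cat M W) \<longleftrightarrow> X \<in> ob (alg_cat M W) \<and> Y \<in> ob (alg_cat M W)
     \<and> \<alpha> \<in> hom (arrow_cat M) (fst X) (fst Y) \<and>
     \<alpha> \<cdot>\<^bsub>arrow_cat M\<^esub> alg_sq M W X = alg_sq M W Y \<cdot>\<^bsub>arrow_cat M\<^esub> far (rgt_func W) \<alpha>"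
    by (auto simp: alg_cat_def structured_cat_def)
  also have "\<dots> \<longleftrightarrow> (\<exists>u v. \<alpha> = Sq (fst X) u v (fst Y) \<and> alg_map (fst X) (snd X) u v (fst Y) (snd Y))"
    unfolding ob_alg_cat alg_map_def
    by (cases X; cases Y; cases \<alpha>) (auto simp: alg_sq_def rgt_func_def square_def)
  finally show ?thesis .
qed

end

section \<open>Generated awfs\<close>

text \<open>Algebraic freeness in elementary terms: \<open>arr\<close> and \<open>str\<close> are the arrows and coalgebra structures
of the generators, \<open>Mor\<close> the squares between them.  Algebra structures on \<open>h\<close> correspond to natural
choices \<open>\<phi>\<close> of solutions against the generators (\<open>gen_ex\<close>, \<open>gen_unique\<close>), and algebra maps to
squares that preserve the chosen solutions (\<open>gen_full\<close>).\<close>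

locale generated_awfs = awfs_laws +
  fixes Ob :: "'i set" and Mor :: "('i \<times> 'b \<times> 'b \<times> 'i) set" and arr :: "'i \<Rightarrow> 'b" and str :: "'i \<Rightarrow> 'b"
  assumes gen_coalg: "x \<in> Ob \<Longrightarrow> coalg (arr x) (str x)"
    and gen_mor: "(x, a, b, x') \<in> Mor \<Longrightarrow> x \<in> Ob \<and> x' \<in> Ob \<and> coalg_map (arr x) (str x) a b (arr x') (str x')"
    and gen_ex: "\<lbrakk>h \<in> ar C;
        \<And>x u v. \<lbrakk>x \<in> Ob; square C (arr x) u v h\<rbrakk> \<Longrightarrow> \<phi> x u v \<in> hom C (tgt C (arr x)) (src C h)
          \<and> \<phi> x u v \<cdot> arr x = u \<and> h \<cdot> \<phi> x u v = v;
        \<And>x a b x' u v. \<lbrakk>(x, a, b, x') \<in> Mor; square C (arr x') u v h\<rbrakk> \<Longrightarrow>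
          \<phi> x (u \<cdot> a) (v \<cdot> b) = \<phi> x' u v \<cdot> b\<rbrakk>
      \<Longrightarrow> \<exists>\<theta>. alg h \<theta> \<and> (\<forall>x u v. x \<in> Ob \<longrightarrow> square C (arr x) u v h \<longrightarrow>
            \<theta> \<cdot> (Qm (arr x) u v h \<cdot> str x) = \<phi> x u v)"
    and gen_unique: "\<lbrakk>alg h \<theta>; alg h \<theta>'; \<And>x u v. \<lbrakk>x \<in> Ob; square C (arr x) u v h\<rbrakk> \<Longrightarrow>
            \<theta> \<cdot> (Qm (arr x) u v h \<cdot> str x) = \<theta>' \<cdot> (Qm (arr x) u v h \<cdot> str x)\<rbrakk> \<Longrightarrow> \<theta> = \<theta>'"
    and gen_full: "\<lbrakk>alg h \<theta>; alg h' \<theta>'; square C h a b h'; \<And>x u v. \<lbrakk>x \<in> Ob; square C (arr x) u v h\<rbrakk> \<Longrightarrow>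
            a \<cdot> (\<theta> \<cdot> (Qm (arr x) u v h \<cdot> str x)) = \<theta>' \<cdot> (Qm (arr x) (a \<cdot> u) (b \<cdot> v) h' \<cdot> str x)\<rbrakk>
        \<Longrightarrow> alg_map h \<theta> a b h' \<theta>'"

definition functor_squares :: "('jo, 'ja) cat \<Rightarrow> ('jo, 'ja, 'a, 'a sq) func \<Rightarrow> ('jo \<times> 'a \<times> 'a \<times> 'jo) set" where
  "functor_squares J V = {(x, u, v, x'). \<exists>a. a \<in> hom J x x' \<and> far V a = Sq (fob V x) u v (fob V x')}"

text \<open>Bijectivity of the canonical functor on objects gives existence and uniqueness of the structures,
bijectivity on arrows gives fullness.\<close>

lemma generated_awfsI:
  fixes M :: "('o, 'a) cat" (structure) and J :: "('jo, 'ja) cat"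
  assumes "category M" and "generates M J V W"
  obtains G where "is_functor_over J (coalg_cat M W) V G"
    and "generated_awfs M (fob (mid W)) (\<lambda>f u v g. far (mid W) (Sq f u v g)) (lft W) (rgt W)
       (comult W) (mult W) (ob J) (functor_squares J V) (fob V) (\<lambda>x. snd (fob G x))"
proof -
  from assms(2) obtain G where V: "is_functor J (arrow_cat M) V" and W: "is_awfs M W"
    and G: "is_functor_over J (coalg_cat M W) V G"
    and iso: "is_iso_functor (alg_cat M W) (lift_cat M J V) (canonical_functor M J W G)"
    unfolding generates_def by blast
  interpret category M by fact
  interpret awfs M W by unfold_locales (rule W)
  interpret V: is_functor J "arrow_cat M" V by (rule V)
  interpret G: is_functor J "coalg_cat M W" G using G by (simp add: is_functor_over_def)
  have Gob: "fob G x = (fob V x, snd (fob G x))" if "x \<in> ob J" for x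
    using G that by (auto simp: is_functor_over_def func_eq_def prod_eq_iff)
  have Gf: "fst (fob G x) = fob V x" if "x \<in> ob J" for x using Gob[OF that] by (metis fst_conv)
  have coal: "coalg (fob V x) (snd (fob G x))" if "x \<in> ob J" for x
    using G.fob_ob[OF that] Gob[OF that] by (simp add: ob_coalg_cat) (metis fst_conv)
  let ?cc = "canonical_choice M J W G"
  have inj: "inj_on ?cc (ob (alg_cat M W))" and surj: "?cc ` ob (alg_cat M W) = lift_choices M J V"
    and surja: "far (canonical_functor M J W G) ` ar (alg_cat M W) = ar (lift_cat M J V)"
    using iso by (auto simp: is_iso_functor_def canonical_functor_def bij_betw_def lift_cat_def structured_cat_def)
  have cc: "?cc (h, \<theta>) = (h, \<lambda>x \<alpha>. if x \<in> ob J \<and> \<alpha> \<in> hom (arrow_cat M) (fob V x) h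
       then \<theta> \<cdot> (far (mid W) \<alpha> \<cdot> snd (fob G x)) else undefined)" for h \<theta>
    unfolding canonical_choice_def canonical_solution_def
    by (auto intro!: ext simp: Gf)
  have hom_sq: "\<alpha> \<in> hom (arrow_cat M) f g \<longleftrightarrow> (\<exists>u v. \<alpha> = Sq f u v g \<and> square M f u v g)" for \<alpha> f g
    by (cases \<alpha>) auto
  show thesis
  proof (rule that[OF G], unfold_locales)
    fix x assume "x \<in> ob J" then show "coalg (fob V x) (snd (fob G x))" by (rule coal)
  next
    fix x a b x' assume "(x, a, b, x') \<in> functor_squares J V"
    then obtain e where e: "e \<in> hom J x x'" "far V e = Sq (fob V x) a b (fob V x')"
      by (auto simp: functor_squares_def)
    have x: "x \<in> ob J" "x' \<in> ob J" using e by auto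
    obtain X \<alpha> Y where f: "far G e = (X, \<alpha>, Y)" by (cases "far G e")
    have "\<alpha> = far V e" using G e f by (auto simp: is_functor_over_def func_eq_def)
    moreover have "X = fob G x" "Y = fob G x'"
      using G.far_hom[OF e(1)] f by (auto simp: coalg_cat_def structured_cat_def)
    moreover have "far G e \<in> ar (coalg_cat M W)" using G.far_hom[OF e(1)] by simp
    ultimately have "coalg_map (fob V x) (snd (fob G x)) a b (fob V x') (snd (fob G x'))"
      using f e(2) Gob[OF x(1)] Gob[OF x(2)] by (auto simp: ar_coalg_cat)
    then show "x \<in> ob J \<and> x' \<in> ob J \<and> coalg_map (fob V x) (snd (fob G x)) a b (fob V x') (snd (fob G x'))"
      using x by simp
  next
    fix h \<phi> assume h: "h \<in> ar M"
      and sol: "\<And>x u v. \<lbrakk>x \<in> ob J; square M (fob V x) u v h\<rbrakk> \<Longrightarrow> \<phi> x u v \<in> hom M (tgt M (fob V x)) (src M h)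
          \<and> \<phi> x u v \<cdot> fob V x = u \<and> h \<cdot> \<phi> x u v = v"
      and nat: "\<And>x a b x' u v. \<lbrakk>(x, a, b, x') \<in> functor_squares J V; square M (fob V x') u v h\<rbrakk> \<Longrightarrow>
          \<phi> x (u \<cdot> a) (v \<cdot> b) = \<phi> x' u v \<cdot> b"
    define \<psi> where "\<psi> = (\<lambda>x \<alpha>. if x \<in> ob J \<and> \<alpha> \<in> hom (arrow_cat M) (fob V x) h
       then \<phi> x (stop \<alpha>) (sbot \<alpha>) else undefined)"
    have "(h, \<psi>) \<in> lift_choices M J V"
      unfolding lift_choices_def
    proof (intro CollectI case_prodI conjI ballI allI impI)
      fix a \<alpha> assume a: "a \<in> ar J" and \<alpha>: "\<alpha> \<in> hom (arrow_cat M) (fob V (tgt J a)) h"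
      obtain u v where uv: "\<alpha> = Sq (fob V (tgt J a)) u v h" "square M (fob V (tgt J a)) u v h"
        using \<alpha> by (auto simp: hom_sq simp del: hom_iff)
      have e: "a \<in> hom J (src J a) (tgt J a)" using a by simp
      have "far V a \<in> hom (arrow_cat M) (fob V (src J a)) (fob V (tgt J a))" by (rule V.far_hom[OF e])
      then obtain c d where cd: "far V a = Sq (fob V (src J a)) c d (fob V (tgt J a))"
         "square M (fob V (src J a)) c d (fob V (tgt J a))"
        by (auto simp: hom_sq simp del: hom_iff)
      have "(src J a, c, d, tgt J a) \<in> functor_squares J V" using a cd(1) by (auto simp: functor_squares_def)
      from nat[OF this uv(2)] show "\<psi> (src J a) (\<alpha> \<cdot>\<^bsub>arrow_cat M\<^esub> far V a) = \<psi> (tgt J a) \<alpha> \<cdot> sbot (far V a)"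
        using a uv cd square_comp[OF cd(2) uv(2)] by (simp add: \<psi>_def)
    qed (use h sol in \<open>auto simp: \<psi>_def hom_sq simp del: hom_iff\<close>)
    then have "(h, \<psi>) \<in> ?cc ` ob (alg_cat M W)" by (simp add: surj)
    then obtain h' \<theta> where "(h', \<theta>) \<in> ob (alg_cat M W)" "?cc (h', \<theta>) = (h, \<psi>)" by auto
    then have a: "alg h \<theta>" and e: "?cc (h, \<theta>) = (h, \<psi>)"
      by (auto simp: ob_alg_cat canonical_choice_def)
    have "\<theta> \<cdot> (far (mid W) (Sq (fob V x) u v h) \<cdot> snd (fob G x)) = \<phi> x u v"
      if "x \<in> ob J" "square M (fob V x) u v h" for x u v
      using arg_cong[OF e, of "\<lambda>p. snd p x (Sq (fob V x) u v h)"] that by (simp add: cc \<psi>_def)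
    then show "\<exists>\<theta>. alg h \<theta> \<and> (\<forall>x u v. x \<in> ob J \<longrightarrow> square M (fob V x) u v h \<longrightarrow>
        \<theta> \<cdot> (far (mid W) (Sq (fob V x) u v h) \<cdot> snd (fob G x)) = \<phi> x u v)" using a by blast
  next
    fix h \<theta> \<theta>' assume a: "alg h \<theta>" "alg h \<theta>'"
      and e: "\<And>x u v. \<lbrakk>x \<in> ob J; square M (fob V x) u v h\<rbrakk> \<Longrightarrow>
        \<theta> \<cdot> (far (mid W) (Sq (fob V x) u v h) \<cdot> snd (fob G x))
          = \<theta>' \<cdot> (far (mid W) (Sq (fob V x) u v h) \<cdot> snd (fob G x))"
    have "?cc (h, \<theta>) = ?cc (h, \<theta>')" unfolding cc using e by (auto intro!: ext simp: hom_sq simp del: hom_iff)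
    then show "\<theta> = \<theta>'" using inj_onD[OF inj, of "(h, \<theta>)" "(h, \<theta>')"] a by (simp add: ob_alg_cat)
  next
    fix h \<theta> h' \<theta>' a b assume al: "alg h \<theta>" "alg h' \<theta>'" and q: "square M h a b h'"
      and e: "\<And>x u v. \<lbrakk>x \<in> ob J; square M (fob V x) u v h\<rbrakk> \<Longrightarrow>
        a \<cdot> (\<theta> \<cdot> (far (mid W) (Sq (fob V x) u v h) \<cdot> snd (fob G x)))
          = \<theta>' \<cdot> (far (mid W) (Sq (fob V x) (a \<cdot> u) (b \<cdot> v) h') \<cdot> snd (fob G x))"
    have in_lc: "?cc (h, \<theta>) \<in> lift_choices M J V" "?cc (h', \<theta>') \<in> lift_choices M J V"
      using surj al by (auto simp: ob_alg_cat)
    have fst_cc: "fst (?cc (f, r)) = f" for f r by (simp add: canonical_choice_def)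
    have key: "a \<cdot> snd (?cc (h, \<theta>)) x \<alpha> = snd (?cc (h', \<theta>')) x (Sq (fob V x) (a \<cdot> stop \<alpha>) (b \<cdot> sbot \<alpha>) h')"
      if x: "x \<in> ob J" and \<alpha>: "\<alpha> \<in> hom (arrow_cat M) (fob V x) h" for x \<alpha>
    proof -
      obtain u v where uv: "\<alpha> = Sq (fob V x) u v h" "square M (fob V x) u v h"
        using \<alpha> by (cases \<alpha>) auto
      show ?thesis using uv x e[OF x uv(2)] square_comp[OF uv(2) q] by (simp add: cc)
    qed
    have "(?cc (h, \<theta>), Sq h a b h', ?cc (h', \<theta>')) \<in> ar (lift_cat M J V)"
      unfolding lift_cat_def structured_cat_def using in_lc q key by (auto simp: fst_cc)
    then have "(?cc (h, \<theta>), Sq h a b h', ?cc (h', \<theta>')) \<in> far (canonical_functor M J W G) ` ar (alg_cat M W)"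
      by (simp add: surja)
    then obtain X Y where XY: "(X, Sq h a b h', Y) \<in> ar (alg_cat M W)" "?cc X = ?cc (h, \<theta>)" "?cc Y = ?cc (h', \<theta>')"
      by (auto simp: canonical_functor_def)
    have "X \<in> ob (alg_cat M W)" "Y \<in> ob (alg_cat M W)" using XY(1) by (auto simp: alg_cat_def structured_cat_def)
    then have "X = (h, \<theta>)" "Y = (h', \<theta>')"
      using XY(2,3) inj al by (auto simp: inj_on_eq_iff ob_alg_cat)
    then show "alg_map h \<theta> a b h' \<theta>'" using XY(1) by (simp add: ar_alg_cat)
  qed
qed


section \<open>Pushouts and pullbacks\<close>

context category
begin

lemma is_pushout_po:
  assumes "has_pushouts C" "f \<in> ar C" "g \<in> ar C" "src C f = src C g"
  shows "is_pushout C f g (po_inl C f g) (po_inr C f g)"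
proof -
  have "\<exists>pq. case pq of (p, q) \<Rightarrow> is_pushout C f g p q" using assms by (auto simp: has_pushouts_def)
  then have "case (SOME (p, q). is_pushout C f g p q) of (p, q) \<Rightarrow> is_pushout C f g p q" by (rule someI_ex)
  then show ?thesis by (simp add: po_inl_def po_inr_def case_prod_unfold)
qed

lemma po_map:
  assumes "has_pushouts C" "f \<in> ar C" "g \<in> ar C" "src C f = src C g"
    and "x \<in> ar C" "y \<in> ar C" "src C x = tgt C f" "src C y = tgt C g" "tgt C x = tgt C y" "x \<cdot> f = y \<cdot> g"
  shows "po_map C f g x y \<in> hom C (tgt C (po_inl C f g)) (tgt C x)"
    "po_map C f g x y \<cdot> po_inl C f g = x" "po_map C f g x y \<cdot> po_inr C f g = y"
proof -
  have "\<forall>z. \<forall>x\<in>hom C (tgt C f) z. \<forall>y\<in>hom C (tgt C g) z.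
          x \<cdot> f = y \<cdot> g \<longrightarrow>
          (\<exists>!m. m \<in> hom C (tgt C (po_inl C f g)) z \<and> m \<cdot> po_inl C f g = x \<and> m \<cdot> po_inr C f g = y)"
    using is_pushout_po[OF assms(1-4)] unfolding is_pushout_def by blast
  from this[rule_format, of x "tgt C x" y]
  have "\<exists>!m. m \<in> hom C (tgt C (po_inl C f g)) (tgt C x) \<and> m \<cdot> po_inl C f g = x \<and> m \<cdot> po_inr C f g = y"
    using assms by simp
  from theI'[OF this] show "po_map C f g x y \<in> hom C (tgt C (po_inl C f g)) (tgt C x)"
    "po_map C f g x y \<cdot> po_inl C f g = x" "po_map C f g x y \<cdot> po_inr C f g = y"
    unfolding po_map_def by blast+
qed

lemma po_eqI:
  assumes "has_pushouts C" "f \<in> ar C" "g \<in> ar C" "src C f = src C g"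
    and m: "m \<in> ar C" "m' \<in> ar C" "src C m = tgt C (po_inl C f g)" "src C m' = tgt C (po_inl C f g)"
    and e: "m \<cdot> po_inl C f g = m' \<cdot> po_inl C f g" "m \<cdot> po_inr C f g = m' \<cdot> po_inr C f g"
  shows "m = m'"
proof -
  let ?p = "po_inl C f g" and ?q = "po_inr C f g"
  have p: "is_pushout C f g ?p ?q" by (rule is_pushout_po) fact+
  have [simp]: "?p \<in> ar C" "?q \<in> ar C" "src C ?p = tgt C f" "src C ?q = tgt C g" "tgt C ?q = tgt C ?p"
    using p by (auto simp: is_pushout_def)
  have pq: "?p \<cdot> f = ?q \<cdot> g" using p by (auto simp: is_pushout_def)
  have t: "tgt C m = tgt C m'" using e(1) m comp_simps(3) \<open>?p \<in> ar C\<close> by metis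
  have c: "(m \<cdot> ?p) \<cdot> f = (m \<cdot> ?q) \<cdot> g" using m assms(2-4) pq by simp
  have "\<forall>z. \<forall>x\<in>hom C (tgt C f) z. \<forall>y\<in>hom C (tgt C g) z.
          x \<cdot> f = y \<cdot> g \<longrightarrow> (\<exists>!m. m \<in> hom C (tgt C ?p) z \<and> m \<cdot> ?p = x \<and> m \<cdot> ?q = y)"
    using p unfolding is_pushout_def by blast
  from this[rule_format, OF _ _ c, of "tgt C m"]
  have "\<exists>!n. n \<in> hom C (tgt C ?p) (tgt C m) \<and> n \<cdot> ?p = m \<cdot> ?p \<and> n \<cdot> ?q = m \<cdot> ?q"
    using m by simp
  moreover have "m \<in> hom C (tgt C ?p) (tgt C m)" "m' \<in> hom C (tgt C ?p) (tgt C m)" using m t by simp_all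
  ultimately show ?thesis using e[symmetric] by blast
qed

lemma po_simps:
  assumes "has_pushouts C" "f \<in> ar C" "g \<in> ar C" "src C f = src C g"
  shows "po_inl C f g \<in> ar C" "po_inr C f g \<in> ar C" "src C (po_inl C f g) = tgt C f"
    "src C (po_inr C f g) = tgt C g" "tgt C (po_inr C f g) = tgt C (po_inl C f g)"
    "po_inl C f g \<cdot> f = po_inr C f g \<cdot> g"
  using is_pushout_po[OF assms] by (auto simp: is_pushout_def)

end

section \<open>Lifting problems of a two-variable adjunction\<close>

text \<open>All constructions are made for the variable in \<open>K\<close>, that is with \<open>homr\<close>; those for the variable
in \<open>M\<close> are obtained by exchanging \<open>K\<close> and \<open>M\<close> (\<open>swap_tva\<close> below).  In the notation introduced
here \<open>T a b\<close> and \<open>H b c\<close> are the actions of the tensor and of \<open>homr\<close> on arrows, \<open>TO\<close> and \<open>HO\<close> those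
on objects, \<open>tr\<close> transposes a map out of a tensor into one into \<open>homr\<close>, and \<open>sK\<close>, \<open>tK\<close>, \<dots> are
the identities at the source and the target of an arrow.\<close>

locale tva = K: category K + M: category M + N: category N
  for K :: "('ko, 'ka) cat" and M :: "('mo, 'ma) cat" and N :: "('no, 'na) cat" +
  fixes A :: "('ko, 'ka, 'mo, 'ma, 'no, 'na) tva"
  assumes tva: "is_two_variable_adjunction K M N A"
    and pbK: "has_pullbacks K" and pbM: "has_pullbacks M" and poN: "has_pushouts N"
begin

abbreviation compK (infixr "\<cdot>\<^sub>K" 70) where "g \<cdot>\<^sub>K f \<equiv> g \<cdot>\<^bsub>K\<^esub> f"
abbreviation compM (infixr "\<cdot>\<^sub>M" 70) where "g \<cdot>\<^sub>M f \<equiv> g \<cdot>\<^bsub>M\<^esub> f"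
abbreviation compN (infixr "\<cdot>\<^sub>N" 70) where "g \<cdot>\<^sub>N f \<equiv> g \<cdot>\<^bsub>N\<^esub> f"

abbreviation "sK i \<equiv> idt K (src K i)"
abbreviation "tK i \<equiv> idt K (tgt K i)"
abbreviation "sM j \<equiv> idt M (src M j)"
abbreviation "tM j \<equiv> idt M (tgt M j)"
abbreviation "sN f \<equiv> idt N (src N f)"
abbreviation "tN f \<equiv> idt N (tgt N f)"

abbreviation TO where "TO k m \<equiv> fob (tensor A) (k, m)"
abbreviation T where "T a b \<equiv> far (tensor A) (a, b)"
abbreviation HO where "HO m n \<equiv> fob (homr A) (m, n)"
abbreviation H where "H b c \<equiv> far (homr A) (b, c)"
abbreviation tr where "tr \<equiv> transr A"

lemma T_functor: "is_functor (prod_cat K M) N (tensor A)" using tva by (simp add: is_two_variable_adjunction_def)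
lemma H_functor: "is_functor (prod_cat (op_cat M) N) K (homr A)" using tva
    by (simp add: is_two_variable_adjunction_def)

lemma T_simps [simp]:
  "k \<in> ob K \<Longrightarrow> m \<in> ob M \<Longrightarrow> TO k m \<in> ob N"
  "a \<in> ar K \<Longrightarrow> b \<in> ar M \<Longrightarrow> T a b \<in> ar N"
  "a \<in> ar K \<Longrightarrow> b \<in> ar M \<Longrightarrow> src N (T a b) = TO (src K a) (src M b)"
  "a \<in> ar K \<Longrightarrow> b \<in> ar M \<Longrightarrow> tgt N (T a b) = TO (tgt K a) (tgt M b)"
  "k \<in> ob K \<Longrightarrow> m \<in> ob M \<Longrightarrow> T (idt K k) (idt M m) = idt N (TO k m)"
proof -
  interpret F: is_functor "prod_cat K M" N "tensor A" by (rule T_functor)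
  show "k \<in> ob K \<Longrightarrow> m \<in> ob M \<Longrightarrow> TO k m \<in> ob N" using F.fob_ob[of "(k, m)"] by simp
  show "k \<in> ob K \<Longrightarrow> m \<in> ob M \<Longrightarrow> T (idt K k) (idt M m) = idt N (TO k m)" using F.far_idt[of "(k, m)"] by simp
  assume "a \<in> ar K" "b \<in> ar M"
  then show "T a b \<in> ar N" "src N (T a b) = TO (src K a) (src M b)" "tgt N (T a b) = TO (tgt K a) (tgt M b)"
    using F.far_hom[of "(a, b)" "(src K a, src M b)" "(tgt K a, tgt M b)"] by simp_all
qed

lemma T_comp [simp]:
  assumes "a \<in> ar K" "b \<in> ar M" "a' \<in> ar K" "b' \<in> ar M" "tgt K a' = src K a" "tgt M b' = src M b"
  shows "T a b \<cdot>\<^sub>N T a' b' = T (a \<cdot>\<^sub>K a') (b \<cdot>\<^sub>M b')"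
proof -
  interpret F: is_functor "prod_cat K M" N "tensor A" by (rule T_functor)
  show ?thesis using F.far_cmp[of "(a', b')" "(src K a', src M b')" "(src K a, src M b)" "(a, b)"
      "(tgt K a, tgt M b)"]
    assms by simp
qed

lemma T_comp' [simp]:
  assumes "a \<in> ar K" "b \<in> ar M" "a' \<in> ar K" "b' \<in> ar M" "tgt K a' = src K a" "tgt M b' = src M b"
    "x \<in> ar N" "tgt N x = TO (src K a') (src M b')"
  shows "T a b \<cdot>\<^sub>N (T a' b' \<cdot>\<^sub>N x) = T (a \<cdot>\<^sub>K a') (b \<cdot>\<^sub>M b') \<cdot>\<^sub>N x"
  by (rule N.comp_reduce) (use assms in simp_all)

lemma H_simps [simp]:
  "m \<in> ob M \<Longrightarrow> n \<in> ob N \<Longrightarrow> HO m n \<in> ob K"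
  "b \<in> ar M \<Longrightarrow> c \<in> ar N \<Longrightarrow> H b c \<in> ar K"
  "b \<in> ar M \<Longrightarrow> c \<in> ar N \<Longrightarrow> src K (H b c) = HO (tgt M b) (src N c)"
  "b \<in> ar M \<Longrightarrow> c \<in> ar N \<Longrightarrow> tgt K (H b c) = HO (src M b) (tgt N c)"
  "m \<in> ob M \<Longrightarrow> n \<in> ob N \<Longrightarrow> H (idt M m) (idt N n) = idt K (HO m n)"
proof -
  interpret F: is_functor "prod_cat (op_cat M) N" K "homr A" by (rule H_functor)
  show "m \<in> ob M \<Longrightarrow> n \<in> ob N \<Longrightarrow> HO m n \<in> ob K" using F.fob_ob[of "(m, n)"] by simp
  show "m \<in> ob M \<Longrightarrow> n \<in> ob N \<Longrightarrow> H (idt M m) (idt N n) = idt K (HO m n)" using F.far_idt[of "(m, n)"] by simp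
  assume "b \<in> ar M" "c \<in> ar N"
  then show "H b c \<in> ar K" "src K (H b c) = HO (tgt M b) (src N c)" "tgt K (H b c) = HO (src M b) (tgt N c)"
    using F.far_hom[of "(b, c)" "(tgt M b, src N c)" "(src M b, tgt N c)"] by simp_all
qed

lemma H_comp [simp]:
  assumes "b \<in> ar M" "c \<in> ar N" "b' \<in> ar M" "c' \<in> ar N" "tgt M b = src M b'" "tgt N c' = src N c"
  shows "H b c \<cdot>\<^sub>K H b' c' = H (b' \<cdot>\<^sub>M b) (c \<cdot>\<^sub>N c')"
proof -
  interpret F: is_functor "prod_cat (op_cat M) N" K "homr A" by (rule H_functor)
  show ?thesis using F.far_cmp[of "(b', c')" "(tgt M b', src N c')" "(tgt M b, src N c)" "(b, c)"
      "(src M b, tgt N c)"]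
    assms by simp
qed

lemma H_comp' [simp]:
  assumes "b \<in> ar M" "c \<in> ar N" "b' \<in> ar M" "c' \<in> ar N" "tgt M b = src M b'" "tgt N c' = src N c"
    "x \<in> ar K" "tgt K x = HO (tgt M b') (src N c')"
  shows "H b c \<cdot>\<^sub>K (H b' c' \<cdot>\<^sub>K x) = H (b' \<cdot>\<^sub>M b) (c \<cdot>\<^sub>N c') \<cdot>\<^sub>K x"
  by (rule K.comp_reduce) (use assms in simp_all)

definition untr where "untr k m n e = inv_into (hom N (TO k m) n) (tr k m n) e"

lemma tr_bij: "k \<in> ob K \<Longrightarrow> m \<in> ob M \<Longrightarrow> n \<in> ob N \<Longrightarrow> bij_betw (tr k m n) (hom N (TO k m) n) (hom K k (HO m n))"
  using tva by (auto simp: is_two_variable_adjunction_def simp del: hom_iff)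

lemma tr_simps [simp]:
  assumes "k \<in> ob K" "m \<in> ob M" "d \<in> ar N" "src N d = TO k m" "tgt N d = n"
  shows "tr k m n d \<in> ar K" "src K (tr k m n d) = k" "tgt K (tr k m n d) = HO m n" "untr k m n (tr k m n d) = d"
proof -
  have n: "n \<in> ob N" and d: "d \<in> hom N (TO k m) n" using assms by auto
  have "tr k m n d \<in> hom K k (HO m n)" using bij_betwE[OF tr_bij[OF assms(1,2) n]] d by blast
  then show "tr k m n d \<in> ar K" "src K (tr k m n d) = k" "tgt K (tr k m n d) = HO m n" by simp_all
  show "untr k m n (tr k m n d) = d" unfolding untr_def
    using tr_bij[OF assms(1,2) n] d by (intro inv_into_f_f) (auto simp: bij_betw_def)
qed

lemma untr_simps [simp]:
  assumes "k \<in> ob K" "m \<in> ob M" "n \<in> ob N" "e \<in> ar K" "src K e = k" "tgt K e = HO m n"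
  shows "untr k m n e \<in> ar N" "src N (untr k m n e) = TO k m" "tgt N (untr k m n e) = n" "tr k m n (untr k m n e) = e"
proof -
  have e: "e \<in> tr k m n ` hom N (TO k m) n" using tr_bij[OF assms(1-3)] assms by (auto simp: bij_betw_def)
  have "untr k m n e \<in> hom N (TO k m) n" unfolding untr_def using e by (rule inv_into_into)
  then show "untr k m n e \<in> ar N" "src N (untr k m n e) = TO k m" "tgt N (untr k m n e) = n" by simp_all
  show "tr k m n (untr k m n e) = e" unfolding untr_def using e by (rule f_inv_into_f)
qed

lemma tr_inj:
  assumes "tr k m n d = tr k m n d'" "k \<in> ob K" "m \<in> ob M" "d \<in> ar N" "src N d = TO k m" "tgt N d = n"
    "d' \<in> ar N" "src N d' = TO k m" "tgt N d' = n"
  shows "d = d'"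
  using assms tr_simps(4) by metis

lemma tr_nat:
  assumes "a \<in> ar K" "b \<in> ar M" "c \<in> ar N" "d \<in> ar N" "src N d = TO (tgt K a) (tgt M b)" "tgt N d = src N c"
  shows "tr (src K a) (src M b) (tgt N c) (c \<cdot>\<^sub>N (d \<cdot>\<^sub>N T a b))
      = H b c \<cdot>\<^sub>K (tr (tgt K a) (tgt M b) (src N c) d \<cdot>\<^sub>K a)"
  using tva assms by (auto simp: is_two_variable_adjunction_def)

lemma tr_precomp:
  assumes "a \<in> ar K" "m \<in> ob M" "d \<in> ar N" "src N d = TO (tgt K a) m" "tgt N d = n" "src K a = k"
  shows "tr k m n (d \<cdot>\<^sub>N T a (idt M m)) = tr (tgt K a) m n d \<cdot>\<^sub>K a"
  using tr_nat[of a "idt M m" "idt N n" d] assms by auto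

lemma tr_prebm:
  assumes "b \<in> ar M" "k \<in> ob K" "d \<in> ar N" "src N d = TO k (tgt M b)" "tgt N d = n" "src M b = m"
  shows "tr k m n (d \<cdot>\<^sub>N T (idt K k) b) = H b (idt N n) \<cdot>\<^sub>K tr k (tgt M b) n d"
  using tr_nat[of "idt K k" b "idt N n" d] assms by auto

lemma tr_postcomp:
  assumes "c \<in> ar N" "k \<in> ob K" "m \<in> ob M" "d \<in> ar N" "src N d = TO k m" "tgt N d = src N c" "tgt N c = n"
  shows "tr k m n (c \<cdot>\<^sub>N d) = H (idt M m) c \<cdot>\<^sub>K tr k m (src N c) d"
  using tr_nat[of "idt K k" "idt M m" c d] assms by simp

text \<open>The pullback-hom \<open>hh j f\<close> of \<open>j : J \<rightarrow> K\<close> and \<open>f : X \<rightarrow> Y\<close> ends in the pullback \<open>PO j f\<close> of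
\<open>homr K Y\<close> and \<open>homr J X\<close> over \<open>homr J Y\<close>, with projections \<open>p1\<close> and \<open>p2\<close>.\<close>

abbreviation p1 where "p1 \<equiv> ph_fst M N K (homr A)"
abbreviation p2 where "p2 \<equiv> ph_snd M N K (homr A)"
abbreviation pair where "pair \<equiv> ph_map M N K (homr A)"
abbreviation hh where "hh j f \<equiv> fob (pullback_hom M N K (homr A)) (j, f)"
abbreviation PO where "PO j f \<equiv> src K (p1 j f)"

lemma p_simps:
  assumes "j \<in> ar M" "f \<in> ar N"
  shows "p1 j f \<in> ar K" "p2 j f \<in> ar K" "src K (p2 j f) = PO j f" "tgt K (p1 j f) = HO (tgt M j) (tgt N f)"
    "tgt K (p2 j f) = HO (src M j) (src N f)"
    and p_comm: "H j (tN f) \<cdot>\<^sub>K p1 j f = H (sM j) f \<cdot>\<^sub>K p2 j f"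
proof -
  interpret op: category "op_cat K" by (rule category_op) (rule K.category_axioms)
  note op.po_simps[of "H j (tN f)" "H (sM j) f"]
  then show "p1 j f \<in> ar K" "p2 j f \<in> ar K" "src K (p2 j f) = PO j f" "tgt K (p1 j f) = HO (tgt M j) (tgt N f)"
    "tgt K (p2 j f) = HO (src M j) (src N f)" "H j (tN f) \<cdot>\<^sub>K p1 j f = H (sM j) f \<cdot>\<^sub>K p2 j f"
    using assms pbK unfolding ph_fst_def ph_snd_def ph_cospan1_def ph_cospan2_def pb_fst_def pb_snd_def
        has_pullbacks_def
    by simp_all
qed

declare p_simps(1-5) [simp]

lemma pair:
  assumes "j \<in> ar M" "f \<in> ar N" "x \<in> ar K" "y \<in> ar K" "src K x = src K y" "tgt K x = HO (tgt M j) (tgt N f)"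
    "tgt K y = HO (src M j) (src N f)" "H j (tN f) \<cdot>\<^sub>K x = H (sM j) f \<cdot>\<^sub>K y"
  shows "pair j f x y \<in> ar K" "src K (pair j f x y) = src K x" "tgt K (pair j f x y) = PO j f"
    "p1 j f \<cdot>\<^sub>K pair j f x y = x" "p2 j f \<cdot>\<^sub>K pair j f x y = y"
proof -
  interpret op: category "op_cat K" by (rule category_op) (rule K.category_axioms)
  note op.po_map[of "H j (tN f)" "H (sM j) f" x y]
  then show "pair j f x y \<in> ar K" "src K (pair j f x y) = src K x" "tgt K (pair j f x y) = PO j f"
    "p1 j f \<cdot>\<^sub>K pair j f x y = x" "p2 j f \<cdot>\<^sub>K pair j f x y = y"
    using assms pbK unfolding ph_fst_def ph_snd_def ph_cospan1_def ph_cospan2_def pb_fst_def pb_snd_def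
      has_pullbacks_def ph_map_def pb_map_def
    by simp_all
qed

lemma p_eqI:
  assumes "j \<in> ar M" "f \<in> ar N" "m \<in> ar K" "m' \<in> ar K" "tgt K m = PO j f" "tgt K m' = PO j f"
    "p1 j f \<cdot>\<^sub>K m = p1 j f \<cdot>\<^sub>K m'" "p2 j f \<cdot>\<^sub>K m = p2 j f \<cdot>\<^sub>K m'"
  shows "m = m'"
proof -
  interpret op: category "op_cat K" by (rule category_op) (rule K.category_axioms)
  show ?thesis
    by (rule op.po_eqI[of "H j (tN f)" "H (sM j) f"])
      (use assms pbK in \<open>unfold ph_fst_def ph_snd_def ph_cospan1_def ph_cospan2_def pb_fst_def pb_snd_def
      has_pullbacks_def, simp_all\<close>)
qed

lemma hh:
  assumes "j \<in> ar M" "f \<in> ar N"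
  shows "hh j f \<in> ar K" "src K (hh j f) = HO (tgt M j) (src N f)" "tgt K (hh j f) = PO j f"
    "p1 j f \<cdot>\<^sub>K hh j f = H (tM j) f" "p2 j f \<cdot>\<^sub>K hh j f = H j (sN f)"
  using pair[of j f "H (tM j) f" "H j (sN f)"] assms
  by (simp_all add: pullback_hom_def)

declare hh(1-3) [simp]

text \<open>For \<open>i : A \<rightarrow> B\<close>, \<open>j : J \<rightarrow> K\<close> and \<open>f : X \<rightarrow> Y\<close>, the maps \<open>y : B \<otimes> K \<rightarrow> Y\<close>, \<open>b : A \<otimes> K \<rightarrow> X\<close> and
\<open>c : B \<otimes> J \<rightarrow> X\<close> are the components of a lifting problem.  In contrast to the three equivalent
squares, in \<open>K\<close>, \<open>M\<close> and \<open>N\<close>, this form treats the variables alike.\<close>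

definition prob where
  "prob i j f y b c \<longleftrightarrow> i \<in> ar K \<and> j \<in> ar M \<and> f \<in> ar N \<and>
     y \<in> ar N \<and> src N y = TO (tgt K i) (tgt M j) \<and> tgt N y = tgt N f \<and>
     b \<in> ar N \<and> src N b = TO (src K i) (tgt M j) \<and> tgt N b = src N f \<and>
     c \<in> ar N \<and> src N c = TO (tgt K i) (src M j) \<and> tgt N c = src N f \<and>
     f \<cdot>\<^sub>N b = y \<cdot>\<^sub>N T i (tM j) \<and> f \<cdot>\<^sub>N c = y \<cdot>\<^sub>N T (tK i) j \<and>
     b \<cdot>\<^sub>N T (sK i) j = c \<cdot>\<^sub>N T i (sM j)"

definition sol where
  "sol i j f y b c d \<longleftrightarrow> d \<in> ar N \<and> src N d = TO (tgt K i) (tgt M j) \<and> tgt N d = src N f \<and>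
     f \<cdot>\<^sub>N d = y \<and> d \<cdot>\<^sub>N T i (tM j) = b \<and> d \<cdot>\<^sub>N T (tK i) j = c"

lemma probD:
  assumes "prob i j f y b c"
  shows "i \<in> ar K" "j \<in> ar M" "f \<in> ar N"
     "y \<in> ar N" "src N y = TO (tgt K i) (tgt M j)" "tgt N y = tgt N f"
     "b \<in> ar N" "src N b = TO (src K i) (tgt M j)" "tgt N b = src N f"
     "c \<in> ar N" "src N c = TO (tgt K i) (src M j)" "tgt N c = src N f"
     "f \<cdot>\<^sub>N b = y \<cdot>\<^sub>N T i (tM j)" "f \<cdot>\<^sub>N c = y \<cdot>\<^sub>N T (tK i) j"
     "b \<cdot>\<^sub>N T (sK i) j = c \<cdot>\<^sub>N T i (sM j)"
  using assms by (auto simp: prob_def)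

lemma solD:
  assumes "sol i j f y b c d"
  shows "d \<in> ar N" "src N d = TO (tgt K i) (tgt M j)" "tgt N d = src N f"
     "f \<cdot>\<^sub>N d = y" "d \<cdot>\<^sub>N T i (tM j) = b" "d \<cdot>\<^sub>N T (tK i) j = c"
  using assms by (auto simp: sol_def)

text \<open>A problem transposes to the square \<open>(top, bot)\<close> from \<open>i\<close> to the pullback-hom of \<open>j\<close> and \<open>f\<close>.\<close>

definition top where "top i j f b = tr (src K i) (tgt M j) (src N f) b"
definition bot where "bot i j f y c = pair j f (tr (tgt K i) (tgt M j) (tgt N f) y) (tr (tgt K i) (src M j)
    (src N f) c)"

lemma bot:
  assumes "prob i j f y b c"
  shows "bot i j f y c \<in> ar K" "src K (bot i j f y c) = tgt K i" "tgt K (bot i j f y c) = PO j f"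
    "p1 j f \<cdot>\<^sub>K bot i j f y c = tr (tgt K i) (tgt M j) (tgt N f) y"
    "p2 j f \<cdot>\<^sub>K bot i j f y c = tr (tgt K i) (src M j) (src N f) c"
proof -
  note [simp] = probD(1-12)[OF assms]
  have "H j (tN f) \<cdot>\<^sub>K tr (tgt K i) (tgt M j) (tgt N f) y
    = tr (tgt K i) (src M j) (tgt N f) (y \<cdot>\<^sub>N T (tK i) j)" by (simp add: tr_prebm)
  also have "\<dots> = H (sM j) f \<cdot>\<^sub>K tr (tgt K i) (src M j) (src N f) c"
    by (simp add: probD(14)[OF assms, symmetric] tr_postcomp)
  finally have e: "H j (tN f) \<cdot>\<^sub>K tr (tgt K i) (tgt M j) (tgt N f) y
     = H (sM j) f \<cdot>\<^sub>K tr (tgt K i) (src M j) (src N f) c" .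
  show "bot i j f y c \<in> ar K" "src K (bot i j f y c) = tgt K i" "tgt K (bot i j f y c) = PO j f"
    "p1 j f \<cdot>\<^sub>K bot i j f y c = tr (tgt K i) (tgt M j) (tgt N f) y"
    "p2 j f \<cdot>\<^sub>K bot i j f y c = tr (tgt K i) (src M j) (src N f) c"
    unfolding bot_def using e by (simp_all add: pair)
qed

lemma top [simp]:
  assumes "prob i j f y b c"
  shows "top i j f b \<in> ar K" "src K (top i j f b) = src K i" "tgt K (top i j f b) = HO (tgt M j) (src N f)"
  unfolding top_def using probD(1-12)[OF assms] by simp_all

lemma botI:
  assumes "prob i j f y b c" "v \<in> ar K" "tgt K v = PO j f"
    "p1 j f \<cdot>\<^sub>K v = tr (tgt K i) (tgt M j) (tgt N f) y"
    "p2 j f \<cdot>\<^sub>K v = tr (tgt K i) (src M j) (src N f) c"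
  shows "bot i j f y c = v"
  by (rule p_eqI[of j f]) (use assms probD[OF assms(1)] bot[OF assms(1)] in auto)

lemma prob_square:
  assumes "prob i j f y b c"
  shows "square K i (top i j f b) (bot i j f y c) (hh j f)"
proof -
  note [simp] = probD(1-12)[OF assms] bot(1-3)[OF assms] top[OF assms]
  have "hh j f \<cdot>\<^sub>K top i j f b = bot i j f y c \<cdot>\<^sub>K i"
  proof (rule p_eqI[of j f])
    have "p1 j f \<cdot>\<^sub>K (hh j f \<cdot>\<^sub>K top i j f b) = H (tM j) f \<cdot>\<^sub>K top i j f b"
      by (rule K.comp_reduce) (simp_all add: hh)
    also have "\<dots> = tr (src K i) (tgt M j) (tgt N f) (f \<cdot>\<^sub>N b)" by (simp add: tr_postcomp top_def)
    also have "\<dots> = tr (tgt K i) (tgt M j) (tgt N f) y \<cdot>\<^sub>K i" by (simp add: probD(13)[OF assms] tr_precomp)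
    also have "\<dots> = p1 j f \<cdot>\<^sub>K (bot i j f y c \<cdot>\<^sub>K i)"
      by (rule K.comp_reduce[symmetric]) (simp_all add: bot[OF assms])
    finally show "p1 j f \<cdot>\<^sub>K (hh j f \<cdot>\<^sub>K top i j f b) = p1 j f \<cdot>\<^sub>K (bot i j f y c \<cdot>\<^sub>K i)" .
    have "p2 j f \<cdot>\<^sub>K (hh j f \<cdot>\<^sub>K top i j f b) = H j (sN f) \<cdot>\<^sub>K top i j f b"
      by (rule K.comp_reduce) (simp_all add: hh)
    also have "\<dots> = tr (src K i) (src M j) (src N f) (b \<cdot>\<^sub>N T (sK i) j)" by (simp add: tr_prebm top_def)
    also have "\<dots> = tr (tgt K i) (src M j) (src N f) c \<cdot>\<^sub>K i" by (simp add: probD(15)[OF assms] tr_precomp)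
    also have "\<dots> = p2 j f \<cdot>\<^sub>K (bot i j f y c \<cdot>\<^sub>K i)"
      by (rule K.comp_reduce[symmetric]) (simp_all add: bot[OF assms])
    finally show "p2 j f \<cdot>\<^sub>K (hh j f \<cdot>\<^sub>K top i j f b) = p2 j f \<cdot>\<^sub>K (bot i j f y c \<cdot>\<^sub>K i)" .
  qed simp_all
  then show ?thesis by (simp add: square_def)
qed

text \<open>The components of the problem that transposes to a given square.\<close>

definition uny where "uny i j f v = untr (tgt K i) (tgt M j) (tgt N f) (p1 j f \<cdot>\<^sub>K v)"
definition unb where "unb i j f u = untr (src K i) (tgt M j) (src N f) u"
definition unc where "unc i j f v = untr (tgt K i) (src M j) (src N f) (p2 j f \<cdot>\<^sub>K v)"

lemma square_prob:
  assumes j: "j \<in> ar M" and f: "f \<in> ar N" and q: "square K i u v (hh j f)"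
  shows "prob i j f (uny i j f v) (unb i j f u) (unc i j f v)"
    "top i j f (unb i j f u) = u" "bot i j f (uny i j f v) (unc i j f v) = v"
proof -
  note [simp] = squareD(1-4)[OF q] squareD(5-8)[OF q, simplified hh(2,3)[OF j f]] j f
  have y[simp]: "uny i j f v \<in> ar N" "src N (uny i j f v) = TO (tgt K i) (tgt M j)" "tgt N (uny i j f v) = tgt N f"
    and y': "tr (tgt K i) (tgt M j) (tgt N f) (uny i j f v) = p1 j f \<cdot>\<^sub>K v"
    by (simp_all add: uny_def)
  have b[simp]: "unb i j f u \<in> ar N" "src N (unb i j f u) = TO (src K i) (tgt M j)" "tgt N (unb i j f u) = src N f"
    and b': "tr (src K i) (tgt M j) (src N f) (unb i j f u) = u"
    by (simp_all add: unb_def)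
  have c[simp]: "unc i j f v \<in> ar N" "src N (unc i j f v) = TO (tgt K i) (src M j)" "tgt N (unc i j f v) = src N f"
    and c': "tr (tgt K i) (src M j) (src N f) (unc i j f v) = p2 j f \<cdot>\<^sub>K v"
    by (simp_all add: unc_def)
  have e1: "p1 j f \<cdot>\<^sub>K (v \<cdot>\<^sub>K i) = H (tM j) f \<cdot>\<^sub>K u"
    unfolding squareD(9)[OF q, symmetric] by (rule K.comp_reduce) (simp_all add: hh)
  have e2: "p2 j f \<cdot>\<^sub>K (v \<cdot>\<^sub>K i) = H j (sN f) \<cdot>\<^sub>K u"
    unfolding squareD(9)[OF q, symmetric] by (rule K.comp_reduce) (simp_all add: hh)
  have e3: "H j (tN f) \<cdot>\<^sub>K (p1 j f \<cdot>\<^sub>K v) = H (sM j) f \<cdot>\<^sub>K (p2 j f \<cdot>\<^sub>K v)"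
    by (rule K.comp_exchange) (simp_all add: p_comm)
  have "f \<cdot>\<^sub>N unb i j f u = uny i j f v \<cdot>\<^sub>N T i (tM j)"
    by (rule tr_inj[of "src K i" "tgt M j" "tgt N f"]) (simp_all add: tr_postcomp[of f] tr_precomp[of i] b' y' e1)
  moreover have "f \<cdot>\<^sub>N unc i j f v = uny i j f v \<cdot>\<^sub>N T (tK i) j"
    by (rule tr_inj[of "tgt K i" "src M j" "tgt N f"]) (simp_all add: tr_postcomp[of f] tr_prebm[of j] c' y' e3)
  moreover have "unb i j f u \<cdot>\<^sub>N T (sK i) j = unc i j f v \<cdot>\<^sub>N T i (sM j)"
    by (rule tr_inj[of "src K i" "src M j" "src N f"]) (simp_all add: tr_precomp tr_prebm c' b' e2)
  ultimately show p: "prob i j f (uny i j f v) (unb i j f u) (unc i j f v)"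
    unfolding prob_def by simp
  show "top i j f (unb i j f u) = u" by (simp add: top_def b')
  show "bot i j f (uny i j f v) (unc i j f v) = v" by (rule botI[OF p]) (simp_all add: y' c')
qed

lemma sol_iff:
  assumes p: "prob i j f y b c" and d: "d \<in> ar N" "src N d = TO (tgt K i) (tgt M j)" "tgt N d = src N f"
  shows "sol i j f y b c d \<longleftrightarrow> tr (tgt K i) (tgt M j) (src N f) d \<cdot>\<^sub>K i = top i j f b
     \<and> hh j f \<cdot>\<^sub>K tr (tgt K i) (tgt M j) (src N f) d = bot i j f y c"
proof -
  note [simp] = probD(1-12)[OF p] bot(1-3)[OF p] d
  let ?t = "tr (tgt K i) (tgt M j) (src N f) d"
  have 1: "d \<cdot>\<^sub>N T i (tM j) = b \<longleftrightarrow> ?t \<cdot>\<^sub>K i = top i j f b"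
  proof -
    have "?t \<cdot>\<^sub>K i = tr (src K i) (tgt M j) (src N f) (d \<cdot>\<^sub>N T i (tM j))" by (simp add: tr_precomp)
    then show ?thesis unfolding top_def using tr_inj[of "src K i" "tgt M j" "src N f" "d \<cdot>\<^sub>N T i (tM j)" b]
      by auto
  qed
  have 2: "p1 j f \<cdot>\<^sub>K (hh j f \<cdot>\<^sub>K ?t) = tr (tgt K i) (tgt M j) (tgt N f) (f \<cdot>\<^sub>N d)"
    by (subst K.comp_reduce[OF hh(4)]) (simp_all add: tr_postcomp)
  have 3: "p2 j f \<cdot>\<^sub>K (hh j f \<cdot>\<^sub>K ?t) = tr (tgt K i) (src M j) (src N f) (d \<cdot>\<^sub>N T (tK i) j)"
    by (subst K.comp_reduce[OF hh(5)]) (simp_all add: tr_prebm)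
  have "hh j f \<cdot>\<^sub>K ?t = bot i j f y c \<longleftrightarrow> f \<cdot>\<^sub>N d = y \<and> d \<cdot>\<^sub>N T (tK i) j = c"
  proof
    assume "hh j f \<cdot>\<^sub>K ?t = bot i j f y c"
    then have "tr (tgt K i) (tgt M j) (tgt N f) (f \<cdot>\<^sub>N d) = tr (tgt K i) (tgt M j) (tgt N f) y"
      "tr (tgt K i) (src M j) (src N f) (d \<cdot>\<^sub>N T (tK i) j) = tr (tgt K i) (src M j) (src N f) c"
      using 2 3 bot(4,5)[OF p] by simp_all
    then show "f \<cdot>\<^sub>N d = y \<and> d \<cdot>\<^sub>N T (tK i) j = c"
      by (auto elim!: tr_inj)
  next
    assume e: "f \<cdot>\<^sub>N d = y \<and> d \<cdot>\<^sub>N T (tK i) j = c"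
    show "hh j f \<cdot>\<^sub>K ?t = bot i j f y c"
      by (rule botI[OF p, symmetric]) (use 2 3 e in simp_all)
  qed
  then show ?thesis using 1 by (auto simp: sol_def)
qed

end

definition swap_tva :: "('ko, 'ka, 'mo, 'ma, 'no, 'na) tva \<Rightarrow> ('mo, 'ma, 'ko, 'ka, 'no, 'na) tva" where
  "swap_tva A = \<lparr>tensor = \<lparr>fob = (\<lambda>(m, k). fob (tensor A) (k, m)), far = (\<lambda>(b, a). far (tensor A) (a, b))\<rparr>,
     homl = homr A, homr = homl A, transl = (\<lambda>m k. transr A k m), transr = (\<lambda>m k. transl A k m)\<rparr>"

lemma swap_tva_simps [simp]:
  "fob (tensor (swap_tva A)) (m, k) = fob (tensor A) (k, m)" "far (tensor (swap_tva A)) (b, a)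
      = far (tensor A) (a, b)"
  "homl (swap_tva A) = homr A" "homr (swap_tva A) = homl A"
  "transl (swap_tva A) m k n = transr A k m n" "transr (swap_tva A) m k n = transl A k m n"
  by (simp_all add: swap_tva_def)

context tva
begin

lemma swap: "tva M K N (swap_tva A)"
proof (unfold_locales)
  have f: "is_functor (prod_cat M K) N (tensor (swap_tva A))"
  proof -
    interpret P: category "prod_cat M K" by (rule category_prod_cat) unfold_locales
    show ?thesis
    proof
      fix x assume "x \<in> ob (prod_cat M K)"
      then show "fob (tensor (swap_tva A)) x \<in> ob N" "far (tensor (swap_tva A)) (idt (prod_cat M K) x)
          = idt N (fob (tensor (swap_tva A)) x)"
        by auto
    next
      fix f x y assume "f \<in> hom (prod_cat M K) x y"
      then show "far (tensor (swap_tva A)) f \<in> hom N (fob (tensor (swap_tva A)) x) (fob (tensor (swap_tva A)) y)"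
        by auto
    next
      fix f x y g z assume "f \<in> hom (prod_cat M K) x y" "g \<in> hom (prod_cat M K) y z"
      then show "far (tensor (swap_tva A)) (g \<cdot>\<^bsub>prod_cat M K\<^esub> f) =
         far (tensor (swap_tva A)) g \<cdot>\<^sub>N far (tensor (swap_tva A)) f"
        by (cases f; cases g) auto
    qed
  qed
  show "is_two_variable_adjunction M K N (swap_tva A)"
    unfolding is_two_variable_adjunction_def
    using tva f by (auto simp: is_two_variable_adjunction_def simp del: hom_iff)
qed (rule pbK pbM poN)+

end


context tva
begin

text \<open>Restricting a problem along a square into \<open>i'\<close> is precomposition with that square on the side
of the pullback-hom.\<close>

lemma prob_pre:
  assumes p: "prob i' j f y b c" and q: "square K i a a' i'"
  shows "prob i j f (y \<cdot>\<^sub>N T a' (tM j)) (b \<cdot>\<^sub>N T a (tM j)) (c \<cdot>\<^sub>N T a' (sM j))"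
    "top i j f (b \<cdot>\<^sub>N T a (tM j)) = top i' j f b \<cdot>\<^sub>K a"
    "bot i j f (y \<cdot>\<^sub>N T a' (tM j)) (c \<cdot>\<^sub>N T a' (sM j)) = bot i' j f y c \<cdot>\<^sub>K a'"
proof -
  note [simp] = probD(1-12)[OF p] squareD(1-8)[OF q] bot(1-3)[OF p]
  have e1: "f \<cdot>\<^sub>N (b \<cdot>\<^sub>N T a (tM j)) = y \<cdot>\<^sub>N (T i' (tM j) \<cdot>\<^sub>N T a (tM j))"
    by (rule N.comp_exchange) (simp_all add: probD(13)[OF p])
  have e2: "f \<cdot>\<^sub>N (c \<cdot>\<^sub>N T a' (sM j)) = y \<cdot>\<^sub>N (T (tK i') j \<cdot>\<^sub>N T a' (sM j))"
    by (rule N.comp_exchange) (simp_all add: probD(14)[OF p])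
  have e3: "b \<cdot>\<^sub>N (T (sK i') j \<cdot>\<^sub>N T a (sM j))
     = c \<cdot>\<^sub>N (T i' (sM j) \<cdot>\<^sub>N T a (sM j))"
    by (rule N.comp_exchange) (simp_all add: probD(15)[OF p])
  show pr: "prob i j f (y \<cdot>\<^sub>N T a' (tM j)) (b \<cdot>\<^sub>N T a (tM j)) (c \<cdot>\<^sub>N T a' (sM j))"
    using e1 e2 e3 by (simp add: prob_def squareD(9)[OF q])
  show "top i j f (b \<cdot>\<^sub>N T a (tM j)) = top i' j f b \<cdot>\<^sub>K a"
    by (simp add: top_def tr_precomp)
  show "bot i j f (y \<cdot>\<^sub>N T a' (tM j)) (c \<cdot>\<^sub>N T a' (sM j)) = bot i' j f y c \<cdot>\<^sub>K a'"
  proof (rule botI[OF pr])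
    show "p1 j f \<cdot>\<^sub>K (bot i' j f y c \<cdot>\<^sub>K a') = tr (tgt K i) (tgt M j) (tgt N f) (y \<cdot>\<^sub>N T a' (tM j))"
      by (subst K.comp_reduce[OF bot(4)[OF p]]) (simp_all add: tr_precomp)
    show "p2 j f \<cdot>\<^sub>K (bot i' j f y c \<cdot>\<^sub>K a') = tr (tgt K i) (src M j) (src N f) (c \<cdot>\<^sub>N T a' (sM j))"
      by (subst K.comp_reduce[OF bot(5)[OF p]]) (simp_all add: tr_precomp)
  qed simp_all
qed

definition hmap where
  "hmap j f j' f' b0 b1 f0 f1 = pair j' f' (H b1 f1 \<cdot>\<^sub>K p1 j f) (H b0 f0 \<cdot>\<^sub>K p2 j f)"

lemma hmap:
  assumes j: "square M j' b0 b1 j" and f: "square N f f0 f1 f'"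
  shows "hmap j f j' f' b0 b1 f0 f1 \<in> ar K" "src K (hmap j f j' f' b0 b1 f0 f1) = PO j f"
    "tgt K (hmap j f j' f' b0 b1 f0 f1) = PO j' f'"
    "p1 j' f' \<cdot>\<^sub>K hmap j f j' f' b0 b1 f0 f1 = H b1 f1 \<cdot>\<^sub>K p1 j f"
    "p2 j' f' \<cdot>\<^sub>K hmap j f j' f' b0 b1 f0 f1 = H b0 f0 \<cdot>\<^sub>K p2 j f"
    "square K (hh j f) (H b1 f0) (hmap j f j' f' b0 b1 f0 f1) (hh j' f')"
proof -
  note [simp] = squareD(1-8)[OF j] squareD(1-8)[OF f]
  have "H j' (tN f') \<cdot>\<^sub>K (H b1 f1 \<cdot>\<^sub>K p1 j f) = H b0 f1 \<cdot>\<^sub>K (H j (tN f) \<cdot>\<^sub>K p1 j f)"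
    using squareD(9)[OF j] by simp
  also have "\<dots> = H (sM j') f' \<cdot>\<^sub>K (H b0 f0 \<cdot>\<^sub>K p2 j f)"
    unfolding p_comm[OF squareD(2)[OF j] squareD(1)[OF f]] by (simp add: squareD(9)[OF f])
  finally have e: "H j' (tN f') \<cdot>\<^sub>K (H b1 f1 \<cdot>\<^sub>K p1 j f) = H (sM j') f' \<cdot>\<^sub>K (H b0 f0 \<cdot>\<^sub>K p2 j f)" .
  have h [simp]: "hmap j f j' f' b0 b1 f0 f1 \<in> ar K" "src K (hmap j f j' f' b0 b1 f0 f1) = PO j f"
    "tgt K (hmap j f j' f' b0 b1 f0 f1) = PO j' f'"
    and h4: "p1 j' f' \<cdot>\<^sub>K hmap j f j' f' b0 b1 f0 f1 = H b1 f1 \<cdot>\<^sub>K p1 j f"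
    and h5: "p2 j' f' \<cdot>\<^sub>K hmap j f j' f' b0 b1 f0 f1 = H b0 f0 \<cdot>\<^sub>K p2 j f"
    unfolding hmap_def using pair[of j' f' "H b1 f1 \<cdot>\<^sub>K p1 j f" "H b0 f0 \<cdot>\<^sub>K p2 j f"] e by simp_all
  show "hmap j f j' f' b0 b1 f0 f1 \<in> ar K" "src K (hmap j f j' f' b0 b1 f0 f1) = PO j f"
    "tgt K (hmap j f j' f' b0 b1 f0 f1) = PO j' f'"
    "p1 j' f' \<cdot>\<^sub>K hmap j f j' f' b0 b1 f0 f1 = H b1 f1 \<cdot>\<^sub>K p1 j f"
    "p2 j' f' \<cdot>\<^sub>K hmap j f j' f' b0 b1 f0 f1 = H b0 f0 \<cdot>\<^sub>K p2 j f" by (fact h h4 h5)+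
  have "hh j' f' \<cdot>\<^sub>K H b1 f0 = hmap j f j' f' b0 b1 f0 f1 \<cdot>\<^sub>K hh j f"
  proof (rule p_eqI[of j' f'])
    have "p1 j' f' \<cdot>\<^sub>K (hh j' f' \<cdot>\<^sub>K H b1 f0) = H b1 f1 \<cdot>\<^sub>K H (tM j) f"
      by (subst K.comp_reduce[OF hh(4)]) (simp_all add: squareD(9)[OF f])
    also have "\<dots> = H b1 f1 \<cdot>\<^sub>K (p1 j f \<cdot>\<^sub>K hh j f)" by (simp only: hh(4) squareD(2)[OF j] squareD(1)[OF f])
    also have "\<dots> = p1 j' f' \<cdot>\<^sub>K (hmap j f j' f' b0 b1 f0 f1 \<cdot>\<^sub>K hh j f)"
      by (rule K.comp_exchange[symmetric]) (simp_all add: h4)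
    finally show "p1 j' f' \<cdot>\<^sub>K (hh j' f' \<cdot>\<^sub>K H b1 f0) = \<dots>" .
    have "p2 j' f' \<cdot>\<^sub>K (hh j' f' \<cdot>\<^sub>K H b1 f0) = H b0 f0 \<cdot>\<^sub>K H j (sN f)"
      by (subst K.comp_reduce[OF hh(5)]) (simp_all add: squareD(9)[OF j])
    also have "\<dots> = H b0 f0 \<cdot>\<^sub>K (p2 j f \<cdot>\<^sub>K hh j f)" by (simp only: hh(5) squareD(2)[OF j] squareD(1)[OF f])
    also have "\<dots> = p2 j' f' \<cdot>\<^sub>K (hmap j f j' f' b0 b1 f0 f1 \<cdot>\<^sub>K hh j f)"
      by (rule K.comp_exchange[symmetric]) (simp_all add: h5)
    finally show "p2 j' f' \<cdot>\<^sub>K (hh j' f' \<cdot>\<^sub>K H b1 f0) = \<dots>" .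
  qed simp_all
  then show "square K (hh j f) (H b1 f0) (hmap j f j' f' b0 b1 f0 f1) (hh j' f')" by (simp add: square_def)
qed

text \<open>Moving a problem along squares \<open>j' \<Rightarrow> j\<close> and \<open>f \<Rightarrow> f'\<close> is composition with the induced square
between the pullback-homs, whose lower side is \<open>hmap\<close>.\<close>

lemma prob_post:
  assumes p: "prob i j f y b c" and j: "square M j' b0 b1 j" and f: "square N f f0 f1 f'"
  shows "prob i j' f' (f1 \<cdot>\<^sub>N (y \<cdot>\<^sub>N T (tK i) b1)) (f0 \<cdot>\<^sub>N (b \<cdot>\<^sub>N T (sK i) b1))
      (f0 \<cdot>\<^sub>N (c \<cdot>\<^sub>N T (tK i) b0))"
    "top i j' f' (f0 \<cdot>\<^sub>N (b \<cdot>\<^sub>N T (sK i) b1)) = H b1 f0 \<cdot>\<^sub>K top i j f b"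
    "bot i j' f' (f1 \<cdot>\<^sub>N (y \<cdot>\<^sub>N T (tK i) b1)) (f0 \<cdot>\<^sub>N (c \<cdot>\<^sub>N T (tK i) b0))
      = hmap j f j' f' b0 b1 f0 f1 \<cdot>\<^sub>K bot i j f y c"
proof -
  note [simp] = probD(1-12)[OF p] squareD(1-8)[OF j] squareD(1-8)[OF f] bot(1-3)[OF p] hmap(1-3)[OF j f]
  let ?k = "tK i" and ?k' = "sK i"
  have "f' \<cdot>\<^sub>N (f0 \<cdot>\<^sub>N (b \<cdot>\<^sub>N T ?k' b1)) = f1 \<cdot>\<^sub>N (f \<cdot>\<^sub>N (b \<cdot>\<^sub>N T ?k' b1))"
    by (rule N.comp_exchange) (simp_all add: squareD(9)[OF f])
  also have "f \<cdot>\<^sub>N (b \<cdot>\<^sub>N T ?k' b1) = y \<cdot>\<^sub>N (T i (tM j) \<cdot>\<^sub>N T ?k' b1)"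
    by (rule N.comp_exchange) (simp_all add: probD(13)[OF p])
  finally have e1: "f' \<cdot>\<^sub>N (f0 \<cdot>\<^sub>N (b \<cdot>\<^sub>N T ?k' b1)) = f1 \<cdot>\<^sub>N (y \<cdot>\<^sub>N T i b1)" by simp
  have "f' \<cdot>\<^sub>N (f0 \<cdot>\<^sub>N (c \<cdot>\<^sub>N T ?k b0)) = f1 \<cdot>\<^sub>N (f \<cdot>\<^sub>N (c \<cdot>\<^sub>N T ?k b0))"
    by (rule N.comp_exchange) (simp_all add: squareD(9)[OF f])
  also have "f \<cdot>\<^sub>N (c \<cdot>\<^sub>N T ?k b0) = y \<cdot>\<^sub>N (T ?k j \<cdot>\<^sub>N T ?k b0)"
    by (rule N.comp_exchange) (simp_all add: probD(14)[OF p])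
  finally have e2: "f' \<cdot>\<^sub>N (f0 \<cdot>\<^sub>N (c \<cdot>\<^sub>N T ?k b0)) = f1 \<cdot>\<^sub>N (y \<cdot>\<^sub>N T ?k (j \<cdot>\<^sub>M b0))" by simp
  have e3: "b \<cdot>\<^sub>N (T ?k' j \<cdot>\<^sub>N T ?k' b0) = c \<cdot>\<^sub>N (T i (sM j) \<cdot>\<^sub>N T ?k' b0)"
    by (rule N.comp_exchange) (simp_all add: probD(15)[OF p])
  show pr: "prob i j' f' (f1 \<cdot>\<^sub>N (y \<cdot>\<^sub>N T ?k b1)) (f0 \<cdot>\<^sub>N (b \<cdot>\<^sub>N T ?k' b1)) (f0 \<cdot>\<^sub>N (c \<cdot>\<^sub>N T ?k b0))"
    using e1 e2 e3 squareD(9)[OF j] by (simp add: prob_def)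
  show "top i j' f' (f0 \<cdot>\<^sub>N (b \<cdot>\<^sub>N T ?k' b1)) = H b1 f0 \<cdot>\<^sub>K top i j f b"
    unfolding top_def by (subst tr_postcomp) (simp_all add: tr_prebm)
  show "bot i j' f' (f1 \<cdot>\<^sub>N (y \<cdot>\<^sub>N T ?k b1)) (f0 \<cdot>\<^sub>N (c \<cdot>\<^sub>N T ?k b0)) = hmap j f j' f' b0 b1 f0 f1 \<cdot>\<^sub>K bot i j f y c"
  proof (rule botI[OF pr])
    have "p1 j' f' \<cdot>\<^sub>K (hmap j f j' f' b0 b1 f0 f1 \<cdot>\<^sub>K bot i j f y c) = H b1 f1 \<cdot>\<^sub>K (p1 j f \<cdot>\<^sub>K bot i j f y c)"
      by (rule K.comp_exchange) (simp_all add: hmap[OF j f])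
    then show "p1 j' f' \<cdot>\<^sub>K (hmap j f j' f' b0 b1 f0 f1 \<cdot>\<^sub>K bot i j f y c)
        = tr (tgt K i) (tgt M j') (tgt N f') (f1 \<cdot>\<^sub>N (y \<cdot>\<^sub>N T ?k b1))"
      by (subst tr_postcomp) (simp_all add: bot[OF p] tr_prebm)
    have "p2 j' f' \<cdot>\<^sub>K (hmap j f j' f' b0 b1 f0 f1 \<cdot>\<^sub>K bot i j f y c) = H b0 f0 \<cdot>\<^sub>K (p2 j f \<cdot>\<^sub>K bot i j f y c)"
      by (rule K.comp_exchange) (simp_all add: hmap[OF j f])
    then show "p2 j' f' \<cdot>\<^sub>K (hmap j f j' f' b0 b1 f0 f1 \<cdot>\<^sub>K bot i j f y c)
        = tr (tgt K i) (src M j') (src N f') (f0 \<cdot>\<^sub>N (c \<cdot>\<^sub>N T ?k b0))"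
      by (subst tr_postcomp) (simp_all add: bot[OF p] tr_prebm)
  qed simp_all
qed

end

section \<open>Solutions from an algebra structure on the pullback-hom\<close>

locale tva_awfs1 = tva + KW: awfs_laws K Q Qm L R D U for Q Qm L R D U
begin

text \<open>The canonical solution of a problem, where \<open>i\<close> is a coalgebra with structure \<open>s\<close> and the
pullback-hom of \<open>j\<close> and \<open>f\<close> is an algebra with structure \<open>\<theta>\<close>, transposed back to the tensor.\<close>

definition op where
  "op \<theta> i s j f y b c = untr (tgt K i) (tgt M j) (src N f)
     (\<theta> \<cdot>\<^sub>K (Qm i (top i j f b) (bot i j f y c) (hh j f) \<cdot>\<^sub>K s))"

lemma op_hom:
  assumes "KW.coalg i s" "KW.alg (hh j f) \<theta>" "prob i j f y b c"
  shows "op \<theta> i s j f y b c \<in> ar N" "src N (op \<theta> i s j f y b c) = TO (tgt K i) (tgt M j)"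
    "tgt N (op \<theta> i s j f y b c) = src N f"
    "tr (tgt K i) (tgt M j) (src N f) (op \<theta> i s j f y b c)
      = \<theta> \<cdot>\<^sub>K (Qm i (top i j f b) (bot i j f y c) (hh j f) \<cdot>\<^sub>K s)"
  using KW.lift_square[OF assms(1,2) prob_square[OF assms(3)]] probD(1-12)[OF assms(3)]
  by (simp_all add: op_def del: K.comp_simps)

lemma op_sol:
  assumes "KW.coalg i s" "KW.alg (hh j f) \<theta>" "prob i j f y b c"
  shows "sol i j f y b c (op \<theta> i s j f y b c)"
  using KW.lift_square[OF assms(1,2) prob_square[OF assms(3)]]
  by (simp add: sol_iff[OF assms(3)] op_hom[OF assms])

lemma op_cong:
  assumes "KW.coalg i s" "KW.alg (hh j f) \<theta>" "prob i j f y b c" "d \<in> ar N" "src N d = TO (tgt K i) (tgt M j)"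
    "tgt N d = src N f"
    "tr (tgt K i) (tgt M j) (src N f) d = \<theta> \<cdot>\<^sub>K (Qm i (top i j f b) (bot i j f y c) (hh j f) \<cdot>\<^sub>K s)"
  shows "op \<theta> i s j f y b c = d"
  by (rule tr_inj[of "tgt K i" "tgt M j" "src N f"]) (use assms op_hom[OF assms(1-3)] probD(1-12)[OF
      assms(3)] in simp_all)

lemma op_pre:
  assumes m: "KW.coalg_map i s a a' i' s'" and \<theta>: "KW.alg (hh j f) \<theta>" and p: "prob i' j f y b c"
  shows "op \<theta> i s j f (y \<cdot>\<^sub>N T a' (tM j)) (b \<cdot>\<^sub>N T a (tM j)) (c \<cdot>\<^sub>N T a' (sM j))
    = op \<theta> i' s' j f y b c \<cdot>\<^sub>N T a' (tM j)"
proof -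
  have q: "square K i a a' i'" and c: "KW.coalg i s" "KW.coalg i' s'" and e: "s' \<cdot>\<^sub>K a' = Qm i a a' i' \<cdot>\<^sub>K s"
    using m by (auto simp: KW.coalg_map_def)
  note [simp] = squareD(1-8)[OF q] probD(1-12)[OF p] op_hom(1-3)[OF c(2) \<theta> p] KW.coalgD(1-4)[OF c(1)]
    KW.coalgD(1-4)[OF c(2)] KW.algD(1-4)[OF \<theta>] prob_square[OF p] q
  show ?thesis
    by (rule op_cong[OF c(1) \<theta> prob_pre(1)[OF p q]])
      (simp_all add: tr_precomp op_hom(4)[OF c(2) \<theta> p] prob_pre(2,3)[OF p q] e KW.Qm_comp')
qed

lemma op_post:
  assumes c: "KW.coalg i s" and j: "square M j' b0 b1 j" and f: "square N f f0 f1 f'"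
    and m: "KW.alg_map (hh j f) \<theta> (H b1 f0) (hmap j f j' f' b0 b1 f0 f1) (hh j' f') \<theta>'"
    and p: "prob i j f y b c"
  shows "op \<theta>' i s j' f' (f1 \<cdot>\<^sub>N (y \<cdot>\<^sub>N T (tK i) b1)) (f0 \<cdot>\<^sub>N (b \<cdot>\<^sub>N T (sK i) b1))
      (f0 \<cdot>\<^sub>N (c \<cdot>\<^sub>N T (tK i) b0))
    = f0 \<cdot>\<^sub>N (op \<theta> i s j f y b c \<cdot>\<^sub>N T (tK i) b1)"
proof -
  have q: "square K (hh j f) (H b1 f0) (hmap j f j' f' b0 b1 f0 f1) (hh j' f')" and \<theta>: "KW.alg (hh j f) \<theta>"
    "KW.alg (hh j' f') \<theta>'" and e: "H b1 f0 \<cdot>\<^sub>K \<theta> = \<theta>' \<cdot>\<^sub>K Qm (hh j f) (H b1 f0) (hmap j f j' f' b0 b1 f0 f1)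
        (hh j' f')"
    using m by (auto simp: KW.alg_map_def)
  note [simp] = squareD(1-8)[OF j] squareD(1-8)[OF f] probD(1-12)[OF p] op_hom(1-3)[OF c \<theta>(1) p] KW.coalgD(1-4)[OF c]
    KW.algD(1-4)[OF \<theta>(1)] KW.algD(1-4)[OF \<theta>(2)] prob_square[OF p] q
  have "H b1 f0 \<cdot>\<^sub>K (\<theta> \<cdot>\<^sub>K (Qm i (top i j f b) (bot i j f y c) (hh j f) \<cdot>\<^sub>K s))
    = \<theta>' \<cdot>\<^sub>K (Qm (hh j f) (H b1 f0) (hmap j f j' f' b0 b1 f0 f1) (hh j' f')
        \<cdot>\<^sub>K (Qm i (top i j f b) (bot i j f y c) (hh j f) \<cdot>\<^sub>K s))"
    by (rule K.comp_exchange) (use e in simp_all)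
  then show ?thesis
    by (intro op_cong[OF c \<theta>(2) prob_post(1)[OF p j f]])
      (simp_all add: tr_postcomp[of f0] tr_prebm[of b1] op_hom(4)[OF c \<theta>(1) p] prob_post(2,3)[OF p j f] KW.Qm_comp')
qed

text \<open>The pullback-hom of \<open>j\<close> and \<open>g \<cdot> f\<close> is the one of \<open>j\<close> and \<open>f\<close> followed by a pullback of the one of
\<open>j\<close> and \<open>g\<close>.  The resulting composite structure solves problems against \<open>g \<cdot> f\<close> by first solving
against \<open>g\<close> and then against \<open>f\<close>.\<close>

lemma op_composite_f:
  assumes j: "j \<in> ar M" and f: "f \<in> ar N" and g: "g \<in> ar N" and fg: "tgt N f = src N g"
    and \<theta>f: "KW.alg (hh j f) \<theta>f" and \<theta>g: "KW.alg (hh j g) \<theta>g"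
  shows "\<exists>\<theta>. KW.alg (hh j (g \<cdot>\<^sub>N f)) \<theta> \<and> (\<forall>i s y b c. KW.coalg i s \<longrightarrow> prob i j (g \<cdot>\<^sub>N f) y b c \<longrightarrow>
     prob i j g y (f \<cdot>\<^sub>N b) (f \<cdot>\<^sub>N c) \<and> prob i j f (op \<theta>g i s j g y (f \<cdot>\<^sub>N b) (f \<cdot>\<^sub>N c)) b c \<and>
     op \<theta> i s j (g \<cdot>\<^sub>N f) y b c = op \<theta>f i s j f (op \<theta>g i s j g y (f \<cdot>\<^sub>N b) (f \<cdot>\<^sub>N c)) b c)"
proof -
  note [simp] = j f g fg
  let ?gf = "g \<cdot>\<^sub>N f" and ?e = "tM j" and ?e' = "sM j"
  have sj: "square M j ?e' ?e j" by (simp add: square_def)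
  have s1: "square N ?gf f (tN g) g" and s2: "square N f (sN f) g ?gf" by (simp_all add: square_def)
  let ?p = "hmap j ?gf j g ?e' ?e f (tN g)" and ?w = "hmap j f j ?gf ?e' ?e (sN f) g"
  note P = hmap[OF sj s1] and W = hmap[OF sj s2]
  note [simp] = P(1-3) W(1-3)
  have W4: "p1 j ?gf \<cdot>\<^sub>K ?w = H ?e g \<cdot>\<^sub>K p1 j f" and W5: "p2 j ?gf \<cdot>\<^sub>K ?w = p2 j f" using W(4,5) by simp_all
  have P4: "p1 j g \<cdot>\<^sub>K ?p = p1 j ?gf" and P5: "p2 j g \<cdot>\<^sub>K ?p = H ?e' f \<cdot>\<^sub>K p2 j ?gf" using P(4,5) by simp_all
  have w4: "p1 j ?gf \<cdot>\<^sub>K (?w \<cdot>\<^sub>K m) = H ?e g \<cdot>\<^sub>K (p1 j f \<cdot>\<^sub>K m)"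
    and w5: "p2 j ?gf \<cdot>\<^sub>K (?w \<cdot>\<^sub>K m) = p2 j f \<cdot>\<^sub>K m" if "m \<in> ar K" "tgt K m = PO j f" for m
    using that K.comp_exchange[OF W4, of m] K.comp_reduce[OF W5, of m] by simp_all
  have w4': "p1 j g \<cdot>\<^sub>K (?p \<cdot>\<^sub>K m) = p1 j ?gf \<cdot>\<^sub>K m"
    and w5': "p2 j g \<cdot>\<^sub>K (?p \<cdot>\<^sub>K m) = H ?e' f \<cdot>\<^sub>K (p2 j ?gf \<cdot>\<^sub>K m)" if "m \<in> ar K" "tgt K m = PO j ?gf" for m
    using that K.comp_reduce[OF P4, of m] K.comp_exchange[OF P5, of m] by simp_all
  have g4: "p1 j g \<cdot>\<^sub>K (hh j g \<cdot>\<^sub>K m) = H ?e g \<cdot>\<^sub>K m"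
    and g5: "p2 j g \<cdot>\<^sub>K (hh j g \<cdot>\<^sub>K m) = H j (sN g) \<cdot>\<^sub>K m" if "m \<in> ar K" "tgt K m = HO (tgt M j) (src N g)" for m
    using that K.comp_reduce[OF hh(4), of j g m] K.comp_reduce[OF hh(5), of j g m] by simp_all
  have "\<exists>\<theta>. KW.alg (hh j ?gf) \<theta> \<and> (\<forall>i s u v m. KW.coalg i s \<longrightarrow> square K i u v (hh j ?gf) \<longrightarrow>
      m \<in> hom K (tgt K i) (tgt K (hh j f)) \<longrightarrow> ?w \<cdot>\<^sub>K m = v \<longrightarrow>
      p1 j f \<cdot>\<^sub>K m = \<theta>g \<cdot>\<^sub>K (Qm i (H ?e f \<cdot>\<^sub>K u) (?p \<cdot>\<^sub>K v) (hh j g) \<cdot>\<^sub>K s) \<longrightarrow>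
      \<theta> \<cdot>\<^sub>K (Qm i u v (hh j ?gf) \<cdot>\<^sub>K s) = \<theta>f \<cdot>\<^sub>K (Qm i u m (hh j f) \<cdot>\<^sub>K s))"
  proof (rule KW.pullback_composite_alg[OF \<theta>f \<theta>g P(6)])
    show "?w \<cdot>\<^sub>K hh j f = hh j ?gf" using squareD(9)[OF W(6)] by simp
    show "p1 j f \<cdot>\<^sub>K hh j f = H ?e f" by (simp add: hh)
  next
    fix x y assume "x \<in> ar K" "y \<in> ar K" "src K x = src K y" "tgt K x = tgt K (hh j ?gf)" "tgt K y = src K (hh j g)"
      and e: "?p \<cdot>\<^sub>K x = hh j g \<cdot>\<^sub>K y"
    then have [simp]: "x \<in> ar K" "y \<in> ar K" "src K x = src K y" "tgt K x = PO j ?gf" "tgt K y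
        = HO (tgt M j) (src N g)" by simp_all
    have e1: "p1 j ?gf \<cdot>\<^sub>K x = H ?e g \<cdot>\<^sub>K y" using arg_cong[OF e, of "\<lambda>z. p1 j g \<cdot>\<^sub>K z"] by (simp add: w4' g4)
    have e2: "H ?e' f \<cdot>\<^sub>K (p2 j ?gf \<cdot>\<^sub>K x) = H j (sN g) \<cdot>\<^sub>K y" using arg_cong[OF e, of "\<lambda>z. p2 j g \<cdot>\<^sub>K z"]
        by (simp add: w5' g5)
    let ?m = "pair j f y (p2 j ?gf \<cdot>\<^sub>K x)"
    have m: "?m \<in> ar K" "src K ?m = src K y" "tgt K ?m = PO j f" "p1 j f \<cdot>\<^sub>K ?m = y" "p2 j f \<cdot>\<^sub>K ?m = p2 j ?gf \<cdot>\<^sub>K x"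
      using pair[of j f y "p2 j ?gf \<cdot>\<^sub>K x"] e2 by simp_all
    have "?w \<cdot>\<^sub>K ?m = x" by (rule p_eqI[of j ?gf]) (simp_all add: m w4 w5 e1)
    then show "\<exists>m. m \<in> hom K (src K x) (tgt K (hh j f)) \<and> ?w \<cdot>\<^sub>K m = x \<and> p1 j f \<cdot>\<^sub>K m = y"
      using m by (intro exI[of _ ?m]) simp
  next
    fix m m' assume a: "m \<in> ar K" "m' \<in> ar K" "src K m = src K m'" "tgt K m = tgt K (hh j f)" "tgt K m'
        = tgt K (hh j f)"
      and e: "?w \<cdot>\<^sub>K m = ?w \<cdot>\<^sub>K m'" "p1 j f \<cdot>\<^sub>K m = p1 j f \<cdot>\<^sub>K m'"
    have "p2 j f \<cdot>\<^sub>K m = p2 j f \<cdot>\<^sub>K m'" using arg_cong[OF e(1), of "\<lambda>z. p2 j ?gf \<cdot>\<^sub>K z"] a by (simp add: w5)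
    then show "m = m'" using p_eqI[of j f m m'] a e by simp
  qed (simp_all)
  then obtain \<theta> where \<theta>: "KW.alg (hh j ?gf) \<theta>" and key: "\<And>i s u v m. \<lbrakk>KW.coalg i s; square K i u v (hh j ?gf);
      m \<in> hom K (tgt K i) (PO j f); ?w \<cdot>\<^sub>K m = v;
      p1 j f \<cdot>\<^sub>K m = \<theta>g \<cdot>\<^sub>K (Qm i (H ?e f \<cdot>\<^sub>K u) (?p \<cdot>\<^sub>K v) (hh j g) \<cdot>\<^sub>K s)\<rbrakk> \<Longrightarrow>
      \<theta> \<cdot>\<^sub>K (Qm i u v (hh j ?gf) \<cdot>\<^sub>K s) = \<theta>f \<cdot>\<^sub>K (Qm i u m (hh j f) \<cdot>\<^sub>K s)"
    by (simp del: hom_iff) blast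
  have "prob i j g y (f \<cdot>\<^sub>N b) (f \<cdot>\<^sub>N c) \<and> prob i j f (op \<theta>g i s j g y (f \<cdot>\<^sub>N b) (f \<cdot>\<^sub>N c)) b c \<and>
     op \<theta> i s j ?gf y b c = op \<theta>f i s j f (op \<theta>g i s j g y (f \<cdot>\<^sub>N b) (f \<cdot>\<^sub>N c)) b c"
    if i: "KW.coalg i s" and p: "prob i j ?gf y b c" for i s y b c
  proof -
    have [simp]: "i \<in> ar K" "y \<in> ar N" "src N y = TO (tgt K i) (tgt M j)" "tgt N y = tgt N g"
     "b \<in> ar N" "src N b = TO (src K i) (tgt M j)" "tgt N b = src N f"
     "c \<in> ar N" "src N c = TO (tgt K i) (src M j)" "tgt N c = src N f"
      using probD(1-12)[OF p] by simp_all
    have pg: "prob i j g y (f \<cdot>\<^sub>N b) (f \<cdot>\<^sub>N c)" and tg: "top i j g (f \<cdot>\<^sub>N b) = H ?e f \<cdot>\<^sub>K top i j ?gf b"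
      and bg: "bot i j g y (f \<cdot>\<^sub>N c) = ?p \<cdot>\<^sub>K bot i j ?gf y c"
      using prob_post[OF p sj s1] by simp_all
    let ?d = "op \<theta>g i s j g y (f \<cdot>\<^sub>N b) (f \<cdot>\<^sub>N c)"
    note D = solD[OF op_sol[OF i \<theta>g pg]] and D4 = op_hom(4)[OF i \<theta>g pg]
    note [simp] = D(1-3)
    have pf: "prob i j f ?d b c" using D probD(15)[OF p] by (simp add: prob_def)
    note [simp] = bot(1-3)[OF pf]
    have tf: "top i j f b = top i j ?gf b" by (simp add: top_def)
    have bw: "?w \<cdot>\<^sub>K bot i j f ?d c = bot i j ?gf y c"
      by (rule botI[OF p, symmetric]) (simp_all add: w4 w5 bot(4,5)[OF pf] D(4) tr_postcomp[of g, symmetric])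
    have "op \<theta> i s j ?gf y b c = op \<theta>f i s j f ?d b c"
    proof (rule op_cong[OF i \<theta> p])
      show "tr (tgt K i) (tgt M j) (src N ?gf) (op \<theta>f i s j f ?d b c)
        = \<theta> \<cdot>\<^sub>K (Qm i (top i j ?gf b) (bot i j ?gf y c) (hh j ?gf) \<cdot>\<^sub>K s)"
        using key[OF i prob_square[OF p], of "bot i j f ?d c"] op_hom(4)[OF i \<theta>f pf]
        by (simp add: bw tf bot(4)[OF pf] D4[simplified tg bg])
    qed (use op_hom(1-3)[OF i \<theta>f pf] in simp_all)
    then show ?thesis using pg pf by simp
  qed
  then show ?thesis using \<theta> by blast
qed

text \<open>Since the pullback-hom is contravariant in its first argument, composites \<open>j' \<cdot> j\<close> are treated like
composites in \<open>f\<close>: a problem is first solved on \<open>j\<close> and then on \<open>j'\<close>.  Here the pullback is formed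
along the second projection instead of the first.\<close>

lemma op_composite_j:
  assumes j: "j \<in> ar M" and j': "j' \<in> ar M" and f: "f \<in> ar N" and jj: "tgt M j = src M j'"
    and \<theta>1: "KW.alg (hh j f) \<theta>1" and \<theta>2: "KW.alg (hh j' f) \<theta>2"
  shows "\<exists>\<theta>. KW.alg (hh (j' \<cdot>\<^sub>M j) f) \<theta> \<and> (\<forall>i s y b c. KW.coalg i s \<longrightarrow> prob i (j' \<cdot>\<^sub>M j) f y b c \<longrightarrow>
     prob i j f (y \<cdot>\<^sub>N T (tK i) j') (b \<cdot>\<^sub>N T (sK i) j') c \<and>
     prob i j' f y b (op \<theta>1 i s j f (y \<cdot>\<^sub>N T (tK i) j') (b \<cdot>\<^sub>N T (sK i) j') c) \<and>
     op \<theta> i s (j' \<cdot>\<^sub>M j) f y b c =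
      op \<theta>2 i s j' f y b (op \<theta>1 i s j f (y \<cdot>\<^sub>N T (tK i) j') (b \<cdot>\<^sub>N T (sK i) j') c))"
proof -
  note [simp] = j f j' jj
  let ?jj = "j' \<cdot>\<^sub>M j" and ?e = "tN f" and ?e' = "sN f"
  have sf: "square N f ?e' ?e f" by (simp add: square_def)
  have s1: "square M j (sM j) j' ?jj" and s2: "square M ?jj j (tM j') j'" by (simp_all add: square_def)
  let ?p = "hmap ?jj f j f (sM j) j' ?e' ?e" and ?w = "hmap j' f ?jj f j (tM j') ?e' ?e"
  note P = hmap[OF s1 sf] and W = hmap[OF s2 sf]
  note [simp] = P(1-3) W(1-3)
  have W4: "p1 ?jj f \<cdot>\<^sub>K ?w = p1 j' f" and W5: "p2 ?jj f \<cdot>\<^sub>K ?w = H j ?e' \<cdot>\<^sub>K p2 j' f" using W(4,5) by simp_all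
  have P4: "p1 j f \<cdot>\<^sub>K ?p = H j' ?e \<cdot>\<^sub>K p1 ?jj f" and P5: "p2 j f \<cdot>\<^sub>K ?p = p2 ?jj f" using P(4,5) by simp_all
  have w4: "p1 ?jj f \<cdot>\<^sub>K (?w \<cdot>\<^sub>K m) = p1 j' f \<cdot>\<^sub>K m"
    and w5: "p2 ?jj f \<cdot>\<^sub>K (?w \<cdot>\<^sub>K m) = H j ?e' \<cdot>\<^sub>K (p2 j' f \<cdot>\<^sub>K m)" if "m \<in> ar K" "tgt K m = PO j' f" for m
    using that K.comp_reduce[OF W4, of m] K.comp_exchange[OF W5, of m] by simp_all
  have w4': "p1 j f \<cdot>\<^sub>K (?p \<cdot>\<^sub>K m) = H j' ?e \<cdot>\<^sub>K (p1 ?jj f \<cdot>\<^sub>K m)"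
    and w5': "p2 j f \<cdot>\<^sub>K (?p \<cdot>\<^sub>K m) = p2 ?jj f \<cdot>\<^sub>K m" if "m \<in> ar K" "tgt K m = PO ?jj f" for m
    using that K.comp_exchange[OF P4, of m] K.comp_reduce[OF P5, of m] by simp_all
  have g4: "p1 j f \<cdot>\<^sub>K (hh j f \<cdot>\<^sub>K m) = H (tM j) f \<cdot>\<^sub>K m"
    and g5: "p2 j f \<cdot>\<^sub>K (hh j f \<cdot>\<^sub>K m) = H j ?e' \<cdot>\<^sub>K m" if "m \<in> ar K" "tgt K m = HO (tgt M j) (src N f)" for m
    using that K.comp_reduce[OF hh(4), of j f m] K.comp_reduce[OF hh(5), of j f m] by simp_all
  have "\<exists>\<theta>. KW.alg (hh ?jj f) \<theta> \<and> (\<forall>i s u v m. KW.coalg i s \<longrightarrow> square K i u v (hh ?jj f) \<longrightarrow>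
      m \<in> hom K (tgt K i) (tgt K (hh j' f)) \<longrightarrow> ?w \<cdot>\<^sub>K m = v \<longrightarrow>
      p2 j' f \<cdot>\<^sub>K m = \<theta>1 \<cdot>\<^sub>K (Qm i (H j' ?e' \<cdot>\<^sub>K u) (?p \<cdot>\<^sub>K v) (hh j f) \<cdot>\<^sub>K s) \<longrightarrow>
      \<theta> \<cdot>\<^sub>K (Qm i u v (hh ?jj f) \<cdot>\<^sub>K s) = \<theta>2 \<cdot>\<^sub>K (Qm i u m (hh j' f) \<cdot>\<^sub>K s))"
  proof (rule KW.pullback_composite_alg[OF \<theta>2 \<theta>1 P(6)])
    show "?w \<cdot>\<^sub>K hh j' f = hh ?jj f" using squareD(9)[OF W(6)] by simp
    show "p2 j' f \<cdot>\<^sub>K hh j' f = H j' ?e'" by (simp add: hh)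
  next
    fix x y assume "x \<in> ar K" "y \<in> ar K" "src K x = src K y" "tgt K x = tgt K (hh ?jj f)" "tgt K y = src K (hh j f)"
      and e: "?p \<cdot>\<^sub>K x = hh j f \<cdot>\<^sub>K y"
    then have [simp]: "x \<in> ar K" "y \<in> ar K" "src K x = src K y" "tgt K x = PO ?jj f" "tgt K y
        = HO (src M j') (src N f)" by simp_all
    have e1: "H j' ?e \<cdot>\<^sub>K (p1 ?jj f \<cdot>\<^sub>K x) = H (sM j') f \<cdot>\<^sub>K y" using arg_cong[OF e, of "\<lambda>z. p1 j f \<cdot>\<^sub>K z"]
        by (simp add: w4' g4)
    have e2: "p2 ?jj f \<cdot>\<^sub>K x = H j ?e' \<cdot>\<^sub>K y" using arg_cong[OF e, of "\<lambda>z. p2 j f \<cdot>\<^sub>K z"] by (simp add: w5' g5)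
    let ?m = "pair j' f (p1 ?jj f \<cdot>\<^sub>K x) y"
    have m: "?m \<in> ar K" "src K ?m = src K y" "tgt K ?m = PO j' f" "p1 j' f \<cdot>\<^sub>K ?m
        = p1 ?jj f \<cdot>\<^sub>K x" "p2 j' f \<cdot>\<^sub>K ?m = y"
      using pair[of j' f "p1 ?jj f \<cdot>\<^sub>K x" y] e1 by simp_all
    have "?w \<cdot>\<^sub>K ?m = x" by (rule p_eqI[of ?jj f]) (simp_all add: m w4 w5 e2)
    then show "\<exists>m. m \<in> hom K (src K x) (tgt K (hh j' f)) \<and> ?w \<cdot>\<^sub>K m = x \<and> p2 j' f \<cdot>\<^sub>K m = y"
      using m by (intro exI[of _ ?m]) simp
  next
    fix m m' assume a: "m \<in> ar K" "m' \<in> ar K" "src K m = src K m'" "tgt K m = tgt K (hh j' f)" "tgt K m'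
        = tgt K (hh j' f)"
      and e: "?w \<cdot>\<^sub>K m = ?w \<cdot>\<^sub>K m'" "p2 j' f \<cdot>\<^sub>K m = p2 j' f \<cdot>\<^sub>K m'"
    have "p1 j' f \<cdot>\<^sub>K m = p1 j' f \<cdot>\<^sub>K m'" using arg_cong[OF e(1), of "\<lambda>z. p1 ?jj f \<cdot>\<^sub>K z"] a by (simp add: w4)
    then show "m = m'" using p_eqI[of j' f m m'] a e by simp
  qed (simp_all)
  then obtain \<theta> where \<theta>: "KW.alg (hh ?jj f) \<theta>" and key: "\<And>i s u v m. \<lbrakk>KW.coalg i s; square K i u v (hh ?jj f);
      m \<in> hom K (tgt K i) (PO j' f); ?w \<cdot>\<^sub>K m = v;
      p2 j' f \<cdot>\<^sub>K m = \<theta>1 \<cdot>\<^sub>K (Qm i (H j' ?e' \<cdot>\<^sub>K u) (?p \<cdot>\<^sub>K v) (hh j f) \<cdot>\<^sub>K s)\<rbrakk> \<Longrightarrow>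
      \<theta> \<cdot>\<^sub>K (Qm i u v (hh ?jj f) \<cdot>\<^sub>K s) = \<theta>2 \<cdot>\<^sub>K (Qm i u m (hh j' f) \<cdot>\<^sub>K s)"
    by (simp del: hom_iff) blast
  have "prob i j f (y \<cdot>\<^sub>N T (tK i) j') (b \<cdot>\<^sub>N T (sK i) j') c \<and>
     prob i j' f y b (op \<theta>1 i s j f (y \<cdot>\<^sub>N T (tK i) j') (b \<cdot>\<^sub>N T (sK i) j') c) \<and>
     op \<theta> i s ?jj f y b c =
      op \<theta>2 i s j' f y b (op \<theta>1 i s j f (y \<cdot>\<^sub>N T (tK i) j') (b \<cdot>\<^sub>N T (sK i) j') c)"
    if i: "KW.coalg i s" and p: "prob i ?jj f y b c" for i s y b c
  proof -
    have [simp]: "i \<in> ar K" "y \<in> ar N" "src N y = TO (tgt K i) (tgt M j')" "tgt N y = tgt N f"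
     "b \<in> ar N" "src N b = TO (src K i) (tgt M j')" "tgt N b = src N f"
     "c \<in> ar N" "src N c = TO (tgt K i) (src M j)" "tgt N c = src N f"
      using probD(1-12)[OF p] by simp_all
    let ?y = "y \<cdot>\<^sub>N T (tK i) j'" and ?b = "b \<cdot>\<^sub>N T (sK i) j'"
    have pg: "prob i j f ?y ?b c" and tg: "top i j f ?b = H j' ?e' \<cdot>\<^sub>K top i ?jj f b"
      and bg: "bot i j f ?y c = ?p \<cdot>\<^sub>K bot i ?jj f y c"
      using prob_post[OF p s1 sf] by simp_all
    let ?d = "op \<theta>1 i s j f ?y ?b c"
    note D = solD[OF op_sol[OF i \<theta>1 pg]] and D4 = op_hom(4)[OF i \<theta>1 pg]
    note [simp] = D(1-3)
    have pf: "prob i j' f y b ?d" using D probD(13)[OF p] by (simp add: prob_def)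
    note [simp] = bot(1-3)[OF pf]
    have tf: "top i j' f b = top i ?jj f b" by (simp add: top_def)
    have bw: "?w \<cdot>\<^sub>K bot i j' f y ?d = bot i ?jj f y c"
      using D(6) tr_prebm[of j "tgt K i" ?d "src N f" "src M j"]
      by (intro botI[OF p, symmetric]) (simp_all add: w4 w5 bot(4,5)[OF pf])
    have "op \<theta> i s ?jj f y b c = op \<theta>2 i s j' f y b ?d"
    proof (rule op_cong[OF i \<theta> p])
      show "tr (tgt K i) (tgt M ?jj) (src N f) (op \<theta>2 i s j' f y b ?d)
        = \<theta> \<cdot>\<^sub>K (Qm i (top i ?jj f b) (bot i ?jj f y c) (hh ?jj f) \<cdot>\<^sub>K s)"
      proof -
        have "p2 j' f \<cdot>\<^sub>K bot i j' f y ?d = \<theta>1 \<cdot>\<^sub>K (Qm i (H j' ?e' \<cdot>\<^sub>K top i ?jj f b) (?p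
            \<cdot>\<^sub>K bot i ?jj f y c) (hh j f) \<cdot>\<^sub>K s)"
          unfolding bot(5)[OF pf] D4[unfolded tg bg jj] ..
        then show ?thesis
          using key[OF i prob_square[OF p] _ bw] op_hom(4)[OF i \<theta>2 pf] by (simp add: tf)
      qed
    qed (use op_hom(1-3)[OF i \<theta>2 pf] in simp_all)
    then show ?thesis using pg pf by simp
  qed
  then show ?thesis using \<theta> by blast
qed

end


section \<open>Lifting operations and their extension from generators\<close>

context awfs_laws
begin
definition Coalgs where "Coalgs = {(j, s). coalg j s}"
definition CoalgMaps where "CoalgMaps = {((j, s), a, a', (j', s')) | j s a a' j' s'. coalg_map j s a a' j' s'}"
definition CoalgComps where
  "CoalgComps = {((j, s), (j', s'), (j' \<cdot> j, c)) | j s j' s' c. composite_coalg j s j' s' c}"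
end

locale tva_target = tva K M N A + NW: awfs N V
  for K :: "('ko, 'ka) cat" and M :: "('mo, 'ma) cat" and N :: "('no, 'na) cat" and A V
begin

abbreviation "QN \<equiv> fob (mid V)"
abbreviation "EN h u v k \<equiv> far (mid V) (Sq h u v k)"

text \<open>\<open>X\<close> indexes the arrows \<open>u x\<close> of \<open>K\<close>, with \<open>MX\<close> a set of squares between them and \<open>CX\<close> a set of
composites \<open>(x, x', k)\<close>, and likewise \<open>Z\<close>, \<open>w\<close> in \<open>M\<close>; in \<open>N\<close> the indexing is always by algebras.
The clauses say that \<open>S\<close> solves problems, that it is natural in the three variables, and that it
solves problems at composites in two stages.  Leaving the index sets open allows one
notion for generators (without composites) and for coalgebras.\<close>

definition lifting_op ::
  "'x set \<Rightarrow> ('x \<times> 'ka \<times> 'ka \<times> 'x) set \<Rightarrow> ('x \<Rightarrow> 'ka) \<Rightarrow> ('x \<times> 'x \<times> 'x) set \<Rightarrow>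
   'z set \<Rightarrow> ('z \<times> 'ma \<times> 'ma \<times> 'z) set \<Rightarrow> ('z \<Rightarrow> 'ma) \<Rightarrow> ('z \<times> 'z \<times> 'z) set \<Rightarrow>
   ('x \<Rightarrow> 'z \<Rightarrow> 'na \<Rightarrow> 'na \<Rightarrow> 'na \<Rightarrow> 'na \<Rightarrow> 'na \<Rightarrow> 'na) \<Rightarrow> bool" where
  "lifting_op X MX u CX Z MZ w CZ S \<longleftrightarrow>
    (\<forall>x\<in>X. \<forall>z\<in>Z. \<forall>f r y b c. NW.alg f r \<longrightarrow> prob (u x) (w z) f y b c \<longrightarrow>
      sol (u x) (w z) f y b c (S x z f r y b c)) \<and>
    (\<forall>x a a' x' z f r y b c. (x, a, a', x') \<in> MX \<longrightarrow> z \<in> Z \<longrightarrow> NW.alg f r \<longrightarrow> prob (u x') (w z) f y b c \<longrightarrow>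
      S x z f r (y \<cdot>\<^sub>N T a' (tM (w z))) (b \<cdot>\<^sub>N T a (tM (w z))) (c \<cdot>\<^sub>N T a' (sM (w z)))
        = S x' z f r y b c \<cdot>\<^sub>N T a' (tM (w z))) \<and>
    (\<forall>z a a' z' x f r y b c. (z, a, a', z') \<in> MZ \<longrightarrow> x \<in> X \<longrightarrow> NW.alg f r \<longrightarrow> prob (u x) (w z') f y b c \<longrightarrow>
      S x z f r (y \<cdot>\<^sub>N T (tK (u x)) a') (b \<cdot>\<^sub>N T (sK (u x)) a') (c \<cdot>\<^sub>N T (tK (u x)) a)
        = S x z' f r y b c \<cdot>\<^sub>N T (tK (u x)) a') \<and>
    (\<forall>f r a a' f' r' x z y b c. NW.alg_map f r a a' f' r' \<longrightarrow> x \<in> X \<longrightarrow> z \<in> Z \<longrightarrow> prob (u x) (w z) f y b c \<longrightarrow>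
      S x z f' r' (a' \<cdot>\<^sub>N y) (a \<cdot>\<^sub>N b) (a \<cdot>\<^sub>N c) = a \<cdot>\<^sub>N S x z f r y b c) \<and>
    (\<forall>x x' k z f r y b c. (x, x', k) \<in> CX \<longrightarrow> z \<in> Z \<longrightarrow> NW.alg f r \<longrightarrow> prob (u k) (w z) f y b c \<longrightarrow>
      S k z f r y b c = S x' z f r y
        (S x z f r (y \<cdot>\<^sub>N T (u x') (tM (w z))) b (c \<cdot>\<^sub>N T (u x') (sM (w z)))) c) \<and>
    (\<forall>z z' k x f r y b c. (z, z', k) \<in> CZ \<longrightarrow> x \<in> X \<longrightarrow> NW.alg f r \<longrightarrow> prob (u x) (w k) f y b c \<longrightarrow>
      S x k f r y b c = S x z' f r y b
        (S x z f r (y \<cdot>\<^sub>N T (tK (u x)) (w z')) (b \<cdot>\<^sub>N T (sK (u x)) (w z')) c)) \<and>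
    (\<forall>f r g t k x z y b c. NW.composite_alg f r g t k \<longrightarrow> x \<in> X \<longrightarrow> z \<in> Z \<longrightarrow> prob (u x) (w z) (g \<cdot>\<^sub>N f) y b c \<longrightarrow>
      S x z (g \<cdot>\<^sub>N f) k y b c = S x z f r (S x z g t y (f \<cdot>\<^sub>N b) (f \<cdot>\<^sub>N c)) b c)"

lemmas lifting_opD =
  lifting_op_def[THEN iffD1, THEN conjunct1, rule_format]
  lifting_op_def[THEN iffD1, THEN conjunct2, THEN conjunct1, rule_format]
  lifting_op_def[THEN iffD1, THEN conjunct2, THEN conjunct2, THEN conjunct1, rule_format]
  lifting_op_def[THEN iffD1, THEN conjunct2, THEN conjunct2, THEN conjunct2, THEN conjunct1, rule_format]
  lifting_op_def[THEN iffD1, THEN conjunct2, THEN conjunct2, THEN conjunct2, THEN conjunct2, THEN conjunct1,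
      rule_format]
  lifting_op_def[THEN iffD1, THEN conjunct2, THEN conjunct2, THEN conjunct2, THEN conjunct2, THEN conjunct2,
      THEN conjunct1, rule_format]
  lifting_op_def[THEN iffD1, THEN conjunct2, THEN conjunct2, THEN conjunct2, THEN conjunct2, THEN conjunct2,
      THEN conjunct2, rule_format]

lemma swap_target: "tva_target M K N (swap_tva A) V"
  by (intro tva_target.intro swap NW.awfs_axioms)

lemma prob_swap: "tva.prob M K N (swap_tva A) j i f y c b \<longleftrightarrow> prob i j f y b c"
  unfolding tva.prob_def[OF swap] prob_def swap_tva_simps by auto

lemma sol_swap: "tva.sol M K N (swap_tva A) j i f y c b d \<longleftrightarrow> sol i j f y b c d"
  unfolding tva.sol_def[OF swap] sol_def swap_tva_simps by auto

text \<open>The components \<open>b\<close> and \<open>c\<close> of a problem change places with \<open>K\<close> and \<open>M\<close>; apart from this the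
notion is symmetric.\<close>

lemma lifting_op_swap:
  assumes "lifting_op X MX u CX Z MZ w CZ S"
  shows "tva_target.lifting_op M K N (swap_tva A) V Z MZ w CZ X MX u CX (\<lambda>z x f r y c b. S x z f r y b c)"
  unfolding tva_target.lifting_op_def[OF swap_target] prob_swap sol_swap swap_tva_simps
  by (intro conjI ballI allI impI) (rule lifting_opD[OF assms]; assumption)+

end

locale tva_gen = tva_awfs1 K M N A Q Qm L R D U + KW: generated_awfs K Q Qm L R D U Ob Mor arr str
  for K :: "('ko, 'ka) cat" and M :: "('mo, 'ma) cat" and N :: "('no, 'na) cat" and A Q Qm L R D U
    and Ob :: "'i set" and Mor arr str
begin

lemma op_eqD:
  assumes \<theta>: "KW.alg (hh j f) \<theta>" and x: "x \<in> Ob" and j: "j \<in> ar M" and f: "f \<in> ar N" and q: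
      "square K (arr x) u v (hh j f)"
  shows "tr (tgt K (arr x)) (tgt M j) (src N f)
      (op \<theta> (arr x) (str x) j f (uny (arr x) j f v) (unb (arr x) j f u) (unc (arr x) j f v))
    = \<theta> \<cdot>\<^sub>K (Qm (arr x) u v (hh j f) \<cdot>\<^sub>K str x)"
  using op_hom(4)[OF KW.gen_coalg[OF x] \<theta> square_prob(1)[OF j f q]] square_prob(2,3)[OF j f q] by simp

text \<open>For fixed \<open>j\<close> and \<open>f\<close>, a natural solution of all problems at the generators is, after
transposition, a choice of lifts of the pullback-hom against the generators.\<close>

lemma extension_exists:
  assumes j: "j \<in> ar M" and f: "f \<in> ar N"
    and S: "\<And>x y b c. x \<in> Ob \<Longrightarrow> prob (arr x) j f y b c \<Longrightarrow> sol (arr x) j f y b c (S x y b c)"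
    and nat: "\<And>x a a' x' y b c. (x, a, a', x') \<in> Mor \<Longrightarrow> prob (arr x') j f y b c \<Longrightarrow>
      S x (y \<cdot>\<^sub>N T a' (tM j)) (b \<cdot>\<^sub>N T a (tM j)) (c \<cdot>\<^sub>N T a' (sM j))
        = S x' y b c \<cdot>\<^sub>N T a' (tM j)"
  shows "\<exists>\<theta>. KW.alg (hh j f) \<theta> \<and> (\<forall>x y b c. x \<in> Ob \<longrightarrow> prob (arr x) j f y b c \<longrightarrow>
      op \<theta> (arr x) (str x) j f y b c = S x y b c)"
proof -
  let ?d = "\<lambda>x u v. S x (uny (arr x) j f v) (unb (arr x) j f u) (unc (arr x) j f v)"
  define \<phi> where "\<phi> = (\<lambda>x u v. tr (tgt K (arr x)) (tgt M j) (src N f) (?d x u v))"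
  have arr: "arr x \<in> ar K" if "x \<in> Ob" for x using KW.gen_coalg[OF that] by (rule KW.coalgD)
  have "\<exists>\<theta>. KW.alg (hh j f) \<theta> \<and> (\<forall>x u v. x \<in> Ob \<longrightarrow> square K (arr x) u v (hh j f) \<longrightarrow>
            \<theta> \<cdot>\<^sub>K (Qm (arr x) u v (hh j f) \<cdot>\<^sub>K str x) = \<phi> x u v)"
  proof (rule KW.gen_ex)
    show "hh j f \<in> ar K" using j f by simp
    fix x u v assume x: "x \<in> Ob" and q: "square K (arr x) u v (hh j f)"
    note p = square_prob[OF j f q]
    note s = S[OF x p(1)]
    show "\<phi> x u v \<in> hom K (tgt K (arr x)) (src K (hh j f)) \<and> \<phi> x u v \<cdot>\<^sub>K arr x = u \<and> hh j f \<cdot>\<^sub>K \<phi> x u v = v"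
      using sol_iff[OF p(1) solD(1-3)[OF s]] s p(2,3) solD(1-3)[OF s] arr[OF x] j f by (simp add: \<phi>_def)
  next
    fix x a b x' u v assume m: "(x, a, b, x') \<in> Mor" and q: "square K (arr x') u v (hh j f)"
    have x: "x \<in> Ob" "x' \<in> Ob" and cm: "KW.coalg_map (arr x) (str x) a b (arr x') (str x')"
        using KW.gen_mor[OF m] by auto
    have sq: "square K (arr x) a b (arr x')" using cm by (simp add: KW.coalg_map_def)
    note p = square_prob[OF j f q]
    note s = solD(1-3)[OF S[OF x(2) p(1)]]
    note [simp] = squareD(1-8)[OF sq] probD(1-12)[OF p(1)] j f squareD(3-8)[OF q] bot(1-3)[OF p(1)]
    have y: "uny (arr x) j f (v \<cdot>\<^sub>K b) = uny (arr x') j f v \<cdot>\<^sub>N T b (tM j)"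
      by (rule tr_inj[of "tgt K (arr x)" "tgt M j" "tgt N f"])
        (use squareD(3-8)[OF q] bot(4)[OF p(1)] in \<open>simp_all add: tr_precomp p(3) uny_def\<close>)
    have c: "unc (arr x) j f (v \<cdot>\<^sub>K b) = unc (arr x') j f v \<cdot>\<^sub>N T b (sM j)"
      by (rule tr_inj[of "tgt K (arr x)" "src M j" "src N f"])
        (use squareD(3-8)[OF q] in \<open>simp_all add: tr_precomp unc_def\<close>)
    have b: "unb (arr x) j f (u \<cdot>\<^sub>K a) = unb (arr x') j f u \<cdot>\<^sub>N T a (tM j)"
      by (rule tr_inj[of "src K (arr x)" "tgt M j" "src N f"])
        (use squareD(3-8)[OF q] in \<open>simp_all add: tr_precomp unb_def\<close>)
    show "\<phi> x (u \<cdot>\<^sub>K a) (v \<cdot>\<^sub>K b) = \<phi> x' u v \<cdot>\<^sub>K b"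
      using s by (simp add: \<phi>_def y b c nat[OF m p(1)] tr_precomp)
  qed
  then obtain \<theta> where \<theta>: "KW.alg (hh j f) \<theta>" and e: "\<And>x u v. x \<in> Ob \<Longrightarrow> square K (arr x) u v (hh j f) \<Longrightarrow>
            \<theta> \<cdot>\<^sub>K (Qm (arr x) u v (hh j f) \<cdot>\<^sub>K str x) = \<phi> x u v" by blast
  have "op \<theta> (arr x) (str x) j f y b c = S x y b c" if x: "x \<in> Ob" and p: "prob (arr x) j f y b c" for x y b c
  proof (rule op_cong[OF KW.gen_coalg[OF x] \<theta> p])
    note s = S[OF x p]
    show "S x y b c \<in> ar N" "src N (S x y b c) = TO (tgt K (arr x)) (tgt M j)" "tgt N (S x y b c) = src N f"
      using solD[OF s] by simp_all
    have u: "uny (arr x) j f (bot (arr x) j f y c) = y" "unb (arr x) j f (top (arr x) j f b) = b"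
      "unc (arr x) j f (bot (arr x) j f y c) = c"
      using probD(1-12)[OF p] bot[OF p] by (simp_all add: uny_def unb_def unc_def top_def)
    show "tr (tgt K (arr x)) (tgt M j) (src N f) (S x y b c)
      = \<theta> \<cdot>\<^sub>K (Qm (arr x) (top (arr x) j f b) (bot (arr x) j f y c) (hh j f) \<cdot>\<^sub>K str x)"
      by (simp add: e[OF x prob_square[OF p]] \<phi>_def u)
  qed
  then show ?thesis using \<theta> by blast
qed

lemma extension_unique:
  assumes j: "j \<in> ar M" and f: "f \<in> ar N" and \<theta>: "KW.alg (hh j f) \<theta>" "KW.alg (hh j f) \<theta>'"
    and e: "\<And>x y b c. x \<in> Ob \<Longrightarrow> prob (arr x) j f y b c \<Longrightarrow>
      op \<theta> (arr x) (str x) j f y b c = op \<theta>' (arr x) (str x) j f y b c"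
  shows "\<theta> = \<theta>'"
proof (rule KW.gen_unique[OF \<theta>])
  fix x u v assume x: "x \<in> Ob" and q: "square K (arr x) u v (hh j f)"
  show "\<theta> \<cdot>\<^sub>K (Qm (arr x) u v (hh j f) \<cdot>\<^sub>K str x) = \<theta>' \<cdot>\<^sub>K (Qm (arr x) u v (hh j f) \<cdot>\<^sub>K str x)"
    using op_eqD[OF \<theta>(1) x j f q] op_eqD[OF \<theta>(2) x j f q] e[OF x square_prob(1)[OF j f q]] by simp
qed

lemma extension_map:
  assumes j: "square M j' b0 b1 j" and f: "square N f f0 f1 f'"
    and \<theta>: "KW.alg (hh j f) \<theta>" "KW.alg (hh j' f') \<theta>'"
    and e: "\<And>x y b c. x \<in> Ob \<Longrightarrow> prob (arr x) j f y b c \<Longrightarrow>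
      op \<theta>' (arr x) (str x) j' f' (f1 \<cdot>\<^sub>N (y \<cdot>\<^sub>N T (tK (arr x)) b1)) (f0 \<cdot>\<^sub>N (b \<cdot>\<^sub>N T (sK (arr x)) b1))
        (f0 \<cdot>\<^sub>N (c \<cdot>\<^sub>N T (tK (arr x)) b0))
      = f0 \<cdot>\<^sub>N (op \<theta> (arr x) (str x) j f y b c \<cdot>\<^sub>N T (tK (arr x)) b1)"
  shows "KW.alg_map (hh j f) \<theta> (H b1 f0) (hmap j f j' f' b0 b1 f0 f1) (hh j' f') \<theta>'"
proof (rule KW.gen_full[OF \<theta> hmap(6)[OF j f]])
  fix x u v assume x: "x \<in> Ob" and q: "square K (arr x) u v (hh j f)"
  note [simp] = squareD(1-8)[OF j] squareD(1-8)[OF f]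
  have j1: "j \<in> ar M" and f1: "f \<in> ar N" by simp_all
  note p = square_prob[OF j1 f1 q] and c = KW.gen_coalg[OF x]
  note d = op_hom[OF c \<theta>(1) p(1)]
  note pp = prob_post[OF p(1) j f]
  have "tr (tgt K (arr x)) (tgt M j') (src N f') (f0 \<cdot>\<^sub>N (op \<theta> (arr x) (str x) j f (uny (arr x) j f v) (unb
      (arr x) j f u)
      (unc (arr x) j f v) \<cdot>\<^sub>N T (tK (arr x)) b1))
    = H b1 f0 \<cdot>\<^sub>K (\<theta> \<cdot>\<^sub>K (Qm (arr x) u v (hh j f) \<cdot>\<^sub>K str x))"
    using d(1-3) op_eqD[OF \<theta>(1) x j1 f1 q] KW.coalgD(1-4)[OF c] KW.algD(1-4)[OF \<theta>(1)] q
    by (simp add: tr_postcomp[of f0] tr_prebm[of b1])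
  then show "H b1 f0 \<cdot>\<^sub>K (\<theta> \<cdot>\<^sub>K (Qm (arr x) u v (hh j f) \<cdot>\<^sub>K str x))
     = \<theta>' \<cdot>\<^sub>K (Qm (arr x) (H b1 f0 \<cdot>\<^sub>K u) (hmap j f j' f' b0 b1 f0 f1 \<cdot>\<^sub>K v) (hh j' f') \<cdot>\<^sub>K str x)"
    using op_hom(4)[OF c \<theta>(2) pp(1)] e[OF x p(1)] by (simp add: pp(2,3) p(2,3))
qed

end

locale tva_gen_target = tva_gen K M N A Q Qm L R D U Ob Mor arr str + tva_target K M N A V
  for K :: "('ko, 'ka) cat" and M :: "('mo, 'ma) cat" and N :: "('no, 'na) cat" and A Q Qm L R D U
    and Ob :: "'i set" and Mor arr str V
begin

text \<open>For every \<open>z\<close> and every algebra \<open>(f, r)\<close> the given solutions at the generators make the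
pullback-hom of \<open>w z\<close> and \<open>f\<close> an algebra, and \<open>S'\<close> consists of its canonical solutions.  Naturality in
\<open>z\<close> and \<open>f\<close> and compatibility with composites in \<open>z\<close> and \<open>f\<close> are equations between algebra
structures or algebra maps, and these can be tested on the generators, where they hold for
\<open>S\<close>.  Compatibility with composites of coalgebras is part of what canonical solutions satisfy.\<close>

theorem extend_lifting_op:
  fixes S :: "'i \<Rightarrow> 'z \<Rightarrow> 'na \<Rightarrow> 'na \<Rightarrow> 'na \<Rightarrow> 'na \<Rightarrow> 'na \<Rightarrow> 'na"
  assumes S: "lifting_op Ob Mor arr {} Z MZ w CZ S"
    and Z: "\<And>z. z \<in> Z \<Longrightarrow> w z \<in> ar M"
    and MZ: "\<And>z a a' z'. (z, a, a', z') \<in> MZ \<Longrightarrow> z \<in> Z \<and> z' \<in> Z \<and> square M (w z) a a' (w z')"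
    and CZ: "\<And>z z' k. (z, z', k) \<in> CZ \<Longrightarrow> z \<in> Z \<and> z' \<in> Z \<and> k \<in> Z \<and> tgt M (w z) = src M (w z') \<and> w k = w z' \<cdot>\<^sub>M w z"
  shows "\<exists>S'. lifting_op KW.Coalgs KW.CoalgMaps fst KW.CoalgComps Z MZ w CZ S'"
proof -
  note S = lifting_opD[OF S]
  define \<theta> where "\<theta> z f r = (SOME t. KW.alg (hh (w z) f) t \<and> (\<forall>x y b c. x \<in> Ob \<longrightarrow> prob (arr x) (w z) f y b c \<longrightarrow>
      op t (arr x) (str x) (w z) f y b c = S x z f r y b c))" for z f r
  have \<theta>: "KW.alg (hh (w z) f) (\<theta> z f r)"
    and \<theta>S: "\<And>x y b c. x \<in> Ob \<Longrightarrow> prob (arr x) (w z) f y b c \<Longrightarrow>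
      op (\<theta> z f r) (arr x) (str x) (w z) f y b c = S x z f r y b c"
    if z: "z \<in> Z" and f: "NW.alg f r" for z f r
  proof -
    have "\<exists>t. KW.alg (hh (w z) f) t \<and> (\<forall>x y b c. x \<in> Ob \<longrightarrow> prob (arr x) (w z) f y b c \<longrightarrow>
      op t (arr x) (str x) (w z) f y b c = S x z f r y b c)"
      by (rule extension_exists[OF Z[OF z] NW.algD(1)[OF f]]) (use S z f in auto)
    from someI_ex[OF this] show "KW.alg (hh (w z) f) (\<theta> z f r)"
      "\<And>x y b c. x \<in> Ob \<Longrightarrow> prob (arr x) (w z) f y b c \<Longrightarrow>
      op (\<theta> z f r) (arr x) (str x) (w z) f y b c = S x z f r y b c" unfolding \<theta>_def by blast+
  qed
  define S' where "S' X z f r y b c = op (\<theta> z f r) (fst X) (snd X) (w z) f y b c" for X z f r y b c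
  have "lifting_op KW.Coalgs KW.CoalgMaps fst KW.CoalgComps Z MZ w CZ S'"
  proof (unfold lifting_op_def, intro conjI ballI allI impI)
    fix X z f r y b c assume "X \<in> KW.Coalgs" "z \<in> Z" "NW.alg f r" "prob (fst X) (w z) f y b c"
    then show "sol (fst X) (w z) f y b c (S' X z f r y b c)"
      unfolding S'_def by (intro op_sol \<theta>) (auto simp: KW.Coalgs_def)
  next
    fix X a a' X' z f r y b c
    assume "(X, a, a', X') \<in> KW.CoalgMaps" "z \<in> Z" "NW.alg f r" "prob (fst X') (w z) f y b c"
    then show "S' X z f r (y \<cdot>\<^sub>N T a' (tM (w z))) (b \<cdot>\<^sub>N T a (tM (w z))) (c \<cdot>\<^sub>N T a' (sM (w z)))
        = S' X' z f r y b c \<cdot>\<^sub>N T a' (tM (w z))"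
      unfolding S'_def by (intro op_pre \<theta>) (auto simp: KW.CoalgMaps_def)
  next
    fix z a a' z' X f r y b c
    assume m: "(z, a, a', z') \<in> MZ" and X: "X \<in> KW.Coalgs" and f: "NW.alg f r" and p: "prob (fst X) (w z') f y b c"
    have z: "z \<in> Z" "z' \<in> Z" and q: "square M (w z) a a' (w z')" using MZ[OF m] by auto
    note [simp] = NW.algD(1)[OF f] squareD(1-8)[OF q]
    have sf: "square N f (sN f) (tN f) f" by (simp add: square_def)
    have c: "KW.coalg (fst X) (snd X)" using X by (auto simp: KW.Coalgs_def)
    have "KW.alg_map (hh (w z') f) (\<theta> z' f r) (H a' (sN f))
       (hmap (w z') f (w z) f a a' (sN f) (tN f)) (hh (w z) f) (\<theta> z f r)"
    proof (rule extension_map[OF q sf \<theta>[OF z(2) f] \<theta>[OF z(1) f]])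
      fix x y b c assume x: "x \<in> Ob" and p: "prob (arr x) (w z') f y b c"
      note [simp] = probD(1,4-12)[OF p] solD(1-3)[OF S(1)[OF x z(2) f p]]
      have "prob (arr x) (w z) f (y \<cdot>\<^sub>N T (tK (arr x)) a') (b \<cdot>\<^sub>N T (sK (arr x)) a')
          (c \<cdot>\<^sub>N T (tK (arr x)) a)"
        using prob_post(1)[OF p q sf] by simp
      then show "op (\<theta> z f r) (arr x) (str x) (w z) f (tN f \<cdot>\<^sub>N (y \<cdot>\<^sub>N T (tK (arr x)) a'))
          (sN f \<cdot>\<^sub>N (b \<cdot>\<^sub>N T (sK (arr x)) a')) (sN f \<cdot>\<^sub>N (c \<cdot>\<^sub>N T (tK (arr x)) a))
        = sN f \<cdot>\<^sub>N (op (\<theta> z' f r) (arr x) (str x) (w z') f y b c \<cdot>\<^sub>N T (tK (arr x)) a')"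
        by (simp add: \<theta>S[OF z(1) f x] \<theta>S[OF z(2) f x p] S(3)[OF m x f p])
    qed
    from op_post[OF c q sf this p]
    show "S' X z f r (y \<cdot>\<^sub>N T (tK (fst X)) a') (b \<cdot>\<^sub>N T (sK (fst X)) a') (c \<cdot>\<^sub>N T (tK (fst X)) a)
        = S' X z' f r y b c \<cdot>\<^sub>N T (tK (fst X)) a'"
      using probD(1,4-12)[OF p] op_hom(1-3)[OF c \<theta>[OF z(2) f] p] by (simp add: S'_def)
  next
    fix f r a a' f' r' X z y b c
    assume m: "NW.alg_map f r a a' f' r'" and X: "X \<in> KW.Coalgs" and z: "z \<in> Z" and p: "prob (fst X) (w z) f y b c"
    have q: "square N f a a' f'" and f: "NW.alg f r" "NW.alg f' r'" using m by (auto simp: NW.alg_map_def)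
    note [simp] = Z[OF z] squareD(1-8)[OF q]
    have sj: "square M (w z) (sM (w z)) (tM (w z)) (w z)" by (simp add: square_def)
    have c: "KW.coalg (fst X) (snd X)" using X by (auto simp: KW.Coalgs_def)
    have "KW.alg_map (hh (w z) f) (\<theta> z f r) (H (tM (w z)) a)
       (hmap (w z) f (w z) f' (sM (w z)) (tM (w z)) a a') (hh (w z) f') (\<theta> z f' r')"
    proof (rule extension_map[OF sj q \<theta>[OF z f(1)] \<theta>[OF z f(2)]])
      fix x y b c assume x: "x \<in> Ob" and p: "prob (arr x) (w z) f y b c"
      note [simp] = probD(1,4-12)[OF p] solD(1-3)[OF S(1)[OF x z f(1) p]]
      have "prob (arr x) (w z) f' (a' \<cdot>\<^sub>N y) (a \<cdot>\<^sub>N b) (a \<cdot>\<^sub>N c)"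
        using prob_post(1)[OF p sj q] by simp
      then show "op (\<theta> z f' r') (arr x) (str x) (w z) f' (a' \<cdot>\<^sub>N (y \<cdot>\<^sub>N T (tK (arr x)) (tM (w z))))
          (a \<cdot>\<^sub>N (b \<cdot>\<^sub>N T (sK (arr x)) (tM (w z))))
          (a \<cdot>\<^sub>N (c \<cdot>\<^sub>N T (tK (arr x)) (sM (w z))))
        = a \<cdot>\<^sub>N (op (\<theta> z f r) (arr x) (str x) (w z) f y b c \<cdot>\<^sub>N T (tK (arr x)) (tM (w z)))"
        by (simp add: \<theta>S[OF z f(1) x p] \<theta>S[OF z f(2) x] S(4)[OF m x z p])
    qed
    from op_post[OF c sj q this p]
    show "S' X z f' r' (a' \<cdot>\<^sub>N y) (a \<cdot>\<^sub>N b) (a \<cdot>\<^sub>N c) = a \<cdot>\<^sub>N S' X z f r y b c"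
      using probD(1,4-12)[OF p] op_hom(1-3)[OF c \<theta>[OF z f(1)] p] by (simp add: S'_def)
  next
    fix X X' k z f r y b c
    assume c: "(X, X', k) \<in> KW.CoalgComps" and z: "z \<in> Z" and f: "NW.alg f r" and p: "prob (fst k) (w z) f y b c"
    obtain i s i' s' l where X: "X = (i, s)" "X' = (i', s')" "k = (i' \<cdot>\<^sub>K i, l)"
      and cc: "KW.composite_coalg i s i' s' l" using c by (auto simp: KW.CoalgComps_def)
    have a: "KW.coalg i s" "KW.coalg i' s'" "KW.coalg (i' \<cdot>\<^sub>K i) l" and t[simp]: "tgt K i = src K i'"
      using cc by (auto simp: KW.composite_coalg_def)
    note p = p[unfolded X fst_conv]
    note [simp] = KW.coalgD(1)[OF a(1)] KW.coalgD(1)[OF a(2)] Z[OF z] NW.algD(1)[OF f]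
    have [simp]: "y \<in> ar N" "src N y = TO (tgt K i') (tgt M (w z))" "tgt N y = tgt N f"
       "b \<in> ar N" "src N b = TO (src K i) (tgt M (w z))" "tgt N b = src N f"
       "c \<in> ar N" "src N c = TO (tgt K i') (src M (w z))" "tgt N c = src N f"
      using probD(4-12)[OF p] by simp_all
    have q: "square K i (sK i) i' (i' \<cdot>\<^sub>K i)" by (simp add: square_def)
    let ?y = "y \<cdot>\<^sub>N T i' (tM (w z))" and ?c = "c \<cdot>\<^sub>N T i' (sM (w z))"
    have p1: "prob i (w z) f ?y b ?c" and t1: "top i (w z) f b = top (i' \<cdot>\<^sub>K i) (w z) f b"
      and b1: "bot i (w z) f ?y ?c = bot (i' \<cdot>\<^sub>K i) (w z) f y c \<cdot>\<^sub>K i'"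
      using prob_pre[OF p q] top[OF p] by simp_all
    let ?t = "\<theta> z f r"
    let ?d = "op ?t i s (w z) f ?y b ?c"
    note D = solD[OF op_sol[OF a(1) \<theta>[OF z f] p1]]
    note [simp] = D(1,3)
    have [simp]: "src N ?d = TO (src K i') (tgt M (w z))" using D(2) by simp
    have p2: "prob i' (w z) f y ?d c" using D(4,6) probD(14)[OF p] by (simp add: prob_def)
    have t2: "top i' (w z) f ?d = ?t \<cdot>\<^sub>K (Qm i (top (i' \<cdot>\<^sub>K i) (w z) f b) (bot (i' \<cdot>\<^sub>K i) (w z) f y c
        \<cdot>\<^sub>K i') (hh (w z) f) \<cdot>\<^sub>K s)"
      unfolding op_hom(4)[OF a(1) \<theta>[OF z f] p1, unfolded t1 b1, symmetric] by (simp add: top_def)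
    have b2: "bot i' (w z) f y c = bot (i' \<cdot>\<^sub>K i) (w z) f y c" by (simp add: bot_def)
    have "op ?t (i' \<cdot>\<^sub>K i) l (w z) f y b c = op ?t i' s' (w z) f y ?d c"
    proof (rule op_cong[OF a(3) \<theta>[OF z f] p])
      show "tr (tgt K (i' \<cdot>\<^sub>K i)) (tgt M (w z)) (src N f) (op ?t i' s' (w z) f y ?d c)
        = ?t \<cdot>\<^sub>K (Qm (i' \<cdot>\<^sub>K i) (top (i' \<cdot>\<^sub>K i) (w z) f b) (bot (i' \<cdot>\<^sub>K i) (w z) f y c) (hh (w z) f) \<cdot>\<^sub>K l)"
        using cc \<theta>[OF z f] prob_square[OF p] op_hom(4)[OF a(2) \<theta>[OF z f] p2]
        unfolding KW.composite_coalg_def by (simp add: t2 b2)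
    qed (use op_hom(1-3)[OF a(2) \<theta>[OF z f] p2] in simp_all)
    then show "S' k z f r y b c = S' X' z f r y
        (S' X z f r (y \<cdot>\<^sub>N T (fst X') (tM (w z))) b (c \<cdot>\<^sub>N T (fst X') (sM (w z)))) c"
      by (simp add: S'_def X)
  next
    fix z z' k X f r y b c
    assume m: "(z, z', k) \<in> CZ" and X: "X \<in> KW.Coalgs" and f: "NW.alg f r" and p: "prob (fst X) (w k) f y b c"
    have z: "z \<in> Z" "z' \<in> Z" "k \<in> Z" and t: "tgt M (w z) = src M (w z')" and wk: "w k = w z' \<cdot>\<^sub>M w z"
      using CZ[OF m] by auto
    have c: "KW.coalg (fst X) (snd X)" using X by (auto simp: KW.Coalgs_def)
    obtain q where q: "KW.alg (hh (w k) f) q" and e: "\<And>i s y b c. KW.coalg i s \<Longrightarrow> prob i (w k) f y b c \<Longrightarrow>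
     prob i (w z) f (y \<cdot>\<^sub>N T (tK i) (w z')) (b \<cdot>\<^sub>N T (sK i) (w z')) c \<and>
     prob i (w z') f y b (op (\<theta> z f r) i s (w z) f (y \<cdot>\<^sub>N T (tK i) (w z')) (b \<cdot>\<^sub>N T (sK i) (w z')) c) \<and>
     op q i s (w k) f y b c = op (\<theta> z' f r) i s (w z') f y b
       (op (\<theta> z f r) i s (w z) f (y \<cdot>\<^sub>N T (tK i) (w z')) (b \<cdot>\<^sub>N T (sK i) (w z')) c)"
      using op_composite_j[OF Z[OF z(1)] Z[OF z(2)] NW.algD(1)[OF f] t \<theta>[OF z(1) f] \<theta>[OF z(2) f]]
      unfolding wk by blast
    have "\<theta> k f r = q"
    proof (rule extension_unique[OF Z[OF z(3)] NW.algD(1)[OF f] \<theta>[OF z(3) f] q])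
      fix x y b c assume x: "x \<in> Ob" and p: "prob (arr x) (w k) f y b c"
      note h = e[OF KW.gen_coalg[OF x] p]
      show "op (\<theta> k f r) (arr x) (str x) (w k) f y b c = op q (arr x) (str x) (w k) f y b c"
        using \<theta>S[OF z(2) f x h[THEN conjunct2, THEN conjunct1]]
        by (simp add: h \<theta>S[OF z(3) f x p] \<theta>S[OF z(1) f x h[THEN conjunct1]] S(6)[OF m x f p])
    qed
    then show "S' X k f r y b c = S' X z' f r y b
        (S' X z f r (y \<cdot>\<^sub>N T (tK (fst X)) (w z')) (b \<cdot>\<^sub>N T (sK (fst X)) (w z')) c)"
      using e[OF c p] by (simp add: S'_def)
  next
    fix f r g t k X z y b c
    assume m: "NW.composite_alg f r g t k" and X: "X \<in> KW.Coalgs" and z: "z \<in> Z" and p: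
        "prob (fst X) (w z) (g \<cdot>\<^sub>N f) y b c"
    have a: "NW.alg f r" "NW.alg g t" "NW.alg (g \<cdot>\<^sub>N f) k" and fg: "tgt N f = src N g"
      using m by (auto simp: NW.composite_alg_def)
    have c: "KW.coalg (fst X) (snd X)" using X by (auto simp: KW.Coalgs_def)
    obtain q where q: "KW.alg (hh (w z) (g \<cdot>\<^sub>N f)) q" and e: "\<And>i s y b c. KW.coalg i s
        \<Longrightarrow> prob i (w z) (g \<cdot>\<^sub>N f) y b c \<Longrightarrow>
     prob i (w z) g y (f \<cdot>\<^sub>N b) (f \<cdot>\<^sub>N c) \<and> prob i (w z) f (op (\<theta> z g t) i s (w z) g y (f \<cdot>\<^sub>N b) (f \<cdot>\<^sub>N c)) b c \<and>
     op q i s (w z) (g \<cdot>\<^sub>N f) y b c = op (\<theta> z f r) i s (w z) f (op (\<theta> z g t) i s (w z) g y (f \<cdot>\<^sub>N b) (f \<cdot>\<^sub>N c)) b c"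
      using op_composite_f[OF Z[OF z] NW.algD(1)[OF a(1)] NW.algD(1)[OF a(2)] fg \<theta>[OF z a(1)] \<theta>[OF z a(2)]] by blast
    have "\<theta> z (g \<cdot>\<^sub>N f) k = q"
    proof (rule extension_unique[OF Z[OF z] NW.algD(1)[OF a(3)] \<theta>[OF z a(3)] q])
      fix x y b c assume x: "x \<in> Ob" and p: "prob (arr x) (w z) (g \<cdot>\<^sub>N f) y b c"
      note h = e[OF KW.gen_coalg[OF x] p]
      show "op (\<theta> z (g \<cdot>\<^sub>N f) k) (arr x) (str x) (w z) (g \<cdot>\<^sub>N f) y b c = op q (arr x) (str x) (w z) (g \<cdot>\<^sub>N f) y b c"
        using \<theta>S[OF z a(1) x h[THEN conjunct2, THEN conjunct1]]
        by (simp add: h \<theta>S[OF z a(2) x h[THEN conjunct1]] \<theta>S[OF z a(3) x p] S(7)[OF m x z p])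
    qed
    then show "S' X z (g \<cdot>\<^sub>N f) k y b c = S' X z f r (S' X z g t y (f \<cdot>\<^sub>N b) (f \<cdot>\<^sub>N c)) b c"
      using e[OF c p] by (simp add: S'_def)
  qed
  then show ?thesis by blast
qed

end


section \<open>Functors into categories of structured objects\<close>

lemma structured_cat_simps [simp]:
  "ob (structured_cat C S P) = S" "src (structured_cat C S P) (X, h, Y)
      = X" "tgt (structured_cat C S P) (X, h, Y) = Y"
  "(X, h, Y) \<in> ar (structured_cat C S P) \<longleftrightarrow> X \<in> S \<and> Y \<in> S \<and> h \<in> hom C (fst X) (fst Y) \<and> P X h Y"
  "idt (structured_cat C S P) X = (X, idt C (fst X), X)"
  "cmp (structured_cat C S P) (Y, k, Z) (X, h, Y') = (X, k \<cdot>\<^bsub>C\<^esub> h, Z)"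
  by (simp_all add: structured_cat_def)

lemma category_structured_cat:
  assumes "category C" and fst: "\<And>X. X \<in> S \<Longrightarrow> fst X \<in> ob C"
    and id: "\<And>X. X \<in> S \<Longrightarrow> P X (idt C (fst X)) X"
    and comp: "\<And>X h Y k Z. \<lbrakk>X \<in> S; Y \<in> S; Z \<in> S; h \<in> hom C (fst X) (fst Y); k \<in> hom C (fst Y)
        (fst Z); P X h Y; P Y k Z\<rbrakk>
      \<Longrightarrow> P X (k \<cdot>\<^bsub>C\<^esub> h) Z"
  shows "category (structured_cat C S P)"
proof -
  interpret category C by fact
  show ?thesis
  proof
    fix f x y g z assume "f \<in> hom (structured_cat C S P) x y" "g \<in> hom (structured_cat C S P) y z"
    moreover obtain h k where "f = (x, h, y)" "g = (y, k, z)" using calculation by (cases f; cases g) auto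
    ultimately show "g \<cdot>\<^bsub>structured_cat C S P\<^esub> f \<in> hom (structured_cat C S P) x z"
      using comp[of x y z h k] by simp
  next
    fix f x y assume "f \<in> hom (structured_cat C S P) x y"
    then show "idt (structured_cat C S P) y \<cdot>\<^bsub>structured_cat C S P\<^esub> f = f"
       "f \<cdot>\<^bsub>structured_cat C S P\<^esub> idt (structured_cat C S P) x = f"
      by (cases f; auto)+
  next
    fix f w x g y h z
    assume "f \<in> hom (structured_cat C S P) w x" "g \<in> hom (structured_cat C S P) x y"
        "h \<in> hom (structured_cat C S P) y z"
    then show "(h \<cdot>\<^bsub>structured_cat C S P\<^esub> g) \<cdot>\<^bsub>structured_cat C S P\<^esub> f
        = h \<cdot>\<^bsub>structured_cat C S P\<^esub> g \<cdot>\<^bsub>structured_cat C S P\<^esub> f"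
      by (cases f; cases g; cases h) auto
  next
    fix f assume "f \<in> ar (structured_cat C S P)"
    then show "src (structured_cat C S P) f \<in> ob (structured_cat C S P)"
        "tgt (structured_cat C S P) f \<in> ob (structured_cat C S P)"
      by (cases f; auto)+
  qed (use fst id in auto)
qed

lemma forget_functor:
  assumes "category C" "category (structured_cat C S P)" and fst: "\<And>X. X \<in> S \<Longrightarrow> fst X \<in> ob C"
  shows "is_functor (structured_cat C S P) C forget"
proof -
  interpret C: category C by fact
  interpret D: category "structured_cat C S P" by fact
  show ?thesis
  proof
    fix f x y g z assume "f \<in> hom (structured_cat C S P) x y" "g \<in> hom (structured_cat C S P) y z"
    then show "far forget (g \<cdot>\<^bsub>structured_cat C S P\<^esub> f) = far forget g \<cdot>\<^bsub>C\<^esub> far forget f"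
      by (cases f; cases g) auto
  next
    fix f x y assume "f \<in> hom (structured_cat C S P) x y"
    then show "far forget f \<in> hom C (fob forget x) (fob forget y)" by (cases f) auto
  qed (use fst in auto)
qed

text \<open>Morphisms of structured objects are determined by their underlying morphisms, so a lift of a
functor amounts to a structure on each value that all values on arrows respect.\<close>

definition structured_lift ::
    "('o, 'a) cat \<Rightarrow> ('o, 'a, 'p, 'b) func \<Rightarrow> ('o \<Rightarrow> 's) \<Rightarrow> ('o, 'a, 'p \<times> 's, ('p \<times> 's) \<times> 'b \<times> ('p \<times> 's)) func" where
  "structured_lift C F st = \<lparr>fob = (\<lambda>x. (fob F x, st x)),
     far = (\<lambda>f. ((fob F (src C f), st (src C f)), far F f, (fob F (tgt C f), st (tgt C f))))\<rparr>"

lemma structured_lift: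
  assumes F: "is_functor C D F" and D: "category (structured_cat D S P)"
    and st: "\<And>x. x \<in> ob C \<Longrightarrow> (fob F x, st x) \<in> S"
    and P: "\<And>f. f \<in> ar C \<Longrightarrow> P (fob F (src C f), st (src C f)) (far F f) (fob F (tgt C f), st (tgt C f))"
  shows "is_functor C (structured_cat D S P) (structured_lift C F st)"
    "func_eq C (forget \<circ>\<^sub>F structured_lift C F st) F"
proof -
  interpret F: is_functor C D F by fact
  interpret D: category "structured_cat D S P" by fact
  show "is_functor C (structured_cat D S P) (structured_lift C F st)"
  proof
    fix f x y assume f: "f \<in> hom C x y"
    then show "far (structured_lift C F st) f \<in> hom (structured_cat D S P) (fob (structured_lift C F st) x)
        (fob (structured_lift C F st) y)"
      using F.far_hom[OF f] st P[of f] by (auto simp: structured_lift_def)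
  next
    fix f x y g z assume fg: "f \<in> hom C x y" "g \<in> hom C y z"
    show "far (structured_lift C F st) (g \<cdot>\<^bsub>C\<^esub> f) = far (structured_lift C F st) g
        \<cdot>\<^bsub>structured_cat D S P\<^esub> far (structured_lift C F st) f"
      using F.far_cmp[OF fg] fg by (auto simp: structured_lift_def)
  qed (use st F.far_idt in \<open>auto simp: structured_lift_def\<close>)
  show "func_eq C (forget \<circ>\<^sub>F structured_lift C F st) F" by (simp add: func_eq_def structured_lift_def)
qed

context awfs_laws
begin

lemma coalg_map_comp:
  assumes "coalg_map f r u v f' r'" "coalg_map f' r' u' v' f'' r''"
  shows "coalg_map f r (u' \<cdot> u) (v' \<cdot> v) f'' r''"
proof -
  have sq: "square C f u v f'" "square C f' u' v' f''" and al: "coalg f r" "coalg f' r'" "coalg f'' r''"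
    and e: "r' \<cdot> v = Qm f u v f' \<cdot> r" "r'' \<cdot> v' = Qm f' u' v' f'' \<cdot> r'"
    using assms by (auto simp: coalg_map_def)
  note [simp] = squareD(1-8)[OF sq(1)] squareD(1-8)[OF sq(2)] coalgD(1-4)[OF al(1)] coalgD(1-4)[OF al(2)]
    coalgD(1-4)[OF al(3)] sq
  have "r'' \<cdot> v' \<cdot> v = Qm f' u' v' f'' \<cdot> r' \<cdot> v" by (rule comp_exchange) (simp_all add: e)
  also have "\<dots> = Qm f (u' \<cdot> u) (v' \<cdot> v) f'' \<cdot> r" by (simp add: e Qm_comp')
  finally show ?thesis using square_comp[OF sq] by (simp add: coalg_map_def al)
qed

lemma coalg_map_idt: "coalg j s \<Longrightarrow> coalg_map j s (idt C (src C j)) (idt C (tgt C j)) j s"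
  using coalgD[of j s] by (simp add: coalg_map_def square_idt Qm_idt)

lemma alg_map_idt: "alg f r \<Longrightarrow> alg_map f r (idt C (src C f)) (idt C (tgt C f)) f r"
  using algD[of f r] by (simp add: alg_map_def square_idt Qm_idt)

end

context awfs
begin

definition "coalg_set = {X. is_coalgebra (arrow_cat M) (lft_func W) (counit_sq M W) (comult_sq M W) (fst X)
    (coalg_sq M W X)}"
definition "coalg_prop = (\<lambda>X \<alpha> Y. coalg_sq M W Y \<cdot>\<^bsub>arrow_cat M\<^esub> \<alpha> = far (lft_func W) \<alpha> \<cdot>\<^bsub>arrow_cat M\<^esub> coalg_sq M W X)"
definition "alg_set = {X. is_algebra (arrow_cat M) (rgt_func W) (unit_sq M W) (mult_sq M W) (fst X) (alg_sq M W X)}"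
definition "alg_prop = (\<lambda>X \<alpha> Y. \<alpha> \<cdot>\<^bsub>arrow_cat M\<^esub> alg_sq M W X = alg_sq M W Y \<cdot>\<^bsub>arrow_cat M\<^esub> far (rgt_func W) \<alpha>)"

lemma coalg_cat_eq: "coalg_cat M W = structured_cat (arrow_cat M) coalg_set coalg_prop"
  by (simp add: coalg_cat_def coalg_set_def coalg_prop_def)

lemma alg_cat_eq: "alg_cat M W = structured_cat (arrow_cat M) alg_set alg_prop"
  by (simp add: alg_cat_def alg_set_def alg_prop_def)

lemma coalg_set: "X \<in> coalg_set \<longleftrightarrow> coalg (fst X) (snd X)" using ob_coalg_cat[of X] by (simp add: coalg_cat_eq)
lemma alg_set: "X \<in> alg_set \<longleftrightarrow> alg (fst X) (snd X)" using ob_alg_cat[of X] by (simp add: alg_cat_eq)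

lemma coalg_prop:
  assumes "X \<in> coalg_set" "Y \<in> coalg_set" "\<alpha> \<in> hom (arrow_cat M) (fst X) (fst Y)"
  shows "coalg_prop X \<alpha> Y \<longleftrightarrow> coalg_map (fst X) (snd X) (stop \<alpha>) (sbot \<alpha>) (fst Y) (snd Y)"
  using ar_coalg_cat[of X \<alpha> Y] assms by (cases \<alpha>) (auto simp: coalg_cat_eq)

lemma alg_prop:
  assumes "X \<in> alg_set" "Y \<in> alg_set" "\<alpha> \<in> hom (arrow_cat M) (fst X) (fst Y)"
  shows "alg_prop X \<alpha> Y \<longleftrightarrow> alg_map (fst X) (snd X) (stop \<alpha>) (sbot \<alpha>) (fst Y) (snd Y)"
  using ar_alg_cat[of X \<alpha> Y] assms by (cases \<alpha>) (auto simp: alg_cat_eq)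

lemma category_coalg_cat: "category (structured_cat (arrow_cat M) coalg_set coalg_prop)"
proof (rule category_structured_cat[OF category_arrow_cat])
  show "fst X \<in> ob (arrow_cat M)" if "X \<in> coalg_set" for X using that coalgD(1) by (auto simp: coalg_set)
  show "coalg_prop X (idt (arrow_cat M) (fst X)) X" if "X \<in> coalg_set" for X
    using that coalg_map_idt[of "fst X" "snd X"] coalgD(1)[of "fst X" "snd X"] square_idt[of "fst X"]
    by (subst coalg_prop) (auto simp: coalg_set)
  fix X \<alpha> Y \<beta> Z assume X: "X \<in> coalg_set" "Y \<in> coalg_set" "Z \<in> coalg_set" "\<alpha> \<in> hom (arrow_cat M) (fst X) (fst Y)"
    "\<beta> \<in> hom (arrow_cat M) (fst Y) (fst Z)" and a: "coalg_prop X \<alpha> Y" "coalg_prop Y \<beta> Z"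
  have 1: "coalg_map (fst X) (snd X) (stop \<alpha>) (sbot \<alpha>) (fst Y) (snd Y)" using X a by (simp add: coalg_prop)
  have 2: "coalg_map (fst Y) (snd Y) (stop \<beta>) (sbot \<beta>) (fst Z) (snd Z)" using X a by (simp add: coalg_prop)
  from coalg_map_comp[OF 1 2] show "coalg_prop X (\<beta> \<cdot>\<^bsub>arrow_cat M\<^esub> \<alpha>) Z"
    using X by (subst coalg_prop) (auto simp: coalg_map_def)
qed

lemma category_alg_cat: "category (structured_cat (arrow_cat M) alg_set alg_prop)"
proof (rule category_structured_cat[OF category_arrow_cat])
  show "fst X \<in> ob (arrow_cat M)" if "X \<in> alg_set" for X using that algD(1) by (auto simp: alg_set)
  show "alg_prop X (idt (arrow_cat M) (fst X)) X" if "X \<in> alg_set" for X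
    using that alg_map_idt[of "fst X" "snd X"] algD(1)[of "fst X" "snd X"] square_idt[of "fst X"]
    by (subst alg_prop) (auto simp: alg_set)
  fix X \<alpha> Y \<beta> Z assume X: "X \<in> alg_set" "Y \<in> alg_set" "Z \<in> alg_set" "\<alpha> \<in> hom (arrow_cat M) (fst X) (fst Y)"
    "\<beta> \<in> hom (arrow_cat M) (fst Y) (fst Z)" and a: "alg_prop X \<alpha> Y" "alg_prop Y \<beta> Z"
  have 1: "alg_map (fst X) (snd X) (stop \<alpha>) (sbot \<alpha>) (fst Y) (snd Y)" using X a by (simp add: alg_prop)
  have 2: "alg_map (fst Y) (snd Y) (stop \<beta>) (sbot \<beta>) (fst Z) (snd Z)" using X a by (simp add: alg_prop)
  from alg_map_comp[OF 1 2] show "alg_prop X (\<beta> \<cdot>\<^bsub>arrow_cat M\<^esub> \<alpha>) Z"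
    using X by (subst alg_prop) (auto simp: alg_map_def)
qed

lemma mid_functor: "is_functor (arrow_cat M) M (mid W)"
  using W by (simp add: is_awfs_def is_functorial_factorization_def)

end

section \<open>Pushout-products and pullback-homs as functors\<close>

context tva
begin

text \<open>The pushout-product \<open>ee i j\<close> starts in the pushout \<open>PD i j\<close> with inclusions \<open>inl\<close>, \<open>inr\<close>; \<open>cop\<close> is
the copairing and \<open>emap\<close> the map between pushouts induced by two squares.\<close>

abbreviation inl where "inl \<equiv> pp_inl K M N (tensor A)"
abbreviation inr where "inr \<equiv> pp_inr K M N (tensor A)"
abbreviation cop where "cop \<equiv> pp_map K M N (tensor A)"
abbreviation ee where "ee i j \<equiv> fob (pushout_product K M N (tensor A)) (i, j)"
abbreviation PD where "PD i j \<equiv> tgt N (inl i j)"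

lemma in_simps:
  assumes "i \<in> ar K" "j \<in> ar M"
  shows "inl i j \<in> ar N" "inr i j \<in> ar N" "src N (inl i j) = TO (src K i) (tgt M j)"
    "src N (inr i j) = TO (tgt K i) (src M j)" "tgt N (inr i j) = PD i j"
    and in_comm: "inl i j \<cdot>\<^sub>N T (sK i) j = inr i j \<cdot>\<^sub>N T i (sM j)"
  using N.po_simps[of "T (sK i) j" "T i (sM j)"] assms poN
  by (simp_all add: pp_inl_def pp_inr_def pp_span1_def pp_span2_def)

declare in_simps(1-5) [simp]

lemma cop:
  assumes "i \<in> ar K" "j \<in> ar M" "b \<in> ar N" "c \<in> ar N" "src N b = TO (src K i) (tgt M j)" "src N c
      = TO (tgt K i) (src M j)"
    "tgt N b = tgt N c" "b \<cdot>\<^sub>N T (sK i) j = c \<cdot>\<^sub>N T i (sM j)"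
  shows "cop i j b c \<in> ar N" "src N (cop i j b c) = PD i j" "tgt N (cop i j b c) = tgt N b"
    "cop i j b c \<cdot>\<^sub>N inl i j = b" "cop i j b c \<cdot>\<^sub>N inr i j = c"
  using N.po_map[of "T (sK i) j" "T i (sM j)" b c] assms poN
  by (simp_all add: pp_map_def pp_inl_def pp_inr_def pp_span1_def pp_span2_def)

lemma in_eqI:
  assumes "i \<in> ar K" "j \<in> ar M" "m \<in> ar N" "m' \<in> ar N" "src N m = PD i j" "src N m' = PD i j"
    "m \<cdot>\<^sub>N inl i j = m' \<cdot>\<^sub>N inl i j" "m \<cdot>\<^sub>N inr i j = m' \<cdot>\<^sub>N inr i j"
  shows "m = m'"
  by (rule N.po_eqI[of "T (sK i) j" "T i (sM j)"])
    (use assms poN in \<open>simp_all add: pp_inl_def pp_inr_def pp_span1_def pp_span2_def\<close>)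

lemma ee:
  assumes "i \<in> ar K" "j \<in> ar M"
  shows "ee i j \<in> ar N" "src N (ee i j) = PD i j" "tgt N (ee i j) = TO (tgt K i) (tgt M j)"
    "ee i j \<cdot>\<^sub>N inl i j = T i (tM j)" "ee i j \<cdot>\<^sub>N inr i j = T (tK i) j"
  using cop[of i j "T i (tM j)" "T (tK i) j"] assms by (simp_all add: pushout_product_def)

declare ee(1-3) [simp]

definition emap where "emap i j i' j' a0 a1 b0 b1 = cop i j (inl i' j' \<cdot>\<^sub>N T a0 b1) (inr i' j' \<cdot>\<^sub>N T a1 b0)"

lemma emap:
  assumes i: "square K i a0 a1 i'" and j: "square M j b0 b1 j'"
  shows "emap i j i' j' a0 a1 b0 b1 \<in> ar N" "src N (emap i j i' j' a0 a1 b0 b1) = PD i j"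
    "tgt N (emap i j i' j' a0 a1 b0 b1) = PD i' j'"
    "emap i j i' j' a0 a1 b0 b1 \<cdot>\<^sub>N inl i j = inl i' j' \<cdot>\<^sub>N T a0 b1"
    "emap i j i' j' a0 a1 b0 b1 \<cdot>\<^sub>N inr i j = inr i' j' \<cdot>\<^sub>N T a1 b0"
    "square N (ee i j) (emap i j i' j' a0 a1 b0 b1) (T a1 b1) (ee i' j')"
proof -
  note [simp] = squareD(1-8)[OF i] squareD(1-8)[OF j]
  have "inl i' j' \<cdot>\<^sub>N (T (sK i') j' \<cdot>\<^sub>N T a0 b0) = inr i' j' \<cdot>\<^sub>N (T i' (sM j') \<cdot>\<^sub>N T a0 b0)"
    by (rule N.comp_exchange) (simp_all add: in_comm)
  then have e: "(inl i' j' \<cdot>\<^sub>N T a0 b1) \<cdot>\<^sub>N T (sK i) j = (inr i' j' \<cdot>\<^sub>N T a1 b0) \<cdot>\<^sub>N T i (sM j)"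
    by (simp add: squareD(9)[OF i] squareD(9)[OF j])
  have h[simp]: "emap i j i' j' a0 a1 b0 b1 \<in> ar N" "src N (emap i j i' j' a0 a1 b0 b1) = PD i j"
    "tgt N (emap i j i' j' a0 a1 b0 b1) = PD i' j'" and
    h4: "emap i j i' j' a0 a1 b0 b1 \<cdot>\<^sub>N inl i j = inl i' j' \<cdot>\<^sub>N T a0 b1" and
    h5: "emap i j i' j' a0 a1 b0 b1 \<cdot>\<^sub>N inr i j = inr i' j' \<cdot>\<^sub>N T a1 b0"
    unfolding emap_def using cop[of i j "inl i' j' \<cdot>\<^sub>N T a0 b1" "inr i' j' \<cdot>\<^sub>N T a1 b0"] e by simp_all
  show "emap i j i' j' a0 a1 b0 b1 \<in> ar N" "src N (emap i j i' j' a0 a1 b0 b1) = PD i j"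
    "tgt N (emap i j i' j' a0 a1 b0 b1) = PD i' j'"
    "emap i j i' j' a0 a1 b0 b1 \<cdot>\<^sub>N inl i j = inl i' j' \<cdot>\<^sub>N T a0 b1"
    "emap i j i' j' a0 a1 b0 b1 \<cdot>\<^sub>N inr i j = inr i' j' \<cdot>\<^sub>N T a1 b0" by (fact h h4 h5)+
  have "ee i' j' \<cdot>\<^sub>N emap i j i' j' a0 a1 b0 b1 = T a1 b1 \<cdot>\<^sub>N ee i j"
  proof (rule in_eqI[of i j])
    have "ee i' j' \<cdot>\<^sub>N (inl i' j' \<cdot>\<^sub>N T a0 b1) = T i' (tM j') \<cdot>\<^sub>N T a0 b1"
      by (rule N.comp_reduce) (simp_all add: ee)
    then show "(ee i' j' \<cdot>\<^sub>N emap i j i' j' a0 a1 b0 b1) \<cdot>\<^sub>N inl i j = (T a1 b1 \<cdot>\<^sub>N ee i j) \<cdot>\<^sub>N inl i j"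
      by (simp add: h4 ee(4) squareD(9)[OF i])
    have "ee i' j' \<cdot>\<^sub>N (inr i' j' \<cdot>\<^sub>N T a1 b0) = T (tK i') j' \<cdot>\<^sub>N T a1 b0"
      by (rule N.comp_reduce) (simp_all add: ee)
    then show "(ee i' j' \<cdot>\<^sub>N emap i j i' j' a0 a1 b0 b1) \<cdot>\<^sub>N inr i j = (T a1 b1 \<cdot>\<^sub>N ee i j) \<cdot>\<^sub>N inr i j"
      by (simp add: h5 ee(5) squareD(9)[OF j])
  qed simp_all
  then show "square N (ee i j) (emap i j i' j' a0 a1 b0 b1) (T a1 b1) (ee i' j')" by (simp add: square_def)
qed

lemma far_pushout_product:
  "far (pushout_product K M N (tensor A)) (Sq i a0 a1 i', Sq j b0 b1 j')
    = Sq (ee i j) (emap i j i' j' a0 a1 b0 b1) (T a1 b1) (ee i' j')"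
  by (simp add: pushout_product_def emap_def)

lemma pushout_product_functor:
  "is_functor (prod_cat (arrow_cat K) (arrow_cat M)) (arrow_cat N) (pushout_product K M N (tensor A))"
  (is "is_functor ?C ?D ?F")
proof -
  interpret C: category ?C by (intro category_prod_cat K.category_arrow_cat M.category_arrow_cat)
  interpret D: category ?D by (rule N.category_arrow_cat)
  show ?thesis
  proof
    fix x assume "x \<in> ob ?C"
    then obtain i j where x: "x = (i, j)" "i \<in> ar K" "j \<in> ar M" by (cases x) auto
    show "fob ?F x \<in> ob ?D" using x by simp
    have "emap i j i j (sK i) (tK i) (sM j) (tM j) = idt N (PD i j)"
      by (rule in_eqI[of i j]) (use emap[OF K.square_idt[OF x(2)] M.square_idt[OF x(3)]] x in simp_all)
    then show "far ?F (idt ?C x) = idt ?D (fob ?F x)" using x by (simp add: far_pushout_product)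
  next
    fix f x y assume "f \<in> hom ?C x y"
    then show "far ?F f \<in> hom ?D (fob ?F x) (fob ?F y)"
      by (cases f; cases x; cases y) (auto elim!: arrow_catE simp: far_pushout_product emap)
  next
    fix f x y g z assume f: "f \<in> hom ?C x y" and g: "g \<in> hom ?C y z"
    obtain i a0 a1 i' j b0 b1 j' where f': "f = (Sq i a0 a1 i', Sq j b0 b1 j')" "square K i a0 a1 i'"
        "square M j b0 b1 j'"
      using f by (cases f) (auto elim!: arrow_catE)
    obtain i'' c0 c1 j'' d0 d1 where g': "g = (Sq i' c0 c1 i'', Sq j' d0 d1 j'')" "square K i' c0 c1 i''"
        "square M j' d0 d1 j''"
      using f f' g by (cases g) (auto elim!: arrow_catE)
    note [simp] = squareD(1-8)[OF f'(2)] squareD(1-8)[OF f'(3)] squareD(1-8)[OF g'(2)] squareD(1-8)[OF g'(3)]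
    note e1 = emap[OF f'(2,3)] and e2 = emap[OF g'(2,3)]
      and e3 = emap[OF K.square_comp[OF f'(2) g'(2)] M.square_comp[OF f'(3) g'(3)]]
    note [simp] = e1(1-3) e2(1-3) e3(1-3)
    have "emap i j i'' j'' (c0 \<cdot>\<^sub>K a0) (c1 \<cdot>\<^sub>K a1) (d0 \<cdot>\<^sub>M b0) (d1 \<cdot>\<^sub>M b1)
       = emap i' j' i'' j'' c0 c1 d0 d1 \<cdot>\<^sub>N emap i j i' j' a0 a1 b0 b1"
    proof (rule in_eqI[of i j])
      have "emap i' j' i'' j'' c0 c1 d0 d1 \<cdot>\<^sub>N (inl i' j' \<cdot>\<^sub>N T a0 b1) = inl i'' j'' \<cdot>\<^sub>N (T c0 d1 \<cdot>\<^sub>N T a0 b1)"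
        by (rule N.comp_exchange) (simp_all add: e2(4))
      then show "emap i j i'' j'' (c0 \<cdot>\<^sub>K a0) (c1 \<cdot>\<^sub>K a1) (d0 \<cdot>\<^sub>M b0) (d1 \<cdot>\<^sub>M b1) \<cdot>\<^sub>N inl i j
        = (emap i' j' i'' j'' c0 c1 d0 d1 \<cdot>\<^sub>N emap i j i' j' a0 a1 b0 b1) \<cdot>\<^sub>N inl i j" by (simp add: e1(4) e3(4))
      have "emap i' j' i'' j'' c0 c1 d0 d1 \<cdot>\<^sub>N (inr i' j' \<cdot>\<^sub>N T a1 b0) = inr i'' j'' \<cdot>\<^sub>N (T c1 d0 \<cdot>\<^sub>N T a1 b0)"
        by (rule N.comp_exchange) (simp_all add: e2(5))
      then show "emap i j i'' j'' (c0 \<cdot>\<^sub>K a0) (c1 \<cdot>\<^sub>K a1) (d0 \<cdot>\<^sub>M b0) (d1 \<cdot>\<^sub>M b1) \<cdot>\<^sub>N inr i j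
        = (emap i' j' i'' j'' c0 c1 d0 d1 \<cdot>\<^sub>N emap i j i' j' a0 a1 b0 b1) \<cdot>\<^sub>N inr i j" by (simp add: e1(5) e3(5))
    qed simp_all
    then show "far ?F (g \<cdot>\<^bsub>?C\<^esub> f) = far ?F g \<cdot>\<^bsub>?D\<^esub> far ?F f"
      by (simp add: f'(1) g'(1) far_pushout_product)
  qed
qed

text \<open>The universal property of the pushout turns the three conditions on a problem into the
commutativity of one square, which gives access to the canonical solutions of \<open>V\<close>.\<close>

lemma prob_cop:
  assumes p: "prob i j f y b c"
  shows "cop i j b c \<in> ar N" "src N (cop i j b c) = PD i j" "tgt N (cop i j b c) = src N f"
    "cop i j b c \<cdot>\<^sub>N inl i j = b" "cop i j b c \<cdot>\<^sub>N inr i j = c"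
    "square N (ee i j) (cop i j b c) y f"
proof -
  note [simp] = probD(1-12)[OF p]
  have h[simp]: "cop i j b c \<in> ar N" "src N (cop i j b c) = PD i j" "tgt N (cop i j b c) = src N f"
    and h4: "cop i j b c \<cdot>\<^sub>N inl i j = b" and h5: "cop i j b c \<cdot>\<^sub>N inr i j = c"
    using cop[of i j b c] probD(15)[OF p] by simp_all
  then show "cop i j b c \<in> ar N" "src N (cop i j b c) = PD i j" "tgt N (cop i j b c) = src N f"
    "cop i j b c \<cdot>\<^sub>N inl i j = b" "cop i j b c \<cdot>\<^sub>N inr i j = c" by simp_all
  have "f \<cdot>\<^sub>N cop i j b c = y \<cdot>\<^sub>N ee i j"
    by (rule in_eqI[of i j]) (simp_all add: h4 h5 ee(4,5) probD(13,14)[OF p])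
  then show "square N (ee i j) (cop i j b c) y f" by (simp add: square_def)
qed

lemma square_prob_ee:
  assumes i: "i \<in> ar K" and j: "j \<in> ar M" and q: "square N (ee i j) u v f"
  shows "prob i j f v (u \<cdot>\<^sub>N inl i j) (u \<cdot>\<^sub>N inr i j)" "cop i j (u \<cdot>\<^sub>N inl i j) (u \<cdot>\<^sub>N inr i j) = u"
proof -
  note [simp] = i j squareD(1-4)[OF q] squareD(5-8)[OF q, simplified ee(2,3)[OF i j]]
  have "f \<cdot>\<^sub>N (u \<cdot>\<^sub>N inl i j) = v \<cdot>\<^sub>N (ee i j \<cdot>\<^sub>N inl i j)"
    by (rule N.comp_exchange) (simp_all add: squareD(9)[OF q])
  moreover have "f \<cdot>\<^sub>N (u \<cdot>\<^sub>N inr i j) = v \<cdot>\<^sub>N (ee i j \<cdot>\<^sub>N inr i j)"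
    by (rule N.comp_exchange) (simp_all add: squareD(9)[OF q])
  ultimately show p: "prob i j f v (u \<cdot>\<^sub>N inl i j) (u \<cdot>\<^sub>N inr i j)"
    by (simp add: prob_def ee(4,5) in_comm)
  show "cop i j (u \<cdot>\<^sub>N inl i j) (u \<cdot>\<^sub>N inr i j) = u"
    by (rule in_eqI[of i j]) (use prob_cop[OF p] in simp_all)
qed

lemma sol_ee:
  assumes p: "prob i j f y b c" and d: "d \<in> ar N" "src N d = TO (tgt K i) (tgt M j)" "tgt N d = src N f"
  shows "sol i j f y b c d \<longleftrightarrow> d \<cdot>\<^sub>N ee i j = cop i j b c \<and> f \<cdot>\<^sub>N d = y"
proof -
  note [simp] = probD(1-12)[OF p] d prob_cop(1-3)[OF p]
  have "d \<cdot>\<^sub>N ee i j = cop i j b c \<longleftrightarrow> d \<cdot>\<^sub>N T i (tM j) = b \<and> d \<cdot>\<^sub>N T (tK i) j = c"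
  proof
    assume e: "d \<cdot>\<^sub>N ee i j = cop i j b c"
    show "d \<cdot>\<^sub>N T i (tM j) = b \<and> d \<cdot>\<^sub>N T (tK i) j = c"
      using arg_cong[OF e, of "\<lambda>z. z \<cdot>\<^sub>N inl i j"] arg_cong[OF e, of "\<lambda>z. z \<cdot>\<^sub>N inr i j"]
      by (simp add: ee(4,5) prob_cop(4,5)[OF p])
  next
    assume "d \<cdot>\<^sub>N T i (tM j) = b \<and> d \<cdot>\<^sub>N T (tK i) j = c"
    then have e: "d \<cdot>\<^sub>N T i (tM j) = b" "d \<cdot>\<^sub>N T (tK i) j = c" by auto
    show "d \<cdot>\<^sub>N ee i j = cop i j b c"
      by (rule in_eqI[of i j]) (simp_all add: ee(4,5) prob_cop(4,5)[OF p] e)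
  qed
  then show ?thesis by (auto simp: sol_def)
qed

lemma cop_emap:
  assumes p: "prob i' j' f y b c" and i: "square K i a0 a1 i'" and j: "square M j b0 b1 j'"
  shows "cop i' j' b c \<cdot>\<^sub>N emap i j i' j' a0 a1 b0 b1 = cop i j (b \<cdot>\<^sub>N T a0 b1) (c \<cdot>\<^sub>N T a1 b0)"
proof -
  note [simp] = probD(1-12)[OF p] squareD(1-8)[OF i] squareD(1-8)[OF j] emap(1-3)[OF i j] prob_cop(1-3)[OF p]
  have e: "b \<cdot>\<^sub>N T a0 b1 = (cop i' j' b c \<cdot>\<^sub>N emap i j i' j' a0 a1 b0 b1) \<cdot>\<^sub>N inl i j"
    using N.comp_reduce[OF prob_cop(4)[OF p], of "T a0 b1"] by (simp add: emap(4)[OF i j])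
  have e': "c \<cdot>\<^sub>N T a1 b0 = (cop i' j' b c \<cdot>\<^sub>N emap i j i' j' a0 a1 b0 b1) \<cdot>\<^sub>N inr i j"
    using N.comp_reduce[OF prob_cop(5)[OF p], of "T a1 b0"] by (simp add: emap(5)[OF i j])
  have "square N (ee i j) (cop i' j' b c \<cdot>\<^sub>N emap i j i' j' a0 a1 b0 b1) (y \<cdot>\<^sub>N T a1 b1) f"
    by (rule N.square_comp[OF emap(6)[OF i j] prob_cop(6)[OF p]])
  from square_prob_ee(2)[OF _ _ this] show ?thesis unfolding e e' by simp
qed

lemma far_pullback_hom:
  "far (pullback_hom M N K (homr A)) (Sq j' b0 b1 j, Sq f f0 f1 f')
    = Sq (hh j f) (H b1 f0) (hmap j f j' f' b0 b1 f0 f1) (hh j' f')"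
  by (simp add: pullback_hom_def hmap_def)

lemma hmap_idt:
  assumes "j \<in> ar M" "f \<in> ar N"
  shows "hmap j f j f (sM j) (tM j) (sN f) (tN f) = idt K (PO j f)"
  by (rule p_eqI[of j f]) (use hmap[OF M.square_idt[OF assms(1)] N.square_idt[OF assms(2)]] assms in simp_all)

lemma hmap_comp:
  assumes j: "square M j' b0 b1 j" and f: "square N f f0 f1 f'" and j': "square M j'' c0 c1 j'" and f':
      "square N f' g0 g1 f''"
  shows "hmap j' f' j'' f'' c0 c1 g0 g1 \<cdot>\<^sub>K hmap j f j' f' b0 b1 f0 f1
    = hmap j f j'' f'' (b0 \<cdot>\<^sub>M c0) (b1 \<cdot>\<^sub>M c1) (g0 \<cdot>\<^sub>N f0) (g1 \<cdot>\<^sub>N f1)"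
proof -
  note [simp] = squareD(1-8)[OF j] squareD(1-8)[OF f] squareD(1-8)[OF j'] squareD(1-8)[OF f']
  note e1 = hmap[OF j f] and e2 = hmap[OF j' f'] and e3 = hmap[OF M.square_comp[OF j' j] N.square_comp[OF f f']]
  note [simp] = e1(1-3) e2(1-3) e3(1-3)
  show ?thesis
  proof (rule p_eqI[of j'' f''])
    have "p1 j'' f'' \<cdot>\<^sub>K (hmap j' f' j'' f'' c0 c1 g0 g1 \<cdot>\<^sub>K hmap j f j' f' b0 b1 f0 f1)
      = H c1 g1 \<cdot>\<^sub>K (p1 j' f' \<cdot>\<^sub>K hmap j f j' f' b0 b1 f0 f1)" by (rule K.comp_exchange) (simp_all add: e2(4))
    then show "p1 j'' f'' \<cdot>\<^sub>K (hmap j' f' j'' f'' c0 c1 g0 g1 \<cdot>\<^sub>K hmap j f j' f' b0 b1 f0 f1)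
      = p1 j'' f'' \<cdot>\<^sub>K hmap j f j'' f'' (b0 \<cdot>\<^sub>M c0) (b1 \<cdot>\<^sub>M c1) (g0 \<cdot>\<^sub>N f0) (g1 \<cdot>\<^sub>N f1)" by (simp add: e1(4) e3(4))
    have "p2 j'' f'' \<cdot>\<^sub>K (hmap j' f' j'' f'' c0 c1 g0 g1 \<cdot>\<^sub>K hmap j f j' f' b0 b1 f0 f1)
      = H c0 g0 \<cdot>\<^sub>K (p2 j' f' \<cdot>\<^sub>K hmap j f j' f' b0 b1 f0 f1)" by (rule K.comp_exchange) (simp_all add: e2(5))
    then show "p2 j'' f'' \<cdot>\<^sub>K (hmap j' f' j'' f'' c0 c1 g0 g1 \<cdot>\<^sub>K hmap j f j' f' b0 b1 f0 f1)
      = p2 j'' f'' \<cdot>\<^sub>K hmap j f j'' f'' (b0 \<cdot>\<^sub>M c0) (b1 \<cdot>\<^sub>M c1) (g0 \<cdot>\<^sub>N f0) (g1 \<cdot>\<^sub>N f1)" by (simp add: e1(5) e3(5))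
  qed simp_all
qed

lemma pullback_hom_functor:
  "is_functor (prod_cat (op_cat (arrow_cat M)) (arrow_cat N)) (arrow_cat K) (pullback_hom M N K (homr A))"
  (is "is_functor ?C ?D ?F")
proof -
  interpret C: category ?C by (intro category_prod_cat category_op N.category_arrow_cat M.category_arrow_cat)
  interpret D: category ?D by (rule K.category_arrow_cat)
  show ?thesis
  proof
    fix x assume "x \<in> ob ?C"
    then obtain j f where x: "x = (j, f)" "j \<in> ar M" "f \<in> ar N" by (cases x) auto
    show "fob ?F x \<in> ob ?D" using x by simp
    show "far ?F (idt ?C x) = idt ?D (fob ?F x)" using x hmap_idt[OF x(2,3)] by (simp add: far_pullback_hom)
  next
    fix f x y assume "f \<in> hom ?C x y"
    then show "far ?F f \<in> hom ?D (fob ?F x) (fob ?F y)"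
      by (cases f; cases x; cases y) (auto elim!: arrow_catE simp: far_pullback_hom hmap)
  next
    fix f x y g z assume f: "f \<in> hom ?C x y" and g: "g \<in> hom ?C y z"
    obtain j' b0 b1 j e f0 f1 e' where f': "f = (Sq j' b0 b1 j, Sq e f0 f1 e')" "square M j' b0 b1 j"
        "square N e f0 f1 e'"
      using f by (cases f) (auto elim!: arrow_catE)
    obtain j'' c0 c1 g0 g1 e'' where g': "g = (Sq j'' c0 c1 j', Sq e' g0 g1 e'')" "square M j'' c0 c1 j'"
        "square N e' g0 g1 e''"
      using f f' g by (cases g) (auto elim!: arrow_catE)
    note [simp] = squareD(1-8)[OF f'(2)] squareD(1-8)[OF f'(3)] squareD(1-8)[OF g'(2)] squareD(1-8)[OF g'(3)]
    show "far ?F (g \<cdot>\<^bsub>?C\<^esub> f) = far ?F g \<cdot>\<^bsub>?D\<^esub> far ?F f"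
      by (simp add: f'(1) g'(1) far_pullback_hom hmap_comp[OF f'(2,3) g'(2,3)])
  qed
qed

end


section \<open>The lifted homs\<close>

context tva
begin

lemma prob_eqI:
  assumes p: "prob i j f y b c" and p': "prob i j f y' b' c'" and t: "top i j f b
      = top i j f b'" and e: "bot i j f y c = bot i j f y' c'"
  shows "y = y' \<and> b = b' \<and> c = c'"
proof -
  note [simp] = probD(1-12)[OF p] probD(4-12)[OF p']
  have "tr (tgt K i) (tgt M j) (tgt N f) y = tr (tgt K i) (tgt M j) (tgt N f) y'"
    "tr (tgt K i) (src M j) (src N f) c = tr (tgt K i) (src M j) (src N f) c'"
    using bot(4,5)[OF p] bot(4,5)[OF p'] e by simp_all
  then show ?thesis using t tr_inj[of "src K i" "tgt M j" "src N f" b b'] tr_inj[of "tgt K i" "tgt M j"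
      "tgt N f" y y']
    tr_inj[of "tgt K i" "src M j" "src N f" c c'] by (simp add: top_def)
qed

end

locale tva_awfs = tva_target K M N A V + KW: awfs K W' + MW: awfs M W
  for K :: "('ko, 'ka) cat" and M :: "('mo, 'ma) cat" and N :: "('no, 'na) cat" and A V W' W

locale tva_full = tva_awfs +
  fixes S
  assumes full: "lifting_op KW.Coalgs KW.CoalgMaps fst KW.CoalgComps MW.Coalgs MW.CoalgMaps fst MW.CoalgComps S"
begin

lemma swap_full: "tva_full M K N (swap_tva A) V W W' (\<lambda>z x f r y c b. S x z f r y b c)"
proof -
  interpret sw: tva_target M K N "swap_tva A" V by (rule swap_target)
  show ?thesis by (unfold_locales, rule lifting_op_swap[OF full])
qed

lemma S_sol: "\<lbrakk>KW.coalg i s; MW.coalg j t; NW.alg f r; prob i j f y b c\<rbrakk>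
    \<Longrightarrow> sol i j f y b c (S (i, s) (j, t) f r y b c)"
  using lifting_opD(1)[OF full, of "(i, s)" "(j, t)" f r y b c] by (simp add: KW.Coalgs_def MW.Coalgs_def)

lemma S_pre: "\<lbrakk>KW.coalg_map i s a a' i' s'; MW.coalg j t; NW.alg f r; prob i' j f y b c\<rbrakk> \<Longrightarrow>
   S (i, s) (j, t) f r (y \<cdot>\<^sub>N T a' (tM j)) (b \<cdot>\<^sub>N T a (tM j)) (c \<cdot>\<^sub>N T a' (sM j))
        = S (i', s') (j, t) f r y b c \<cdot>\<^sub>N T a' (tM j)"
  using lifting_opD(2)[OF full, of "(i, s)" a a' "(i', s')" "(j, t)" f r y b c]
      by (simp add: KW.CoalgMaps_def MW.Coalgs_def)

lemma S_mid: "\<lbrakk>MW.coalg_map j t a a' j' t'; KW.coalg i s; NW.alg f r; prob i j' f y b c\<rbrakk> \<Longrightarrow>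
   S (i, s) (j, t) f r (y \<cdot>\<^sub>N T (tK i) a') (b \<cdot>\<^sub>N T (sK i) a') (c \<cdot>\<^sub>N T (tK i) a)
        = S (i, s) (j', t') f r y b c \<cdot>\<^sub>N T (tK i) a'"
  using lifting_opD(3)[OF full, of "(j, t)" a a' "(j', t')" "(i, s)" f r y b c]
      by (simp add: MW.CoalgMaps_def KW.Coalgs_def)

lemma S_post: "\<lbrakk>NW.alg_map f r a a' f' r'; KW.coalg i s; MW.coalg j t; prob i j f y b c\<rbrakk> \<Longrightarrow>
   S (i, s) (j, t) f' r' (a' \<cdot>\<^sub>N y) (a \<cdot>\<^sub>N b) (a \<cdot>\<^sub>N c) = a \<cdot>\<^sub>N S (i, s) (j, t) f r y b c"
  using lifting_opD(4)[OF full, of f r a a' f' r' "(i, s)" "(j, t)" y b c] by (simp add: MW.Coalgs_def KW.Coalgs_def)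

lemma S_comp1: "\<lbrakk>KW.composite_coalg i s i' s' k; MW.coalg j t; NW.alg f r; prob (i' \<cdot>\<^sub>K i) j f y b c\<rbrakk> \<Longrightarrow>
   S (i' \<cdot>\<^sub>K i, k) (j, t) f r y b c = S (i', s') (j, t) f r y
        (S (i, s) (j, t) f r (y \<cdot>\<^sub>N T i' (tM j)) b (c \<cdot>\<^sub>N T i' (sM j))) c"
  using lifting_opD(5)[OF full, of "(i, s)" "(i', s')" "(i' \<cdot>\<^sub>K i, k)" "(j, t)" f r y b c]
  by (simp add: KW.CoalgComps_def MW.Coalgs_def)

lemma S_comp3: "\<lbrakk>NW.composite_alg f r g t' k; KW.coalg i s; MW.coalg j t; prob i j (g \<cdot>\<^sub>N f) y b c\<rbrakk> \<Longrightarrow>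
   S (i, s) (j, t) (g \<cdot>\<^sub>N f) k y b c
     = S (i, s) (j, t) f r (S (i, s) (j, t) g t' y (f \<cdot>\<^sub>N b) (f \<cdot>\<^sub>N c)) b c"
  using lifting_opD(7)[OF full, of f r g t' k "(i, s)" "(j, t)" y b c] by (simp add: KW.Coalgs_def MW.Coalgs_def)

abbreviation "QK \<equiv> fob (mid W')"
abbreviation "EK h u v k \<equiv> far (mid W') (Sq h u v k)"
abbreviation "QM \<equiv> fob (mid W)"
abbreviation "EM h u v k \<equiv> far (mid W) (Sq h u v k)"

text \<open>The identity square of the pullback-hom \<open>hh j f\<close> transposes to the counit problem \<open>(ey, eb, ec)\<close>;
its restriction \<open>(yV, bV, cV)\<close> to the cofree coalgebra on \<open>hh j f\<close> is the universal problem against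
\<open>hh j f\<close>, and \<open>Vd\<close> is its chosen solution.\<close>

definition "ey j f = uny (hh j f) j f (idt K (PO j f))"
definition "eb j f = unb (hh j f) j f (idt K (HO (tgt M j) (src N f)))"
definition "ec j f = unc (hh j f) j f (idt K (PO j f))"

lemma p0:
  assumes "j \<in> ar M" "f \<in> ar N"
  shows "prob (hh j f) j f (ey j f) (eb j f) (ec j f)"
    "top (hh j f) j f (eb j f) = idt K (HO (tgt M j) (src N f))" "bot (hh j f) j f (ey j f) (ec j f) = idt K (PO j f)"
  using square_prob[OF assms, of "hh j f" "idt K (HO (tgt M j) (src N f))" "idt K (PO j f)"] K.square_idt[of
      "hh j f"] assms
  by (simp_all add: ey_def eb_def ec_def)

definition "yV j f = ey j f \<cdot>\<^sub>N T (rgt W' (hh j f)) (tM j)"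
definition "bV j f = eb j f"
definition "cV j f = ec j f \<cdot>\<^sub>N T (rgt W' (hh j f)) (sM j)"

lemma pV:
  assumes "j \<in> ar M" "f \<in> ar N"
  shows "prob (lft W' (hh j f)) j f (yV j f) (bV j f) (cV j f)"
    "top (lft W' (hh j f)) j f (bV j f) = idt K (HO (tgt M j) (src N f))"
    "bot (lft W' (hh j f)) j f (yV j f) (cV j f) = rgt W' (hh j f)"
proof -
  have h: "hh j f \<in> ar K" using assms by simp
  note pp = prob_pre[OF p0(1)[OF assms] KW.square_counit[OF h]]
  have b: "eb j f \<cdot>\<^sub>N T (sK (hh j f)) (tM j) = bV j f"
    using probD(7-9)[OF p0(1)[OF assms]] assms by (simp add: bV_def)
  show "prob (lft W' (hh j f)) j f (yV j f) (bV j f) (cV j f)"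
    "top (lft W' (hh j f)) j f (bV j f) = idt K (HO (tgt M j) (src N f))"
    "bot (lft W' (hh j f)) j f (yV j f) (cV j f) = rgt W' (hh j f)"
    using pp p0(2,3)[OF assms] assms unfolding b yV_def[symmetric] cV_def[symmetric] by simp_all
qed

definition "Vd j t f r = S (lft W' (hh j f), comult W' (hh j f)) (j, t) f r (yV j f) (bV j f) (cV j f)"
definition "theta j t f r = tr (QK (hh j f)) (tgt M j) (src N f) (Vd j t f r)"

lemma Vd:
  assumes "MW.coalg j t" "NW.alg f r"
  shows "Vd j t f r \<in> ar N" "src N (Vd j t f r) = TO (QK (hh j f)) (tgt M j)" "tgt N (Vd j t f r) = src N f"
    and theta: "theta j t f r \<in> ar K" "src K (theta j t f r) = QK (hh j f)" "tgt K (theta j t f r)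
        = HO (tgt M j) (src N f)"
      "theta j t f r \<cdot>\<^sub>K lft W' (hh j f) = idt K (HO (tgt M j) (src N f))" "hh j f \<cdot>\<^sub>K theta j t f r
          = rgt W' (hh j f)"
proof -
  have jf[simp]: "j \<in> ar M" "f \<in> ar N" using MW.coalgD[OF assms(1)] NW.algD[OF assms(2)] by simp_all
  have h: "hh j f \<in> ar K" by simp
  note c = KW.cofree_coalg[OF h] and p = pV[OF jf]
  note s = S_sol[OF c assms p(1), folded Vd_def]
  show V: "Vd j t f r \<in> ar N" "src N (Vd j t f r) = TO (QK (hh j f)) (tgt M j)" "tgt N (Vd j t f r) = src N f"
    using solD[OF s] by simp_all
  show "theta j t f r \<in> ar K" "src K (theta j t f r) = QK (hh j f)" "tgt K (theta j t f r) = HO (tgt M j) (src N f)"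
    using V by (simp_all add: theta_def)
  show "theta j t f r \<cdot>\<^sub>K lft W' (hh j f) = idt K (HO (tgt M j) (src N f))" "hh j f \<cdot>\<^sub>K theta j t f r
      = rgt W' (hh j f)"
    using sol_iff[OF p(1), of "Vd j t f r"] s V p(2,3) by (simp_all add: theta_def)
qed

text \<open>Every problem is the restriction of the universal one along a coalgebra map into the cofree
coalgebra on the pullback-hom, so naturality of \<open>S\<close> expresses all its values by the
single map \<open>theta\<close>.\<close>

lemma theta_op:
  assumes i: "KW.coalg i s" and j: "MW.coalg j t" and f: "NW.alg f r" and p: "prob i j f y b c"
  shows "theta j t f r \<cdot>\<^sub>K (EK i (top i j f b) (bot i j f y c) (hh j f) \<cdot>\<^sub>K s)
    = tr (tgt K i) (tgt M j) (src N f) (S (i, s) (j, t) f r y b c)"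
proof -
  have jf[simp]: "j \<in> ar M" "f \<in> ar N" using MW.coalgD[OF j] NW.algD[OF f] by simp_all
  let ?h = "hh j f" and ?u = "top i j f b" and ?v = "bot i j f y c"
  note q = prob_square[OF p] and pv = pV[OF jf]
  note [simp] = q squareD(1-4)[OF q] squareD(5-8)[OF q] KW.coalgD(1-4)[OF i] Vd[OF j f] probD(1-12)[OF p]
      bot(1-3)[OF p]
  let ?a = "EK i ?u ?v ?h \<cdot>\<^sub>K s"
  have m: "KW.coalg_map i s ?u ?a (lft W' ?h) (comult W' ?h)"
    using KW.coalg_map_comp[OF KW.coalg_map_structure[OF i] KW.cofree_coalg_map[OF q]] by simp
  have sq: "square K i ?u ?a (lft W' ?h)" using m by (simp add: KW.coalg_map_def)
  note pp = prob_pre[OF pv(1) sq]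
  have "rgt W' ?h \<cdot>\<^sub>K ?a = ?v \<cdot>\<^sub>K (rgt W' i \<cdot>\<^sub>K s)" by (rule K.comp_exchange) (simp_all add: KW.R_Qm)
  then have v: "rgt W' ?h \<cdot>\<^sub>K ?a = ?v" by (simp add: KW.coalgD(6)[OF i])
  have "y = yV j f \<cdot>\<^sub>N T ?a (tM j) \<and> b = bV j f \<cdot>\<^sub>N T ?u (tM j)
      \<and> c = cV j f \<cdot>\<^sub>N T ?a (sM j)"
    by (rule prob_eqI[OF p pp(1)]) (simp_all add: pp(2,3) pv(2,3) v)
  then have "S (i, s) (j, t) f r y b c = Vd j t f r \<cdot>\<^sub>N T ?a (tM j)"
    using S_pre[OF m j f pv(1), folded Vd_def] by simp
  then show ?thesis by (simp add: tr_precomp theta_def)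
qed

text \<open>By the previous lemma the canonical solutions of \<open>theta\<close> are the values of \<open>S\<close>; as these respect
composites of coalgebras, associativity follows from the criterion for algebras.\<close>

lemma theta_alg:
  assumes j: "MW.coalg j t" and f: "NW.alg f r"
  shows "KW.alg (hh j f) (theta j t f r)"
proof (rule KW.alg_criterion)
  have jf[simp]: "j \<in> ar M" "f \<in> ar N" using MW.coalgD[OF j] NW.algD[OF f] by simp_all
  show "hh j f \<in> ar K" "theta j t f r \<in> hom K (QK (hh j f)) (src K (hh j f))" "hh j f \<cdot>\<^sub>K theta j t f r
      = rgt W' (hh j f)"
    "theta j t f r \<cdot>\<^sub>K lft W' (hh j f) = sK (hh j f)" using theta[OF j f] by simp_all
  fix i s i' s' k u v assume cc: "KW.composite_coalg i s i' s' k" and q: "square K (i' \<cdot>\<^sub>K i) u v (hh j f)"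
  have a: "KW.coalg i s" "KW.coalg i' s'" "KW.coalg (i' \<cdot>\<^sub>K i) k" and t[simp]: "tgt K i = src K i'"
    using cc by (auto simp: KW.composite_coalg_def)
  note [simp] = KW.coalgD(1)[OF a(1)] KW.coalgD(1)[OF a(2)]
  let ?i = "i' \<cdot>\<^sub>K i" and ?t = "theta j t f r"
  define y b c where "y = uny ?i j f v" and "b = unb ?i j f u" and "c = unc ?i j f v"
  note p = square_prob[OF jf q, folded y_def b_def c_def]
  have [simp]: "y \<in> ar N" "src N y = TO (tgt K i') (tgt M j)" "tgt N y = tgt N f"
       "b \<in> ar N" "src N b = TO (src K i) (tgt M j)" "tgt N b = src N f"
       "c \<in> ar N" "src N c = TO (tgt K i') (src M j)" "tgt N c = src N f"
    using probD(4-12)[OF p(1)] by simp_all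
  note [simp] = squareD(3,4)[OF q] squareD(5-8)[OF q, simplified]
  have q1: "square K i (sK i) i' ?i" by (simp add: square_def)
  let ?y = "y \<cdot>\<^sub>N T i' (tM j)" and ?c = "c \<cdot>\<^sub>N T i' (sM j)"
  have p1: "prob i j f ?y b ?c" and t1: "top i j f b = u" and b1: "bot i j f ?y ?c = v \<cdot>\<^sub>K i'"
    using prob_pre[OF p(1) q1] p(2,3) by simp_all
  let ?d = "S (i, s) (j, t) f r ?y b ?c"
  note D = solD[OF S_sol[OF a(1) j f p1]]
  note [simp] = D(1,3)
  have [simp]: "src N ?d = TO (src K i') (tgt M j)" using D(2) by simp
  have p2: "prob i' j f y ?d c" using D(4,6) probD(14)[OF p(1)] by (simp add: prob_def)
  have t2: "top i' j f ?d = ?t \<cdot>\<^sub>K (EK i u (v \<cdot>\<^sub>K i') (hh j f) \<cdot>\<^sub>K s)"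
    using theta_op[OF a(1) j f p1] by (simp add: top_def[of i'] t1 b1)
  have b2: "bot i' j f y c = v" using p(3) by (simp add: bot_def)
  have "?t \<cdot>\<^sub>K (EK ?i u v (hh j f) \<cdot>\<^sub>K k) = tr (tgt K i') (tgt M j) (src N f) (S (?i, k) (j, t) f r y b c)"
    using theta_op[OF a(3) j f p(1)] p(2,3) by simp
  also have "\<dots> = tr (tgt K i') (tgt M j) (src N f) (S (i', s') (j, t) f r y ?d c)"
    by (simp add: S_comp1[OF cc j f p(1)])
  also have "\<dots> = ?t \<cdot>\<^sub>K (EK i' (?t \<cdot>\<^sub>K (EK i u (v \<cdot>\<^sub>K i') (hh j f) \<cdot>\<^sub>K s)) v (hh j f) \<cdot>\<^sub>K s')"
    using theta_op[OF a(2) j f p2] by (simp add: t2 b2)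
  finally show "?t \<cdot>\<^sub>K (EK ?i u v (hh j f) \<cdot>\<^sub>K k)
    = ?t \<cdot>\<^sub>K (EK i' (?t \<cdot>\<^sub>K (EK i u (v \<cdot>\<^sub>K i') (hh j f) \<cdot>\<^sub>K s)) v (hh j f) \<cdot>\<^sub>K s')" .
qed

text \<open>By the counit law a square out of \<open>h\<close> can be evaluated on the cofree coalgebra on \<open>h\<close>, where
the lifting operation is available.\<close>

lemma EK_counit:
  assumes "square K h u v h'"
  shows "EK (lft W' h) u (v \<cdot>\<^sub>K rgt W' h) h' \<cdot>\<^sub>K comult W' h = EK h u v h'"
proof -
  note [simp] = assms squareD(1-8)[OF assms]
  have "EK (lft W' h) u (v \<cdot>\<^sub>K rgt W' h) h' \<cdot>\<^sub>K comult W' h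
    = EK h u v h' \<cdot>\<^sub>K (EK (lft W' h) (sK h) (rgt W' h) h \<cdot>\<^sub>K comult W' h)"
    using KW.square_counit[of h] by (subst KW.Qm_comp') simp_all
  then show ?thesis by (simp add: KW.Qm_D)
qed

text \<open>Both the naturality of \<open>theta\<close> and the mate formula for \<open>rho\<close> come from evaluating \<open>theta\<close> at
\<open>j'\<close>, \<open>f'\<close> on the universal problem of \<open>j\<close>, \<open>f\<close>.\<close>

lemma theta_post:
  assumes j: "square M j' b0 b1 j" and f: "square N f f0 f1 f'" and c: "MW.coalg j' t'" and al: "NW.alg f' r'"
  shows "theta j' t' f' r' \<cdot>\<^sub>K EK (hh j f) (H b1 f0) (hmap j f j' f' b0 b1 f0 f1) (hh j' f')
    = tr (QK (hh j f)) (tgt M j') (src N f') (S (lft W' (hh j f), comult W' (hh j f)) (j', t') f' r'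
        (f1 \<cdot>\<^sub>N (yV j f \<cdot>\<^sub>N T (idt K (QK (hh j f))) b1)) (f0 \<cdot>\<^sub>N (bV j f \<cdot>\<^sub>N T (sK (hh j f)) b1))
        (f0 \<cdot>\<^sub>N (cV j f \<cdot>\<^sub>N T (idt K (QK (hh j f))) b0)))"
    and "prob (lft W' (hh j f)) j' f' (f1 \<cdot>\<^sub>N (yV j f \<cdot>\<^sub>N T (idt K (QK (hh j f))) b1)) (f0 \<cdot>\<^sub>N (bV j f
        \<cdot>\<^sub>N T (sK (hh j f)) b1))
        (f0 \<cdot>\<^sub>N (cV j f \<cdot>\<^sub>N T (idt K (QK (hh j f))) b0))"
proof -
  note [simp] = squareD(1-8)[OF j] squareD(1-8)[OF f]
  let ?h = "hh j f"
  have pv: "prob (lft W' ?h) j f (yV j f) (bV j f) (cV j f)"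
    "top (lft W' (hh j f)) j f (bV j f) = idt K (HO (tgt M j) (src N f))"
    "bot (lft W' (hh j f)) j f (yV j f) (cV j f) = rgt W' (hh j f)" by (rule pV; simp)+
  have cf: "KW.coalg (lft W' ?h) (comult W' ?h)" by (rule KW.cofree_coalg) simp
  note pp = prob_post[OF pv(1) j f]
  show "theta j' t' f' r' \<cdot>\<^sub>K EK (hh j f) (H b1 f0) (hmap j f j' f' b0 b1 f0 f1) (hh j' f')
    = tr (QK (hh j f)) (tgt M j') (src N f') (S (lft W' (hh j f), comult W' (hh j f)) (j', t') f' r'
        (f1 \<cdot>\<^sub>N (yV j f \<cdot>\<^sub>N T (idt K (QK (hh j f))) b1)) (f0 \<cdot>\<^sub>N (bV j f \<cdot>\<^sub>N T (sK (hh j f)) b1))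
        (f0 \<cdot>\<^sub>N (cV j f \<cdot>\<^sub>N T (idt K (QK (hh j f))) b0)))"
    using theta_op[OF cf c al pp(1), unfolded pp(2,3) pv(2,3)] EK_counit[OF hmap(6)[OF j f]] hmap(1-3)[OF j f] by simp
  show "prob (lft W' (hh j f)) j' f' (f1 \<cdot>\<^sub>N (yV j f \<cdot>\<^sub>N T (idt K (QK (hh j f))) b1)) (f0 \<cdot>\<^sub>N (bV j f
      \<cdot>\<^sub>N T (sK (hh j f)) b1))
        (f0 \<cdot>\<^sub>N (cV j f \<cdot>\<^sub>N T (idt K (QK (hh j f))) b0))" using pp(1) by simp
qed

lemma theta_map:
  assumes j: "MW.coalg_map j' t' b0 b1 j t" and f: "NW.alg_map f r f0 f1 f' r'"
  shows "KW.alg_map (hh j f) (theta j t f r) (H b1 f0) (hmap j f j' f' b0 b1 f0 f1) (hh j' f') (theta j' t' f' r')"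
proof -
  have sj: "square M j' b0 b1 j" and cj: "MW.coalg j' t'" "MW.coalg j t" using j by (auto simp: MW.coalg_map_def)
  have sf: "square N f f0 f1 f'" and af: "NW.alg f r" "NW.alg f' r'" using f by (auto simp: NW.alg_map_def)
  note [simp] = squareD(1-8)[OF sj] squareD(1-8)[OF sf]
  have h: "hh j f \<in> ar K" by simp
  have pv: "prob (lft W' (hh j f)) j f (yV j f) (bV j f) (cV j f)" by (rule pV) simp_all
  note [simp] = Vd[OF cj(2) af(1)] Vd[OF cj(1) af(2)]
  note cf = KW.cofree_coalg[OF h]
  note [simp] = probD(4-12)[OF pv, simplified]
  have pm: "prob (lft W' (hh j f)) j' f (yV j f \<cdot>\<^sub>N T (idt K (QK (hh j f))) b1) (bV j f \<cdot>\<^sub>N T (sK (hh j f)) b1)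
        (cV j f \<cdot>\<^sub>N T (idt K (QK (hh j f))) b0)"
    using prob_post(1)[OF pv sj N.square_idt[of f]] by simp
  have "S (lft W' (hh j f), comult W' (hh j f)) (j', t') f' r'
        (f1 \<cdot>\<^sub>N (yV j f \<cdot>\<^sub>N T (idt K (QK (hh j f))) b1)) (f0 \<cdot>\<^sub>N (bV j f \<cdot>\<^sub>N T (sK (hh j f)) b1))
        (f0 \<cdot>\<^sub>N (cV j f \<cdot>\<^sub>N T (idt K (QK (hh j f))) b0))
     = f0 \<cdot>\<^sub>N (Vd j t f r \<cdot>\<^sub>N T (idt K (QK (hh j f))) b1)"
    using S_post[OF f cf cj(1) pm] S_mid[OF j cf af(1) pv, folded Vd_def] by simp
  then have "theta j' t' f' r' \<cdot>\<^sub>K EK (hh j f) (H b1 f0) (hmap j f j' f' b0 b1 f0 f1) (hh j' f')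
    = H b1 f0 \<cdot>\<^sub>K theta j t f r"
    using theta_post(1)[OF sj sf cj(1) af(2)] by (simp add: tr_postcomp[of f0] tr_prebm[of b1] theta_def)
  then show ?thesis unfolding KW.alg_map_def using hmap(6)[OF sj sf] theta_alg cj af by simp
qed

text \<open>The transformation \<open>\<rho>\<close> that characterises the lifted hom: the structure at a cofree coalgebra
and a free algebra, restricted along the counit of the one and the unit of the other.\<close>

definition "rho j f = theta (lft W j) (comult W j) (rgt V f) (mult V f) \<cdot>\<^sub>K
  EK (hh j f) (H (rgt W j) (lft V f)) (hmap j f (lft W j) (rgt V f) (sM j) (rgt W j) (lft V f) (tN f))
    (hh (lft W j) (rgt V f))"

lemma rho_mate:
  assumes j: "j \<in> ar M" and f: "f \<in> ar N"
  shows "rho j f = tr (QK (hh j f)) (QM j) (QN f) (S (lft W' (hh j f), comult W' (hh j f))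
      (lft W j, comult W j) (rgt V f) (mult V f)
        (ey j f \<cdot>\<^sub>N T (rgt W' (hh j f)) (rgt W j)) (lft V f \<cdot>\<^sub>N (eb j f \<cdot>\<^sub>N T (sK (hh j f)) (rgt W j)))
        (lft V f \<cdot>\<^sub>N (ec j f \<cdot>\<^sub>N T (rgt W' (hh j f)) (sM j))))"
proof -
  note [simp] = j f
  note [simp] = probD(4-12)[OF p0(1)[OF j f], simplified]
  show ?thesis unfolding rho_def theta_post(1)[OF MW.square_counit[OF j] NW.square_unit[OF f]
      MW.cofree_coalg[OF j] NW.free_alg[OF f]]
    by (simp add: yV_def bV_def cV_def)
qed

lemma rho_simps:
  assumes j[simp]: "j \<in> ar M" and f[simp]: "f \<in> ar N"
  shows "rho j f \<in> ar K" "src K (rho j f) = QK (hh j f)" "tgt K (rho j f) = HO (QM j) (QN f)"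
  unfolding rho_def using theta(1-3)[OF MW.cofree_coalg[OF j] NW.free_alg[OF f]]
     hmap(6)[OF MW.square_counit[OF j] NW.square_unit[OF f]] by simp_all

lemma rho_nat:
  assumes j: "square M j' b0 b1 j" and f: "square N f f0 f1 f'"
  shows "rho j' f' \<cdot>\<^sub>K EK (hh j f) (H b1 f0) (hmap j f j' f' b0 b1 f0 f1) (hh j' f')
    = H (EM j' b0 b1 j) (EN f f0 f1 f') \<cdot>\<^sub>K rho j f"
proof -
  note [simp] = squareD(1-8)[OF j] squareD(1-8)[OF f] j f
  have ja: "j \<in> ar M" "j' \<in> ar M" and fa: "f \<in> ar N" "f' \<in> ar N" by simp_all
  note cu = MW.square_counit[OF ja(1)] MW.square_counit[OF ja(2)] and un
      = NW.square_unit[OF fa(1)] NW.square_unit[OF fa(2)]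
  note h1 = hmap[OF cu(1) un(1)] and h2 = hmap[OF cu(2) un(2)] and h3 = hmap[OF j f]
  note L = MW.square_L[OF j] and R = NW.square_R[OF f]
  note h4 = hmap[OF L R]
  note th = theta(1-3)[OF MW.cofree_coalg[OF ja(1)] NW.free_alg[OF fa(1)]] theta(1-3)[OF MW.cofree_coalg[OF
      ja(2)] NW.free_alg[OF fa(2)]]
  note [simp] = h1(1-3,6) h2(1-3,6) h3(1-3,6) h4(1-3,6) th
  have m: "KW.alg_map (hh (lft W j) (rgt V f)) (theta (lft W j) (comult W j) (rgt V f) (mult V f)) (H
      (EM j' b0 b1 j) (EN f f0 f1 f'))
     (hmap (lft W j) (rgt V f) (lft W j') (rgt V f') b0 (EM j' b0 b1 j) (EN f f0 f1 f') f1)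
     (hh (lft W j') (rgt V f')) (theta (lft W j') (comult W j') (rgt V f') (mult V f'))"
    by (rule theta_map[OF MW.cofree_coalg_map[OF j] NW.free_alg_map[OF f]])
  then have e: "H (EM j' b0 b1 j) (EN f f0 f1 f') \<cdot>\<^sub>K theta (lft W j) (comult W j) (rgt V f) (mult V f)
     = theta (lft W j') (comult W j') (rgt V f') (mult V f')
         \<cdot>\<^sub>K EK (hh (lft W j) (rgt V f)) (H (EM j' b0 b1 j) (EN f f0 f1 f'))
       (hmap (lft W j) (rgt V f) (lft W j') (rgt V f') b0 (EM j' b0 b1 j) (EN f f0 f1 f') f1) (hh (lft W j')
           (rgt V f'))"
    by (simp add: KW.alg_map_def)
  have "H (EM j' b0 b1 j) (EN f f0 f1 f') \<cdot>\<^sub>K rho j f = theta (lft W j') (comult W j') (rgt V f') (mult V f') \<cdot>\<^sub>K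
     (EK (hh (lft W j) (rgt V f)) (H (EM j' b0 b1 j) (EN f f0 f1 f'))
       (hmap (lft W j) (rgt V f) (lft W j') (rgt V f') b0 (EM j' b0 b1 j) (EN f f0 f1 f') f1) (hh (lft W j')
           (rgt V f')) \<cdot>\<^sub>K
      EK (hh j f) (H (rgt W j) (lft V f)) (hmap j f (lft W j) (rgt V f) (sM j) (rgt W j) (lft V f) (tN f))
    (hh (lft W j) (rgt V f)))"
    unfolding rho_def by (rule K.comp_exchange) (simp_all add: e)
  also have "\<dots> = rho j' f' \<cdot>\<^sub>K EK (hh j f) (H b1 f0) (hmap j f j' f' b0 b1 f0 f1) (hh j' f')"
    using hmap_comp[OF cu(1) un(1) L R] hmap_comp[OF j f cu(2) un(2)]
    by (simp add: rho_def KW.Qm_comp MW.R_Qm[OF j] NW.Qm_L[OF f])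
  finally show ?thesis ..
qed

text \<open>The structures of \<open>j\<close> and \<open>f\<close> are maps to the cofree coalgebra and from the free algebra, and
composing them with the counit and the unit used in \<open>rho\<close> gives identities.\<close>

lemma rho_structure:
  assumes j: "MW.coalg j t" and f: "NW.alg f r"
  shows "H t r \<cdot>\<^sub>K rho j f = theta j t f r"
proof -
  note [simp] = MW.coalgD(1-4)[OF j] NW.algD(1-4)[OF f]
  have ja: "j \<in> ar M" and fa: "f \<in> ar N" by simp_all
  note cu = MW.square_counit[OF ja] and un = NW.square_unit[OF fa]
  note mj = MW.coalg_map_structure[OF j] and mf = NW.alg_map_structure[OF f]
  note sj = MW.coalgD(8)[OF j] and sf = NW.algD(8)[OF f]
  note h1 = hmap[OF cu un] and h2 = hmap[OF sj sf]
  note [simp] = h1(1-3,6) h2(1-3,6) theta(1-3)[OF MW.cofree_coalg[OF ja] NW.free_alg[OF fa]] theta(1-3)[OF j f]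
  have e: "H t r \<cdot>\<^sub>K theta (lft W j) (comult W j) (rgt V f) (mult V f) = theta j t f r \<cdot>\<^sub>K
     EK (hh (lft W j) (rgt V f)) (H t r) (hmap (lft W j) (rgt V f) j f (sM j) t r (tN f)) (hh j f)"
    using theta_map[OF mj mf] by (simp add: KW.alg_map_def)
  have "H t r \<cdot>\<^sub>K rho j f = theta j t f r \<cdot>\<^sub>K
     (EK (hh (lft W j) (rgt V f)) (H t r) (hmap (lft W j) (rgt V f) j f (sM j) t r (tN f)) (hh j f) \<cdot>\<^sub>K
      EK (hh j f) (H (rgt W j) (lft V f)) (hmap j f (lft W j) (rgt V f) (sM j) (rgt W j) (lft V f) (tN f))
    (hh (lft W j) (rgt V f)))"
    unfolding rho_def by (rule K.comp_exchange) (simp_all add: e)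
  also have "\<dots> = theta j t f r"
    using hmap_comp[OF cu un sj sf] hmap_idt[OF ja fa] KW.Qm_idt[of "hh j f"]
    by (simp add: KW.Qm_comp MW.coalgD(6)[OF j] NW.algD(6)[OF f])
  finally show ?thesis .
qed

definition "Hlift = structured_lift (prod_cat (op_cat (coalg_cat M W)) (alg_cat N V))
  (pullback_hom M N K (homr A) \<circ>\<^sub>F (forget \<times>\<^sub>F forget)) (\<lambda>(X, Y). theta (fst X) (snd X) (fst Y) (snd Y))"

lemma forget_coalg: "is_functor (coalg_cat M W) (arrow_cat M) forget"
  unfolding MW.coalg_cat_eq
  by (rule forget_functor[OF M.category_arrow_cat MW.category_coalg_cat]) (auto simp: MW.coalg_set dest: MW.coalgD)

lemma forget_alg: "is_functor (alg_cat N V) (arrow_cat N) forget"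
  unfolding NW.alg_cat_eq
  by (rule forget_functor[OF N.category_arrow_cat NW.category_alg_cat]) (auto simp: NW.alg_set dest: NW.algD)

lemma Hlift:
  "is_lifted_functor (prod_cat (op_cat (coalg_cat M W)) (alg_cat N V)) (alg_cat K W')
       (forget \<times>\<^sub>F forget) forget (pullback_hom M N K (homr A)) Hlift"
proof -
  let ?C = "prod_cat (op_cat (coalg_cat M W)) (alg_cat N V)"
  let ?F = "pullback_hom M N K (homr A) \<circ>\<^sub>F (forget \<times>\<^sub>F forget)"
  let ?st = "\<lambda>(X, Y). theta (fst X) (snd X) (fst Y) (snd Y)"
  have F: "is_functor ?C (arrow_cat K) ?F"
    by (rule is_functor_comp[OF is_functor_prod[OF is_functor_op[OF forget_coalg] forget_alg] pullback_hom_functor])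
  have st: "(fob ?F x, ?st x) \<in> KW.alg_set" if "x \<in> ob ?C" for x
    using that theta_alg by (auto simp: KW.alg_set MW.ob_coalg_cat NW.ob_alg_cat)
  have P: "KW.alg_prop (fob ?F (src ?C g), ?st (src ?C g)) (far ?F g) (fob ?F (tgt ?C g), ?st
      (tgt ?C g))" if g: "g \<in> ar ?C" for g
  proof -
    interpret F: is_functor ?C "arrow_cat K" ?F by (rule F)
    obtain X \<alpha> X' Y \<beta> Y' where g': "g = ((X, \<alpha>, X'), (Y, \<beta>, Y'))" by (cases g) auto
    have a: "(X, \<alpha>, X') \<in> ar (coalg_cat M W)" "(Y, \<beta>, Y') \<in> ar (alg_cat N V)" using g g' by auto
    obtain b0 b1 where b: "\<alpha> = Sq (fst X) b0 b1 (fst X')" "MW.coalg_map (fst X) (snd X) b0 b1 (fst X') (snd X')"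
      using a(1) by (auto simp: MW.ar_coalg_cat)
    obtain f0 f1 where f: "\<beta> = Sq (fst Y) f0 f1 (fst Y')" "NW.alg_map (fst Y) (snd Y) f0 f1 (fst Y') (snd Y')"
      using a(2) by (auto simp: NW.ar_alg_cat)
    have st': "src ?C g = (X', Y)" "tgt ?C g = (X, Y')" using g' by (auto simp: MW.coalg_cat_eq NW.alg_cat_eq)
    have ob: "(X', Y) \<in> ob ?C" "(X, Y') \<in> ob ?C" using F.source.ob_simps[OF g] st' by auto
    have h: "far ?F g \<in> hom (arrow_cat K) (fob ?F (X', Y)) (fob ?F (X, Y'))" using F.far_hom[of g] g st'
        by (metis hom_iff)
    have fF: "far ?F g = Sq (hh (fst X') (fst Y)) (H b1 f0) (hmap (fst X') (fst Y) (fst X)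
        (fst Y') b0 b1 f0 f1) (hh (fst X) (fst Y'))"
      by (simp add: g' b(1) f(1) far_pullback_hom)
    show ?thesis unfolding st'
      by (subst KW.alg_prop[OF st[OF ob(1)] st[OF ob(2)]]) (use h theta_map[OF b(2) f(2)] fF in simp_all)
  qed
  show ?thesis unfolding is_lifted_functor_def Hlift_def KW.alg_cat_eq
    using structured_lift[OF F KW.category_alg_cat st P] by simp
qed

lemma Hlift_characterized:
  "characterizes_hom M N K (homr A) (pullback_hom M N K (homr A)) W V W' Hlift (\<lambda>(j, f). rho j f)"
  unfolding characterizes_hom_def
proof (intro conjI)
  let ?C = "prod_cat (op_cat (arrow_cat M)) (arrow_cat N)"
  show "nat_trans ?C K (mid W' \<circ>\<^sub>F pullback_hom M N K (homr A)) (homr A \<circ>\<^sub>F (mid W \<times>\<^sub>F mid V)) (\<lambda>(j, f). rho j f)"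
    unfolding nat_trans_def
  proof (intro conjI ballI)
    show "is_functor ?C K (mid W' \<circ>\<^sub>F pullback_hom M N K (homr A))"
      by (rule is_functor_comp[OF pullback_hom_functor KW.mid_functor])
    show "is_functor ?C K (homr A \<circ>\<^sub>F (mid W \<times>\<^sub>F mid V))"
      by (rule is_functor_comp[OF is_functor_prod[OF is_functor_op[OF MW.mid_functor] NW.mid_functor] H_functor])
    fix x assume "x \<in> ob ?C"
    then show "(case x of (j, f) \<Rightarrow> rho j f) \<in> hom K (fob (mid W' \<circ>\<^sub>F pullback_hom M N K (homr A)) x) (fob
        (homr A \<circ>\<^sub>F (mid W \<times>\<^sub>F mid V)) x)"
      by (cases x) (simp add: rho_simps)
  next
    fix g assume "g \<in> ar ?C"
    then obtain j' b0 b1 j f f0 f1 f' where g: "g = (Sq j' b0 b1 j, Sq f f0 f1 f')" "square M j' b0 b1 j"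
        "square N f f0 f1 f'"
      by (cases g) (auto elim!: arrow_catE)
    show "far (homr A \<circ>\<^sub>F (mid W \<times>\<^sub>F mid V)) g \<cdot>\<^sub>K (case src ?C g of (j, f) \<Rightarrow> rho j f) =
         (case tgt ?C g of (j, f) \<Rightarrow> rho j f) \<cdot>\<^sub>K far (mid W' \<circ>\<^sub>F pullback_hom M N K (homr A)) g"
      by (simp add: g(1) far_pullback_hom rho_nat[OF g(2,3)])
  qed
  show "\<forall>(i, s)\<in>ob (coalg_cat M W). \<forall>(f, r)\<in>ob (alg_cat N V). fob Hlift ((i, s), f, r) =
      (fob (pullback_hom M N K (homr A)) (i, f), H s r \<cdot>\<^sub>K (case (i, f) of (j, f) \<Rightarrow> rho j f))"
    by (auto simp: Hlift_def structured_lift_def MW.ob_coalg_cat NW.ob_alg_cat rho_structure)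
qed

end


section \<open>Canonical solutions for pushout-products of generators\<close>

context tva_target
begin

text \<open>Coalgebra structures on pushout-products solve problems by their canonical solutions, which are
natural and, by the characterisation of composite algebras, solve problems against composites
in stages.\<close>

lemma base_lifting_op:
  assumes \<sigma>: "\<And>x z. x \<in> X \<Longrightarrow> z \<in> Z \<Longrightarrow> NW.coalg (ee (u x) (w z)) (\<sigma> x z)"
    and u: "\<And>x. x \<in> X \<Longrightarrow> u x \<in> ar K" and w: "\<And>z. z \<in> Z \<Longrightarrow> w z \<in> ar M"
    and MX: "\<And>x a a' x' z. (x, a, a', x') \<in> MX \<Longrightarrow> z \<in> Z \<Longrightarrow> x \<in> X \<and> x' \<in> X \<and> square K (u x) a a' (u x') \<and>
      NW.coalg_map (ee (u x) (w z)) (\<sigma> x z) (emap (u x) (w z) (u x') (w z) a a' (sM (w z)) (tM (w z)))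
        (T a' (tM (w z))) (ee (u x') (w z)) (\<sigma> x' z)"
    and MZ: "\<And>z a a' z' x. (z, a, a', z') \<in> MZ \<Longrightarrow> x \<in> X \<Longrightarrow> z \<in> Z \<and> z' \<in> Z \<and> square M (w z) a a' (w z') \<and>
      NW.coalg_map (ee (u x) (w z)) (\<sigma> x z) (emap (u x) (w z) (u x) (w z') (sK (u x)) (tK (u x)) a a')
        (T (tK (u x)) a') (ee (u x) (w z')) (\<sigma> x z')"
  shows "lifting_op X MX u {} Z MZ w {} (\<lambda>x z f r y b c. r \<cdot>\<^sub>N
    (EN (ee (u x) (w z)) (cop (u x) (w z) b c) y f \<cdot>\<^sub>N \<sigma> x z))"
proof -
  have nat: "r \<cdot>\<^sub>N (EN (ee i j) (cop i j (b \<cdot>\<^sub>N T a0 b1) (c \<cdot>\<^sub>N T a1 b0)) (y \<cdot>\<^sub>N T a1 b1) f \<cdot>\<^sub>N s)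
      = (r \<cdot>\<^sub>N (EN (ee i' j') (cop i' j' b c) y f \<cdot>\<^sub>N s')) \<cdot>\<^sub>N T a1 b1"
    if i: "square K i a0 a1 i'" and j: "square M j b0 b1 j'" and p: "prob i' j' f y b c" and f: "NW.alg f r"
      and m: "NW.coalg_map (ee i j) s (emap i j i' j' a0 a1 b0 b1) (T a1 b1) (ee i' j') s'"
    for i j i' j' f r y b c a0 a1 b0 b1 s s'
  proof -
    have c: "NW.coalg (ee i j) s" "NW.coalg (ee i' j') s'"
      and e: "s' \<cdot>\<^sub>N T a1 b1 = EN (ee i j) (emap i j i' j' a0 a1 b0 b1) (T a1 b1) (ee i' j') \<cdot>\<^sub>N s"
      using m by (auto simp: NW.coalg_map_def)
    note [simp] = squareD(1-8)[OF i] squareD(1-8)[OF j] probD(1-12)[OF p] NW.algD(1-4)[OF f] emap[OF i j]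
        prob_cop[OF p]
      NW.coalgD(2-4)[OF c(1)] NW.coalgD(2-4)[OF c(2)]
    show ?thesis by (simp add: e NW.Qm_comp' cop_emap[OF p i j])
  qed
  have cop_comp: "cop i j (a \<cdot>\<^sub>N b) (a \<cdot>\<^sub>N c) = a \<cdot>\<^sub>N cop i j b c"
    if p: "prob i j f y b c" and q: "square N f a a' f'" for i j f y b c a a' f'
  proof -
    note [simp] = probD(1-12)[OF p] prob_cop[OF p] squareD(1-8)[OF q]
    show ?thesis using square_prob_ee(2)[OF _ _ N.square_comp[OF prob_cop(6)[OF p] q]] by simp
  qed
  show ?thesis
  proof (unfold lifting_op_def, intro conjI ballI allI impI)
    fix x z f r y b c assume x: "x \<in> X" "z \<in> Z" and f: "NW.alg f r" and p: "prob (u x) (w z) f y b c"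
    note l = NW.lift_square[OF \<sigma>[OF x] f prob_cop(6)[OF p]]
    note [simp] = u[OF x(1)] w[OF x(2)]
    show "sol (u x) (w z) f y b c (r \<cdot>\<^sub>N (EN (ee (u x) (w z)) (cop (u x) (w z) b c) y f \<cdot>\<^sub>N \<sigma> x z))"
      using sol_ee[OF p] l by simp
  next
    fix x a a' x' z f r y b c
    assume m: "(x, a, a', x') \<in> MX" and z: "z \<in> Z" and f: "NW.alg f r" and p: "prob (u x') (w z) f y b c"
    note M = MX[OF m z]
    show "r \<cdot>\<^sub>N (EN (ee (u x) (w z)) (cop (u x) (w z) (b \<cdot>\<^sub>N T a (tM (w z)))
        (c \<cdot>\<^sub>N T a' (sM (w z)))) (y \<cdot>\<^sub>N T a' (tM (w z))) f \<cdot>\<^sub>N \<sigma> x z)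
      = (r \<cdot>\<^sub>N (EN (ee (u x') (w z)) (cop (u x') (w z) b c) y f \<cdot>\<^sub>N \<sigma> x' z)) \<cdot>\<^sub>N T a' (tM (w z))"
      by (rule nat[OF _ M.square_idt[OF w[OF z]] p f]) (use M in auto)
  next
    fix z a a' z' x f r y b c
    assume m: "(z, a, a', z') \<in> MZ" and x: "x \<in> X" and f: "NW.alg f r" and p: "prob (u x) (w z') f y b c"
    note M = MZ[OF m x]
    show "r \<cdot>\<^sub>N (EN (ee (u x) (w z)) (cop (u x) (w z) (b \<cdot>\<^sub>N T (sK (u x)) a')
        (c \<cdot>\<^sub>N T (tK (u x)) a)) (y \<cdot>\<^sub>N T (tK (u x)) a') f \<cdot>\<^sub>N \<sigma> x z)
      = (r \<cdot>\<^sub>N (EN (ee (u x) (w z')) (cop (u x) (w z') b c) y f \<cdot>\<^sub>N \<sigma> x z')) \<cdot>\<^sub>N T (tK (u x)) a'"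
      by (rule nat[OF K.square_idt[OF u[OF x]] _ p f]) (use M in auto)
  next
    fix f r a a' f' r' x z y b c
    assume m: "NW.alg_map f r a a' f' r'" and x: "x \<in> X" "z \<in> Z" and p: "prob (u x) (w z) f y b c"
    have q: "square N f a a' f'" and al: "NW.alg f r" "NW.alg f' r'" and e: "a \<cdot>\<^sub>N r = r' \<cdot>\<^sub>N EN f a a' f'"
      using m by (auto simp: NW.alg_map_def)
    note [simp] = squareD(1-8)[OF q] q NW.algD(1-4)[OF al(1)] NW.algD(1-4)[OF al(2)] u[OF x(1)] w[OF x(2)]
        prob_cop[OF p]
      NW.coalgD(2-4)[OF \<sigma>[OF x]]
    have "a \<cdot>\<^sub>N (r \<cdot>\<^sub>N (EN (ee (u x) (w z)) (cop (u x) (w z) b c) y f \<cdot>\<^sub>N \<sigma> x z))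
      = r' \<cdot>\<^sub>N (EN f a a' f' \<cdot>\<^sub>N (EN (ee (u x) (w z)) (cop (u x) (w z) b c) y f \<cdot>\<^sub>N \<sigma> x z))"
      by (rule N.comp_exchange) (simp_all add: e)
    then show "r' \<cdot>\<^sub>N (EN (ee (u x) (w z)) (cop (u x) (w z) (a \<cdot>\<^sub>N b) (a \<cdot>\<^sub>N c)) (a' \<cdot>\<^sub>N y) f' \<cdot>\<^sub>N \<sigma> x z)
      = a \<cdot>\<^sub>N (r \<cdot>\<^sub>N (EN (ee (u x) (w z)) (cop (u x) (w z) b c) y f \<cdot>\<^sub>N \<sigma> x z))"
      by (simp add: cop_comp[OF p q] NW.Qm_comp')
  next
    fix f r g t k x z y b c
    assume m: "NW.composite_alg f r g t k" and x: "x \<in> X" "z \<in> Z" and p: "prob (u x) (w z) (g \<cdot>\<^sub>N f) y b c"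
    have a: "NW.alg f r" "NW.alg g t" and fg[simp]: "tgt N f = src N g" using m by (auto simp: NW.composite_alg_def)
    note [simp] = NW.algD(1-4)[OF a(1)] NW.algD(1-4)[OF a(2)]
    have q: "square N (g \<cdot>\<^sub>N f) f (tN g) g" by (simp add: square_def)
    show "k \<cdot>\<^sub>N (EN (ee (u x) (w z)) (cop (u x) (w z) b c) y (g \<cdot>\<^sub>N f) \<cdot>\<^sub>N \<sigma> x z)
      = r \<cdot>\<^sub>N (EN (ee (u x) (w z)) (cop (u x) (w z) b c)
         (t \<cdot>\<^sub>N (EN (ee (u x) (w z)) (cop (u x) (w z) (f \<cdot>\<^sub>N b) (f \<cdot>\<^sub>N c)) y g \<cdot>\<^sub>N \<sigma> x z)) f \<cdot>\<^sub>N \<sigma> x z)"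
      using m \<sigma>[OF x] prob_cop(6)[OF p] unfolding NW.composite_alg_def cop_comp[OF p q] by blast
  qed auto
qed

text \<open>The counit of the adjunction between pushout-product and pullback-hom is the square of the
counit problem, since transposing turns it into the identity square.\<close>

lemma counit_right:
  assumes j: "j \<in> ar M" and f: "f \<in> ar N" and p: "prob (hh j f) j f y b c"
    and t: "top (hh j f) j f b = sK (hh j f)" and bt: "bot (hh j f) j f y c = tK (hh j f)"
  shows "adj_counit (arrow_cat K) (arrow_cat N) (adj_fix_right (arrow_cat M) (arrow_tva K M N A) j) f
    = Sq (ee (hh j f) j) (cop (hh j f) j b c) y f"
proof -
  let ?h = "hh j f"
  have h: "?h \<in> ar K" using j f by simp
  have tr: "transr (arrow_tva K M N A) ?h j f (Sq (ee ?h j) u v f)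
     = Sq ?h (top ?h j f (u \<cdot>\<^sub>N inl ?h j)) (bot ?h j f v (u \<cdot>\<^sub>N inr ?h j)) ?h" for u v
    by (simp add: arrow_tva_def top_def bot_def)
  have hom: "\<gamma> \<in> hom (arrow_cat N) (ee ?h j) f \<longleftrightarrow> (\<exists>u v. \<gamma> = Sq (ee ?h j) u v f \<and> square N (ee ?h j) u v f)" for \<gamma>
    by (cases \<gamma>) auto
  have inj: "inj_on (transr (arrow_tva K M N A) ?h j f) (hom (arrow_cat N) (ee ?h j) f)"
  proof (rule inj_onI)
    fix \<gamma> \<gamma>' assume "\<gamma> \<in> hom (arrow_cat N) (ee ?h j) f" "\<gamma>' \<in> hom (arrow_cat N) (ee ?h j) f"
      and e: "transr (arrow_tva K M N A) ?h j f \<gamma> = transr (arrow_tva K M N A) ?h j f \<gamma>'"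
    then obtain u v u' v' where g: "\<gamma> = Sq (ee ?h j) u v f" "square N (ee ?h j) u v f"
      "\<gamma>' = Sq (ee ?h j) u' v' f" "square N (ee ?h j) u' v' f" unfolding hom by blast
    note q = square_prob_ee[OF h j g(2)] and q' = square_prob_ee[OF h j g(4)]
    have "v = v' \<and> u \<cdot>\<^sub>N inl ?h j = u' \<cdot>\<^sub>N inl ?h j \<and> u \<cdot>\<^sub>N inr ?h j = u' \<cdot>\<^sub>N inr ?h j"
      by (rule prob_eqI[OF q(1) q'(1)]) (use e in \<open>unfold g(1,3) tr sq.inject, blast+\<close>)
    then have "v = v'" "u = u'" using q(2) q'(2) by metis+
    then show "\<gamma> = \<gamma>'" by (simp only: g(1,3))
  qed
  have "inv_into (hom (arrow_cat N) (ee ?h j) f) (transr (arrow_tva K M N A) ?h j f) (idt (arrow_cat K) ?h)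
     = Sq (ee ?h j) (cop ?h j b c) y f"
    by (rule inv_into_f_eq[OF inj])
      (unfold tr hom, use prob_cop[OF p] t bt in \<open>simp_all\<close>)
  then show ?thesis by (simp add: adj_counit_def adj_fix_right_def, simp add: arrow_tva_def)
qed

lemma counit_left:
  assumes i: "i \<in> ar K" and f: "f \<in> ar N"
    and h: "h = fob (pullback_hom K N M (homl A)) (i, f)"
    and p: "prob i h f y b c"
    and t: "tva.top M K N (swap_tva A) h i f c = sM h" and bt: "tva.bot M K N (swap_tva A) h i f y b = tM h"
  shows "adj_counit (arrow_cat M) (arrow_cat N) (adj_fix_left (arrow_cat K) (arrow_tva K M N A) i) f
    = Sq (ee i h) (cop i h b c) y f"
proof -
  interpret sw: tva_target M K N "swap_tva A" V by (rule swap_target)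
  have hM: "h \<in> ar M" using i f sw.hh(1)[of i f] by (simp add: h)
  have tr: "transl (arrow_tva K M N A) i h f (Sq (ee i h) u v f)
     = Sq h (sw.top h i f (u \<cdot>\<^bsub>N\<^esub> inr i h)) (sw.bot h i f v (u \<cdot>\<^bsub>N\<^esub> inl i h)) h" for u v
    by (simp add: arrow_tva_def sw.top_def sw.bot_def h[symmetric])
  have hom: "\<gamma> \<in> hom (arrow_cat N) (ee i h) f \<longleftrightarrow> (\<exists>u v. \<gamma> = Sq (ee i h) u v f \<and> square N (ee i h) u v f)" for \<gamma>
    by (cases \<gamma>) auto
  have inj: "inj_on (transl (arrow_tva K M N A) i h f) (hom (arrow_cat N) (ee i h) f)"
  proof (rule inj_onI)
    fix \<gamma> \<gamma>' assume "\<gamma> \<in> hom (arrow_cat N) (ee i h) f" "\<gamma>' \<in> hom (arrow_cat N) (ee i h) f"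
      and e: "transl (arrow_tva K M N A) i h f \<gamma> = transl (arrow_tva K M N A) i h f \<gamma>'"
    then obtain u v u' v' where g: "\<gamma> = Sq (ee i h) u v f" "square N (ee i h) u v f"
      "\<gamma>' = Sq (ee i h) u' v' f" "square N (ee i h) u' v' f" unfolding hom by blast
    note q = square_prob_ee[OF i hM g(2)] and q' = square_prob_ee[OF i hM g(4)]
    have "v = v' \<and> u \<cdot>\<^bsub>N\<^esub> inr i h = u' \<cdot>\<^bsub>N\<^esub> inr i h \<and> u \<cdot>\<^bsub>N\<^esub> inl i h = u' \<cdot>\<^bsub>N\<^esub> inl i h"
      by (rule sw.prob_eqI[OF q(1)[folded prob_swap] q'(1)[folded prob_swap]])
          (use e in \<open>unfold g(1,3) tr sq.inject, blast+\<close>)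
    then have "v = v'" "u = u'" using q(2) q'(2) by metis+
    then show "\<gamma> = \<gamma>'" by (simp only: g(1,3))
  qed
  have "inv_into (hom (arrow_cat N) (ee i h) f) (transl (arrow_tva K M N A) i h f) (idt (arrow_cat M) h)
     = Sq (ee i h) (cop i h b c) y f"
    by (rule inv_into_f_eq[OF inj])
      (unfold tr hom, use prob_cop[OF p] t bt in \<open>simp_all\<close>)
  then show ?thesis by (simp add: adj_counit_def adj_fix_left_def, simp add: arrow_tva_def h)
qed

end

section \<open>The lifted tensor and the mates\<close>

context tva_full
begin

text \<open>The transformation \<open>\<lambda>\<close>: the solution at two cofree coalgebras and the free algebra on the
pushout-product, for the square that consists of the counits and the unit.\<close>

definition "lam i j = S (lft W' i, comult W' i) (lft W j, comult W j) (rgt V (ee i j)) (mult V (ee i j))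
   (T (rgt W' i) (rgt W j)) (lft V (ee i j) \<cdot>\<^sub>N (inl i j \<cdot>\<^sub>N T (sK i) (rgt W j)))
   (lft V (ee i j) \<cdot>\<^sub>N (inr i j \<cdot>\<^sub>N T (rgt W' i) (sM j)))"

lemma prob_unit:
  assumes i: "i \<in> ar K" and j: "j \<in> ar M"
  shows "prob i j (rgt V (ee i j)) (idt N (TO (tgt K i) (tgt M j))) (lft V (ee i j)
      \<cdot>\<^sub>N inl i j) (lft V (ee i j) \<cdot>\<^sub>N inr i j)"
  using square_prob_ee(1)[OF i j NW.square_unit[of "ee i j"]] i j by simp

lemma prob_counit:
  assumes p: "prob i j f y b c"
  shows "prob (lft W' i) (lft W j) f (y \<cdot>\<^sub>N T (rgt W' i) (rgt W j)) (b \<cdot>\<^sub>N T (sK i) (rgt W j))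
    (c \<cdot>\<^sub>N T (rgt W' i) (sM j))"
proof -
  note [simp] = probD(1-12)[OF p]
  have i: "i \<in> ar K" and j: "j \<in> ar M" and f: "f \<in> ar N" by simp_all
  show ?thesis using prob_post(1)[OF prob_pre(1)[OF p KW.square_counit[OF i]] MW.square_counit[OF j]
      N.square_idt[OF f]] by simp
qed

lemma prob_lam:
  assumes i[simp]: "i \<in> ar K" and j[simp]: "j \<in> ar M"
  shows "prob (lft W' i) (lft W j) (rgt V (ee i j)) (T (rgt W' i) (rgt W j)) (lft V (ee i j) \<cdot>\<^sub>N (inl i j
      \<cdot>\<^sub>N T (sK i) (rgt W j)))
   (lft V (ee i j) \<cdot>\<^sub>N (inr i j \<cdot>\<^sub>N T (rgt W' i) (sM j)))"
  using prob_counit[OF prob_unit[OF assms]] by simp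

lemma lam:
  assumes i[simp]: "i \<in> ar K" and j[simp]: "j \<in> ar M"
  shows "lam i j \<in> ar N" "src N (lam i j) = TO (QK i) (QM j)" "tgt N (lam i j) = QN (ee i j)"
  using solD(1-3)[OF S_sol[OF KW.cofree_coalg[OF i] MW.cofree_coalg[OF j] NW.free_alg[of "ee i j"] prob_lam[OF i j]]]
  by (simp_all add: lam_def)

lemma lam_free:
  assumes p: "prob i j f y b c"
  shows "S (lft W' i, comult W' i) (lft W j, comult W j) (rgt V f) (mult V f) (y \<cdot>\<^sub>N T (rgt W' i) (rgt W j))
     (lft V f \<cdot>\<^sub>N (b \<cdot>\<^sub>N T (sK i) (rgt W j))) (lft V f \<cdot>\<^sub>N (c \<cdot>\<^sub>N T (rgt W' i) (sM j)))
   = EN (ee i j) (cop i j b c) y f \<cdot>\<^sub>N lam i j"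
proof -
  note [simp] = probD(1-12)[OF p] prob_cop(1-3,6)[OF p]
  have i: "i \<in> ar K" and j: "j \<in> ar M" by simp_all
  have b: "cop i j b c \<cdot>\<^sub>N (inl i j \<cdot>\<^sub>N m) = b \<cdot>\<^sub>N m" if "m \<in> ar N" "tgt N m = TO (src K i) (tgt M j)" for m
    using that N.comp_reduce[OF prob_cop(4)[OF p], of m] by simp
  have c: "cop i j b c \<cdot>\<^sub>N (inr i j \<cdot>\<^sub>N m) = c \<cdot>\<^sub>N m" if "m \<in> ar N" "tgt N m = TO (tgt K i) (src M j)" for m
    using that N.comp_reduce[OF prob_cop(5)[OF p], of m] by simp
  show ?thesis
    using S_post[OF NW.free_alg_map[OF prob_cop(6)[OF p]] KW.cofree_coalg[OF i] MW.cofree_coalg[OF j]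
        prob_lam[OF i j], folded lam_def]
    by (simp add: b c NW.Qm_L')
qed

text \<open>Restricting \<open>\<lambda>\<close> along the structures of two coalgebras gives the solution for the unit square
of their pushout-product, by naturality in the coalgebra maps into the cofree coalgebras.\<close>

lemma lam_coalg:
  assumes i: "KW.coalg i s" and j: "MW.coalg j t"
  shows "lam i j \<cdot>\<^sub>N T s t = S (i, s) (j, t) (rgt V (ee i j)) (mult V (ee i j)) (idt N (TO (tgt K i) (tgt M j)))
    (lft V (ee i j) \<cdot>\<^sub>N inl i j) (lft V (ee i j) \<cdot>\<^sub>N inr i j)"
proof -
  note [simp] = KW.coalgD(1-4)[OF i] MW.coalgD(1-4)[OF j]
  have ij: "i \<in> ar K" "j \<in> ar M" by simp_all
  have al: "NW.alg (rgt V (ee i j)) (mult V (ee i j))" by (rule NW.free_alg) simp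
  note pl = prob_lam[OF ij]
  note mi = KW.coalg_map_structure[OF i] and mj = MW.coalg_map_structure[OF j]
  have pm: "prob i (lft W j) (rgt V (ee i j)) (T (tK i) (rgt W j))
     (lft V (ee i j) \<cdot>\<^sub>N (inl i j \<cdot>\<^sub>N T (sK i) (rgt W j))) (lft V (ee i j) \<cdot>\<^sub>N inr i j)"
    using prob_pre(1)[OF pl KW.coalgD(8)[OF i]] by (simp add: KW.coalgD(6)[OF i])
  have 1: "S (i, s) (lft W j, comult W j) (rgt V (ee i j)) (mult V (ee i j)) (T (tK i) (rgt W j))
     (lft V (ee i j) \<cdot>\<^sub>N (inl i j \<cdot>\<^sub>N T (sK i) (rgt W j))) (lft V (ee i j) \<cdot>\<^sub>N inr i j)
    = lam i j \<cdot>\<^sub>N T s (idt M (QM j))"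
    using S_pre[OF mi MW.cofree_coalg[OF ij(2)] al pl, folded lam_def] by (simp add: KW.coalgD(6)[OF i])
  show ?thesis
    using S_mid[OF mj i al pm] by (simp add: 1 MW.coalgD(6)[OF j] lam[OF ij])
qed

text \<open>Every problem against an algebra factors through the unit square of the pushout-product followed
by an algebra map out of the free algebra, so \<open>S\<close> is given by \<open>\<lambda>\<close>: its values are the canonical
solutions for the structure \<open>\<lambda> \<cdot> (s \<otimes> t)\<close>.\<close>

lemma S_formula:
  assumes i: "KW.coalg i s" and j: "MW.coalg j t" and f: "NW.alg f r" and p: "prob i j f y b c"
  shows "S (i, s) (j, t) f r y b c = r \<cdot>\<^sub>N (EN (ee i j) (cop i j b c) y f \<cdot>\<^sub>N (lam i j \<cdot>\<^sub>N T s t))"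
proof -
  note [simp] = probD(1-12)[OF p] prob_cop(1-3,6)[OF p] KW.coalgD(2-4)[OF i] MW.coalgD(2-4)[OF j] NW.algD(1-4)[OF f]
  have ij: "i \<in> ar K" "j \<in> ar M" by simp_all
  have m: "NW.alg_map (rgt V (ee i j)) (mult V (ee i j)) (r \<cdot>\<^sub>N EN (ee i j) (cop i j b c) y f) y f r"
    using NW.alg_map_comp[OF NW.free_alg_map[OF prob_cop(6)[OF p]] NW.alg_map_structure[OF f]] by simp
  have u: "r \<cdot>\<^sub>N (EN (ee i j) (cop i j b c) y f \<cdot>\<^sub>N (lft V (ee i j) \<cdot>\<^sub>N m)) = cop i j b c \<cdot>\<^sub>N m"
    if "m \<in> ar N" "tgt N m = PD i j" for m
    using that N.comp_reduce[OF NW.algD(6)[OF f], of "cop i j b c \<cdot>\<^sub>N m"] by (simp add: NW.Qm_L')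
  show ?thesis
    using S_post[OF m i j prob_unit[OF ij], folded lam_coalg[OF i j]]
    by (simp add: u prob_cop(4,5)[OF p] lam[OF ij])
qed

lemma lam_nat:
  assumes i: "square K i a0 a1 i'" and j: "square M j b0 b1 j'"
  shows "EN (ee i j) (emap i j i' j' a0 a1 b0 b1) (T a1 b1) (ee i' j') \<cdot>\<^sub>N lam i j
    = lam i' j' \<cdot>\<^sub>N T (EK i a0 a1 i') (EM j b0 b1 j')"
proof -
  note [simp] = i j squareD(1-8)[OF i] squareD(1-8)[OF j]
  have ij: "i \<in> ar K" "j \<in> ar M" and ij': "i' \<in> ar K" "j' \<in> ar M" by simp_all
  let ?e = "ee i j" and ?e' = "ee i' j'" and ?m = "emap i j i' j' a0 a1 b0 b1"
  note em = emap[OF i j]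
  note [simp] = em(1-3,6) lam[OF ij] lam[OF ij']
  have al: "NW.alg (rgt V ?e') (mult V ?e')" by (rule NW.free_alg) simp
  note pl = prob_lam[OF ij'] and mi = KW.cofree_coalg_map[OF i] and mj = MW.cofree_coalg_map[OF j]
  let ?y = "T (rgt W' i') (rgt W j')" and ?b = "lft V ?e' \<cdot>\<^sub>N (inl i' j' \<cdot>\<^sub>N T (sK i') (rgt W j'))"
    and ?c = "lft V ?e' \<cdot>\<^sub>N (inr i' j' \<cdot>\<^sub>N T (rgt W' i') (sM j'))"
  have pm: "prob (lft W' i) (lft W j') (rgt V ?e') (?y \<cdot>\<^sub>N T (EK i a0 a1 i') (idt M (QM j')))
      (?b \<cdot>\<^sub>N T a0 (idt M (QM j'))) (?c \<cdot>\<^sub>N T (EK i a0 a1 i') (sM j'))"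
    using prob_pre(1)[OF pl KW.square_L[OF i]] by simp
  have 1: "S (lft W' i, comult W' i) (lft W j', comult W j') (rgt V ?e') (mult V ?e')
      (?y \<cdot>\<^sub>N T (EK i a0 a1 i') (idt M (QM j')))
      (?b \<cdot>\<^sub>N T a0 (idt M (QM j'))) (?c \<cdot>\<^sub>N T (EK i a0 a1 i') (sM j'))
          = lam i' j' \<cdot>\<^sub>N T (EK i a0 a1 i') (idt M (QM j'))"
    using S_pre[OF mi MW.cofree_coalg[OF ij'(2)] al pl, folded lam_def] by simp
  have 2: "S (lft W' i, comult W' i) (lft W j, comult W j) (rgt V ?e') (mult V ?e')
      (T (a1 \<cdot>\<^sub>K rgt W' i) (b1 \<cdot>\<^sub>M rgt W j))
      (lft V ?e' \<cdot>\<^sub>N (inl i' j' \<cdot>\<^sub>N T a0 (b1 \<cdot>\<^sub>M rgt W j)))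
      (lft V ?e' \<cdot>\<^sub>N (inr i' j' \<cdot>\<^sub>N T (a1 \<cdot>\<^sub>K rgt W' i) b0))
    = lam i' j' \<cdot>\<^sub>N T (EK i a0 a1 i') (EM j b0 b1 j')"
    using S_mid[OF mj KW.cofree_coalg[OF ij(1)] al pm, unfolded 1] by (simp add: KW.R_Qm MW.R_Qm)
  have b: "?m \<cdot>\<^sub>N (inl i j \<cdot>\<^sub>N m) = inl i' j' \<cdot>\<^sub>N (T a0 b1 \<cdot>\<^sub>N m)" if "m \<in> ar N" "tgt N m
      = TO (src K i) (tgt M j)" for m
    using that N.comp_exchange[OF em(4), of m] by simp
  have c: "?m \<cdot>\<^sub>N (inr i j \<cdot>\<^sub>N m) = inr i' j' \<cdot>\<^sub>N (T a1 b0 \<cdot>\<^sub>N m)" if "m \<in> ar N" "tgt N m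
      = TO (tgt K i) (src M j)" for m
    using that N.comp_exchange[OF em(5), of m] by simp
  have "S (lft W' i, comult W' i) (lft W j, comult W j) (rgt V ?e') (mult V ?e')
      (T a1 b1 \<cdot>\<^sub>N T (rgt W' i) (rgt W j))
      (EN ?e ?m (T a1 b1) ?e' \<cdot>\<^sub>N (lft V ?e \<cdot>\<^sub>N (inl i j \<cdot>\<^sub>N T (sK i) (rgt W j))))
      (EN ?e ?m (T a1 b1) ?e' \<cdot>\<^sub>N (lft V ?e \<cdot>\<^sub>N (inr i j \<cdot>\<^sub>N T (rgt W' i) (sM j))))
    = EN ?e ?m (T a1 b1) ?e' \<cdot>\<^sub>N lam i j"
    unfolding lam_def by (rule S_post[OF NW.free_alg_map[OF em(6)] KW.cofree_coalg[OF ij(1)]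
        MW.cofree_coalg[OF ij(2)] prob_lam[OF ij]])
  then show ?thesis using 2 by (simp add: b c NW.Qm_L')
qed

text \<open>The (co)unit laws say that the value of \<open>S\<close> at the unit square is a solution; coassociativity
follows from the criterion, because \<open>S\<close> respects composite algebras.\<close>

lemma tensor_coalg:
  assumes i: "KW.coalg i s" and j: "MW.coalg j t"
  shows "NW.coalg (ee i j) (lam i j \<cdot>\<^sub>N T s t)"
proof (rule NW.coalg_criterion)
  note [simp] = KW.coalgD(1-4)[OF i] MW.coalgD(1-4)[OF j]
  have ij: "i \<in> ar K" "j \<in> ar M" by simp_all
  let ?e = "ee i j" and ?\<sigma> = "lam i j \<cdot>\<^sub>N T s t"
  show e: "?e \<in> ar N" by simp
  note [simp] = lam[OF ij]
  show "?\<sigma> \<in> hom N (tgt N ?e) (QN ?e)" by simp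
  note p = prob_unit[OF ij]
  have "sol i j (rgt V ?e) (idt N (TO (tgt K i) (tgt M j))) (lft V ?e \<cdot>\<^sub>N inl i j) (lft V ?e \<cdot>\<^sub>N inr i j) ?\<sigma>"
    unfolding lam_coalg[OF i j] by (rule S_sol[OF i j NW.free_alg[OF e] p])
  then have "?\<sigma> \<cdot>\<^sub>N ?e = cop i j (lft V ?e \<cdot>\<^sub>N inl i j) (lft V ?e \<cdot>\<^sub>N inr i j)
     \<and> rgt V ?e \<cdot>\<^sub>N ?\<sigma> = idt N (TO (tgt K i) (tgt M j))"
    by (subst (asm) sol_ee[OF p]) simp_all
  then show "?\<sigma> \<cdot>\<^sub>N ?e = lft V ?e" "rgt V ?e \<cdot>\<^sub>N ?\<sigma> = tN ?e"
    using square_prob_ee(2)[OF ij NW.square_unit[OF e]] by simp_all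
  fix f r g t' c u v assume cc: "NW.composite_alg f r g t' c" and q: "square N ?e u v (g \<cdot>\<^sub>N f)"
  have a: "NW.alg f r" "NW.alg g t'" "NW.alg (g \<cdot>\<^sub>N f) c" and fg[simp]: "tgt N f = src N g" using cc
      by (auto simp: NW.composite_alg_def)
  note [simp] = NW.algD(1-4)[OF a(1)] NW.algD(1-4)[OF a(2)] squareD(3,4)[OF q] squareD(5-8)[OF q, simplified]
  note P = square_prob_ee[OF ij q]
  have qg: "square N ?e (f \<cdot>\<^sub>N u) v g" using squareD(9)[OF q] by (simp add: square_def)
  note Pg = square_prob_ee[OF ij qg]
  have fi: "(f \<cdot>\<^sub>N u) \<cdot>\<^sub>N inl i j = f \<cdot>\<^sub>N (u \<cdot>\<^sub>N inl i j)" "(f \<cdot>\<^sub>N u) \<cdot>\<^sub>N inr i j = f \<cdot>\<^sub>N (u \<cdot>\<^sub>N inr i j)" by simp_all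
  let ?d = "S (i, s) (j, t) g t' v (f \<cdot>\<^sub>N (u \<cdot>\<^sub>N inl i j)) (f \<cdot>\<^sub>N (u \<cdot>\<^sub>N inr i j))"
  have d: "?d = t' \<cdot>\<^sub>N (EN ?e (f \<cdot>\<^sub>N u) v g \<cdot>\<^sub>N ?\<sigma>)"
    using S_formula[OF i j a(2) Pg(1)] unfolding Pg(2) unfolding fi .
  note D = solD[OF S_sol[OF i j a(2) Pg(1)[unfolded fi]]]
  have sd: "sol i j g v (f \<cdot>\<^sub>N (u \<cdot>\<^sub>N inl i j)) (f \<cdot>\<^sub>N (u \<cdot>\<^sub>N inr i j)) ?d"
      by (rule S_sol[OF i j a(2) Pg(1)[unfolded fi]])
  have "?d \<cdot>\<^sub>N ?e = f \<cdot>\<^sub>N u" using sd sol_ee[OF Pg(1)[unfolded fi] D(1-3)] Pg(2)[unfolded fi] by simp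
  then have qd: "square N ?e u ?d f" using D(1-3) by (simp add: square_def)
  note Pf = square_prob_ee[OF ij qd]
  have "c \<cdot>\<^sub>N (EN ?e u v (g \<cdot>\<^sub>N f) \<cdot>\<^sub>N ?\<sigma>) = S (i, s) (j, t) (g \<cdot>\<^sub>N f) c v (u \<cdot>\<^sub>N inl i j) (u \<cdot>\<^sub>N inr i j)"
    using S_formula[OF i j a(3) P(1)] P(2) by simp
  also have "\<dots> = S (i, s) (j, t) f r ?d (u \<cdot>\<^sub>N inl i j) (u \<cdot>\<^sub>N inr i j)" by (rule S_comp3[OF cc i j P(1)])
  also have "\<dots> = r \<cdot>\<^sub>N (EN ?e u ?d f \<cdot>\<^sub>N ?\<sigma>)" using S_formula[OF i j a(1) Pf(1)] Pf(2) by simp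
  finally show "c \<cdot>\<^sub>N (EN ?e u v (g \<cdot>\<^sub>N f) \<cdot>\<^sub>N ?\<sigma>)
     = r \<cdot>\<^sub>N (EN ?e u (t' \<cdot>\<^sub>N (EN ?e (f \<cdot>\<^sub>N u) v g \<cdot>\<^sub>N ?\<sigma>)) f \<cdot>\<^sub>N ?\<sigma>)" by (simp only: d)
qed

lemma tensor_coalg_map:
  assumes i: "KW.coalg_map i s a0 a1 i' s'" and j: "MW.coalg_map j t b0 b1 j' t'"
  shows "NW.coalg_map (ee i j) (lam i j \<cdot>\<^sub>N T s t) (emap i j i' j' a0 a1 b0 b1) (T a1 b1) (ee i' j')
      (lam i' j' \<cdot>\<^sub>N T s' t')"
proof -
  have i1: "square K i a0 a1 i'" "KW.coalg i s" "KW.coalg i' s'" "s' \<cdot>\<^sub>K a1 = EK i a0 a1 i' \<cdot>\<^sub>K s"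
    using i by (auto simp: KW.coalg_map_def)
  have j1: "square M j b0 b1 j'" "MW.coalg j t" "MW.coalg j' t'" "t' \<cdot>\<^sub>M b1 = EM j b0 b1 j' \<cdot>\<^sub>M t"
    using j by (auto simp: MW.coalg_map_def)
  note [simp] = i1(1) j1(1) squareD(1-8)[OF i1(1)] squareD(1-8)[OF j1(1)] KW.coalgD(2-4)[OF i1(2)]
      KW.coalgD(2-4)[OF i1(3)]
     MW.coalgD(2-4)[OF j1(2)] MW.coalgD(2-4)[OF j1(3)] emap[OF i1(1) j1(1)]
  have ij: "i \<in> ar K" "j \<in> ar M" and ij': "i' \<in> ar K" "j' \<in> ar M" by simp_all
  note [simp] = lam[OF ij] lam[OF ij']
  have "EN (ee i j) (emap i j i' j' a0 a1 b0 b1) (T a1 b1) (ee i' j') \<cdot>\<^sub>N (lam i j \<cdot>\<^sub>N T s t)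
     = lam i' j' \<cdot>\<^sub>N (T (EK i a0 a1 i') (EM j b0 b1 j') \<cdot>\<^sub>N T s t)"
    by (rule N.comp_exchange) (simp_all add: lam_nat[OF i1(1) j1(1)])
  then show ?thesis using tensor_coalg[OF i1(2) j1(2)] tensor_coalg[OF i1(3) j1(3)]
    by (simp add: NW.coalg_map_def i1(4) j1(4))
qed

definition "Tlift = structured_lift (prod_cat (coalg_cat K W') (coalg_cat M W))
  (pushout_product K M N (tensor A) \<circ>\<^sub>F (forget \<times>\<^sub>F forget)) (\<lambda>(X, Y). lam (fst X) (fst Y) \<cdot>\<^sub>N T (snd X) (snd Y))"

lemma forget_coalg': "is_functor (coalg_cat K W') (arrow_cat K) forget"
  unfolding KW.coalg_cat_eq
  by (rule forget_functor[OF K.category_arrow_cat KW.category_coalg_cat]) (auto simp: KW.coalg_set dest: KW.coalgD)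

lemma Tlift:
  "is_lifted_functor (prod_cat (coalg_cat K W') (coalg_cat M W)) (coalg_cat N V)
       (forget \<times>\<^sub>F forget) forget (pushout_product K M N (tensor A)) Tlift"
proof -
  let ?C = "prod_cat (coalg_cat K W') (coalg_cat M W)"
  let ?F = "pushout_product K M N (tensor A) \<circ>\<^sub>F (forget \<times>\<^sub>F forget)"
  let ?st = "\<lambda>(X, Y). lam (fst X) (fst Y) \<cdot>\<^sub>N T (snd X) (snd Y)"
  have F: "is_functor ?C (arrow_cat N) ?F"
    by (rule is_functor_comp[OF is_functor_prod[OF forget_coalg' forget_coalg] pushout_product_functor])
  have st: "(fob ?F x, ?st x) \<in> NW.coalg_set" if "x \<in> ob ?C" for x
    using that tensor_coalg by (auto simp: NW.coalg_set KW.ob_coalg_cat MW.ob_coalg_cat)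
  have P: "NW.coalg_prop (fob ?F (src ?C g), ?st (src ?C g)) (far ?F g) (fob ?F (tgt ?C g), ?st
      (tgt ?C g))" if g: "g \<in> ar ?C" for g
  proof -
    interpret F: is_functor ?C "arrow_cat N" ?F by (rule F)
    obtain X \<alpha> X' Y \<beta> Y' where g': "g = ((X, \<alpha>, X'), (Y, \<beta>, Y'))" by (cases g) auto
    have a: "(X, \<alpha>, X') \<in> ar (coalg_cat K W')" "(Y, \<beta>, Y') \<in> ar (coalg_cat M W)" using g g' by auto
    obtain a0 a1 where b: "\<alpha> = Sq (fst X) a0 a1 (fst X')" "KW.coalg_map (fst X) (snd X) a0 a1 (fst X') (snd X')"
      using a(1) by (auto simp: KW.ar_coalg_cat)
    obtain b0 b1 where f: "\<beta> = Sq (fst Y) b0 b1 (fst Y')" "MW.coalg_map (fst Y) (snd Y) b0 b1 (fst Y') (snd Y')"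
      using a(2) by (auto simp: MW.ar_coalg_cat)
    have st': "src ?C g = (X, Y)" "tgt ?C g = (X', Y')" using g' by (auto simp: MW.coalg_cat_eq KW.coalg_cat_eq)
    have ob: "(X, Y) \<in> ob ?C" "(X', Y') \<in> ob ?C" using F.source.ob_simps[OF g] st' by auto
    have h: "far ?F g \<in> hom (arrow_cat N) (fob ?F (X, Y)) (fob ?F (X', Y'))" using F.far_hom[of g] g st'
        by (metis hom_iff)
    have fF: "far ?F g = Sq (ee (fst X) (fst Y)) (emap (fst X) (fst Y) (fst X') (fst Y') a0 a1 b0 b1)
        (T a1 b1) (ee (fst X') (fst Y'))"
      by (simp add: g' b(1) f(1) far_pushout_product)
    show ?thesis unfolding st'
      by (subst NW.coalg_prop[OF st[OF ob(1)] st[OF ob(2)]]) (use h tensor_coalg_map[OF b(2) f(2)] fF in simp_all)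
  qed
  show ?thesis unfolding is_lifted_functor_def Tlift_def NW.coalg_cat_eq
    using structured_lift[OF F NW.category_coalg_cat st P] by simp
qed

lemma Tlift_characterized: "characterizes_tensor K M N A W' W V Tlift (\<lambda>(i, j). lam i j)"
  unfolding characterizes_tensor_def
proof (intro conjI)
  let ?C = "prod_cat (arrow_cat K) (arrow_cat M)"
  have t: "tensor (arrow_tva K M N A) = pushout_product K M N (tensor A)" by (simp add: arrow_tva_def)
  show "nat_trans ?C N (tensor A \<circ>\<^sub>F (mid W' \<times>\<^sub>F mid W)) (mid V \<circ>\<^sub>F tensor (arrow_tva K M N A)) (\<lambda>(i, j). lam i j)"
    unfolding nat_trans_def t
  proof (intro conjI ballI)
    show "is_functor ?C N (mid V \<circ>\<^sub>F pushout_product K M N (tensor A))"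
      by (rule is_functor_comp[OF pushout_product_functor NW.mid_functor])
    show "is_functor ?C N (tensor A \<circ>\<^sub>F (mid W' \<times>\<^sub>F mid W))"
      by (rule is_functor_comp[OF is_functor_prod[OF KW.mid_functor MW.mid_functor] T_functor])
    fix x assume "x \<in> ob ?C"
    then show "(case x of (i, j) \<Rightarrow> lam i j) \<in> hom N (fob (tensor A \<circ>\<^sub>F (mid W' \<times>\<^sub>F mid W)) x) (fob
        (mid V \<circ>\<^sub>F pushout_product K M N (tensor A)) x)"
      by (cases x) (simp add: lam)
  next
    fix g assume "g \<in> ar ?C"
    then obtain i a0 a1 i' j b0 b1 j' where g: "g = (Sq i a0 a1 i', Sq j b0 b1 j')" "square K i a0 a1 i'"
        "square M j b0 b1 j'"
      by (cases g) (auto elim!: arrow_catE)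
    show "far (mid V \<circ>\<^sub>F pushout_product K M N (tensor A)) g \<cdot>\<^sub>N (case src ?C g of (i, j) \<Rightarrow> lam i j) =
         (case tgt ?C g of (i, j) \<Rightarrow> lam i j) \<cdot>\<^sub>N far (tensor A \<circ>\<^sub>F (mid W' \<times>\<^sub>F mid W)) g"
      by (simp add: g(1) far_pushout_product lam_nat[OF g(2,3)])
  qed
  show "\<forall>(i, s)\<in>ob (coalg_cat K W'). \<forall>(j, t)\<in>ob (coalg_cat M W). fob Tlift ((i, s), j, t) =
      (fob (tensor (arrow_tva K M N A)) (i, j), (case (i, j) of (i, j) \<Rightarrow> lam i j) \<cdot>\<^sub>N T s t)"
    by (auto simp: Tlift_def structured_lift_def t)
qed

text \<open>Both sides are the transpose of the solution at cofree coalgebras and a free algebra of the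
counit problem, once computed through the algebra structure on the pullback-hom and once
through \<open>\<lambda>\<close>.\<close>

lemma mates_right:
  assumes j: "j \<in> ar M"
  shows "are_mates (arrow_cat K) (arrow_cat N) K N
        (adj_fix_right (arrow_cat M) (arrow_tva K M N A) j) (adj_fix_right M A (QM j))
        (mid W') (mid V) (\<lambda>i. lam i j) (\<lambda>f. rho j f)"
  unfolding are_mates_def
proof
  fix f assume "f \<in> ob (arrow_cat N)"
  then have f: "f \<in> ar N" by simp
  let ?h = "hh j f"
  have h: "?h \<in> ar K" using j f by simp
  note p = p0[OF j f]
  have c: "adj_counit (arrow_cat K) (arrow_cat N) (adj_fix_right (arrow_cat M) (arrow_tva K M N A) j) f
    = Sq (ee ?h j) (cop ?h j (eb j f) (ec j f)) (ey j f) f"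
    by (rule counit_right[OF j f p(1)]) (use p j f in simp_all)
  have r: "fob (radj (adj_fix_right (arrow_cat M) (arrow_tva K M N A) j)) f = ?h"
    by (simp add: adj_fix_right_def arrow_tva_def)
  note [simp] = prob_cop(1-3,6)[OF p(1)] lam[OF h j] j f h
  show "rho j f = far (radj (adj_fix_right M A (QM j))) (far (mid V) (adj_counit (arrow_cat K) (arrow_cat N)
      (adj_fix_right (arrow_cat M) (arrow_tva K M N A) j) f)) \<cdot>\<^sub>K
    far (radj (adj_fix_right M A (QM j))) (lam (fob (radj (adj_fix_right (arrow_cat M)
        (arrow_tva K M N A) j)) f) j) \<cdot>\<^sub>K
    adj_unit N (adj_fix_right M A (QM j)) (QK (fob (radj (adj_fix_right (arrow_cat M) (arrow_tva K M N A) j)) f))"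
    unfolding r c rho_mate[OF j f] lam_free[OF p(1)]
    using tr_postcomp[of "EN (ee ?h j) (cop ?h j (eb j f) (ec j f)) (ey j f) f
        \<cdot>\<^sub>N lam ?h j" "QK ?h" "QM j" "idt N (TO (QK ?h) (QM j))" "QN f"]
    by (simp add: adj_fix_right_def adj_unit_def)
qed

text \<open>As for the right-hand mates, with \<open>rho\<close> taken for the exchanged variables.\<close>

lemma mates_left:
  assumes i: "i \<in> ar K"
  shows "are_mates (arrow_cat M) (arrow_cat N) M N
        (adj_fix_left (arrow_cat K) (arrow_tva K M N A) i) (adj_fix_left K A (QK i))
        (mid W) (mid V) (\<lambda>j. lam i j)
        (\<lambda>f. tva_full.rho M K N (swap_tva A) V W W' (\<lambda>z x f r y c b. S x z f r y b c) i f)"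
  unfolding are_mates_def
proof
  interpret sw: tva_full M K N "swap_tva A" V W W' "\<lambda>z x f r y c b. S x z f r y b c" by (rule swap_full)
  fix f assume "f \<in> ob (arrow_cat N)"
  then have f: "f \<in> ar N" by simp
  define h where "h = fob (pullback_hom K N M (homl A)) (i, f)"
  have h: "h \<in> ar M" and hs: "sw.hh i f = h" using i f sw.hh(1)[of i f] by (simp_all add: h_def)
  note p = sw.p0[OF i f, unfolded hs]
  have p1: "prob i h f (sw.ey i f) (sw.ec i f) (sw.eb i f)" using p(1) by (simp add: prob_swap)
  have c: "adj_counit (arrow_cat M) (arrow_cat N) (adj_fix_left (arrow_cat K) (arrow_tva K M N A) i) f
    = Sq (ee i h) (cop i h (sw.ec i f) (sw.eb i f)) (sw.ey i f) f"
    by (rule counit_left[OF i f h_def p1]) (use p sw.hh[OF i f, unfolded hs] in simp_all)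
  have r: "fob (radj (adj_fix_left (arrow_cat K) (arrow_tva K M N A) i)) f = h"
    by (simp add: adj_fix_left_def arrow_tva_def h_def)
  note [simp] = prob_cop(1-3,6)[OF p1] lam[OF i h] i f h
  have m: "sw.rho i f = sw.tr (QM h) (QK i) (QN f) (EN (ee i h) (cop i h (sw.ec i f) (sw.eb i f))
      (sw.ey i f) f \<cdot>\<^bsub>N\<^esub> lam i h)"
    using sw.rho_mate[OF i f, unfolded hs] lam_free[OF p1] by simp
  have m': "sw.tr (QM h) (QK i) (QN f) (EN (ee i h) (cop i h (sw.ec i f) (sw.eb i f)) (sw.ey i f) f \<cdot>\<^bsub>N\<^esub> lam i h)
    = sw.H (idt K (QK i)) (EN (ee i h) (cop i h (sw.ec i f) (sw.eb i f)) (sw.ey i f) f \<cdot>\<^bsub>N\<^esub> lam i h) \<cdot>\<^bsub>M\<^esub>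
      sw.tr (QM h) (QK i) (TO (QK i) (QM h)) (idt N (TO (QK i) (QM h)))"
    using sw.tr_postcomp[of "EN (ee i h) (cop i h (sw.ec i f) (sw.eb i f)) (sw.ey i f) f
        \<cdot>\<^bsub>N\<^esub> lam i h" "QM h" "QK i" "idt N (TO (QK i) (QM h))" "QN f"]
    by simp
  have m'': "sw.H (idt K (QK i)) (EN (ee i h) (cop i h (sw.ec i f) (sw.eb i f)) (sw.ey i f) f \<cdot>\<^bsub>N\<^esub> lam i h)
    = sw.H (idt K (QK i)) (EN (ee i h) (cop i h (sw.ec i f) (sw.eb i f)) (sw.ey i f) f)
        \<cdot>\<^bsub>M\<^esub> sw.H (idt K (QK i)) (lam i h)"
    by (subst sw.H_comp) simp_all
  have t: "sw.tr (QM h) (QK i) (TO (QK i) (QM h)) (idt N (TO (QK i) (QM h))) \<in> ar M"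
    "tgt M (sw.tr (QM h) (QK i) (TO (QK i) (QM h)) (idt N (TO (QK i) (QM h)))) = sw.HO (QK i) (TO (QK i) (QM h))"
    by (rule sw.tr_simps; simp)+
  show "sw.rho i f = far (radj (adj_fix_left K A (QK i))) (far (mid V) (adj_counit (arrow_cat M)
      (arrow_cat N) (adj_fix_left (arrow_cat K) (arrow_tva K M N A) i) f)) \<cdot>\<^bsub>M\<^esub>
    far (radj (adj_fix_left K A (QK i))) (lam i (fob (radj (adj_fix_left (arrow_cat K)
        (arrow_tva K M N A) i)) f)) \<cdot>\<^bsub>M\<^esub>
    adj_unit N (adj_fix_left K A (QK i)) (QM (fob (radj (adj_fix_left (arrow_cat K) (arrow_tva K M N A) i)) f))"
    unfolding r c m m' m'' using t sw.H_simps(2-4)[of "idt K (QK i)"]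
    by (simp add: adj_fix_left_def adj_unit_def)
qed

theorem full_forms: "forms_two_variable_adjunction_of_awfs K M N A W' W V"
proof -
  interpret sw: tva_full M K N "swap_tva A" V W W' "\<lambda>z x f r y c b. S x z f r y b c" by (rule swap_full)
  have t: "tensor (arrow_tva K M N A) = pushout_product K M N (tensor A)"
    "homl (arrow_tva K M N A) = pullback_hom K N M (homl A)" "homr (arrow_tva K M N A) = pullback_hom M N K (homr A)"
    by (simp_all add: arrow_tva_def)
  have "lifted_two_variable_adjunction K M N A W' W V Tlift sw.Hlift Hlift"
    unfolding lifted_two_variable_adjunction_def t using Tlift Hlift sw.Hlift by simp
  moreover have "parameterized_mates K M N A W' W V (\<lambda>(i, j). lam i j) (\<lambda>(i, f). sw.rho i f) (\<lambda>(j, f). rho j f)"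
    unfolding parameterized_mates_def using mates_left mates_right by simp
  moreover have "characterizes_hom K N M (homl A) (homl (arrow_tva K M N A)) W' V W sw.Hlift (\<lambda>(i, f). sw.rho i f)"
    unfolding t using sw.Hlift_characterized by simp
  moreover have "characterizes_hom M N K (homr A) (homr (arrow_tva K M N A)) W V W' Hlift (\<lambda>(j, f). rho j f)"
    unfolding t by (rule Hlift_characterized)
  ultimately show ?thesis unfolding forms_two_variable_adjunction_of_awfs_def using Tlift_characterized by blast
qed

end

section \<open>The characterisation\<close>

lemma swap_swap_tva: "swap_tva (swap_tva A) = A"
  by (cases A, rename_tac t l r tl tr, case_tac t) (simp add: swap_tva_def case_prod_unfold)

lemma functor_squares_square:
  assumes "is_functor J (arrow_cat M) V" "(x, a, b, x') \<in> functor_squares J V"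
  shows "x \<in> ob J \<and> x' \<in> ob J \<and> square M (fob V x) a b (fob V x')"
proof -
  interpret V: is_functor J "arrow_cat M" V by fact
  obtain e where e: "e \<in> hom J x x'" "far V e = Sq (fob V x) a b (fob V x')"
    using assms(2) by (auto simp: functor_squares_def)
  show ?thesis using e V.far_hom[OF e(1)] by auto
qed

context tva_awfs
begin

text \<open>The lifting operation on generators is extended twice, first in the variable in \<open>K\<close> and then,
after exchanging the variables, in the variable in \<open>M\<close>.  In the second step the coalgebras in \<open>K\<close>
are spectators, and their composites are respected because the first step has produced
canonical solutions.\<close>

theorem cellular_forms:
  assumes genK: "generates K \<I> U W'" and genM: "generates M \<J> X W"
    and cell: "cellular N V (prod_cat \<I> \<J>) (tensor (arrow_tva K M N A) \<circ>\<^sub>F (U \<times>\<^sub>F X))"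
  shows "forms_two_variable_adjunction_of_awfs K M N A W' W V"
proof -
  have U: "is_functor \<I> (arrow_cat K) U" and X: "is_functor \<J> (arrow_cat M) X"
    using genK genM by (auto simp: generates_def)
  interpret U: is_functor \<I> "arrow_cat K" U by (rule U)
  interpret X: is_functor \<J> "arrow_cat M" X by (rule X)
  obtain G' where "is_functor_over \<I> (coalg_cat K W') U G'" and G':
      "generated_awfs K (fob (mid W')) (\<lambda>f u v g. far (mid W') (Sq f u v g)) (lft W') (rgt W')
       (comult W') (mult W') (ob \<I>) (functor_squares \<I> U) (fob U) (\<lambda>x. snd (fob G' x))"
    by (rule generated_awfsI[OF K.category_axioms genK])
  obtain G where "is_functor_over \<J> (coalg_cat M W) X G" and G:
      "generated_awfs M (fob (mid W)) (\<lambda>f u v g. far (mid W) (Sq f u v g)) (lft W) (rgt W)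
       (comult W) (mult W) (ob \<J>) (functor_squares \<J> X) (fob X) (\<lambda>x. snd (fob G x))"
    by (rule generated_awfsI[OF M.category_axioms genM])
  obtain \<Gamma> where \<Gamma>: "is_functor (prod_cat \<I> \<J>) (coalg_cat N V) \<Gamma>"
    and over: "func_eq (prod_cat \<I> \<J>) (forget \<circ>\<^sub>F \<Gamma>) (pushout_product K M N (tensor A) \<circ>\<^sub>F (U \<times>\<^sub>F X))"
    using cell by (auto simp: cellular_def is_functor_over_def arrow_tva_def)
  interpret \<Gamma>: is_functor "prod_cat \<I> \<J>" "coalg_cat N V" \<Gamma> by (rule \<Gamma>)
  define \<sigma> where "\<sigma> x z = snd (fob \<Gamma> (x, z))" for x z
  have \<Gamma>ob: "fob \<Gamma> (x, z) = (ee (fob U x) (fob X z), \<sigma> x z)" if "x \<in> ob \<I>" "z \<in> ob \<J>" for x z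
    using over that by (auto simp: func_eq_def \<sigma>_def prod_eq_iff)
  have \<sigma>: "NW.coalg (ee (fob U x) (fob X z)) (\<sigma> x z)" if "x \<in> ob \<I>" "z \<in> ob \<J>" for x z
    using \<Gamma>.fob_ob[of "(x, z)"] that by (simp add: \<Gamma>ob NW.ob_coalg_cat)
  have \<sigma>map: "NW.coalg_map (ee (fob U x) (fob X z)) (\<sigma> x z) (emap (fob U x) (fob X z) (fob U x')
      (fob X z') a0 a1 b0 b1)
        (T a1 b1) (ee (fob U x') (fob X z')) (\<sigma> x' z')"
    if e: "e \<in> hom \<I> x x'" "far U e = Sq (fob U x) a0 a1 (fob U x')" and d: "d \<in> hom \<J> z z'" "far X d
        = Sq (fob X z) b0 b1 (fob X z')"
    for e x x' a0 a1 d z z' b0 b1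
  proof -
    have ob: "x \<in> ob \<I>" "x' \<in> ob \<I>" "z \<in> ob \<J>" "z' \<in> ob \<J>" using e(1) d(1) by auto
    have h: "far \<Gamma> (e, d) \<in> hom (coalg_cat N V) (fob \<Gamma> (x, z)) (fob \<Gamma> (x', z'))"
      by (rule \<Gamma>.far_hom) (use e(1) d(1) in simp)
    obtain P \<alpha> P' where g: "far \<Gamma> (e, d) = (P, \<alpha>, P')" by (cases "far \<Gamma> (e, d)")
    have "P = fob \<Gamma> (x, z)" "P' = fob \<Gamma> (x', z')" using h g by (auto simp: NW.coalg_cat_eq)
    moreover have "far (forget \<circ>\<^sub>F \<Gamma>) (e, d) = far (pushout_product K M N (tensor A) \<circ>\<^sub>F (U \<times>\<^sub>F X)) (e, d)"
      using over e(1) d(1) by (auto simp: func_eq_def)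
    then have "\<alpha> = Sq (ee (fob U x) (fob X z)) (emap (fob U x) (fob X z) (fob U x') (fob X z') a0 a1 b0 b1)
        (T a1 b1) (ee (fob U x') (fob X z'))"
      by (simp add: g e(2) d(2) far_pushout_product)
    moreover have "(P, \<alpha>, P') \<in> ar (coalg_cat N V)" using h g by simp
    ultimately show ?thesis using ob by (simp add: NW.ar_coalg_cat \<Gamma>ob)
  qed
  have Uid: "far U (idt \<I> x) = Sq (fob U x) (sK (fob U x)) (tK (fob U x)) (fob U x)" if "x \<in> ob \<I>" for x
    using U.far_idt[OF that] by simp
  have Xid: "far X (idt \<J> z) = Sq (fob X z) (sM (fob X z)) (tM (fob X z)) (fob X z)" if "z \<in> ob \<J>" for z
    using X.far_idt[OF that] by simp
  have base: "lifting_op (ob \<I>) (functor_squares \<I> U) (fob U) {} (ob \<J>) (functor_squares \<J> X) (fob X) {}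
      (\<lambda>x z f r y b c. r \<cdot>\<^sub>N
    (EN (ee (fob U x) (fob X z)) (cop (fob U x) (fob X z) b c) y f \<cdot>\<^sub>N \<sigma> x z))"
  proof (rule base_lifting_op)
    show "NW.coalg (ee (fob U x) (fob X z)) (\<sigma> x z)" if "x \<in> ob \<I>" "z \<in> ob \<J>" for x z by (rule \<sigma>[OF that])
    show "fob U x \<in> ar K" if "x \<in> ob \<I>" for x using U.fob_ob[OF that] by simp
    show "fob X z \<in> ar M" if "z \<in> ob \<J>" for z using X.fob_ob[OF that] by simp
  next
    fix x a a' x' z assume m: "(x, a, a', x') \<in> functor_squares \<I> U" and z: "z \<in> ob \<J>"
    obtain e where e: "e \<in> hom \<I> x x'" "far U e = Sq (fob U x) a a' (fob U x')" using m
        by (auto simp: functor_squares_def)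
    show "x \<in> ob \<I> \<and> x' \<in> ob \<I> \<and> square K (fob U x) a a' (fob U x') \<and>
      NW.coalg_map (ee (fob U x) (fob X z)) (\<sigma> x z) (emap (fob U x) (fob X z) (fob U x') (fob X z) a a' (sM
          (fob X z)) (tM (fob X z)))
        (T a' (tM (fob X z))) (ee (fob U x') (fob X z)) (\<sigma> x' z)"
      using functor_squares_square[OF U m] \<sigma>map[OF e X.source.idt_hom[OF z] Xid[OF z]] by simp
  next
    fix z a a' z' x assume m: "(z, a, a', z') \<in> functor_squares \<J> X" and x: "x \<in> ob \<I>"
    obtain d where d: "d \<in> hom \<J> z z'" "far X d = Sq (fob X z) a a' (fob X z')" using m
        by (auto simp: functor_squares_def)
    show "z \<in> ob \<J> \<and> z' \<in> ob \<J> \<and> square M (fob X z) a a' (fob X z') \<and>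
      NW.coalg_map (ee (fob U x) (fob X z)) (\<sigma> x z) (emap (fob U x) (fob X z) (fob U x) (fob X z') (sK
          (fob U x)) (tK (fob U x)) a a')
        (T (tK (fob U x)) a') (ee (fob U x) (fob X z')) (\<sigma> x z')"
      using functor_squares_square[OF X m] \<sigma>map[OF U.source.idt_hom[OF x] Uid[OF x] d] by simp
  qed
  interpret genK: generated_awfs K "fob (mid W')" "\<lambda>f u v g. far (mid W') (Sq f u v g)" "lft W'" "rgt W'"
       "comult W'" "mult W'" "ob \<I>" "functor_squares \<I> U" "fob U" "\<lambda>x. snd (fob G' x)" by (rule G')
  interpret genM: generated_awfs M "fob (mid W)" "\<lambda>f u v g. far (mid W) (Sq f u v g)" "lft W" "rgt W"
       "comult W" "mult W" "ob \<J>" "functor_squares \<J> X" "fob X" "\<lambda>x. snd (fob G x)" by (rule G)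
  interpret stepK: tva_gen_target K M N A "fob (mid W')" "\<lambda>f u v g. far (mid W') (Sq f u v g)" "lft W'" "rgt W'"
       "comult W'" "mult W'" "ob \<I>" "functor_squares \<I> U" "fob U" "\<lambda>x. snd (fob G' x)" V by unfold_locales
  interpret sw: tva_target M K N "swap_tva A" V by (rule swap_target)
  interpret stepM: tva_gen_target M K N "swap_tva A" "fob (mid W)" "\<lambda>f u v g. far (mid W) (Sq f u v g)"
      "lft W" "rgt W"
       "comult W" "mult W" "ob \<J>" "functor_squares \<J> X" "fob X" "\<lambda>x. snd (fob G x)" V by unfold_locales
  obtain S1 where S1: "lifting_op KW.Coalgs KW.CoalgMaps fst KW.CoalgComps (ob \<J>) (functor_squares \<J> X) (fob X) {} S1"
    using stepK.extend_lifting_op[OF base] X.fob_ob functor_squares_square[OF X] by auto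
  have "\<exists>S2. sw.lifting_op MW.Coalgs MW.CoalgMaps fst MW.CoalgComps KW.Coalgs KW.CoalgMaps fst KW.CoalgComps S2"
  proof (rule stepM.extend_lifting_op[OF lifting_op_swap[OF S1]])
    show "fst z \<in> ar K" if "z \<in> KW.Coalgs" for z using that by (auto simp: KW.Coalgs_def dest: KW.coalgD)
    show "z \<in> KW.Coalgs \<and> z' \<in> KW.Coalgs \<and> square K (fst z) a a' (fst z')" if
        "(z, a, a', z') \<in> KW.CoalgMaps" for z a a' z'
      using that by (auto simp: KW.Coalgs_def KW.CoalgMaps_def KW.coalg_map_def)
    show "z \<in> KW.Coalgs \<and> z' \<in> KW.Coalgs \<and> k \<in> KW.Coalgs \<and> tgt K (fst z) = src K (fst z') \<and> fst k = fst z' \<cdot>\<^bsub>K\<^esub> fst z"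
      if "(z, z', k) \<in> KW.CoalgComps" for z z' k
      using that by (auto simp: KW.Coalgs_def KW.CoalgComps_def KW.composite_coalg_def)
  qed
  then obtain S2 where "sw.lifting_op MW.Coalgs MW.CoalgMaps fst MW.CoalgComps KW.Coalgs KW.CoalgMaps fst
      KW.CoalgComps S2" by blast
  from sw.lifting_op_swap[OF this]
  have S2: "lifting_op KW.Coalgs KW.CoalgMaps fst KW.CoalgComps MW.Coalgs MW.CoalgMaps fst MW.CoalgComps
      (\<lambda>z x f r y c b. S2 x z f r y b c)"
    by (simp only: swap_swap_tva)
  interpret tva_full K M N A V W' W "\<lambda>z x f r y c b. S2 x z f r y b c" by unfold_locales (rule S2)
  show ?thesis by (rule full_forms)
qed

theorem forms_cellular:
  assumes genK: "generates K \<I> U W'" and genM: "generates M \<J> X W"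
    and forms: "forms_two_variable_adjunction_of_awfs K M N A W' W V"
  shows "cellular N V (prod_cat \<I> \<J>) (tensor (arrow_tva K M N A) \<circ>\<^sub>F (U \<times>\<^sub>F X))"
proof -
  obtain G' where G': "is_functor_over \<I> (coalg_cat K W') U G'" using genK by (auto simp: generates_def)
  obtain G where G: "is_functor_over \<J> (coalg_cat M W) X G" using genM by (auto simp: generates_def)
  obtain F where F: "is_lifted_functor (prod_cat (coalg_cat K W') (coalg_cat M W)) (coalg_cat N V)
       (forget \<times>\<^sub>F forget) forget (tensor (arrow_tva K M N A)) F"
    using forms unfolding forms_two_variable_adjunction_of_awfs_def lifted_two_variable_adjunction_def by blast
  have P: "is_functor (prod_cat \<I> \<J>) (prod_cat (coalg_cat K W') (coalg_cat M W)) (G' \<times>\<^sub>F G)"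
    by (rule is_functor_prod) (use G' G in \<open>simp_all add: is_functor_over_def\<close>)
  interpret P: is_functor "prod_cat \<I> \<J>" "prod_cat (coalg_cat K W') (coalg_cat M W)" "G' \<times>\<^sub>F G" by (rule P)
  have F': "is_functor (prod_cat \<I> \<J>) (coalg_cat N V) (F \<circ>\<^sub>F (G' \<times>\<^sub>F G))"
    by (rule is_functor_comp[OF P]) (use F in \<open>simp add: is_lifted_functor_def\<close>)
  have e: "\<forall>x\<in>ob \<I>. fst (fob G' x) = fob U x" "\<forall>a\<in>ar \<I>. far forget (far G' a) = far U a"
    "\<forall>x\<in>ob \<J>. fst (fob G x) = fob X x" "\<forall>a\<in>ar \<J>. far forget (far G a) = far X a"
    using G' G by (simp_all add: is_functor_over_def func_eq_def)
  have o: "\<forall>x\<in>ob (prod_cat (coalg_cat K W') (coalg_cat M W)). fst (fob F x)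
      = fob (tensor (arrow_tva K M N A)) (fst (fst x), fst (snd x))"
    and a: "\<forall>x\<in>ar (prod_cat (coalg_cat K W') (coalg_cat M W)). far forget (far F x)
       = far (tensor (arrow_tva K M N A)) (far forget (fst x), far forget (snd x))"
    using F by (simp_all add: is_lifted_functor_def func_eq_def)
  have "func_eq (prod_cat \<I> \<J>) (forget \<circ>\<^sub>F (F \<circ>\<^sub>F (G' \<times>\<^sub>F G))) (tensor (arrow_tva K M N A) \<circ>\<^sub>F (U \<times>\<^sub>F X))"
    unfolding func_eq_def
  proof (intro conjI ballI)
    fix x assume x: "x \<in> ob (prod_cat \<I> \<J>)"
    show "fob (forget \<circ>\<^sub>F (F \<circ>\<^sub>F (G' \<times>\<^sub>F G))) x = fob (tensor (arrow_tva K M N A) \<circ>\<^sub>F (U \<times>\<^sub>F X)) x"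
      using o[rule_format, OF P.fob_ob[OF x]] e x by auto
  next
    fix x assume x: "x \<in> ar (prod_cat \<I> \<J>)"
    have "far (G' \<times>\<^sub>F G) x \<in> ar (prod_cat (coalg_cat K W') (coalg_cat M W))" using P.far_hom[of x] x by simp
    from a[rule_format, OF this]
    show "far (forget \<circ>\<^sub>F (F \<circ>\<^sub>F (G' \<times>\<^sub>F G))) x = far (tensor (arrow_tva K M N A) \<circ>\<^sub>F (U \<times>\<^sub>F X)) x"
      using e x by auto
  qed
  then show ?thesis using F' by (auto simp: cellular_def is_functor_over_def)
qed

end

theorem theorem6p6:
  fixes K :: "('ko, 'ka) cat" and M :: "('mo, 'ma) cat" and N :: "('no, 'na) cat"
    and A :: "('ko, 'ka, 'mo, 'ma, 'no, 'na) tva"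
    and \<I> :: "('io, 'ia) cat" and U :: "('io, 'ia, 'ka, 'ka sq) func"
    and \<J> :: "('jo, 'ja) cat" and V :: "('jo, 'ja, 'ma, 'ma sq) func"
    and CF' :: "('ko, 'ka) awfs" and CF :: "('mo, 'ma) awfs" and LR :: "('no, 'na) awfs"
  assumes "category K" and "category M" and "category N"
    and "has_pullbacks K" and "has_pullbacks M" and "has_pushouts N"
    and "is_two_variable_adjunction K M N A"
    and "category \<I>" and "is_functor \<I> (arrow_cat K) U" and "generates K \<I> U CF'"
    and "category \<J>" and "is_functor \<J> (arrow_cat M) V" and "generates M \<J> V CF"
    and "is_awfs N LR"
  shows "forms_two_variable_adjunction_of_awfs K M N A CF' CF LR \<longleftrightarrow>
    cellular N LR (prod_cat \<I> \<J>) (tensor (arrow_tva K M N A) \<circ>\<^sub>F (U \<times>\<^sub>F V))"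
proof -
  have "is_awfs K CF'" "is_awfs M CF" using assms(10,13) by (auto simp: generates_def)
  with assms interpret tva_awfs K M N A LR CF' CF
    by (simp add: tva_awfs_def tva_target_def tva_def tva_axioms_def awfs_def awfs_axioms_def)
  show ?thesis using forms_cellular cellular_forms assms(10,13) by blast
qed

end
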